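(* Let $k$ be an algebraically closed field of characteristic zero. Let $X\subset\mathbb{P}^N$ be a nondegenerate reduced quadratic scheme whose saturated ideal $I_X$ satisfies property $\mathbf{N}_{2,p}$ for some $p\ge 1$, and let $q\in X$ be a smooth point. Consider the inner projection $\pi_q:X\dashrightarrow X_q\subset\mathbb{P}^{N-1}$. Then there is an injection between the minimal free resolutions of $I_{X_q}$ and $I_X$ up to the first $(p-1)$-th step, i.e. there is an injective map $$f:\mathrm{Tor}^{S}_{i}(I_{X_q},k)_{i+j}\hookrightarrow\mathrm{Tor}^{R}_{i}(I_X,k)_{i+j}\qquad\text{for } 0\le i\le p-2 \text{ and all } j\in\mathbb{Z},$$ which is induced by the natural inclusion $I_{X_q}\hookrightarrow I_X$ and the elimination mapping cone sequence; that is, $f$ is the composition of the map $\mathrm{Tor}^{S}_{i}(I_{X_q},k)_{i+j}\to\mathrm{Tor}^{S}_{i}(I_X,k)_{i+j}$ induced by the inclusion with the map $\mathrm{Tor}^{S}_{i}(I_X,k)_{i+j}\to\mathrm{Tor}^{R}_{i}(I_X,k)_{i+j}$ of the elimination mapping cone sequence.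
   Context: Coordinates are chosen so that $q=(1:0:\cdots:0)$; $R=k[x_0,\ldots,x_N]$ and $S=k[x_1,\ldots,x_N]$ are the homogeneous coordinate rings of $\mathbb{P}^N$ and $\mathbb{P}^{N-1}$. $\pi_q$ is the linear projection from $q$, $X_q=\overline{\pi_q(X\setminus\{q\})}\subset\mathbb{P}^{N-1}$ (reduced), and $I_X\subset R$, $I_{X_q}\subset S$ are the saturated homogeneous ideals; $I_{X_q}=I_X\cap S$. $X$ is nondegenerate if it is contained in no hyperplane. $X$ is quadratic if some homogeneous ideal generated by forms of degree 2 defines $X$ scheme-theoretically. An ideal $I\subset R$ satisfies property $\mathbf{N}_{2,p}$ if $\mathrm{Tor}_i^R(R/I,k)_{i+j}=0$ for all $0\le i\le p$ and $j\ge 2$. Elimination mapping cone sequence: for a graded $R$-module $M$ (viewed also as an $S$-module), there is a natural long exact sequence $$\cdots\to\mathrm{Tor}_{i+1}^R(M,k)_{i+j}\to\mathrm{Tor}_i^S(M,k)_{i+j-1}\xrightarrow{\times x_0}\mathrm{Tor}_i^S(M,k)_{i+j}\to\mathrm{Tor}_i^R(M,k)_{i+j}\to\cdots,$$ obtained by realizing the Koszul complex of $M$ over $R$ as the mapping cone of multiplication by $x_0$ on the Koszul complex of $M$ over $S$; the last displayed map is induced by the inclusion of the Koszul complex over $S$ into the Koszul complex over $R$. *)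

theory Defs
  imports
    "HOL-Library.Poly_Mapping"
    "HOL-Computational_Algebra.Polynomial"
    "HOL-Algebra.QuotRing"
    "HOL-Algebra.Module"
begin

section \<open>Polynomial rings\<close>

text \<open>
  All polynomial rings over \<open>k\<close> live in one type: variables are indexed by natural numbers,
  \<open>k[x\<^sub>v | v \<in> V]\<close> is the set \<open>polys V\<close>. In this way \<open>S = k[x\<^sub>1,\<dots>,x\<^sub>N]\<close> is literally a subring of
  \<open>R = k[x\<^sub>0,\<dots>,x\<^sub>N]\<close>.
\<close>

type_synonym 'k mpoly = "(nat \<Rightarrow>\<^sub>0 nat) \<Rightarrow>\<^sub>0 'k"

definition pvar :: "nat \<Rightarrow> 'k::comm_ring_1 mpoly" where
  "pvar i = Poly_Mapping.single (Poly_Mapping.single i 1) 1"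

definition pconst :: "'k \<Rightarrow> 'k::comm_ring_1 mpoly" where
  "pconst a = Poly_Mapping.single 0 a"

definition polys :: "nat set \<Rightarrow> 'k::comm_ring_1 mpoly set" where
  "polys V = {f. \<forall>m\<in>Poly_Mapping.keys f. Poly_Mapping.keys m \<subseteq> V}"

definition poly_ring :: "nat set \<Rightarrow> 'k::comm_ring_1 mpoly ring" where
  "poly_ring V = \<lparr>carrier = polys V, mult = (*), one = 1, zero = 0, add = (+)\<rparr>"

lemma cring_poly_ring: "cring (poly_ring V :: 'k::comm_ring_1 mpoly ring)"
proof -
  have add: "f + g \<in> polys V" if "f \<in> polys V" "g \<in> polys V" for f g :: "'k mpoly"
    using that Poly_Mapping.keys_add[of f g] unfolding polys_def by blast
  have mult: "f * g \<in> polys V" if "f \<in> polys V" "g \<in> polys V" for f g :: "'k mpoly"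
  proof -
    have "Poly_Mapping.keys m \<subseteq> V" if m: "m \<in> Poly_Mapping.keys (f * g)" for m
    proof -
      obtain a b where "m = a + b" "a \<in> Poly_Mapping.keys f" "b \<in> Poly_Mapping.keys g"
        using m Poly_Mapping.keys_mult[of f g] by blast
      then show ?thesis
        using \<open>f \<in> polys V\<close> \<open>g \<in> polys V\<close> Poly_Mapping.keys_add[of a b]
        unfolding polys_def by blast
    qed
    then show ?thesis by (simp add: polys_def)
  qed
  have uminus: "- f \<in> polys V" if "f \<in> polys V" for f :: "'k mpoly"
    using that by (simp add: polys_def)
  have zero: "0 \<in> (polys V :: 'k mpoly set)" and one: "1 \<in> (polys V :: 'k mpoly set)"
    by (simp_all add: polys_def)
  show ?thesis
  proof (rule cringI)
    show "abelian_group (poly_ring V :: 'k mpoly ring)"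
      by (rule abelian_groupI)
        (auto simp: poly_ring_def add zero ac_simps intro!: bexI[OF _ uminus])
    show "comm_monoid (poly_ring V :: 'k mpoly ring)"
      by (rule comm_monoidI) (auto simp: poly_ring_def mult one ac_simps)
  qed (simp add: poly_ring_def distrib_right)
qed

definition mono_deg :: "(nat \<Rightarrow>\<^sub>0 nat) \<Rightarrow> nat" where
  "mono_deg m = (\<Sum>i\<in>Poly_Mapping.keys m. Poly_Mapping.lookup m i)"

text \<open>Degrees are integers; a form of negative degree is \<open>0\<close>.\<close>

definition homogeneous :: "int \<Rightarrow> 'k::comm_ring_1 mpoly \<Rightarrow> bool" where
  "homogeneous e f \<longleftrightarrow> (\<forall>m\<in>Poly_Mapping.keys f. int (mono_deg m) = e)"

definition forms :: "nat set \<Rightarrow> int \<Rightarrow> 'k::comm_ring_1 mpoly set" where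
  "forms V e = {f \<in> polys V. homogeneous e f}"

definition hom_component :: "int \<Rightarrow> 'k::comm_ring_1 mpoly \<Rightarrow> 'k mpoly" where
  "hom_component e f =
     (\<Sum>m\<in>{m \<in> Poly_Mapping.keys f. int (mono_deg m) = e}.
        Poly_Mapping.single m (Poly_Mapping.lookup f m))"

definition homogeneous_ideal :: "nat set \<Rightarrow> 'k::comm_ring_1 mpoly set \<Rightarrow> bool" where
  "homogeneous_ideal V I \<longleftrightarrow>
     ideal I (poly_ring V) \<and> (\<forall>f\<in>I. \<forall>e. hom_component e f \<in> I)"

section \<open>Projective schemes\<close>

text \<open>
  A closed subscheme \<open>X\<close> of \<open>Proj k[x\<^sub>v | v \<in> V]\<close> is given by its saturated homogeneous ideal \<open>I\<^sub>X\<close>; \<open>saturated\<close> says that \<open>\<mm>\<^sup>n f \<subseteq> I\<close> implies \<open>f \<in> I\<close>, where \<open>\<mm>\<close> is the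
  irrelevant ideal.
\<close>

definition saturated :: "nat set \<Rightarrow> 'k::comm_ring_1 mpoly set \<Rightarrow> bool" where
  "saturated V I \<longleftrightarrow>
     (\<forall>f\<in>polys V. (\<exists>n. \<forall>g\<in>forms V (int n). g * f \<in> I) \<longrightarrow> f \<in> I)"

definition closed_subscheme_ideal :: "nat set \<Rightarrow> 'k::comm_ring_1 mpoly set \<Rightarrow> bool" where
  "closed_subscheme_ideal V I \<longleftrightarrow> homogeneous_ideal V I \<and> saturated V I"

text \<open>
  On the standard chart \<open>x\<^sub>i \<noteq> 0\<close>, an affine space with coordinate ring \<open>polys (V - {i})\<close>, the
  ideal sheaf attached to \<open>I\<close> is given by the dehomogenizations (\<open>x\<^sub>i := 1\<close>) of the elements of \<open>I\<close>.
\<close>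

definition dehomogenize :: "nat \<Rightarrow> 'k::comm_ring_1 mpoly \<Rightarrow> 'k mpoly" where
  "dehomogenize i f =
     (\<Sum>m\<in>Poly_Mapping.keys f.
        Poly_Mapping.single (Poly_Mapping.update i 0 m) (Poly_Mapping.lookup f m))"

definition chart_ideal :: "nat \<Rightarrow> 'k::comm_ring_1 mpoly set \<Rightarrow> 'k mpoly set" where
  "chart_ideal i I = dehomogenize i ` I"

definition reduced_scheme :: "nat set \<Rightarrow> 'k::comm_ring_1 mpoly set \<Rightarrow> bool" where
  "reduced_scheme V I \<longleftrightarrow>
     (\<forall>i\<in>V. \<forall>f\<in>polys (V - {i}). \<forall>n. f ^ n \<in> chart_ideal i I \<longrightarrow> f \<in> chart_ideal i I)"

definition nondegenerate :: "nat set \<Rightarrow> 'k::comm_ring_1 mpoly set \<Rightarrow> bool" where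
  "nondegenerate V I \<longleftrightarrow> \<not> (\<exists>l\<in>forms V 1. l \<noteq> 0 \<and> l \<in> I)"

definition quadratic_scheme :: "nat set \<Rightarrow> 'k::comm_ring_1 mpoly set \<Rightarrow> bool" where
  "quadratic_scheme V I \<longleftrightarrow>
     (\<exists>F\<subseteq>forms V 2. \<forall>i\<in>V. chart_ideal i (genideal (poly_ring V) F) = chart_ideal i I)"

definition proj_points :: "nat set \<Rightarrow> 'k::comm_ring_1 mpoly set set" where
  "proj_points V =
     {P. primeideal P (poly_ring V) \<and> homogeneous_ideal V P \<and> \<not> pvar ` V \<subseteq> P}"

definition proj_zeros :: "nat set \<Rightarrow> 'k::comm_ring_1 mpoly set \<Rightarrow> 'k mpoly set set" where
  "proj_zeros V A = {P \<in> proj_points V. A \<subseteq> P}"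

definition zariski_closure ::
    "nat set \<Rightarrow> 'k::comm_ring_1 mpoly set set \<Rightarrow> 'k mpoly set set" where
  "zariski_closure V Z =
     {P \<in> proj_points V. \<forall>A\<subseteq>polys V. Z \<subseteq> proj_zeros V A \<longrightarrow> P \<in> proj_zeros V A}"

text \<open>
  The saturated homogeneous ideal of the reduced subscheme structure on a closed set \<open>C\<close>;
  it is the unit ideal if \<open>C\<close> is empty.
\<close>

definition vanishing_ideal ::
    "nat set \<Rightarrow> 'k::comm_ring_1 mpoly set set \<Rightarrow> 'k mpoly set" where
  "vanishing_ideal V C = {f \<in> polys V. \<forall>P\<in>C. f \<in> P}"

section \<open>The centre of projection and the inner projection\<close>

text \<open>
  The point \<open>q = (1:0:\<dots>:0)\<close> of \<open>\<P>\<^sup>N\<close> is the homogeneous prime \<open>(x\<^sub>1,\<dots>,x\<^sub>N)\<close> of \<open>R\<close>. The projection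
  from \<open>q\<close> is the rational map \<open>Proj R \<dashrightarrow> Proj S\<close> given by the inclusion \<open>S \<subseteq> R\<close>, which
  is defined away from \<open>q\<close> and sends \<open>P\<close> to \<open>P \<inter> S\<close>.
\<close>

definition center_q :: "nat \<Rightarrow> 'k::comm_ring_1 mpoly set" where
  "center_q N = genideal (poly_ring {0..N}) (pvar ` {1..N})"

definition project_q :: "nat \<Rightarrow> 'k::comm_ring_1 mpoly set \<Rightarrow> 'k mpoly set" where
  "project_q N P = P \<inter> polys {1..N}"

definition inner_projection :: "nat \<Rightarrow> 'k::comm_ring_1 mpoly set \<Rightarrow> 'k mpoly set set" where
  "inner_projection N I =
     zariski_closure {1..N} (project_q N ` (proj_zeros {0..N} I - {center_q N}))"

definition inner_projection_ideal :: "nat \<Rightarrow> 'k::comm_ring_1 mpoly set \<Rightarrow> 'k mpoly set" where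
  "inner_projection_ideal N I = vanishing_ideal {1..N} (inner_projection N I)"

text \<open>
  \<open>X\<close> is smooth over \<open>k\<close> at \<open>q\<close> if near \<open>q\<close> it is cut out in \<open>\<P>\<^sup>N\<close> by \<open>c\<close> equations whose
  differentials at \<open>q\<close> are linearly independent (the definition of smoothness by a Jacobian matrix
  of maximal rank, as in Mumford's Red Book, III.10, or Bosch--Luetkebohmert--Raynaud, \<^emph>\<open>Neron
  Models\<close>, 2.2). In the chart \<open>x\<^sub>0 = 1\<close> the point \<open>q\<close> is the origin, so that \<open>u\<close> is a unit of the
  local ring at \<open>q\<close> iff its constant term is nonzero, and \<open>\<partial>f/\<partial>x\<^sub>j(q)\<close> is the coefficient of \<open>x\<^sub>j\<close>
  in \<open>f\<close>.
\<close>

definition gradient_q :: "'k::comm_ring_1 mpoly \<Rightarrow> nat \<Rightarrow> 'k" where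
  "gradient_q f j = Poly_Mapping.lookup f (Poly_Mapping.single j 1)"

definition smooth_at_q :: "nat \<Rightarrow> 'k::field mpoly set \<Rightarrow> bool" where
  "smooth_at_q N I \<longleftrightarrow>
     (\<exists>c. \<exists>f :: nat \<Rightarrow> 'k mpoly.
        (\<forall>l<c. f l \<in> chart_ideal 0 I) \<and>
        (\<forall>g\<in>chart_ideal 0 I. \<exists>u\<in>polys {1..N}.
           Poly_Mapping.lookup u 0 \<noteq> 0 \<and> u * g \<in> genideal (poly_ring {1..N}) (f ` {..<c})) \<and>
        (\<forall>a. (\<forall>j\<in>{1..N}. (\<Sum>l<c. a l * gradient_q (f l) j) = 0) \<longrightarrow> (\<forall>l<c. a l = 0)))"

section \<open>Graded modules\<close>

record ('a, 'b) graded_module = "('a, 'b) module" +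
  grading :: "int \<Rightarrow> 'b set"

text \<open>
  The fields \<open>mult\<close> and \<open>one\<close> of the module record carry no meaning here. The module \<open>ideal_module I\<close> is \<open>I\<close> over whichever subring of the polynomials acts on
  it: for \<open>I\<^sub>X\<close> both \<open>R\<close> and \<open>S\<close> do.
\<close>

definition ideal_module ::
    "'k::comm_ring_1 mpoly set \<Rightarrow> ('k mpoly, 'k mpoly) graded_module" where
  "ideal_module I =
     \<lparr>carrier = I, mult = (*), one = 1, zero = 0, add = (+), smult = (*),
      grading = (\<lambda>e. {f \<in> I. homogeneous e f})\<rparr>"

text \<open>In \<open>smult\<close>, all members \<open>x\<close> of a coset \<open>C\<close> give the same coset \<open>B + a x\<close>.\<close>

definition quotient_module ::
    "('a, 'b, 'c) module_scheme \<Rightarrow> 'b set \<Rightarrow> ('a, 'b set) module" where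
  "quotient_module M B =
     \<lparr>carrier = a_rcosets\<^bsub>M\<^esub> B, mult = undefined, one = undefined, zero = B, add = set_add M,
      smult = (\<lambda>a C. \<Union>x\<in>C. B +>\<^bsub>M\<^esub> (a \<odot>\<^bsub>M\<^esub> x))\<rparr>"

definition graded_quotient ::
    "('a, 'b) graded_module \<Rightarrow> 'b set \<Rightarrow> ('a, 'b set) graded_module" where
  "graded_quotient M B =
     module.extend (quotient_module M B)
       (graded_module.fields (\<lambda>e. (\<lambda>x. B +>\<^bsub>M\<^esub> x) ` grading M e))"

section \<open>Koszul complexes and Tor\<close>

text \<open>
  Over \<open>A = k[x\<^sub>v | v \<in> V]\<close>, the Koszul complex of \<open>(x\<^sub>v)\<close> is the graded free resolution of
  \<open>k\<close>; tensored with \<open>M\<close> it computes \<open>Tor\<^sup>A\<^sub>i(M,k)\<close>. Its elements of homological degree \<open>i\<close> are the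
  sums \<open>\<Sum>\<^sub>T c T \<otimes> e\<^sub>T\<close> over the subsets \<open>T\<close> of \<open>V\<close> with \<open>i\<close> elements, with \<open>e\<^sub>T\<close> of internal
  degree \<open>i\<close> and \<open>d e\<^sub>T = \<Sum>\<^sub>j\<^sub>\<in>\<^sub>T \<plusminus> x\<^sub>j e\<^sub>T\<^sub>-\<^sub>j\<close>, where the sign is the parity of the number of elements of
  \<open>T\<close> below \<open>j\<close>. Extending \<open>c\<close> by \<open>0\<close> to all sets makes the Koszul complex of an \<open>R\<close>-module over
  \<open>S\<close> literally a subcomplex of the one over \<open>R\<close>.
\<close>

definition koszul_chains ::
    "nat set \<Rightarrow> ('a, 'm) graded_module \<Rightarrow> nat \<Rightarrow> int \<Rightarrow> (nat set \<Rightarrow> 'm) set" where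
  "koszul_chains V M i d =
     {c. \<forall>T. if T \<subseteq> V \<and> card T = i then c T \<in> grading M (d - int i) else c T = \<zero>\<^bsub>M\<^esub>}"

definition koszul_diff ::
    "nat set \<Rightarrow> ('k::comm_ring_1 mpoly, 'm) graded_module \<Rightarrow> (nat set \<Rightarrow> 'm) \<Rightarrow> nat set \<Rightarrow> 'm" where
  "koszul_diff V M c =
     (\<lambda>T. \<Oplus>\<^bsub>M\<^esub>j\<in>V - T. ((- 1) ^ card {t \<in> T. t < j} * pvar j) \<odot>\<^bsub>M\<^esub> c (insert j T))"

definition koszul_cycles ::
    "nat set \<Rightarrow> ('k::comm_ring_1 mpoly, 'm) graded_module \<Rightarrow> nat \<Rightarrow> int
       \<Rightarrow> ('k, nat set \<Rightarrow> 'm) module" where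
  "koszul_cycles V M i d =
     \<lparr>carrier = {c \<in> koszul_chains V M i d. koszul_diff V M c = (\<lambda>_. \<zero>\<^bsub>M\<^esub>)},
      mult = undefined, one = undefined,
      zero = (\<lambda>_. \<zero>\<^bsub>M\<^esub>), add = (\<lambda>c c' T. c T \<oplus>\<^bsub>M\<^esub> c' T),
      smult = (\<lambda>a c T. pconst a \<odot>\<^bsub>M\<^esub> c T)\<rparr>"

definition koszul_boundaries ::
    "nat set \<Rightarrow> ('k::comm_ring_1 mpoly, 'm) graded_module \<Rightarrow> nat \<Rightarrow> int \<Rightarrow> (nat set \<Rightarrow> 'm) set" where
  "koszul_boundaries V M i d = koszul_diff V M ` koszul_chains V M (i + 1) d"

text \<open>\<open>Tor V M i d\<close> is the \<open>k\<close>-vector space \<open>Tor\<^sup>A\<^sub>i(M,k)\<^sub>d\<close>.\<close>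

definition Tor ::
    "nat set \<Rightarrow> ('k::comm_ring_1 mpoly, 'm) graded_module \<Rightarrow> nat \<Rightarrow> int
       \<Rightarrow> ('k, (nat set \<Rightarrow> 'm) set) module" where
  "Tor V M i d = quotient_module (koszul_cycles V M i d) (koszul_boundaries V M i d)"

text \<open>
  The map into \<open>Tor V M i d\<close> induced by a chain map \<open>\<phi>\<close> with values in the Koszul complex of \<open>M\<close>
  over \<open>V\<close>: the class of \<open>z\<close> goes to the class of \<open>\<phi> z\<close>.
\<close>

definition tor_map ::
    "nat set \<Rightarrow> ('k::comm_ring_1 mpoly, 'm) graded_module \<Rightarrow> nat \<Rightarrow> int
       \<Rightarrow> ((nat set \<Rightarrow> 'n) \<Rightarrow> nat set \<Rightarrow> 'm) \<Rightarrow> (nat set \<Rightarrow> 'n) set \<Rightarrow> (nat set \<Rightarrow> 'm) set" where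
  "tor_map V M i d \<phi> C = (\<phi> ` C) <+>\<^bsub>koszul_cycles V M i d\<^esub> koszul_boundaries V M i d"

text \<open>Functoriality in the module: the map \<open>Tor\<^sup>A\<^sub>i(M',k)\<^sub>d \<rightarrow> Tor\<^sup>A\<^sub>i(M,k)\<^sub>d\<close> induced by \<open>h : M' \<rightarrow> M\<close>.\<close>

definition tor_module_map ::
    "nat set \<Rightarrow> ('k::comm_ring_1 mpoly, 'm) graded_module \<Rightarrow> nat \<Rightarrow> int
       \<Rightarrow> ('n \<Rightarrow> 'm) \<Rightarrow> (nat set \<Rightarrow> 'n) set \<Rightarrow> (nat set \<Rightarrow> 'm) set" where
  "tor_module_map V M i d h = tor_map V M i d (\<lambda>c T. h (c T))"

text \<open>
  The map \<open>Tor\<^sup>S\<^sub>i(M,k)\<^sub>d \<rightarrow> Tor\<^sup>R\<^sub>i(M,k)\<^sub>d\<close> of the elimination mapping cone sequence, for the variables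
  \<open>V\<close> of \<open>R\<close>. It is induced by the inclusion of the Koszul complex over \<open>S\<close> into the one over \<open>R\<close>,
  which here is the identity on chains.
\<close>

definition tor_elimination_map ::
    "nat set \<Rightarrow> ('k::comm_ring_1 mpoly, 'm) graded_module \<Rightarrow> nat \<Rightarrow> int
       \<Rightarrow> (nat set \<Rightarrow> 'm) set \<Rightarrow> (nat set \<Rightarrow> 'm) set" where
  "tor_elimination_map V M i d = tor_map V M i d (\<lambda>c. c)"

definition property_N2 :: "nat set \<Rightarrow> nat \<Rightarrow> 'k::comm_ring_1 mpoly set \<Rightarrow> bool" where
  "property_N2 V p I \<longleftrightarrow>
     (\<forall>i\<le>p. \<forall>j\<ge>2.
        carrier (Tor V (graded_quotient (ideal_module (polys V)) I) i (int i + j))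
          = {\<zero>\<^bsub>Tor V (graded_quotient (ideal_module (polys V)) I) i (int i + j)\<^esub>})"

definition linear_maps ::
    "('k, 'a) module \<Rightarrow> ('k, 'b) module \<Rightarrow> ('a \<Rightarrow> 'b) set" where
  "linear_maps A B =
     {f \<in> carrier A \<rightarrow> carrier B.
        (\<forall>x\<in>carrier A. \<forall>y\<in>carrier A. f (x \<oplus>\<^bsub>A\<^esub> y) = f x \<oplus>\<^bsub>B\<^esub> f y) \<and>
        (\<forall>a. \<forall>x\<in>carrier A. f (a \<odot>\<^bsub>A\<^esub> x) = a \<odot>\<^bsub>B\<^esub> f x)}"

end

theory Submission
  imports Defs "HOL-Library.Function_Algebras"
begin

text \<open>
  Over \<open>R\<close> and \<open>S\<close> the map \<open>f\<close> sends the class of a Koszul cycle with coefficients in \<open>J = I\<^sub>X \<inter> S\<close> to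
  its class over \<open>I\<^sub>X\<close>. If the coefficients are forms of degree at most 2, there are no boundaries
  over \<open>R\<close>, since \<open>I\<^sub>X\<close> contains no linear form. Otherwise every cycle \<open>c\<close> over \<open>J\<close> already is a
  boundary over \<open>J\<close>, for the following reason.

  Filter \<open>I\<^sub>X\<close> by the degree in \<open>x\<^sub>0\<close>. As \<open>q\<close> is a smooth point, the leading coefficients lie in the
  ideal \<open>L\<close> of the tangent space at \<open>q\<close>, whose Koszul homology lives in polynomial degree 1 because
  \<open>L\<close> is generated by linear forms. So every Koszul chain over \<open>I\<^sub>X\<close> with boundary in \<open>S\<close> and of small
  degree in \<open>x\<^sub>0\<close> is homologous to one over \<open>J\<close>. For large \<open>t\<close>, the cycle \<open>x\<^sub>0\<^sup>t c\<close> is thus homologous to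
  a cycle over \<open>J\<close> of high degree, which is a boundary by Hilbert's basis theorem. By
  property \<open>N\<^bsub>2,p\<^esub>\<close> and the mapping cone sequence, multiplication by \<open>x\<^sub>0\<close> is injective on the
  homology, hence \<open>c = d w\<close> with \<open>w\<close> over \<open>I\<^sub>X\<close>. The leading coefficient of \<open>w\<close> is a Koszul cycle of \<open>L\<close>
  in degree 1, and such a cycle is the leading coefficient of a cycle over \<open>I\<^sub>X\<close>: a suitable multiple
  by a power of \<open>x\<^sub>0\<close> lifts by means of quadrics in \<open>I\<^sub>X\<close> with leading coefficients generating \<open>L\<close>, and the
  surjectivity of multiplication by \<open>x\<^sub>0\<close> removes that power. Subtracting the lift puts \<open>w\<close> over \<open>J\<close>.
\<close>

section \<open>Polynomials\<close>

text \<open>Property N_{2,p} makes Tor^R_i(I_X) vanish in the degrees i + j with j >= 3, so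
  injectivity there amounts to property N_{2,p-1} for X_q; hence cycles over J have to be shown to
  bound. Two steps fix the range i <= p - 2, both through the homology over R in homological degree
  i + 1: multiplication by x_0 must be injective in degree i, and the correction of w takes place in
  degree i + 1, where it must be surjective. Smoothness provides local equations of arbitrary
  degree, while lifting requires quadrics; as I_X is generated by quadrics, the linear part at q of
  any equation is that of a quadric. That the leading coefficients of all forms in I_X lie in L is a
  statement about the tangent cone: cancellation among the equations may hide their linear parts, so
  the equations are solved formally up to a finite order, and the forms are restricted to the
  solution. Characteristic zero enters mainly through Cartan homotopies: dh + hd is multiplication
  by an integer, or an operator with known integer eigenvalues, and is inverted.\<close>

abbreviation "lookup \<equiv> Poly_Mapping.lookup"
abbreviation "keys \<equiv> Poly_Mapping.keys"

lemma sum_fun_apply: "(\<Sum>i\<in>A. f i) x = (\<Sum>i\<in>A. f i x :: 'a::comm_monoid_add)"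
  by (induction A rule: infinite_finite_induct) auto

subsection \<open>Linear extension from monomials\<close>

lemma mpoly_expand: "(\<Sum>m\<in>keys f. Poly_Mapping.single m (lookup f m)) = f"
proof (rule poly_mapping_eqI)
  fix k
  show "lookup (\<Sum>m\<in>keys f. Poly_Mapping.single m (lookup f m)) k = lookup f k"
    by (auto simp: lookup_sum lookup_single when_def in_keys_iff)
qed

lemma mpoly_induct [case_names zero single add]:
  fixes f :: "'a \<Rightarrow>\<^sub>0 'b::comm_monoid_add"
  assumes "P 0" and "\<And>m a. m \<in> keys f \<Longrightarrow> P (Poly_Mapping.single m a)"
    and "\<And>g h. P g \<Longrightarrow> P h \<Longrightarrow> P (g + h)"
  shows "P f"
proof -
  have "P (\<Sum>m\<in>A. Poly_Mapping.single m (lookup f m))" if "A \<subseteq> keys f" for A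
    using finite_subset[OF that finite_keys] that
    by (induction A rule: finite_induct) (auto intro: assms)
  from this[of "keys f"] show ?thesis by (simp add: mpoly_expand)
qed

text \<open>The k-linear map with value \<open>t m\<close> on the monomial m. Substitutions, partial
  derivatives and coefficients in x0 are all of this kind.\<close>

definition linear_ext :: "((nat \<Rightarrow>\<^sub>0 nat) \<Rightarrow> 'k mpoly) \<Rightarrow> 'k::comm_ring_1 mpoly \<Rightarrow> 'k mpoly" where
  "linear_ext t f = (\<Sum>m\<in>keys f. pconst (lookup f m) * t m)"

lemma pconst_0 [simp]: "pconst 0 = 0"
  and pconst_1 [simp]: "pconst 1 = 1"
  and pconst_add: "pconst (a + b) = pconst a + pconst b"
  and pconst_minus: "pconst (- a) = - pconst a"
  and pconst_mult: "pconst (a * b) = pconst a * pconst b"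
  by (simp_all add: pconst_def single_add mult_single single_uminus)

lemma pconst_of_nat: "pconst (of_nat n) = of_nat n"
  by (simp add: pconst_def)

lemma pconst_mult_single: "pconst b * Poly_Mapping.single m a = Poly_Mapping.single m (b * a)"
  by (simp add: pconst_def mult_single)

lemma linear_ext_superset:
  assumes "finite A" "keys f \<subseteq> A"
  shows "linear_ext t f = (\<Sum>m\<in>A. pconst (lookup f m) * t m)"
  unfolding linear_ext_def
  by (rule sum.mono_neutral_left) (use assms in \<open>auto simp: in_keys_iff\<close>)

lemma linear_ext_0 [simp]: "linear_ext t 0 = 0"
  by (simp add: linear_ext_def)

lemma linear_ext_add: "linear_ext t (f + g) = linear_ext t f + linear_ext t g"
proof -
  let ?A = "keys f \<union> keys g"
  have "linear_ext t (f + g) = (\<Sum>m\<in>?A. pconst (lookup (f + g) m) * t m)"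
    by (rule linear_ext_superset) (auto dest: subsetD[OF Poly_Mapping.keys_add])
  moreover have "linear_ext t f = (\<Sum>m\<in>?A. pconst (lookup f m) * t m)"
    by (rule linear_ext_superset) auto
  moreover have "linear_ext t g = (\<Sum>m\<in>?A. pconst (lookup g m) * t m)"
    by (rule linear_ext_superset) auto
  ultimately show ?thesis
    by (simp add: lookup_add pconst_add distrib_right sum.distrib)
qed

lemma linear_ext_single [simp]: "linear_ext t (Poly_Mapping.single m a) = pconst a * t m"
  by (cases "a = 0") (simp_all add: linear_ext_def)

lemma linear_ext_pconst_mult: "linear_ext t (pconst a * f) = pconst a * linear_ext t f"
  by (induction f rule: mpoly_induct)
    (simp_all add: pconst_mult_single linear_ext_add distrib_left pconst_mult mult.assoc)

lemma linear_ext_minus: "linear_ext t (- f) = - linear_ext t f"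
  using linear_ext_pconst_mult[of t "- 1" f] by (simp add: pconst_minus)

lemma linear_ext_diff: "linear_ext t (f - g) = linear_ext t f - linear_ext t g"
  using linear_ext_add[of t f "- g"] by (simp add: linear_ext_minus)

lemma linear_ext_sum: "linear_ext t (\<Sum>i\<in>A. f i) = (\<Sum>i\<in>A. linear_ext t (f i))"
  by (induction A rule: infinite_finite_induct) (auto simp: linear_ext_add)

subsection \<open>Subrings generated by variables\<close>

lemma zero_polys [simp, intro]: "0 \<in> polys V"
  by (simp add: polys_def)

lemma polys_add [intro]: "f \<in> polys V \<Longrightarrow> g \<in> polys V \<Longrightarrow> f + g \<in> polys V"
  using Poly_Mapping.keys_add[of f g] unfolding polys_def by blast

lemma polys_mult [intro]: "f \<in> polys V \<Longrightarrow> g \<in> polys V \<Longrightarrow> f * g \<in> polys V"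
  using cring.axioms(1)[OF cring_poly_ring, THEN ring.ring_simprules(5), of f V g]
  by (simp add: poly_ring_def)

lemma polys_minus [intro]: "f \<in> polys V \<Longrightarrow> - f \<in> polys V"
  by (simp add: polys_def)

lemma polys_diff [intro]: "f \<in> polys V \<Longrightarrow> g \<in> polys V \<Longrightarrow> f - g \<in> polys V"
  using polys_add[of f V "- g"] polys_minus by auto

lemma one_polys [simp, intro]: "1 \<in> polys V"
  by (simp add: polys_def)

lemma polys_sum [intro]: "(\<And>i. i \<in> A \<Longrightarrow> f i \<in> polys V) \<Longrightarrow> (\<Sum>i\<in>A. f i) \<in> polys V"
  by (induction A rule: infinite_finite_induct) auto

lemma polys_prod [intro]: "(\<And>i. i \<in> A \<Longrightarrow> f i \<in> polys V) \<Longrightarrow> (\<Prod>i\<in>A. f i) \<in> polys V"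
  by (induction A rule: infinite_finite_induct) auto

lemma polys_power [intro]: "f \<in> polys V \<Longrightarrow> f ^ n \<in> polys V"
  by (induction n) auto

lemma pconst_polys [simp, intro]: "pconst a \<in> polys V"
  by (auto simp: pconst_def polys_def split: if_splits)

lemma single_polys: "keys m \<subseteq> V \<Longrightarrow> Poly_Mapping.single m a \<in> polys V"
  by (auto simp: polys_def)

lemma pvar_polys [intro]: "i \<in> V \<Longrightarrow> pvar i \<in> polys V"
  by (auto simp: polys_def pvar_def)

lemma polys_mono: "V \<subseteq> W \<Longrightarrow> f \<in> polys V \<Longrightarrow> f \<in> polys W"
  by (auto simp: polys_def)

lemma polys_induct [consumes 1, case_names zero single add]:
  assumes "f \<in> polys V" "P 0"
    and "\<And>m a. keys m \<subseteq> V \<Longrightarrow> P (Poly_Mapping.single m a)"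
    and "\<And>g h. P g \<Longrightarrow> P h \<Longrightarrow> P (g + h)"
  shows "P f"
  by (rule mpoly_induct) (use assms in \<open>auto simp: polys_def\<close>)

lemma pvar_neq_0 [simp]: "pvar i \<noteq> (0 :: 'k::comm_ring_1 mpoly)"
  by (metis pvar_def keys_single keys_zero zero_neq_one insert_not_empty)

subsection \<open>Homogeneous polynomials\<close>

lemma mono_deg_superset:
  assumes "finite A" "keys m \<subseteq> A"
  shows "mono_deg m = (\<Sum>i\<in>A. lookup m i)"
  unfolding mono_deg_def
  by (rule sum.mono_neutral_left) (use assms in \<open>auto simp: in_keys_iff\<close>)

lemma mono_deg_add: "mono_deg (m + n) = mono_deg m + mono_deg n"
proof -
  let ?A = "keys m \<union> keys n"
  have "mono_deg (m + n) = (\<Sum>i\<in>?A. lookup (m + n) i)"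
    by (rule mono_deg_superset) (auto dest: subsetD[OF Poly_Mapping.keys_add])
  moreover have "mono_deg m = (\<Sum>i\<in>?A. lookup m i)"
    by (rule mono_deg_superset) auto
  moreover have "mono_deg n = (\<Sum>i\<in>?A. lookup n i)"
    by (rule mono_deg_superset) auto
  ultimately show ?thesis by (simp add: lookup_add sum.distrib)
qed

lemma mono_deg_0 [simp]: "mono_deg 0 = 0"
  by (simp add: mono_deg_def)

lemma mono_deg_single [simp]: "mono_deg (Poly_Mapping.single i n) = n"
  by (simp add: mono_deg_def)

lemma mono_deg_eq_0: "mono_deg m = 0 \<longleftrightarrow> m = 0"
  unfolding mono_deg_def by (auto simp: in_keys_iff intro!: poly_mapping_eqI)

lemma homogeneous_0 [simp]: "homogeneous e 0"
  by (simp add: homogeneous_def)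

lemma homogeneous_add: "homogeneous e f \<Longrightarrow> homogeneous e g \<Longrightarrow> homogeneous e (f + g)"
  using Poly_Mapping.keys_add[of f g] unfolding homogeneous_def by blast

lemma homogeneous_minus: "homogeneous e f \<Longrightarrow> homogeneous e (- f)"
  by (simp add: homogeneous_def)

lemma homogeneous_diff: "homogeneous e f \<Longrightarrow> homogeneous e g \<Longrightarrow> homogeneous e (f - g)"
  using homogeneous_add[of e f "- g"] homogeneous_minus by auto

lemma homogeneous_sum: "(\<And>i. i \<in> A \<Longrightarrow> homogeneous e (f i)) \<Longrightarrow> homogeneous e (\<Sum>i\<in>A. f i)"
  by (induction A rule: infinite_finite_induct) (auto intro: homogeneous_add)

lemma homogeneous_mult:
  assumes "homogeneous d f" "homogeneous e g" shows "homogeneous (d + e) (f * g)"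
  unfolding homogeneous_def
proof
  fix m assume "m \<in> keys (f * g)"
  then obtain a b where "m = a + b" "a \<in> keys f" "b \<in> keys g"
    using Poly_Mapping.keys_mult[of f g] by blast
  with assms show "int (mono_deg m) = d + e"
    by (auto simp: homogeneous_def mono_deg_add)
qed

lemma homogeneous_single: "homogeneous (int (mono_deg m)) (Poly_Mapping.single m a)"
  by (simp add: homogeneous_def)

lemma homogeneous_pvar [simp]: "homogeneous 1 (pvar i)"
  by (simp add: homogeneous_def pvar_def)

lemma homogeneous_pconst [simp]: "homogeneous 0 (pconst a)"
  by (auto simp: homogeneous_def pconst_def split: if_splits)

lemma homogeneous_one [simp]: "homogeneous 0 1"
  using homogeneous_pconst[of 1] by simp

lemma homogeneous_pconst_mult: "homogeneous e f \<Longrightarrow> homogeneous e (pconst a * f)"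
  using homogeneous_mult[of 0 "pconst a" e f] by simp

lemma homogeneous_power: "homogeneous e f \<Longrightarrow> homogeneous (int n * e) (f ^ n)"
  by (induction n) (auto simp: distrib_right intro: homogeneous_mult)

lemma homogeneous_neg_eq_0: "homogeneous e f \<Longrightarrow> e < 0 \<Longrightarrow> f = 0"
  unfolding homogeneous_def
  by (metis (no_types, lifting) keys_eq_empty ex_in_conv of_nat_0_le_iff not_less)

lemma homogeneous_degree_0:
  assumes "homogeneous 0 f" shows "f = pconst (lookup f 0)"
proof (rule poly_mapping_eqI)
  fix m
  show "lookup f m = lookup (pconst (lookup f 0)) m"
  proof (cases "m = 0")
    case False
    then have "m \<notin> keys f" using assms by (auto simp: homogeneous_def mono_deg_eq_0)
    then show ?thesis using False by (simp add: pconst_def lookup_single in_keys_iff)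
  qed (simp add: pconst_def)
qed

lemma lookup_hom_component:
  "lookup (hom_component e f) m = (if int (mono_deg m) = e then lookup f m else 0)"
  unfolding hom_component_def
  by (auto simp: lookup_sum lookup_single when_def in_keys_iff)

lemma homogeneous_hom_component [simp]: "homogeneous e (hom_component e f)"
  by (auto simp: homogeneous_def in_keys_iff lookup_hom_component split: if_splits)

lemma hom_component_homogeneous: "homogeneous e f \<Longrightarrow> hom_component e f = f"
  by (rule poly_mapping_eqI) (auto simp: homogeneous_def in_keys_iff lookup_hom_component)

lemma hom_component_other: "homogeneous e f \<Longrightarrow> d \<noteq> e \<Longrightarrow> hom_component d f = 0"
  by (rule poly_mapping_eqI) (auto simp: homogeneous_def in_keys_iff lookup_hom_component)

lemma hom_component_add: "hom_component e (f + g) = hom_component e f + hom_component e g"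
  by (rule poly_mapping_eqI) (simp add: lookup_hom_component lookup_add)

lemma hom_component_0 [simp]: "hom_component e 0 = 0"
  by (rule poly_mapping_eqI) (simp add: lookup_hom_component)

lemma hom_component_sum: "hom_component e (\<Sum>i\<in>A. f i) = (\<Sum>i\<in>A. hom_component e (f i))"
  by (induction A rule: infinite_finite_induct) (auto simp: hom_component_add)

lemma hom_component_polys: "f \<in> polys V \<Longrightarrow> hom_component e f \<in> polys V"
  by (auto simp: polys_def in_keys_iff lookup_hom_component split: if_splits)

lemma sum_hom_components:
  obtains E where "finite E" "f = (\<Sum>e\<in>E. hom_component e f)"
proof
  let ?E = "(\<lambda>m. int (mono_deg m)) ` keys f"
  show "finite ?E" by simp
  show "f = (\<Sum>e\<in>?E. hom_component e f)"
  proof (rule poly_mapping_eqI)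
    fix m
    have "(\<Sum>e\<in>?E. if int (mono_deg m) = e then lookup f m else 0) = lookup f m"
      by (auto simp: in_keys_iff)
    then show "lookup f m = lookup (\<Sum>e\<in>?E. hom_component e f) m"
      by (simp add: lookup_sum lookup_hom_component)
  qed
qed

lemma hom_component_mult:
  assumes "homogeneous d f"
  shows "hom_component e (f * g) = f * hom_component (e - d) g"
proof (induction g rule: mpoly_induct)
  case (single m a)
  have *: "homogeneous (d + int (mono_deg m)) (f * Poly_Mapping.single m a)"
    by (rule homogeneous_mult[OF assms homogeneous_single])
  show ?case
  proof (cases "e = d + int (mono_deg m)")
    case True
    then show ?thesis using hom_component_homogeneous[OF *]
      hom_component_homogeneous[OF homogeneous_single[of m a]] by simp
  next
    case False
    then show ?thesis using hom_component_other[OF *]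
      hom_component_other[OF homogeneous_single[of m a], of "e - d"] by simp
  qed
qed (simp_all add: hom_component_add distrib_left)

lemma formsI: "f \<in> polys V \<Longrightarrow> homogeneous e f \<Longrightarrow> f \<in> forms V e"
  by (simp add: forms_def)

lemma forms_0 [simp]: "0 \<in> forms V e"
  by (simp add: forms_def)

lemma forms_add: "f \<in> forms V e \<Longrightarrow> g \<in> forms V e \<Longrightarrow> f + g \<in> forms V e"
  by (auto simp: forms_def intro: homogeneous_add)

lemma forms_diff: "f \<in> forms V e \<Longrightarrow> g \<in> forms V e \<Longrightarrow> f - g \<in> forms V e"
  by (auto simp: forms_def intro: homogeneous_diff)

lemma forms_mult: "f \<in> forms V d \<Longrightarrow> g \<in> forms V e \<Longrightarrow> f * g \<in> forms V (d + e)"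
  by (auto simp: forms_def intro: homogeneous_mult)

lemma forms_pconst_mult: "f \<in> forms V e \<Longrightarrow> pconst a * f \<in> forms V e"
  by (auto simp: forms_def intro: homogeneous_pconst_mult)

lemma forms_sum: "(\<And>i. i \<in> A \<Longrightarrow> f i \<in> forms V e) \<Longrightarrow> (\<Sum>i\<in>A. f i) \<in> forms V e"
  by (auto simp: forms_def intro: homogeneous_sum)

lemma forms_mono: "V \<subseteq> W \<Longrightarrow> f \<in> forms V e \<Longrightarrow> f \<in> forms W e"
  using polys_mono by (auto simp: forms_def)

lemma pvar_forms: "i \<in> V \<Longrightarrow> pvar i \<in> forms V 1"
  by (auto simp: forms_def)

lemma forms_neg: "f \<in> forms V e \<Longrightarrow> e < 0 \<Longrightarrow> f = 0"
  using homogeneous_neg_eq_0 by (auto simp: forms_def)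

subsection \<open>Substitutions\<close>

definition subst :: "(nat \<Rightarrow> 'k mpoly) \<Rightarrow> 'k::comm_ring_1 mpoly \<Rightarrow> 'k mpoly" where
  "subst \<gamma> = linear_ext (\<lambda>m. \<Prod>i\<in>keys m. \<gamma> i ^ lookup m i)"

lemma prod_power_superset:
  fixes \<gamma> :: "nat \<Rightarrow> 'a::comm_monoid_mult"
  assumes "finite A" "keys m \<subseteq> A"
  shows "(\<Prod>i\<in>keys m. \<gamma> i ^ lookup m i) = (\<Prod>i\<in>A. \<gamma> i ^ lookup m i)"
  by (rule prod.mono_neutral_left) (use assms in \<open>auto simp: in_keys_iff\<close>)

lemma prod_power_add:
  fixes \<gamma> :: "nat \<Rightarrow> 'a::comm_monoid_mult"
  shows "(\<Prod>i\<in>keys (m + n). \<gamma> i ^ lookup (m + n) i)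
    = (\<Prod>i\<in>keys m. \<gamma> i ^ lookup m i) * (\<Prod>i\<in>keys n. \<gamma> i ^ lookup n i)"
proof -
  let ?A = "keys m \<union> keys n"
  have "(\<Prod>i\<in>keys (m + n). \<gamma> i ^ lookup (m + n) i) = (\<Prod>i\<in>?A. \<gamma> i ^ lookup (m + n) i)"
    by (rule prod_power_superset) (auto dest: subsetD[OF Poly_Mapping.keys_add])
  moreover have "(\<Prod>i\<in>keys m. \<gamma> i ^ lookup m i) = (\<Prod>i\<in>?A. \<gamma> i ^ lookup m i)"
    by (rule prod_power_superset) auto
  moreover have "(\<Prod>i\<in>keys n. \<gamma> i ^ lookup n i) = (\<Prod>i\<in>?A. \<gamma> i ^ lookup n i)"
    by (rule prod_power_superset) auto
  ultimately show ?thesis by (simp add: lookup_add power_add prod.distrib)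
qed

lemma subst_add: "subst \<gamma> (f + g) = subst \<gamma> f + subst \<gamma> g"
  by (simp add: subst_def linear_ext_add)

lemma subst_diff: "subst \<gamma> (f - g) = subst \<gamma> f - subst \<gamma> g"
  by (simp add: subst_def linear_ext_diff)

lemma subst_0 [simp]: "subst \<gamma> 0 = 0"
  by (simp add: subst_def)

lemma subst_sum: "subst \<gamma> (\<Sum>i\<in>A. f i) = (\<Sum>i\<in>A. subst \<gamma> (f i))"
  by (simp add: subst_def linear_ext_sum)

lemma subst_single:
  "subst \<gamma> (Poly_Mapping.single m a) = pconst a * (\<Prod>i\<in>keys m. \<gamma> i ^ lookup m i)"
  by (simp add: subst_def)

lemma subst_pconst [simp]: "subst \<gamma> (pconst a) = pconst a"
  using subst_single[of \<gamma> 0 a] by (simp add: pconst_def)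

lemma subst_1 [simp]: "subst \<gamma> 1 = 1"
  using subst_pconst[of \<gamma> 1] by simp

lemma subst_pvar [simp]: "subst \<gamma> (pvar i) = \<gamma> i"
  by (simp add: pvar_def subst_single)

lemma subst_mult: "subst \<gamma> (f * g) = subst \<gamma> f * subst \<gamma> g"
proof (induction f rule: mpoly_induct)
  case (single m a)
  show ?case
    by (induction g rule: mpoly_induct)
      (simp_all add: subst_single subst_add distrib_left mult_single prod_power_add pconst_mult
        mult.assoc mult.left_commute)
qed (simp_all add: subst_add distrib_right)

lemma subst_power: "subst \<gamma> (f ^ n) = subst \<gamma> f ^ n"
  by (induction n) (simp_all add: subst_mult)

lemma pvar_power: "pvar i ^ n = Poly_Mapping.single (Poly_Mapping.single i n) (1 :: 'k::comm_ring_1)"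
  by (induction n) (auto simp: pvar_def mult_single simp flip: single_add)

lemma single_eq_prod_pvar:
  "Poly_Mapping.single m a = pconst a * (\<Prod>i\<in>keys m. pvar i ^ lookup m i)"
proof -
  have "(\<Prod>i\<in>A. Poly_Mapping.single (h i) (1 :: 'a::comm_ring_1)) = Poly_Mapping.single (\<Sum>i\<in>A. h i) 1"
    for A and h :: "nat \<Rightarrow> nat \<Rightarrow>\<^sub>0 nat"
    by (induction A rule: infinite_finite_induct) (auto simp: mult_single)
  then show ?thesis
    using mpoly_expand[of m] by (simp add: pvar_power pconst_mult_single)
qed

lemma subst_pvar_id: "f \<in> polys V \<Longrightarrow> (\<And>i. i \<in> V \<Longrightarrow> \<gamma> i = pvar i) \<Longrightarrow> subst \<gamma> f = f"
proof (induction rule: polys_induct)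
  case (single m a)
  then have "(\<Prod>i\<in>keys m. \<gamma> i ^ lookup m i) = (\<Prod>i\<in>keys m. pvar i ^ lookup m i)"
    by (intro prod.cong) auto
  then show ?case unfolding subst_single by (simp add: single_eq_prod_pvar[of m a])
qed (simp_all add: subst_add)

lemma subst_polys:
  assumes "f \<in> polys V" "\<And>i. i \<in> V \<Longrightarrow> \<gamma> i \<in> polys W"
  shows "subst \<gamma> f \<in> polys W"
  using assms(1)
proof (induction rule: polys_induct)
  case (single m a)
  then show ?case unfolding subst_single using assms(2) by (intro polys_mult polys_prod) auto
qed (auto simp: subst_add)

text \<open>Exhibits the passage to a chart as a ring homomorphism, so that it respects sums,
  products and powers.\<close>

lemma dehomogenize_eq_subst: "dehomogenize i = subst (pvar(i := 1))"
proof
  fix f :: "'a mpoly"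
  have "Poly_Mapping.single (Poly_Mapping.update i 0 m) a
      = pconst a * (\<Prod>j\<in>keys m. (pvar(i := 1)) j ^ lookup m j)" for m and a :: 'a
  proof -
    let ?u = "Poly_Mapping.update i 0 m"
    have "(\<Prod>j\<in>keys m. (pvar(i := 1)) j ^ lookup m j :: 'a mpoly) = (\<Prod>j\<in>keys ?u. pvar j ^ lookup ?u j)"
      by (rule prod.mono_neutral_cong_right) (auto simp: keys_update lookup_update)
    then show ?thesis unfolding single_eq_prod_pvar[of ?u] by simp
  qed
  then show "dehomogenize i f = subst (pvar(i := 1)) f"
    by (simp add: dehomogenize_def subst_def linear_ext_def)
qed

subsection \<open>Partial derivatives\<close>

text \<open>Subtraction of exponents is truncated; it goes wrong only where x_j does not occur, and
  there the coefficient \<open>of_nat (lookup m j)\<close> is 0.\<close>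

definition pderivative :: "nat \<Rightarrow> 'k::comm_ring_1 mpoly \<Rightarrow> 'k mpoly" where
  "pderivative j =
    linear_ext (\<lambda>m. Poly_Mapping.single (m - Poly_Mapping.single j 1) (of_nat (lookup m j)))"

lemma pderivative_add: "pderivative j (f + g) = pderivative j f + pderivative j g"
  by (simp add: pderivative_def linear_ext_add)

lemma pderivative_0 [simp]: "pderivative j 0 = 0"
  by (simp add: pderivative_def)

lemma pderivative_single: "pderivative j (Poly_Mapping.single m a)
    = Poly_Mapping.single (m - Poly_Mapping.single j 1) (a * of_nat (lookup m j))"
  by (simp add: pderivative_def pconst_mult_single)

lemma diff_single_add:
  fixes m n :: "nat \<Rightarrow>\<^sub>0 nat"
  assumes "lookup m j \<noteq> 0"
  shows "m - Poly_Mapping.single j 1 + n = m + n - Poly_Mapping.single j 1"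
  by (rule poly_mapping_eqI)
    (use assms in \<open>auto simp: lookup_add lookup_minus lookup_single when_def\<close>)

lemma pderivative_mult: "pderivative j (f * g) = f * pderivative j g + pderivative j f * g"
proof (induction f rule: mpoly_induct)
  case (single m a)
  show ?case
  proof (induction g rule: mpoly_induct)
    case (single n b)
    have 1: "Poly_Mapping.single (m + (n - Poly_Mapping.single j 1)) (a * (b * of_nat (lookup n j)))
        = Poly_Mapping.single (m + n - Poly_Mapping.single j 1) (a * (b * of_nat (lookup n j)))"
      using diff_single_add[of n j m] by (cases "lookup n j = 0") (simp_all add: add.commute)
    have 2: "Poly_Mapping.single (m - Poly_Mapping.single j 1 + n) (a * of_nat (lookup m j) * b)
        = Poly_Mapping.single (m + n - Poly_Mapping.single j 1) (a * of_nat (lookup m j) * b)"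
      using diff_single_add[of m j n] by (cases "lookup m j = 0") simp_all
    show ?case
      by (simp only: pderivative_single mult_single 1 2 lookup_add flip: single_add)
        (simp add: algebra_simps)
  qed (simp_all add: pderivative_add algebra_simps)
qed (simp_all add: pderivative_add algebra_simps)

lemma pderivative_pconst [simp]: "pderivative j (pconst a) = 0"
  by (simp add: pconst_def pderivative_single)

lemma pderivative_pvar: "pderivative j (pvar i) = (if i = j then 1 else 0)"
  by (auto simp: pvar_def pderivative_single lookup_single when_def)

lemma pderivative_polys: "f \<in> polys V \<Longrightarrow> pderivative j f \<in> polys V"
proof (induction rule: polys_induct)
  case (single m a)
  have "keys (m - Poly_Mapping.single j 1) \<subseteq> keys m"
    by (auto simp: in_keys_iff lookup_minus)
  with single show ?case unfolding pderivative_single by (intro single_polys) auto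
qed (auto simp: pderivative_add)

lemma pderivative_forms: "f \<in> forms V e \<Longrightarrow> pderivative j f \<in> forms V (e - 1)"
proof -
  assume f: "f \<in> forms V e"
  have "homogeneous (e - 1) (pderivative j f)"
    unfolding pderivative_def linear_ext_def
  proof (rule homogeneous_sum, rule homogeneous_pconst_mult)
    fix m assume m: "m \<in> keys f"
    show "homogeneous (e - 1) (Poly_Mapping.single (m - Poly_Mapping.single j 1)
        (of_nat (lookup m j) :: 'a))"
    proof (cases "lookup m j = 0")
      case False
      then have "m - Poly_Mapping.single j 1 + Poly_Mapping.single j 1 = m"
        by (intro poly_mapping_eqI) (auto simp: lookup_add lookup_minus lookup_single when_def)
      then have "mono_deg m = mono_deg (m - Poly_Mapping.single j 1) + 1"
        by (metis mono_deg_add mono_deg_single)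
      moreover have "int (mono_deg m) = e" using f m by (auto simp: forms_def homogeneous_def)
      ultimately show ?thesis
        using homogeneous_single[of "m - Poly_Mapping.single j 1" "of_nat (lookup m j) :: 'a"] by auto
    qed simp
  qed
  then show ?thesis using f pderivative_polys by (auto simp: forms_def)
qed

text \<open>On a monomial, x_j times the derivative by x_j multiplies by the exponent of x_j. After
  division by an integer this is the source of the contracting homotopies below.\<close>

lemma euler_identity:
  assumes "f \<in> forms V e" "finite V"
  shows "(\<Sum>j\<in>V. pvar j * pderivative j f) = of_int e * f"
proof -
  have single: "(\<Sum>j\<in>V. pvar j * pderivative j (Poly_Mapping.single m a))
      = Poly_Mapping.single m (of_nat (mono_deg m) * a)" if "keys m \<subseteq> V" for m and a :: 'a
  proof -
    have "pvar j * pderivative j (Poly_Mapping.single m a)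
        = Poly_Mapping.single m (a * of_nat (lookup m j))" for j
    proof (cases "lookup m j = 0")
      case False
      then have "m = Poly_Mapping.single j 1 + (m - Poly_Mapping.single j 1)"
        by (intro poly_mapping_eqI) (auto simp: lookup_add lookup_minus lookup_single when_def)
      then show ?thesis by (simp add: pvar_def pderivative_single mult_single)
    qed (simp add: pderivative_single)
    then have "(\<Sum>j\<in>V. pvar j * pderivative j (Poly_Mapping.single m a))
      = (\<Sum>j\<in>V. Poly_Mapping.single m (a * of_nat (lookup m j)))" by simp
    also have "\<dots> = Poly_Mapping.single m (\<Sum>j\<in>V. a * of_nat (lookup m j))"
      by (induction V rule: infinite_finite_induct) (auto simp: single_add)
    also have "(\<Sum>j\<in>V. a * of_nat (lookup m j)) = of_nat (mono_deg m) * a"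
      using mono_deg_superset[OF assms(2) that] by (simp add: sum_distrib_left mult.commute)
    finally show ?thesis .
  qed
  let ?E = "\<lambda>f :: 'a mpoly. \<Sum>j\<in>V. pvar j * pderivative j f"
  have add: "?E (g + h) = ?E g + ?E h" for g h
    by (simp add: pderivative_add distrib_left sum.distrib)
  have "?E (\<Sum>m\<in>A. Poly_Mapping.single m (lookup f m))
      = (\<Sum>m\<in>A. ?E (Poly_Mapping.single m (lookup f m)))" for A
    by (induction A rule: infinite_finite_induct) (simp_all add: add)
  then have "?E f = (\<Sum>m\<in>keys f. ?E (Poly_Mapping.single m (lookup f m)))"
    using mpoly_expand[of f] by metis
  also have "\<dots> = (\<Sum>m\<in>keys f. of_int e * Poly_Mapping.single m (lookup f m))"
  proof (rule sum.cong)
    fix m assume m: "m \<in> keys f"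
    then have "keys m \<subseteq> V" "e = int (mono_deg m)"
      using assms(1) by (auto simp: forms_def polys_def homogeneous_def)
    moreover have "of_nat n * Poly_Mapping.single m a = Poly_Mapping.single m (of_nat n * a)"
      for n and a :: 'a
      using pconst_mult_single[of "of_nat n" m a] by (simp add: pconst_of_nat)
    ultimately show "?E (Poly_Mapping.single m (lookup f m))
        = of_int e * Poly_Mapping.single m (lookup f m)"
      using single[of m] by simp
  qed simp
  also have "\<dots> = of_int e * f"
    by (simp add: mpoly_expand flip: sum_distrib_left)
  finally show ?thesis .
qed

subsection \<open>Expansion in powers of the first variable\<close>

definition x0_coeff :: "nat \<Rightarrow> 'k::comm_ring_1 mpoly \<Rightarrow> 'k mpoly" where
  "x0_coeff n = linear_ext (\<lambda>m. if lookup m 0 = n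
    then Poly_Mapping.single (Poly_Mapping.update 0 0 m) 1 else 0)"

lemma x0_coeff_add: "x0_coeff n (f + g) = x0_coeff n f + x0_coeff n g"
  by (simp add: x0_coeff_def linear_ext_add)

lemma x0_coeff_diff: "x0_coeff n (f - g) = x0_coeff n f - x0_coeff n g"
  by (simp add: x0_coeff_def linear_ext_diff)

lemma x0_coeff_0 [simp]: "x0_coeff n 0 = 0"
  by (simp add: x0_coeff_def)

lemma x0_coeff_sum: "x0_coeff n (\<Sum>i\<in>A. f i) = (\<Sum>i\<in>A. x0_coeff n (f i))"
  by (simp add: x0_coeff_def linear_ext_sum)

lemma x0_coeff_single: "x0_coeff n (Poly_Mapping.single m a)
    = (if lookup m 0 = n then Poly_Mapping.single (Poly_Mapping.update 0 0 m) a else 0)"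
  by (simp add: x0_coeff_def pconst_mult_single)

lemma update_0_add:
  fixes m n :: "nat \<Rightarrow>\<^sub>0 nat"
  shows "Poly_Mapping.update i 0 (m + n) = Poly_Mapping.update i 0 m + Poly_Mapping.update i 0 n"
  by (rule poly_mapping_eqI) (auto simp: lookup_update lookup_add)

lemma update_0_id: "lookup m i = 0 \<Longrightarrow> Poly_Mapping.update i 0 m = m"
  by (rule poly_mapping_eqI) (auto simp: lookup_update)

text \<open>Polynomials free of x0 act as scalars on the expansion in x0. Hence taking coefficients
  commutes with the Koszul differential over S, though not with the one over R.\<close>

lemma x0_coeff_mult:
  assumes "g \<in> polys V" "0 \<notin> V"
  shows "x0_coeff n (g * f) = g * x0_coeff n f"
  using assms(1)
proof (induction rule: polys_induct)
  case (single m a)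
  then have m: "lookup m 0 = 0" using assms(2) by (auto simp: in_keys_iff)
  show ?case
    by (induction f rule: mpoly_induct)
      (auto simp: x0_coeff_add distrib_left mult_single x0_coeff_single lookup_add m update_0_add
        update_0_id)
qed (simp_all add: x0_coeff_add distrib_right)

lemma x0_coeff_Suc_pvar: "x0_coeff (Suc n) (pvar 0 * f) = x0_coeff n f"
proof (induction f rule: mpoly_induct)
  case (single m a)
  have "Poly_Mapping.update 0 0 (Poly_Mapping.single 0 1 + m) = Poly_Mapping.update 0 0 m"
    by (rule poly_mapping_eqI) (auto simp: lookup_update lookup_add lookup_single)
  then show ?case by (simp add: pvar_def mult_single x0_coeff_single lookup_add)
qed (simp_all add: x0_coeff_add distrib_left)

lemma x0_coeff_0_pvar: "x0_coeff 0 (pvar 0 * f) = 0"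
  by (induction f rule: mpoly_induct)
    (simp_all add: x0_coeff_add distrib_left pvar_def mult_single x0_coeff_single lookup_add)

lemma x0_coeff_power_mult:
  "x0_coeff n (pvar 0 ^ m * f) = (if n < m then 0 else x0_coeff (n - m) f)"
proof (induction m arbitrary: n)
  case (Suc m)
  show ?case
  proof (cases n)
    case 0
    then show ?thesis using x0_coeff_0_pvar[of "pvar 0 ^ m * f"] by (simp add: mult.assoc)
  next
    case (Suc n')
    then show ?thesis using x0_coeff_Suc_pvar[of n' "pvar 0 ^ m * f"] Suc.IH[of n']
      by (simp add: mult.assoc)
  qed
qed simp

lemma x0_coeff_polys:
  assumes "f \<in> polys V" shows "x0_coeff n f \<in> polys (V - {0})"
  using assms
proof (induction rule: polys_induct)
  case (single m a)
  then show ?case by (auto simp: x0_coeff_single keys_update intro!: single_polys)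
qed (auto simp: x0_coeff_add)

lemma x0_coeff_free:
  assumes "f \<in> polys V" "0 \<notin> V" shows "x0_coeff n f = (if n = 0 then f else 0)"
  using assms(1)
proof (induction rule: polys_induct)
  case (single m a)
  then have "lookup m 0 = 0" using assms(2) by (auto simp: in_keys_iff)
  then show ?case by (simp add: x0_coeff_single update_0_id)
qed (simp_all add: x0_coeff_add)

lemma mono_deg_update_0: "mono_deg m = lookup m i + mono_deg (Poly_Mapping.update i 0 m)"
proof -
  have "m = Poly_Mapping.single i (lookup m i) + Poly_Mapping.update i 0 m"
    by (rule poly_mapping_eqI) (auto simp: lookup_update lookup_add lookup_single when_def)
  then show ?thesis by (metis mono_deg_add mono_deg_single)
qed

lemma x0_coeff_homogeneous:
  assumes "homogeneous e f" shows "homogeneous (e - int n) (x0_coeff n f)"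
  unfolding x0_coeff_def linear_ext_def
proof (rule homogeneous_sum, rule homogeneous_pconst_mult)
  fix m assume m: "m \<in> keys f"
  then have "e = int (mono_deg m)" using assms by (simp add: homogeneous_def)
  then show "homogeneous (e - int n) (if lookup m 0 = n
      then Poly_Mapping.single (Poly_Mapping.update 0 0 m) (1 :: 'a) else 0)"
    using homogeneous_single[of "Poly_Mapping.update 0 0 m" "1 :: 'a"] mono_deg_update_0[of m 0]
    by auto
qed

lemma x0_coeff_forms: "f \<in> forms V e \<Longrightarrow> x0_coeff n f \<in> forms (V - {0}) (e - int n)"
  by (auto simp: forms_def intro: x0_coeff_homogeneous x0_coeff_polys)

lemma x0_coeff_eq_0: "f \<in> forms V e \<Longrightarrow> e < int n \<Longrightarrow> x0_coeff n f = 0"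
  using forms_neg[OF x0_coeff_forms] by auto

text \<open>The length stays open above M, so that the expansions of two polynomials can be compared
  at a common length.\<close>

lemma x0_expansion: "\<exists>M. \<forall>n\<ge>M. f = (\<Sum>k<n. pvar 0 ^ k * x0_coeff k f)"
proof (induction f rule: mpoly_induct)
  case (single m a)
  have eq: "Poly_Mapping.single 0 (lookup m 0) + Poly_Mapping.update 0 0 m = m"
    by (rule poly_mapping_eqI) (auto simp: lookup_update lookup_add lookup_single when_def)
  have "(\<Sum>k<n. pvar 0 ^ k * x0_coeff k (Poly_Mapping.single m a)) = Poly_Mapping.single m a"
    if "n \<ge> Suc (lookup m 0)" for n
  proof -
    have "(\<Sum>k<n. pvar 0 ^ k * x0_coeff k (Poly_Mapping.single m a))
       = (\<Sum>k\<in>{lookup m 0}. pvar 0 ^ k * x0_coeff k (Poly_Mapping.single m a))"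
      by (rule sum.mono_neutral_right) (use that in \<open>auto simp: x0_coeff_single\<close>)
    then show ?thesis by (simp add: x0_coeff_single pvar_power mult_single eq)
  qed
  then show ?case by metis
next
  case (add g h)
  then obtain M M' where M: "\<forall>n\<ge>M. g = (\<Sum>k<n. pvar 0 ^ k * x0_coeff k g)"
    and M': "\<forall>n\<ge>M'. h = (\<Sum>k<n. pvar 0 ^ k * x0_coeff k h)" by blast
  have "g + h = (\<Sum>k<n. pvar 0 ^ k * x0_coeff k (g + h))" if "n \<ge> max M M'" for n
  proof -
    have "g = (\<Sum>k<n. pvar 0 ^ k * x0_coeff k g)" "h = (\<Sum>k<n. pvar 0 ^ k * x0_coeff k h)"
      using M M' that by (meson max.boundedE)+
    then show ?thesis
      unfolding x0_coeff_add distrib_left sum.distrib by (rule arg_cong2)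
  qed
  then show ?case by blast
qed simp

lemma x0_coeff_eqI: "(\<And>n. x0_coeff n f = x0_coeff n g) \<Longrightarrow> f = g"
proof -
  assume eq: "\<And>n. x0_coeff n f = x0_coeff n g"
  obtain M where M: "\<forall>n\<ge>M. f = (\<Sum>k<n. pvar 0 ^ k * x0_coeff k f)"
    using x0_expansion by blast
  obtain M' where M': "\<forall>n\<ge>M'. g = (\<Sum>k<n. pvar 0 ^ k * x0_coeff k g)"
    using x0_expansion by blast
  have "f = (\<Sum>k<max M M'. pvar 0 ^ k * x0_coeff k f)" using M by (meson max.cobounded1)
  also have "\<dots> = (\<Sum>k<max M M'. pvar 0 ^ k * x0_coeff k g)" by (simp only: eq)
  also have "\<dots> = g" using M' by (metis max.cobounded2)
  finally show "f = g" .
qed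

lemma x0_free_polysI:
  assumes "f \<in> polys V" "\<And>n. n > 0 \<Longrightarrow> x0_coeff n f = 0"
  shows "f \<in> polys (V - {0})"
proof -
  have "x0_coeff 0 f = f"
  proof (rule x0_coeff_eqI)
    fix n
    have "x0_coeff n (x0_coeff 0 f) = (if n = 0 then x0_coeff 0 f else 0)"
      by (rule x0_coeff_free[OF x0_coeff_polys[OF assms(1)]]) simp
    then show "x0_coeff n (x0_coeff 0 f) = x0_coeff n f"
      using assms(2)[of n] by (cases "n = 0") simp_all
  qed
  then show ?thesis using x0_coeff_polys[OF assms(1), of 0] by simp
qed

lemma pconst_of_int: "pconst (of_int n) = of_int n"
  by (simp add: pconst_def)

section \<open>The Koszul complex\<close>

subsection \<open>Contraction and wedge operators\<close>

definition koszul_sign :: "nat \<Rightarrow> nat set \<Rightarrow> 'a::comm_ring_1" where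
  "koszul_sign j T = (- 1) ^ card {t \<in> T. t < j}"

text \<open>Interior product with the dual of e_j, in coordinates. With the differential written as
  the sum of the x_j \<open>contract j\<close>, sign computations reduce to the anticommutation
  rules of \<open>contract\<close> and \<open>wedge\<close>.\<close>

definition contract :: "nat \<Rightarrow> (nat set \<Rightarrow> 'a) \<Rightarrow> nat set \<Rightarrow> 'a::comm_ring_1" where
  "contract j c = (\<lambda>T. if j \<in> T then 0 else koszul_sign j T * c (insert j T))"

definition wedge :: "nat \<Rightarrow> (nat set \<Rightarrow> 'a) \<Rightarrow> nat set \<Rightarrow> 'a::comm_ring_1" where
  "wedge j c = (\<lambda>T. if j \<in> T then koszul_sign j T * c (T - {j}) else 0)"

definition scale :: "'a \<Rightarrow> ('b \<Rightarrow> 'a) \<Rightarrow> 'b \<Rightarrow> 'a::comm_ring_1" where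
  "scale a c = (\<lambda>T. a * c T)"

lemma koszul_sign_insert:
  "k \<notin> T \<Longrightarrow> koszul_sign j (insert k T) = (if k < j then - koszul_sign j T else koszul_sign j T)"
proof -
  assume k: "k \<notin> T"
  have "{t \<in> insert k T. t < j} = (if k < j then insert k {t \<in> T. t < j} else {t \<in> T. t < j})"
    by auto
  then show ?thesis using k by (simp add: koszul_sign_def)
qed

lemma koszul_sign_Diff:
  fixes T :: "nat set"
  assumes "k \<in> T"
  shows "koszul_sign j (T - {k})
    = (if k < j then - koszul_sign j T else koszul_sign j T :: 'a::comm_ring_1)"
  using koszul_sign_insert[of k "T - {k}" j, where 'a='a] assms by (simp add: insert_absorb)

lemma koszul_sign_square [simp]: "koszul_sign j T * koszul_sign j T = 1"
  by (simp add: koszul_sign_def flip: power_mult_distrib)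

lemma koszul_sign_square_left [simp]: "koszul_sign j T * (koszul_sign j T * a) = a"
  by (simp flip: mult.assoc)

lemma contract_contract: "contract j (contract k c) = - contract k (contract j c)"
proof
  fix T
  show "contract j (contract k c) T = (- contract k (contract j c)) T"
    by (cases j k rule: linorder_cases)
      (auto simp: contract_def koszul_sign_insert insert_commute mult.left_commute)
qed

lemma wedge_wedge: "wedge j (wedge k c) = - wedge k (wedge j c)"
proof
  fix T
  have "T - {j} - {k} = T - {k} - {j}" by auto
  then show "wedge j (wedge k c) T = (- wedge k (wedge j c)) T"
    by (cases j k rule: linorder_cases)
      (auto simp: wedge_def koszul_sign_Diff mult.left_commute)
qed

lemma contract_wedge: "contract j (wedge k c) = (if j = k then c else 0) - wedge k (contract j c)"
proof
  fix T
  show "contract j (wedge k c) T = ((if j = k then c else 0) - wedge k (contract j c)) T"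
  proof (cases "j = k")
    case True
    then show ?thesis
      by (auto simp: contract_def wedge_def koszul_sign_insert koszul_sign_Diff insert_absorb)
  next
    case False
    then have "insert j T - {k} = insert j (T - {k})" by auto
    with False show ?thesis
      by (cases j k rule: linorder_cases)
        (auto simp: contract_def wedge_def koszul_sign_insert koszul_sign_Diff mult.left_commute)
  qed
qed

lemma scale_add: "scale a (c + c') = scale a c + scale a c'"
  and scale_add_left: "scale (a + b) c = scale a c + scale b c"
  and scale_minus: "scale a (- c) = - scale a c"
  and scale_diff: "scale a (c - c') = scale a c - scale a c'"
  and scale_0 [simp]: "scale a 0 = 0"
  and scale_0_left [simp]: "scale 0 c = 0"
  and scale_1 [simp]: "scale 1 c = c"
  and scale_scale: "scale a (scale b c) = scale (a * b) c"
  by (auto simp: scale_def fun_eq_iff algebra_simps)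

lemma contract_add: "contract j (c + c') = contract j c + contract j c'"
  and wedge_add: "wedge j (c + c') = wedge j c + wedge j c'"
  and contract_minus: "contract j (- c) = - contract j c"
  and wedge_minus: "wedge j (- c) = - wedge j c"
  and contract_diff: "contract j (c - c') = contract j c - contract j c'"
  and wedge_diff: "wedge j (c - c') = wedge j c - wedge j c'"
  and contract_0 [simp]: "contract j 0 = 0"
  and wedge_0 [simp]: "wedge j 0 = 0"
  and contract_scale: "contract j (scale a c) = scale a (contract j c)"
  and wedge_scale: "wedge j (scale a c) = scale a (wedge j c)"
  by (auto simp: contract_def wedge_def scale_def fun_eq_iff algebra_simps)

lemma scale_sum: "scale a (\<Sum>i\<in>A. f i) = (\<Sum>i\<in>A. scale a (f i))"
  using sum_comp_morphism[of "scale a" f A, OF scale_0 scale_add] by (simp add: comp_def)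

lemma contract_sum: "contract j (\<Sum>i\<in>A. f i) = (\<Sum>i\<in>A. contract j (f i))"
  using sum_comp_morphism[of "contract j" f A, OF contract_0 contract_add] by (simp add: comp_def)

lemma wedge_sum: "wedge j (\<Sum>i\<in>A. f i) = (\<Sum>i\<in>A. wedge j (f i))"
  using sum_comp_morphism[of "wedge j" f A, OF wedge_0 wedge_add] by (simp add: comp_def)

subsection \<open>Chains with coefficients in a set of polynomials\<close>

text \<open>The set A also fixes the degree of the coefficients; the internal degree of a chain is
  that degree plus i.\<close>

definition chains :: "nat set \<Rightarrow> nat \<Rightarrow> 'a set \<Rightarrow> (nat set \<Rightarrow> 'a::zero) set" where
  "chains V i A = {c. \<forall>T. if T \<subseteq> V \<and> card T = i then c T \<in> A else c T = 0}"

lemma chainsI: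
  "(\<And>T. T \<subseteq> V \<Longrightarrow> card T = i \<Longrightarrow> c T \<in> A) \<Longrightarrow> (\<And>T. \<not> (T \<subseteq> V \<and> card T = i) \<Longrightarrow> c T = 0)
    \<Longrightarrow> c \<in> chains V i A"
  by (auto simp: chains_def)

lemma chainsD: "c \<in> chains V i A \<Longrightarrow> 0 \<in> A \<Longrightarrow> c T \<in> A"
  by (auto simp: chains_def split: if_splits)

lemma chains_outside: "c \<in> chains V i A \<Longrightarrow> \<not> (T \<subseteq> V \<and> card T = i) \<Longrightarrow> c T = 0"
  by (auto simp: chains_def split: if_splits)

lemma chains_mono: "A \<subseteq> B \<Longrightarrow> c \<in> chains V i A \<Longrightarrow> c \<in> chains V i B"
  by (auto simp: chains_def split: if_splits)

lemma chains_coeffs: "c \<in> chains V i A \<Longrightarrow> (\<And>T. c T \<in> B) \<Longrightarrow> c \<in> chains V i B"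
  by (auto simp: chains_def split: if_splits)

lemma chains_map:
  "c \<in> chains V i A \<Longrightarrow> (\<And>a. a \<in> A \<Longrightarrow> \<phi> a \<in> B) \<Longrightarrow> \<phi> 0 = 0 \<Longrightarrow> (\<lambda>T. \<phi> (c T)) \<in> chains V i B"
  by (auto simp: chains_def)

lemma chains_scale: "c \<in> chains V i A \<Longrightarrow> (\<And>b. b \<in> A \<Longrightarrow> a * b \<in> B) \<Longrightarrow> scale a c \<in> chains V i B"
  by (auto simp: chains_def scale_def)

lemma chains_zero: "0 \<in> A \<Longrightarrow> 0 \<in> chains V i A"
  by (simp add: chains_def)

definition additive_set :: "'a::ab_group_add set \<Rightarrow> bool" where
  "additive_set A \<longleftrightarrow> 0 \<in> A \<and> (\<forall>a\<in>A. \<forall>b\<in>A. a - b \<in> A)"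

lemma additive_set_0: "additive_set A \<Longrightarrow> 0 \<in> A"
  and additive_set_diff: "additive_set A \<Longrightarrow> a \<in> A \<Longrightarrow> b \<in> A \<Longrightarrow> a - b \<in> A"
  by (auto simp: additive_set_def)

lemma additive_set_minus: "additive_set A \<Longrightarrow> a \<in> A \<Longrightarrow> - a \<in> A"
  using additive_set_diff[of A 0 a] additive_set_0[of A] by simp

lemma additive_set_add: "additive_set A \<Longrightarrow> a \<in> A \<Longrightarrow> b \<in> A \<Longrightarrow> a + b \<in> A"
  using additive_set_diff[of A a "- b"] additive_set_minus[of A b] by simp

lemma additive_set_sum: "additive_set A \<Longrightarrow> (\<And>i. i \<in> I \<Longrightarrow> f i \<in> A) \<Longrightarrow> (\<Sum>i\<in>I. f i) \<in> A"
  by (induction I rule: infinite_finite_induct) (auto intro: additive_set_add additive_set_0)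

lemma additive_set_sign: "additive_set A \<Longrightarrow> a \<in> A \<Longrightarrow> koszul_sign j T * a \<in> (A :: 'a::comm_ring_1 set)"
  using neg_one_even_power[of "card {t \<in> T. t < j}"] neg_one_odd_power[of "card {t \<in> T. t < j}"]
  by (cases "even (card {t \<in> T. t < j})") (auto simp: koszul_sign_def additive_set_minus)

lemma additive_set_forms: "additive_set (forms V e)"
  by (auto simp: additive_set_def forms_diff)

lemma additive_set_Int: "additive_set A \<Longrightarrow> additive_set B \<Longrightarrow> additive_set (A \<inter> B)"
  by (auto simp: additive_set_def)

lemma chains_additive: "additive_set A \<Longrightarrow> additive_set (chains V i A)"
  by (auto simp: additive_set_def chains_def)

lemma chains_diff:
  "additive_set A \<Longrightarrow> c \<in> chains V i A \<Longrightarrow> c' \<in> chains V i A \<Longrightarrow> c - c' \<in> chains V i A"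
  by (rule additive_set_diff[OF chains_additive])

lemma chains_add:
  "additive_set A \<Longrightarrow> c \<in> chains V i A \<Longrightarrow> c' \<in> chains V i A \<Longrightarrow> c + c' \<in> chains V i A"
  by (rule additive_set_add[OF chains_additive])

lemma chains_sum:
  "additive_set A \<Longrightarrow> (\<And>j. j \<in> I \<Longrightarrow> f j \<in> chains V i A) \<Longrightarrow> (\<Sum>j\<in>I. f j) \<in> chains V i A"
  by (rule additive_set_sum[OF chains_additive])

lemma contract_chains:
  assumes "additive_set A" "c \<in> chains V (Suc i) A" "finite V"
  shows "contract j c \<in> chains V i A"
proof (rule chainsI)
  fix T assume T: "T \<subseteq> V" "card T = i"
  show "contract j c T \<in> A"
    using assms(1) chainsD[OF assms(2) additive_set_0[OF assms(1)]]
    by (simp add: contract_def additive_set_0 additive_set_sign)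
next
  fix T assume T: "\<not> (T \<subseteq> V \<and> card T = i)"
  show "contract j c T = 0"
  proof (cases "j \<in> T")
    case False
    have "\<not> (insert j T \<subseteq> V \<and> card (insert j T) = Suc i)"
      using T False finite_subset[OF _ assms(3), of T] by auto
    then show ?thesis using chains_outside[OF assms(2)] by (simp add: contract_def)
  qed (simp add: contract_def)
qed

lemma contract_chains_0:
  assumes "c \<in> chains V 0 A" "finite V" shows "contract j c = 0"
proof
  fix T
  have "c (insert j T) = 0"
    using assms(2) finite_subset[of "insert j T" V]
    by (intro chains_outside[OF assms(1)]) (auto simp: card_eq_0_iff)
  then show "contract j c T = 0 T" by (simp add: contract_def)
qed

lemma wedge_chains:
  assumes "additive_set A" "c \<in> chains V i A" "finite V" "j \<in> V"
  shows "wedge j c \<in> chains V (Suc i) A"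
proof (rule chainsI)
  fix T assume T: "T \<subseteq> V" "card T = Suc i"
  show "wedge j c T \<in> A"
    using assms(1) chainsD[OF assms(2) additive_set_0[OF assms(1)]]
    by (simp add: wedge_def additive_set_0 additive_set_sign)
next
  fix T assume T: "\<not> (T \<subseteq> V \<and> card T = Suc i)"
  show "wedge j c T = 0"
  proof (cases "j \<in> T")
    case True
    have "\<not> (T - {j} \<subseteq> V \<and> card (T - {j}) = i)"
    proof
      assume a: "T - {j} \<subseteq> V \<and> card (T - {j}) = i"
      then have "T \<subseteq> V" using assms(4) by auto
      moreover from this have "finite T" using assms(3) finite_subset by blast
      ultimately show False using T a True card.remove[of T j] by auto
    qed
    then have "c (T - {j}) = 0" by (rule chains_outside[OF assms(2)])
    then show ?thesis by (simp add: wedge_def)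
  qed (simp add: wedge_def)
qed

text \<open>In the coordinate T, each of the i elements of T contributes \<open>c T\<close> once:
  the signs of \<open>wedge\<close> and \<open>contract\<close> agree and cancel.\<close>

lemma wedge_contract_number:
  assumes "c \<in> chains V i A" "finite V"
  shows "(\<Sum>j\<in>V. wedge j (contract j c)) = scale (of_nat i) c"
proof
  fix T
  have *: "wedge j (contract j c) T = (if j \<in> T then c T else 0)" for j
    by (auto simp: wedge_def contract_def koszul_sign_Diff insert_absorb)
  show "(\<Sum>j\<in>V. wedge j (contract j c)) T = scale (of_nat i) c T"
  proof (cases "T \<subseteq> V \<and> card T = i")
    case True
    then have "(\<Sum>j\<in>V. if j \<in> T then c T else 0) = (\<Sum>j\<in>T. c T)"
      using assms(2) by (intro sum.mono_neutral_cong_right) auto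
    then show ?thesis using True by (simp add: sum_fun_apply * scale_def)
  next
    case False
    then have "c T = 0" by (rule chains_outside[OF assms(1)])
    then show ?thesis by (simp add: sum_fun_apply * scale_def sum.neutral)
  qed
qed

subsection \<open>The differential\<close>

definition kdiff :: "nat set \<Rightarrow> (nat set \<Rightarrow> 'k mpoly) \<Rightarrow> nat set \<Rightarrow> 'k::comm_ring_1 mpoly" where
  "kdiff V c = (\<Sum>j\<in>V. scale (pvar j) (contract j c))"

lemma kdiff_add: "kdiff V (c + c') = kdiff V c + kdiff V c'"
  by (simp add: kdiff_def contract_add scale_add sum.distrib)

lemma kdiff_0 [simp]: "kdiff V 0 = 0"
  by (simp add: kdiff_def)

lemma kdiff_diff: "kdiff V (c - c') = kdiff V c - kdiff V c'"
  by (simp add: kdiff_def contract_diff scale_diff sum_subtractf)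

lemma kdiff_scale: "kdiff V (scale a c) = scale a (kdiff V c)"
  by (simp add: kdiff_def contract_scale scale_sum scale_scale mult.commute)

lemma kdiff_sum: "kdiff V (\<Sum>i\<in>A. f i) = (\<Sum>i\<in>A. kdiff V (f i))"
  using sum_comp_morphism[of "kdiff V" f A, OF kdiff_0 kdiff_add] by (simp add: comp_def)

lemma kdiff_apply:
  assumes "finite V"
  shows "kdiff V c T = (\<Sum>j\<in>V - T. (koszul_sign j T * pvar j) * c (insert j T))"
proof -
  have "kdiff V c T = (\<Sum>j\<in>V. pvar j * contract j c T)"
    by (simp add: kdiff_def sum_fun_apply scale_def)
  also have "\<dots> = (\<Sum>j\<in>V - T. (koszul_sign j T * pvar j) * c (insert j T))"
    by (rule sum.mono_neutral_cong_right)
      (use assms in \<open>auto simp: contract_def mult.commute mult.left_commute\<close>)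
  finally show ?thesis .
qed

lemma kdiff_map:
  assumes "\<And>a b. \<phi> (a + b) = \<phi> a + \<phi> b" "\<And>j a. j \<in> V \<Longrightarrow> \<phi> (pvar j * a) = pvar j * \<phi> a"
    and "finite V"
  shows "kdiff V (\<lambda>T. \<phi> (c T)) = (\<lambda>T. \<phi> (kdiff V c T))"
proof
  fix T
  have 0: "\<phi> 0 = 0" using assms(1)[of 0 0] by simp
  have "\<phi> (- a) = - \<phi> a" for a using assms(1)[of a "- a"] 0 by (simp add: eq_neg_iff_add_eq_0 add.commute)
  then have sign: "\<phi> (koszul_sign j T * a) = koszul_sign j T * \<phi> a" for j a
    using neg_one_even_power[of "card {t \<in> T. t < j}"] neg_one_odd_power[of "card {t \<in> T. t < j}"]
    by (cases "even (card {t \<in> T. t < j})") (auto simp: koszul_sign_def)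
  have sum: "\<phi> (sum f A) = (\<Sum>i\<in>A. \<phi> (f i))" for f :: "nat \<Rightarrow> 'a mpoly" and A
    by (induction A rule: infinite_finite_induct) (auto simp: 0 assms(1))
  show "kdiff V (\<lambda>T. \<phi> (c T)) T = \<phi> (kdiff V c T)"
    unfolding kdiff_apply[OF assms(3)] sum
    by (rule sum.cong) (auto simp: mult.assoc sign assms(2))
qed

text \<open>Exchanging the two summation indices changes the sign of every term, so the sum is its
  own negative; halving it uses characteristic zero.\<close>

lemma kdiff_kdiff: "kdiff V (kdiff V c) = (0 :: nat set \<Rightarrow> 'k::field_char_0 mpoly)"
proof -
  let ?s = "kdiff V (kdiff V c)"
  have "?s = (\<Sum>j\<in>V. \<Sum>k\<in>V. scale (pvar j * pvar k) (contract j (contract k c)))"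
    by (simp add: kdiff_def contract_sum scale_sum contract_scale scale_scale)
  also have "\<dots> = (\<Sum>k\<in>V. \<Sum>j\<in>V. scale (pvar j * pvar k) (contract j (contract k c)))"
    by (rule sum.swap)
  also have "\<dots> = - (\<Sum>k\<in>V. \<Sum>j\<in>V. scale (pvar k * pvar j) (contract k (contract j c)))"
  proof -
    have eq: "scale (pvar j * pvar k) (contract j (contract k c))
        = - scale (pvar k * pvar j) (contract k (contract j c))" for j k
      by (subst contract_contract) (simp add: scale_minus mult.commute)
    show ?thesis unfolding sum_negf[symmetric] by (intro sum.cong refl eq)
  qed
  also have "\<dots> = - ?s"
    by (simp add: kdiff_def contract_sum scale_sum contract_scale scale_scale)
  finally have s: "?s = - ?s" .
  show ?thesis
  proof
    fix T
    have "2 * ?s T = 0" using fun_cong[OF s, of T] by (simp add: eq_neg_iff_add_eq_0)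
    then have "pconst (1/2) * (2 * ?s T) = 0" by simp
    moreover have "pconst (1/2) * 2 = (1 :: 'k mpoly)"
      using pconst_mult[of "1/2" "2 :: 'k"] pconst_of_nat[of 2, where 'a='k] by simp
    ultimately show "?s T = 0 T" by (simp flip: mult.assoc)
  qed
qed

lemma kdiff_wedge:
  assumes "finite V" "j \<in> V"
  shows "kdiff V (wedge j c) = scale (pvar j) c - wedge j (kdiff V c)"
proof -
  have "kdiff V (wedge j c)
      = (\<Sum>m\<in>V. (if m = j then scale (pvar m) c else 0) - wedge j (scale (pvar m) (contract m c)))"
    unfolding kdiff_def
    by (intro sum.cong refl) (simp add: contract_wedge scale_diff wedge_scale)
  also have "\<dots> = scale (pvar j) c - wedge j (kdiff V c)"
    using assms by (simp add: sum_subtractf kdiff_def wedge_sum)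
  finally show ?thesis .
qed

lemma kdiff_chains:
  assumes "c \<in> chains V (Suc i) A" "finite V" "additive_set A" "additive_set B"
    and "\<And>j a. j \<in> V \<Longrightarrow> a \<in> A \<Longrightarrow> pvar j * a \<in> B"
  shows "kdiff V c \<in> chains V i B"
  unfolding kdiff_def
  using assms by (intro chains_sum chains_scale[OF contract_chains]) auto

lemma kdiff_chains_0: "c \<in> chains V 0 A \<Longrightarrow> finite V \<Longrightarrow> kdiff V c = 0"
  by (simp add: kdiff_def contract_chains_0)

text \<open>Cartan's formula for the operator h that applies D_j to the coefficients and multiplies
  by e_j. The first sum is the Euler field acting on coefficients, the second its action on the
  basis vectors e_m. The derivations stay abstract because both the partial derivatives and
  \<open>deriv_Q\<close> are used.\<close>

lemma kdiff_homotopy: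
  assumes add: "\<And>j f g. j \<in> Q \<Longrightarrow> D j (f + g) = D j f + D j g"
    and mult: "\<And>j f g. j \<in> Q \<Longrightarrow> D j (f * g) = f * D j g + D j f * (g :: 'k::comm_ring_1 mpoly)"
    and "finite V" "Q \<subseteq> V"
  defines "h \<equiv> \<lambda>c. \<Sum>j\<in>Q. wedge j (\<lambda>T. D j (c T))"
  shows "kdiff V (h c) + h (kdiff V c) = (\<Sum>j\<in>Q. scale (pvar j) (\<lambda>T. D j (c T)))
    + (\<Sum>j\<in>Q. \<Sum>m\<in>V. scale (D j (pvar m)) (wedge j (contract m c)))"
proof -
  have D0: "D j 0 = 0" if "j \<in> Q" for j using add[of j 0 0] that by simp
  have Dminus: "D j (- a) = - D j a" if "j \<in> Q" for j a
    using add[of j a "- a"] that by (simp add: D0 eq_neg_iff_add_eq_0 add.commute)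
  have sign: "D j (koszul_sign m T * a) = koszul_sign m T * D j a" if "j \<in> Q" for j m T a
    using that neg_one_even_power[of "card {t \<in> T. t < m}"]
      neg_one_odd_power[of "card {t \<in> T. t < m}"]
    by (cases "even (card {t \<in> T. t < m})") (auto simp: koszul_sign_def Dminus)
  have Dc: "(\<lambda>T. D j (contract m c T)) = contract m (\<lambda>T. D j (c T))" if "j \<in> Q" for j m
    using that by (auto simp: contract_def fun_eq_iff D0 sign)
  have Dsum: "D j (sum f A) = (\<Sum>i\<in>A. D j (f i))" if "j \<in> Q" for j and f :: "nat \<Rightarrow> 'k mpoly" and A
    using that by (induction A rule: infinite_finite_induct) (auto simp: D0 add)
  have Dk: "(\<lambda>T. D j (kdiff V c T)) = (\<Sum>m\<in>V. scale (pvar m) (contract m (\<lambda>T. D j (c T)))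
      + scale (D j (pvar m)) (contract m c))" if j: "j \<in> Q" for j
  proof
    fix T
    have "D j (kdiff V c T) = (\<Sum>m\<in>V. D j (pvar m * contract m c T))"
      by (simp add: kdiff_def sum_fun_apply scale_def Dsum j)
    also have "\<dots> = (\<Sum>m\<in>V. pvar m * contract m (\<lambda>T. D j (c T)) T + D j (pvar m) * contract m c T)"
      by (intro sum.cong refl) (simp add: mult j flip: Dc)
    finally show "D j (kdiff V c T) = (\<Sum>m\<in>V. scale (pvar m) (contract m (\<lambda>T. D j (c T)))
      + scale (D j (pvar m)) (contract m c)) T"
      by (simp add: sum_fun_apply scale_def)
  qed
  have 1: "kdiff V (h c) = (\<Sum>j\<in>Q. scale (pvar j) (\<lambda>T. D j (c T)))
      - (\<Sum>j\<in>Q. wedge j (kdiff V (\<lambda>T. D j (c T))))"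
    unfolding h_def kdiff_sum sum_subtractf[symmetric]
    using assms(3,4) by (intro sum.cong refl kdiff_wedge) auto
  have 2: "h (kdiff V c) = (\<Sum>j\<in>Q. wedge j (kdiff V (\<lambda>T. D j (c T))))
      + (\<Sum>j\<in>Q. \<Sum>m\<in>V. scale (D j (pvar m)) (wedge j (contract m c)))"
    unfolding h_def sum.distrib[symmetric]
    by (intro sum.cong refl)
      (simp add: Dk, simp add: wedge_sum wedge_add wedge_scale sum.distrib kdiff_def)
  show ?thesis unfolding 1 2 by simp
qed

text \<open>With the partial derivatives as derivations, Cartan's formula becomes multiplication by
  the total degree i + e: Euler's identity gives e on the coefficients, the number operator gives i
  on the basis vectors. Its inverse is \<open>u\<close>.\<close>

lemma koszul_acyclic:
  fixes c :: "nat set \<Rightarrow> 'k::field_char_0 mpoly"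
  assumes "finite V" "c \<in> chains V i (forms V e)" "kdiff V c = 0" "int i + e > 0"
  obtains b where "b \<in> chains V (Suc i) (forms V (e - 1))" "kdiff V b = c"
proof
  define h where "h c = (\<Sum>j\<in>V. wedge j (\<lambda>T. pderivative j (c T)))"
    for c :: "nat set \<Rightarrow> 'k mpoly"
  define u :: "'k mpoly" where "u = pconst (1 / of_int (int i + e))"
  have u: "u * (of_nat i + of_int e) = 1"
  proof -
    have "of_nat i + of_int e = pconst (of_int (int i + e) :: 'k)"
      by (simp only: pconst_of_int) simp
    moreover have "of_int (int i + e) \<noteq> (0 :: 'k)" using assms(4) by (subst of_int_eq_0_iff) simp
    ultimately show ?thesis by (simp add: u_def flip: pconst_mult)
  qed
  have hc: "h c \<in> chains V (Suc i) (forms V (e - 1))"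
    unfolding h_def using assms(1,2)
    by (intro chains_sum wedge_chains additive_set_forms chains_map[OF assms(2)])
      (auto intro: pderivative_forms)
  then show "scale u (h c) \<in> chains V (Suc i) (forms V (e - 1))"
    by (rule chains_scale) (auto simp: u_def forms_pconst_mult)
  have ch: "c T \<in> forms V e" for T by (rule chainsD[OF assms(2)]) simp
  have "kdiff V (h c) + h (kdiff V c) = (\<Sum>j\<in>V. scale (pvar j) (\<lambda>T. pderivative j (c T)))
    + (\<Sum>j\<in>V. \<Sum>m\<in>V. scale (pderivative j (pvar m)) (wedge j (contract m c)))"
    unfolding h_def
    by (rule kdiff_homotopy) (auto simp: pderivative_add pderivative_mult assms(1))
  moreover have "(\<Sum>j\<in>V. scale (pvar j) (\<lambda>T. pderivative j (c T))) = scale (of_int e) c"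
    using euler_identity[OF ch assms(1)] by (auto simp: fun_eq_iff sum_fun_apply scale_def)
  moreover have "(\<Sum>j\<in>V. \<Sum>m\<in>V. scale (pderivative j (pvar m)) (wedge j (contract m c)))
      = scale (of_nat i) c"
  proof -
    have "(\<Sum>m\<in>V. scale (pderivative j (pvar m)) (wedge j (contract m c)))
        = wedge j (contract j c)" if "j \<in> V" for j
    proof -
      have "(\<Sum>m\<in>V. scale (pderivative j (pvar m)) (wedge j (contract m c)))
          = (\<Sum>m\<in>V. if m = j then wedge j (contract j c) else 0)"
        by (intro sum.cong) (auto simp: pderivative_pvar)
      then show ?thesis using that assms(1) by simp
    qed
    then show ?thesis using wedge_contract_number[OF assms(2,1)] by simp
  qed
  moreover have "h (kdiff V c) = 0"
    by (simp add: assms(3) h_def zero_fun_def[symmetric])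
  ultimately have "kdiff V (h c) = scale (of_nat i + of_int e) c"
    by (simp add: scale_add_left)
  then show "kdiff V (scale u (h c)) = c"
    by (simp add: kdiff_scale scale_scale u)
qed

section \<open>Vanishing of Koszul homology in high degrees\<close>

text \<open>A monotone subsequence may be decreasing; being one of natural numbers, it is then
  constant from its least value on.\<close>

lemma mono_subseq:
  fixes s :: "nat \<Rightarrow> nat"
  obtains r :: "nat \<Rightarrow> nat" where "strict_mono r" "mono (\<lambda>n. s (r n))"
proof -
  obtain f where f: "strict_mono f" "monoseq (\<lambda>n. s (f n))"
    using seq_monosub[of s] by blast
  show thesis
  proof (cases "mono (\<lambda>n. s (f n))")
    case False
    then have dec: "s (f n) \<le> s (f m)" if "m \<le> n" for m n
      using f(2) that by (auto simp: monoseq_def mono_def)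
    define a where "a = (LEAST a. \<exists>n. a = s (f n))"
    have "\<exists>n. a = s (f n)" unfolding a_def by (rule LeastI_ex) blast
    then obtain N where N: "a = s (f N)" by blast
    have "s (f (N + n)) = a" for n
    proof (rule antisym)
      show "a \<le> s (f (N + n))" unfolding a_def by (rule Least_le) blast
    qed (use dec[of N "N + n"] N in simp)
    then show thesis
      using that[of "\<lambda>n. f (N + n)"] f(1) by (auto simp: strict_mono_def mono_def)
  qed (use f that in blast)
qed

text \<open>The variables are treated one after the other: thinning out a sequence further preserves
  the monotonicity reached in the earlier variables.\<close>

lemma dickson_subseq:
  fixes s :: "nat \<Rightarrow> nat \<Rightarrow>\<^sub>0 nat"
  assumes "finite V"
  shows "\<exists>r :: nat \<Rightarrow> nat. strict_mono r \<and> (\<forall>v\<in>V. mono (\<lambda>n. lookup (s (r n)) v))"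
  using assms
proof (induction V rule: finite_induct)
  case (insert v V)
  then obtain r :: "nat \<Rightarrow> nat" where r: "strict_mono r" "\<forall>v\<in>V. mono (\<lambda>n. lookup (s (r n)) v)" by blast
  obtain q :: "nat \<Rightarrow> nat" where q: "strict_mono q" "mono (\<lambda>n. lookup (s (r (q n))) v)"
    by (rule mono_subseq[of "\<lambda>n. lookup (s (r n)) v"])
  have "mono (\<lambda>n. lookup (s (r (q n))) w)" if "w \<in> V" for w
    using r(2) that q(1) unfolding mono_def by (meson strict_mono_less_eq)
  moreover have "strict_mono (\<lambda>n. r (q n))"
    using r(1) q(1) by (simp add: strict_mono_def)
  ultimately show ?case using q(2) by (intro exI[of _ "\<lambda>n. r (q n)"]) auto
qed (auto intro: exI[of _ id] simp: strict_mono_id)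

text \<open>Otherwise there are minimal elements of M for divisibility of arbitrarily high degree,
  and Dickson's lemma finds two comparable ones among them. Only a degree bound on the minimal
  elements is recorded, since graded generation asks for no more.\<close>

lemma dickson_degree_bound:
  fixes M :: "(nat \<Rightarrow>\<^sub>0 nat) set"
  assumes "finite V" "\<And>m. m \<in> M \<Longrightarrow> keys m \<subseteq> V"
  obtains t where "\<And>m. m \<in> M \<Longrightarrow> t < mono_deg m
    \<Longrightarrow> \<exists>m'\<in>M. m' \<noteq> m \<and> (\<forall>v. lookup m' v \<le> lookup m v)"
proof (rule ccontr)
  let ?B = "{m \<in> M. \<not> (\<exists>m'\<in>M. m' \<noteq> m \<and> (\<forall>v. lookup m' v \<le> lookup m v))}"
  assume "\<not> thesis"
  with that have ex: "\<exists>m. m \<in> ?B \<and> t < mono_deg m" for t by blast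
  \<comment> \<open>Minimal elements of strictly increasing degree; thus two comparable terms of the
    sequence are distinct.\<close>
  define s where "s = rec_nat (SOME m. m \<in> ?B \<and> 0 < mono_deg m)
    (\<lambda>_ m'. SOME m. m \<in> ?B \<and> mono_deg m' < mono_deg m)"
  have sB: "s n \<in> ?B" for n
    using someI_ex[OF ex] by (cases n) (simp_all add: s_def)
  have "mono_deg (s n) < mono_deg (s (Suc n))" for n
    using someI_ex[OF ex[of "mono_deg (s n)"]] by (simp add: s_def)
  then have inc: "strict_mono (\<lambda>n. mono_deg (s n))" by (rule strict_mono_Suc_iff[THEN iffD2, rule_format])
  obtain r :: "nat \<Rightarrow> nat" where r: "strict_mono r" "\<forall>v\<in>V. mono (\<lambda>n. lookup (s (r n)) v)"
    using dickson_subseq[OF assms(1)] by blast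
  have lt: "mono_deg (s (r 0)) < mono_deg (s (r 1))"
    using inc r(1) by (simp add: strict_mono_def)
  have "lookup (s (r 0)) v \<le> lookup (s (r 1)) v" for v
  proof (cases "v \<in> V")
    case True
    then show ?thesis using r(2) by (auto simp: mono_def)
  next
    case False
    then have "v \<notin> keys (s (r 0))" using assms(2)[of "s (r 0)"] sB[of "r 0"] by auto
    then show ?thesis by (simp add: in_keys_iff)
  qed
  then show False using sB[of "r 0"] sB[of "r 1"] lt by auto
qed

lemma lookup_pconst_mult: "lookup (pconst a * f) m = a * lookup f m"
  by (induction f rule: mpoly_induct)
    (simp_all add: pconst_mult_single distrib_left lookup_add lookup_single when_def)

lemma lookup_le_mono_deg: "lookup m i \<le> mono_deg m"
proof (cases "i \<in> keys m")
  case True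
  then show ?thesis unfolding mono_deg_def by (intro member_le_sum) auto
qed (simp add: in_keys_iff)

lemma finite_monomials:
  assumes "finite V" shows "finite {m. keys m \<subseteq> V \<and> mono_deg m = d}"
proof (rule inj_on_finite)
  show "inj_on (\<lambda>m. restrict (lookup m) V) {m. keys m \<subseteq> V \<and> mono_deg m = d}"
  proof (rule inj_onI, rule poly_mapping_eqI)
    fix m n k
    assume mn: "m \<in> {m. keys m \<subseteq> V \<and> mono_deg m = d}" "n \<in> {m. keys m \<subseteq> V \<and> mono_deg m = d}"
      and eq: "restrict (lookup m) V = restrict (lookup n) V"
    show "lookup m k = lookup n k"
    proof (cases "k \<in> V")
      case True
      then show ?thesis using fun_cong[OF eq, of k] by simp
    next
      case False
      then have "k \<notin> keys m" "k \<notin> keys n" using mn by auto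
      then show ?thesis by (simp add: in_keys_iff)
    qed
  qed
  show "(\<lambda>m. restrict (lookup m) V) ` {m. keys m \<subseteq> V \<and> mono_deg m = d} \<subseteq> PiE V (\<lambda>_. {..d})"
    using lookup_le_mono_deg by auto
  show "finite (PiE V (\<lambda>_. {..d}))" using assms by (intro finite_PiE) auto
qed

section \<open>Bounded generation of graded ideals and modules\<close>

lemma graded_ideal_monomial_mult:
  fixes A :: "nat \<Rightarrow> 'k::comm_ring_1 mpoly set"
  assumes "\<And>t j f. j \<in> V \<Longrightarrow> f \<in> A t \<Longrightarrow> pvar j * f \<in> A (Suc t)"
    and "keys m \<subseteq> V" "f \<in> A t"
  shows "Poly_Mapping.single m 1 * f \<in> A (mono_deg m + t)"
  using assms(2)
proof (induction "mono_deg m" arbitrary: m)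
  case 0
  then have "m = 0" by (simp add: mono_deg_eq_0)
  then show ?case using assms(3) by simp
next
  case (Suc d)
  then have "m \<noteq> 0" using mono_deg_eq_0[of m] by auto
  then obtain j where j: "j \<in> keys m" by (metis keys_eq_empty ex_in_conv)
  define n where "n = m - Poly_Mapping.single j 1"
  have m: "m = Poly_Mapping.single j 1 + n"
    using j by (intro poly_mapping_eqI)
      (auto simp: n_def lookup_add lookup_minus lookup_single when_def in_keys_iff)
  have "keys n \<subseteq> V" using Suc.prems by (auto simp: n_def in_keys_iff lookup_minus)
  moreover have "d = mono_deg n" using Suc.hyps(2) m by (simp add: mono_deg_add)
  ultimately have "Poly_Mapping.single n 1 * f \<in> A (mono_deg n + t)" using Suc.hyps(1) by blast
  then have "pvar j * (Poly_Mapping.single n 1 * f) \<in> A (Suc (mono_deg n + t))"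
    using assms(1) j Suc.prems by blast
  moreover have "pvar j * (Poly_Mapping.single n 1 * f) = Poly_Mapping.single m 1 * f"
    by (simp add: m pvar_def mult_single flip: mult.assoc)
  ultimately show ?case using m by (simp add: mono_deg_add)
qed

text \<open>
  Hilbert's basis theorem for the graded ideal \<open>\<Oplus> A t\<close>. The leading monomial is the largest
  one in the order of the type of monomials; Dickson's lemma bounds the degrees of the minimal leading monomials.
\<close>

lemma graded_ideal_bounded_generators:
  fixes A :: "nat \<Rightarrow> 'k::field mpoly set"
  assumes "finite V"
    and forms: "\<And>t. A t \<subseteq> forms V (int t)"
    and add: "\<And>t. additive_set (A t)"
    and const: "\<And>t a f. f \<in> A t \<Longrightarrow> pconst a * f \<in> A t"
    and mult: "\<And>t j f. j \<in> V \<Longrightarrow> f \<in> A t \<Longrightarrow> pvar j * f \<in> A (Suc t)"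
  obtains t\<^sub>0 where "\<And>t f. t\<^sub>0 \<le> t \<Longrightarrow> f \<in> A (Suc t)
    \<Longrightarrow> \<exists>b. (\<forall>j\<in>V. b j \<in> A t) \<and> f = (\<Sum>j\<in>V. pvar j * b j)"
proof -
  define lm where "lm f = Max (keys f)" for f :: "'k mpoly"
  define M where "M = {m. \<exists>t f. f \<in> A t \<and> f \<noteq> 0 \<and> m = lm f}"
  have lm_in: "lm f \<in> keys f" if "f \<noteq> 0" for f
    unfolding lm_def using that by (intro Max_in) auto
  have lm_ge: "m \<le> lm f" if "m \<in> keys f" for f m
    unfolding lm_def using that by (intro Max_ge) auto
  have keysA: "keys m \<subseteq> V" "mono_deg m = t" if "f \<in> A t" "m \<in> keys f" for f t m
    using forms[of t] that by (auto simp: forms_def polys_def homogeneous_def)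
  obtain t\<^sub>0 where t\<^sub>0: "\<And>m. m \<in> M \<Longrightarrow> t\<^sub>0 < mono_deg m
      \<Longrightarrow> \<exists>m'\<in>M. m' \<noteq> m \<and> (\<forall>v. lookup m' v \<le> lookup m v)"
  proof (rule dickson_degree_bound[OF assms(1), of M])
    show "keys m \<subseteq> V" if "m \<in> M" for m
      using that keysA lm_in unfolding M_def by blast
  qed blast
  show thesis
  proof (rule that)
    fix t f assume "t\<^sub>0 \<le> t" "f \<in> A (Suc t)"
    let ?Mon = "{m. keys m \<subseteq> V \<and> mono_deg m = Suc t}"
    \<comment> \<open>The induction measure: the number of monomials of degree t + 1 not above the
      leading one. It drops when the leading term is cancelled.\<close>
    let ?below = "\<lambda>f. {m \<in> ?Mon. \<exists>m'\<in>keys f. m \<le> m'}"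
    show "\<exists>b. (\<forall>j\<in>V. b j \<in> A t) \<and> f = (\<Sum>j\<in>V. pvar j * b j)"
      using \<open>f \<in> A (Suc t)\<close>
    proof (induction "card (?below f)" arbitrary: f rule: less_induct)
      case less
      show ?case
      proof (cases "f = 0")
        case True
        then show ?thesis using additive_set_0[OF add] by (intro exI[of _ "\<lambda>_. 0"]) auto
      next
        case False
        let ?m = "lm f"
        have m: "?m \<in> M" "keys ?m \<subseteq> V" "mono_deg ?m = Suc t"
          using keysA[OF less.prems lm_in[OF False]] False less.prems unfolding M_def by blast+
        obtain m' where m': "m' \<in> M" "m' \<noteq> ?m" "\<forall>v. lookup m' v \<le> lookup ?m v"
          using t\<^sub>0[OF m(1)] m(3) \<open>t\<^sub>0 \<le> t\<close> by auto
        then obtain s g where g: "g \<in> A s" "g \<noteq> 0" "m' = lm g" unfolding M_def by blast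
        have eq: "m' + (?m - m') = ?m"
          using m'(3) by (intro poly_mapping_eqI) (simp add: lookup_add lookup_minus)
        have "?m - m' \<noteq> 0" using eq m'(2) by (metis add.right_neutral)
        \<comment> \<open>The leading monomial is not minimal, so the quotient by m' contains a
          variable x_j. Splitting x_j off makes the correcting term a multiple of x_j by an element
          of \<open>A t\<close>.\<close>
        then obtain j where j: "j \<in> keys (?m - m')" by (metis keys_eq_empty ex_in_conv)
        have jV: "j \<in> V" using j m(2) by (auto simp: in_keys_iff lookup_minus)
        define n where "n = ?m - m' - Poly_Mapping.single j 1"
        have n: "?m - m' = Poly_Mapping.single j 1 + n"
          using j unfolding n_def by (intro poly_mapping_eqI)
            (auto simp: lookup_add lookup_minus lookup_single when_def in_keys_iff)
        have nV: "keys n \<subseteq> V"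
          using m(2) by (auto simp: n_def in_keys_iff lookup_minus)
        define g' where "g' = Poly_Mapping.single n 1 * g"
        define c where "c = lookup f ?m / lookup g m'"
        have deg: "mono_deg n + s = t"
          using arg_cong[OF eq, of mono_deg] m(3) keysA(2)[OF g(1) lm_in[OF g(2)]] g(3) n
          by (simp add: mono_deg_add)
        have g': "g' \<in> A t"
          using graded_ideal_monomial_mult[of V A n g s, OF mult nV g(1)] deg by (simp add: g'_def)
        have xg: "pvar j * g' = Poly_Mapping.single (?m - m') 1 * g"
          by (simp add: g'_def n pvar_def mult_single flip: mult.assoc)
        have keys_xg: "k \<le> ?m" if k: "k \<in> keys (pvar j * g')" for k
        proof -
          obtain a where "k = (?m - m') + a" "a \<in> keys g"
            using k Poly_Mapping.keys_mult[of "Poly_Mapping.single (?m - m') (1 :: 'k)" g]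
            unfolding xg by auto
          moreover from this have "(?m - m') + a \<le> (?m - m') + m'"
            using lm_ge g(3) by (intro add_left_mono) auto
          ultimately show ?thesis using eq by (simp add: add.commute)
        qed
        have lookup_xg: "lookup (pvar j * g') ?m = lookup g m'"
        proof -
          have "lookup (Poly_Mapping.single a 1 * g) (a + b) = lookup g b" for a b
          proof (induction g rule: mpoly_induct)
            case (single m x)
            then show ?case by (simp add: mult_single lookup_single when_def)
          qed (simp_all add: distrib_left lookup_add)
          from this[of "?m - m'" m'] show ?thesis unfolding xg using eq by (simp add: add.commute)
        qed
        define f' where "f' = f - pvar j * (pconst c * g')"
        have f': "f' = f - pconst c * (pvar j * g')" by (simp add: f'_def mult.left_commute)
        have f'A: "f' \<in> A (Suc t)"
          unfolding f' using less.prems g' jV mult const additive_set_diff[OF add] by blast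
        have "lookup f' ?m = 0"
          using lm_in[OF g(2)] g(3)
          by (simp add: f' lookup_minus lookup_pconst_mult lookup_xg c_def in_keys_iff)
        moreover have "k \<le> ?m" if "k \<in> keys f'" for k
        proof -
          have "k \<in> keys f \<or> k \<in> keys (pvar j * g')"
            using that by (auto simp: f' in_keys_iff lookup_minus lookup_pconst_mult)
          then show ?thesis using keys_xg lm_ge by blast
        qed
        ultimately have keys_f': "k < ?m" if "k \<in> keys f'" for k
          using that by (metis in_keys_iff order.not_eq_order_implies_strict)
        have "?below f' \<subset> ?below f"
        proof
          show "?below f' \<subseteq> ?below f"
          proof
            fix x assume "x \<in> ?below f'"
            then obtain y where y: "x \<in> ?Mon" "y \<in> keys f'" "x \<le> y" by blast
            then have "x \<le> ?m" using keys_f'[OF y(2)] by (meson order.trans order.strict_implies_order)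
            then show "x \<in> ?below f" using y(1) lm_in[OF False] by blast
          qed
          have "?m \<in> ?below f" using m lm_in[OF False] by auto
          moreover have "?m \<notin> ?below f'" using keys_f' by (auto simp: not_less[symmetric])
          ultimately show "?below f' \<noteq> ?below f" by blast
        qed
        moreover have "finite (?below f)" by (rule finite_subset[OF _ finite_monomials[OF assms(1), of "Suc t"]]) auto
        ultimately have "card (?below f') < card (?below f)" by (rule psubset_card_mono[rotated])
        from less.hyps[OF this f'A] obtain b where
          b: "\<forall>i\<in>V. b i \<in> A t" "f' = (\<Sum>i\<in>V. pvar i * b i)" by blast
        let ?b = "\<lambda>i. b i + (if i = j then pconst c * g' else 0)"
        have "(\<Sum>i\<in>V. pvar i * ?b i)
            = f' + (\<Sum>i\<in>V. if i = j then pvar j * (pconst c * g') else 0)"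
          unfolding b(2) sum.distrib[symmetric]
          by (intro sum.cong refl) (simp add: distrib_left)
        then have "f = (\<Sum>i\<in>V. pvar i * ?b i)"
          using jV assms(1) by (simp add: f'_def)
        moreover have "\<forall>i\<in>V. ?b i \<in> A t"
          using b(1) const[OF g'] additive_set_add[OF add] additive_set_0[OF add] by auto
        ultimately show ?thesis by (intro exI[of _ ?b] conjI)
      qed
    qed
  qed
qed

text \<open>Induction on the number of coordinates of a free module: the coordinates at T0 form a
  graded ideal, covered by the basis theorem, and the kernel of the projection to T0 lives on the
  remaining coordinates.\<close>

lemma graded_module_bounded_generators:
  fixes Z :: "nat \<Rightarrow> ('t \<Rightarrow> 'k::field mpoly) set"
  assumes "finite \<T>" "finite V"
    and "\<And>t c T. c \<in> Z t \<Longrightarrow> c T \<in> forms V (int t)"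
    and "\<And>t c T. c \<in> Z t \<Longrightarrow> T \<notin> \<T> \<Longrightarrow> c T = 0"
    and "\<And>t. additive_set (Z t)"
    and "\<And>t a c. c \<in> Z t \<Longrightarrow> scale (pconst a) c \<in> Z t"
    and "\<And>t j c. j \<in> V \<Longrightarrow> c \<in> Z t \<Longrightarrow> scale (pvar j) c \<in> Z (Suc t)"
  shows "\<exists>t\<^sub>0. \<forall>t\<ge>t\<^sub>0. \<forall>c\<in>Z (Suc t).
    \<exists>b. (\<forall>j\<in>V. b j \<in> Z t) \<and> c = (\<Sum>j\<in>V. scale (pvar j) (b j))"
  using assms
proof (induction \<T> arbitrary: Z rule: finite_induct)
  case empty
  show ?case
  proof (rule exI[of _ "0 :: nat"], intro allI impI ballI)
    fix t c assume "c \<in> Z (Suc t)"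
    then have c: "c = 0" using empty.prems(3) by (auto simp: fun_eq_iff)
    have "0 \<in> Z t" by (rule additive_set_0) (rule empty.prems(4))
    moreover have "c = (\<Sum>j\<in>V. scale (pvar j) (0 :: 't \<Rightarrow> 'k mpoly))"
      unfolding c by (simp only: scale_0 sum.neutral_const)
    ultimately show "\<exists>b. (\<forall>j\<in>V. b j \<in> Z t) \<and> c = (\<Sum>j\<in>V. scale (pvar j) (b j))"
      by (intro exI[of _ "\<lambda>_. 0"] conjI ballI)
  qed
next
  case (insert T0 \<T>)
  note Z = insert.prems
  define A where "A t = (\<lambda>c. c T0) ` Z t" for t
  obtain t1 where t1: "\<And>t f. t1 \<le> t \<Longrightarrow> f \<in> A (Suc t)
    \<Longrightarrow> \<exists>b. (\<forall>j\<in>V. b j \<in> A t) \<and> f = (\<Sum>j\<in>V. pvar j * b j)"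
  proof (rule graded_ideal_bounded_generators[OF Z(1), of A])
    show "A t \<subseteq> forms V (int t)" for t using Z(2) by (auto simp: A_def)
    show "additive_set (A t)" for t
      unfolding additive_set_def
    proof (intro conjI ballI)
      have "0 \<in> Z t" using Z(4) by (rule additive_set_0)
      then show "0 \<in> A t" unfolding A_def by (rule rev_image_eqI) simp
      fix a b assume "a \<in> A t" "b \<in> A t"
      then obtain c d where "c \<in> Z t" "d \<in> Z t" "a = c T0" "b = d T0" by (auto simp: A_def)
      with additive_set_diff[OF Z(4)] show "a - b \<in> A t"
        by (auto simp: A_def intro!: image_eqI[of _ _ "c - d"])
    qed
    show "pconst a * f \<in> A t" if f: "f \<in> A t" for t a f
    proof -
      obtain c where "c \<in> Z t" "f = c T0" using f by (auto simp: A_def)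
      with Z(5) show ?thesis by (auto simp: A_def scale_def intro!: image_eqI[of _ _ "scale (pconst a) c"])
    qed
    show "pvar j * f \<in> A (Suc t)" if f: "j \<in> V" "f \<in> A t" for t j f
    proof -
      obtain c where "c \<in> Z t" "f = c T0" using f by (auto simp: A_def)
      with Z(6) f show ?thesis by (auto simp: A_def scale_def intro!: image_eqI[of _ _ "scale (pvar j) c"])
    qed
  qed blast
  define Z' where "Z' t = {c \<in> Z t. c T0 = 0}" for t
  have "\<exists>t\<^sub>0. \<forall>t\<ge>t\<^sub>0. \<forall>c\<in>Z' (Suc t).
    \<exists>b. (\<forall>j\<in>V. b j \<in> Z' t) \<and> c = (\<Sum>j\<in>V. scale (pvar j) (b j))"
  proof (rule insert.IH[OF Z(1)])
    show "c T \<in> forms V (int t)" if "c \<in> Z' t" for t c T using that Z(2) by (auto simp: Z'_def)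
    show "c T = 0" if "c \<in> Z' t" "T \<notin> \<T>" for t c T
      using that Z(3)[of c t T] by (cases "T = T0") (auto simp: Z'_def)
    show "additive_set (Z' t)" for t
      using Z(4)[of t] by (auto simp: Z'_def additive_set_def)
    show "scale (pconst a) c \<in> Z' t" if "c \<in> Z' t" for t a c
      using that Z(5) by (auto simp: Z'_def scale_def)
    show "scale (pvar j) c \<in> Z' (Suc t)" if "j \<in> V" "c \<in> Z' t" for t j c
      using that Z(6)[of j c t] by (auto simp: Z'_def scale_def)
  qed
  then obtain t2 where t2: "\<And>t c. t2 \<le> t \<Longrightarrow> c \<in> Z' (Suc t) \<Longrightarrow>
    \<exists>b. (\<forall>j\<in>V. b j \<in> Z' t) \<and> c = (\<Sum>j\<in>V. scale (pvar j) (b j))" by blast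
  show ?case
  proof (rule exI[of _ "max t1 t2"], intro allI impI ballI)
    fix t c assume t: "max t1 t2 \<le> t" and c: "c \<in> Z (Suc t)"
    have "c T0 \<in> A (Suc t)" using c by (auto simp: A_def)
    then obtain a where a: "\<forall>j\<in>V. a j \<in> A t" "c T0 = (\<Sum>j\<in>V. pvar j * a j)"
      using t1 t by (meson max.boundedE)
    then have "\<forall>j\<in>V. \<exists>d. d \<in> Z t \<and> a j = d T0" by (auto simp: A_def)
    then obtain d where d: "\<And>j. j \<in> V \<Longrightarrow> d j \<in> Z t \<and> a j = d j T0" by metis
    let ?s = "\<Sum>j\<in>V. scale (pvar j) (d j)"
    have "?s \<in> Z (Suc t)" using Z(6) d by (intro additive_set_sum[OF Z(4)]) auto
    then have "c - ?s \<in> Z (Suc t)" by (rule additive_set_diff[OF Z(4) c])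
    moreover have "(c - ?s) T0 = 0"
      using d by (simp add: a(2) sum_fun_apply scale_def)
    ultimately have "c - ?s \<in> Z' (Suc t)" by (simp add: Z'_def)
    then obtain b where b: "\<forall>j\<in>V. b j \<in> Z' t" "c - ?s = (\<Sum>j\<in>V. scale (pvar j) (b j))"
      using t2[of t "c - ?s"] t by auto
    have "c = (\<Sum>j\<in>V. scale (pvar j) (b j)) + ?s" by (simp flip: b(2))
    also have "\<dots> = (\<Sum>j\<in>V. scale (pvar j) (b j + d j))"
      by (simp only: scale_add sum.distrib)
    finally show "\<exists>b. (\<forall>j\<in>V. b j \<in> Z t) \<and> c = (\<Sum>j\<in>V. scale (pvar j) (b j))"
      using b(1) d additive_set_add[OF Z(4)]
      by (intro exI[of _ "\<lambda>j. b j + d j"]) (auto simp: Z'_def)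
  qed
qed

text \<open>
  A cycle \<open>\<Sum>\<^sub>j x\<^sub>j b\<^sub>j\<close> with cycles \<open>b\<^sub>j\<close> is the boundary of \<open>\<Sum>\<^sub>j e\<^sub>j \<and> b\<^sub>j\<close>, so bounded generation of the
  module of cycles kills the homology in high degrees.
\<close>

lemma koszul_homology_high_degree:
  fixes J :: "'k::field_char_0 mpoly set"
  assumes "finite V" "additive_set J" "\<And>f g. f \<in> J \<Longrightarrow> g \<in> polys V \<Longrightarrow> g * f \<in> J"
  obtains t\<^sub>0 where "\<And>t c. t\<^sub>0 \<le> t \<Longrightarrow> c \<in> chains V i (J \<inter> forms V (int (Suc t))) \<Longrightarrow> kdiff V c = 0
    \<Longrightarrow> \<exists>b \<in> chains V (Suc i) (J \<inter> forms V (int t)). kdiff V b = c"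
proof -
  define Z where "Z t = {c \<in> chains V i (J \<inter> forms V (int t)). kdiff V c = 0}" for t
  have addJ: "additive_set (J \<inter> forms V e)" for e
    by (intro additive_set_Int assms(2) additive_set_forms)
  have "\<exists>t\<^sub>0. \<forall>t\<ge>t\<^sub>0. \<forall>c\<in>Z (Suc t).
    \<exists>b. (\<forall>j\<in>V. b j \<in> Z t) \<and> c = (\<Sum>j\<in>V. scale (pvar j) (b j))"
  proof (rule graded_module_bounded_generators)
    show "finite (Pow V)" "finite V" using assms(1) by auto
    show "c T \<in> forms V (int t)" if "c \<in> Z t" for t c T
      using that chainsD[of c V i "J \<inter> forms V (int t)" T] additive_set_0[OF addJ] by (auto simp: Z_def)
    show "c T = 0" if "c \<in> Z t" "T \<notin> Pow V" for t c T
      using that by (auto simp: Z_def chains_def)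
    show "additive_set (Z t)" for t
      using chains_additive[OF addJ, of V i "int t"]
      by (auto simp: Z_def additive_set_def kdiff_diff)
    show "scale (pconst a) c \<in> Z t" if "c \<in> Z t" for t a c
      using that assms(3) by (auto simp: Z_def kdiff_scale forms_pconst_mult elim!: chains_scale)
    show "scale (pvar j) c \<in> Z (Suc t)" if "j \<in> V" "c \<in> Z t" for t j c
    proof -
      have "pvar j * f \<in> J \<inter> forms V (int (Suc t))" if "f \<in> J \<inter> forms V (int t)" for f
        using that forms_mult[OF pvar_forms[OF \<open>j \<in> V\<close>], of f "int t"] assms(3)[of f "pvar j"] \<open>j \<in> V\<close>
        by (auto simp: pvar_polys add.commute)
      then show ?thesis using that by (auto simp: Z_def kdiff_scale elim!: chains_scale)
    qed
  qed
  then obtain t\<^sub>0 where t\<^sub>0: "\<And>t c. t\<^sub>0 \<le> t \<Longrightarrow> c \<in> Z (Suc t) \<Longrightarrow>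
    \<exists>b. (\<forall>j\<in>V. b j \<in> Z t) \<and> c = (\<Sum>j\<in>V. scale (pvar j) (b j))" by blast
  show thesis
  proof (rule that)
    fix t c
    assume t: "t\<^sub>0 \<le> t" and c: "c \<in> chains V i (J \<inter> forms V (int (Suc t)))" "kdiff V c = 0"
    then obtain b where b: "\<forall>j\<in>V. b j \<in> Z t" "c = (\<Sum>j\<in>V. scale (pvar j) (b j))"
      using t\<^sub>0[OF t, of c] by (auto simp: Z_def)
    show "\<exists>b \<in> chains V (Suc i) (J \<inter> forms V (int t)). kdiff V b = c"
    proof (rule bexI[of _ "\<Sum>j\<in>V. wedge j (b j)"])
      show "(\<Sum>j\<in>V. wedge j (b j)) \<in> chains V (Suc i) (J \<inter> forms V (int t))"
        using b(1) assms(1) by (intro chains_sum addJ wedge_chains) (auto simp: Z_def)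
      have "kdiff V (wedge j (b j)) = scale (pvar j) (b j)" if "j \<in> V" for j
        using b(1) that by (simp add: kdiff_wedge[OF assms(1)] Z_def)
      then show "kdiff V (\<Sum>j\<in>V. wedge j (b j)) = c"
        unfolding kdiff_sum b(2) by (rule sum.cong[OF refl])
    qed
  qed
qed

section \<open>The Koszul complex of an ideal of linear forms\<close>

text \<open>The product of \<Lambda> - k, \<Lambda> - (k + 1), ..., \<Lambda> - (k + e - 1), applied
  to w with the factor \<Lambda> - k first. Its vanishing expresses, without eigenvectors, that the
  eigenvalues of \<Lambda> are among k, ..., k + e - 1.\<close>

primrec falling_product :: "(('b \<Rightarrow> 'a) \<Rightarrow> 'b \<Rightarrow> 'a) \<Rightarrow> int \<Rightarrow> nat \<Rightarrow> ('b \<Rightarrow> 'a) \<Rightarrow> 'b \<Rightarrow> 'a::comm_ring_1"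
  where
  "falling_product \<Lambda> k 0 w = w"
| "falling_product \<Lambda> k (Suc e) w = falling_product \<Lambda> (k + 1) e (\<Lambda> w - scale (of_int k) w)"

lemma falling_product_Suc_last:
  "falling_product \<Lambda> k (Suc e) w
    = \<Lambda> (falling_product \<Lambda> k e w) - scale (of_int (k + int e)) (falling_product \<Lambda> k e w)"
proof (induction e arbitrary: k w)
  case (Suc e)
  have "k + 1 + int e = k + int (Suc e)" by simp
  with Suc.IH[of "k + 1" "\<Lambda> w - scale (of_int k) w"] show ?case
    by (simp only: falling_product.simps)
qed simp

text \<open>A sum of \<open>n\<close> commuting idempotents has its eigenvalues among \<open>0, \<dots>, n\<close>.\<close>

lemma falling_product_idempotents:
  fixes \<N> :: "nat \<Rightarrow> ('b \<Rightarrow> 'a) \<Rightarrow> 'b \<Rightarrow> 'a::comm_ring_1"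
  assumes "finite Q"
    and "\<And>j v w. j \<in> Q \<Longrightarrow> \<N> j (v - w) = \<N> j v - \<N> j w"
    and "\<And>j a w. j \<in> Q \<Longrightarrow> \<N> j (scale a w) = scale a (\<N> j w)"
    and "\<And>j w. j \<in> Q \<Longrightarrow> \<N> j (\<N> j w) = \<N> j w"
    and "\<And>j k w. j \<in> Q \<Longrightarrow> k \<in> Q \<Longrightarrow> \<N> j (\<N> k w) = \<N> k (\<N> j w)"
  shows "falling_product (\<lambda>w. \<Sum>j\<in>Q. \<N> j w) 0 (Suc (card Q)) w = 0"
  using assms
proof (induction Q arbitrary: w rule: finite_induct)
  case (insert q Q)
  let ?\<Lambda> = "\<lambda>w. \<Sum>j\<in>Q. \<N> j w" and ?\<Lambda>' = "\<lambda>w. \<Sum>j\<in>insert q Q. \<N> j w"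
  have \<Lambda>': "?\<Lambda>' w = \<N> q w + ?\<Lambda> w" for w using insert.hyps by simp
  have IH: "falling_product ?\<Lambda> 0 (Suc (card Q)) w = 0" for w
  proof (rule insert.IH)
    show "\<N> j (v - w) = \<N> j v - \<N> j w" if "j \<in> Q" for j v w
      using that by (rule insert.prems(1)[OF insertI2])
    show "\<N> j (scale a w) = scale a (\<N> j w)" if "j \<in> Q" for j a w
      using that by (rule insert.prems(2)[OF insertI2])
    show "\<N> j (\<N> j w) = \<N> j w" if "j \<in> Q" for j w
      using that by (rule insert.prems(3)[OF insertI2])
    show "\<N> j (\<N> k w) = \<N> k (\<N> j w)" if "j \<in> Q" "k \<in> Q" for j k w
      using that by (rule insert.prems(4)[OF insertI2 insertI2])
  qed
  have diff: "\<N> j (v - w) = \<N> j v - \<N> j w" if "j \<in> insert q Q" for j v w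
    using insert.prems(1) that .
  have scale: "\<N> j (scale a w) = scale a (\<N> j w)" if "j \<in> insert q Q" for j a w
    using insert.prems(2) that .
  have zero: "\<N> j 0 = 0" if "j \<in> insert q Q" for j
    using diff[OF that, of 0 0] by simp
  have add: "\<N> j (v + w) = \<N> j v + \<N> j w" if "j \<in> insert q Q" for j v w
    using diff[OF that, of v "- w"] diff[OF that, of 0 w] zero[OF that] by simp
  have sum: "\<N> q (\<Sum>j\<in>A. f j) = (\<Sum>j\<in>A. \<N> q (f j))" for A and f :: "nat \<Rightarrow> 'b \<Rightarrow> 'a"
    using sum_comp_morphism[of "\<N> q" f A, OF zero add] by (simp add: comp_def)
  have q\<Lambda>: "\<N> q (?\<Lambda> w) = ?\<Lambda> (\<N> q w)" for w
    unfolding sum using insert.prems(4)[of q _ w] by (intro sum.cong refl) auto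
  \<comment> \<open>The vector w is split as (w - N_q w) + N_q w. On the first summand N_q adds 0 to
    the sum, and the surplus factor of the product is the last one; on the second it adds 1, which
    shifts the product by one and makes the first factor the surplus one.\<close>
  have kernel: "falling_product ?\<Lambda>' k e w = falling_product ?\<Lambda> k e w" if "\<N> q w = 0" for k e w
    using that
  proof (induction e arbitrary: k w)
    case (Suc e)
    have "\<N> q (?\<Lambda> w - scale (of_int k) w) = 0"
    proof -
      have "?\<Lambda> 0 = 0" using zero by (intro sum.neutral) auto
      then show ?thesis
        by (simp only: diff[OF insertI1] scale[OF insertI1] q\<Lambda> Suc.prems scale_0 diff_self)
    qed
    from Suc.IH[OF this] show ?case using Suc.prems by (simp only: falling_product.simps \<Lambda>' add_0)
  qed simp
  have image: "falling_product ?\<Lambda>' k e w = falling_product ?\<Lambda> (k - 1) e w" if "\<N> q w = w" for k e w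
    using that
  proof (induction e arbitrary: k w)
    case (Suc e)
    have w: "?\<Lambda>' w - scale (of_int k) w = ?\<Lambda> w - scale (of_int (k - 1)) w"
      unfolding \<Lambda>' Suc.prems by (simp add: scale_def fun_eq_iff algebra_simps)
    have "\<N> q (?\<Lambda> w - scale (of_int (k - 1)) w) = ?\<Lambda> w - scale (of_int (k - 1)) w"
      using Suc.prems by (simp only: diff[OF insertI1] scale[OF insertI1] q\<Lambda>)
    from Suc.IH[OF this, of "k + 1"] show ?case
      unfolding falling_product.simps w add_diff_cancel_right' diff_add_cancel .
  qed simp
  have linear: "falling_product ?\<Lambda>' k e (v + w) = falling_product ?\<Lambda>' k e v + falling_product ?\<Lambda>' k e w"
    for k e v w
  proof (induction e arbitrary: k v w)
    case (Suc e)
    have "?\<Lambda>' (v + w) = ?\<Lambda>' v + ?\<Lambda>' w"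
      unfolding sum.distrib[symmetric] by (intro sum.cong refl add)
    then have "?\<Lambda>' (v + w) - scale (of_int k) (v + w)
        = (?\<Lambda>' v - scale (of_int k) v) + (?\<Lambda>' w - scale (of_int k) w)"
      by (simp only: scale_add) (simp add: algebra_simps)
    then show ?case unfolding falling_product.simps by (simp only: Suc.IH)
  qed simp
  have "falling_product ?\<Lambda>' 0 (Suc (Suc (card Q))) (w - \<N> q w) = 0"
  proof -
    have "\<N> q (w - \<N> q w) = 0" using insert.prems(3) by (simp add: diff)
    then have "falling_product ?\<Lambda>' 0 (Suc (Suc (card Q))) (w - \<N> q w)
        = falling_product ?\<Lambda> 0 (Suc (Suc (card Q))) (w - \<N> q w)" by (rule kernel)
    also have "\<dots> = ?\<Lambda> 0 - scale (of_int (0 + int (Suc (card Q)))) 0"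
      by (subst falling_product_Suc_last) (simp only: IH)
    also have "?\<Lambda> 0 = 0" using zero by (intro sum.neutral) auto
    finally show ?thesis by (simp only: scale_0 diff_0_right)
  qed
  moreover have "falling_product ?\<Lambda>' 0 (Suc (Suc (card Q))) (\<N> q w) = 0"
  proof -
    have "falling_product ?\<Lambda>' 0 (Suc (Suc (card Q))) (\<N> q w)
        = falling_product ?\<Lambda> (0 - 1) (Suc (Suc (card Q))) (\<N> q w)"
      by (rule image) (simp add: insert.prems(3))
    also have "\<dots> = falling_product ?\<Lambda> 0 (Suc (card Q)) (?\<Lambda> (\<N> q w) - scale (of_int (0 - 1)) (\<N> q w))"
      by (subst falling_product.simps) simp
    finally show ?thesis by (simp only: IH)
  qed
  ultimately have "falling_product ?\<Lambda>' 0 (Suc (Suc (card Q))) ((w - \<N> q w) + \<N> q w) = 0"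
    unfolding linear by (simp only: add_0)
  then show ?case by (simp only: diff_add_cancel card_insert_disjoint[OF insert.hyps])
qed (simp add: fun_eq_iff scale_def)

text \<open>
  After Gaussian elimination a space of linear forms has a basis \<open>x\<^sub>p + \<Sum>\<^sub>j a\<^sub>p\<^sub>j x\<^sub>j\<close>, where \<open>p\<close> runs
  over the set \<open>P\<close> of pivots and \<open>j\<close> over the set \<open>Q\<close> of the remaining variables.
\<close>

locale linear_forms =
  fixes V P Q :: "nat set" and a :: "nat \<Rightarrow> nat \<Rightarrow> 'k::field_char_0"
  assumes finite_V: "finite V" and V_eq: "V = P \<union> Q" and PQ: "P \<inter> Q = {}"
begin

definition lform :: "nat \<Rightarrow> 'k mpoly" where
  "lform p = pvar p + (\<Sum>j\<in>Q. pconst (a p j) * pvar j)"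

definition lideal :: "'k mpoly set" where
  "lideal = {f. \<exists>g. (\<forall>p\<in>P. g p \<in> polys V) \<and> f = (\<Sum>p\<in>P. lform p * g p)}"

lemma finite_P: "finite P" and finite_Q: "finite Q" and P_V: "p \<in> P \<Longrightarrow> p \<in> V" and Q_V: "j \<in> Q \<Longrightarrow> j \<in> V"
  using finite_V V_eq by auto

lemma lform_mult:
  "lform p * f = pvar p * f + (\<Sum>j\<in>Q. pvar j * (pconst (a p j) * f))"
  unfolding lform_def distrib_right sum_distrib_right
  by (intro arg_cong2[of _ _ _ _ "(+)"] sum.cong refl) (simp add: mult_ac)

lemma lform_forms: "p \<in> P \<Longrightarrow> lform p \<in> forms V 1"
  unfolding lform_def
  by (intro forms_add forms_sum forms_pconst_mult pvar_forms P_V Q_V)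

lemma lform_polys: "p \<in> P \<Longrightarrow> lform p \<in> polys V"
  using lform_forms by (auto simp: forms_def)

lemma lidealI: "(\<And>p. p \<in> P \<Longrightarrow> g p \<in> polys V) \<Longrightarrow> (\<Sum>p\<in>P. lform p * g p) \<in> lideal"
  by (auto simp: lideal_def)

lemma lideal_additive: "additive_set lideal"
  unfolding additive_set_def
proof (intro conjI ballI)
  show "0 \<in> lideal" using lidealI[of "\<lambda>_. 0"] by simp
  fix f g assume "f \<in> lideal" "g \<in> lideal"
  then obtain u v where "\<forall>p\<in>P. u p \<in> polys V" "f = (\<Sum>p\<in>P. lform p * u p)"
    "\<forall>p\<in>P. v p \<in> polys V" "g = (\<Sum>p\<in>P. lform p * v p)"
    by (auto simp: lideal_def)
  then have "f - g = (\<Sum>p\<in>P. lform p * (u p - v p))" "\<forall>p\<in>P. u p - v p \<in> polys V"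
    by (auto simp: sum_subtractf right_diff_distrib)
  then show "f - g \<in> lideal" using lidealI[of "\<lambda>p. u p - v p"] by simp
qed

lemma lideal_mult:
  assumes "f \<in> lideal" "h \<in> polys V" shows "h * f \<in> lideal"
proof -
  obtain g where "\<forall>p\<in>P. g p \<in> polys V" "f = (\<Sum>p\<in>P. lform p * g p)"
    using assms(1) by (auto simp: lideal_def)
  then have "h * f = (\<Sum>p\<in>P. lform p * (h * g p))" "\<forall>p\<in>P. h * g p \<in> polys V"
    using assms(2) by (auto simp: sum_distrib_left mult.left_commute)
  then show ?thesis using lidealI[of "\<lambda>p. h * g p"] by simp
qed

lemma lform_mult_lideal: "p \<in> P \<Longrightarrow> f \<in> polys V \<Longrightarrow> lform p * f \<in> lideal"
  using lidealI[of "\<lambda>q. if q = p then f else 0"] finite_P by (simp add: if_distrib cong: if_cong)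

lemma lideal_forms:
  assumes "f \<in> lideal \<inter> forms V s"
  obtains g where "\<And>p. p \<in> P \<Longrightarrow> g p \<in> forms V (s - 1)" "f = (\<Sum>p\<in>P. lform p * g p)"
proof -
  obtain g where g: "\<forall>p\<in>P. g p \<in> polys V" "f = (\<Sum>p\<in>P. lform p * g p)"
    using assms by (auto simp: lideal_def)
  have "f = hom_component s f" using assms by (simp add: forms_def hom_component_homogeneous)
  also have "\<dots> = (\<Sum>p\<in>P. lform p * hom_component (s - 1) (g p))"
    unfolding g(2) hom_component_sum
    by (intro sum.cong refl hom_component_mult) (use lform_forms in \<open>auto simp: forms_def\<close>)
  finally show thesis
    using g(1) by (intro that[of "\<lambda>p. hom_component (s - 1) (g p)"])
      (auto simp: forms_def hom_component_polys)
qed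

lemma lideal_forms_0:
  assumes "f \<in> lideal \<inter> forms V 0" shows "f = 0"
proof -
  obtain g where "\<And>p. p \<in> P \<Longrightarrow> g p \<in> forms V (0 - 1)" "f = (\<Sum>p\<in>P. lform p * g p)"
    using lideal_forms[OF assms] by blast
  moreover from this have "g p = 0" if "p \<in> P" for p using forms_neg that by fastforce
  ultimately show ?thesis by simp
qed

section \<open>Derivations adapted to the linear forms\<close>

text \<open>The partial derivative by x_j in the coordinates formed by the \<open>lform p\<close>
  and the x_j with j in Q. It kills every \<open>lform p\<close>, hence preserves
  \<open>lideal\<close>; an ordinary partial derivative need not.\<close>

definition deriv_Q :: "nat \<Rightarrow> 'k mpoly \<Rightarrow> 'k mpoly" where
  "deriv_Q j f = pderivative j f - (\<Sum>p\<in>P. pconst (a p j) * pderivative p f)"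

lemma deriv_Q_add: "deriv_Q j (f + g) = deriv_Q j f + deriv_Q j g"
  by (simp add: deriv_Q_def pderivative_add distrib_left sum.distrib)

lemma deriv_Q_0 [simp]: "deriv_Q j 0 = 0"
  by (simp add: deriv_Q_def)

lemma deriv_Q_sum: "deriv_Q j (\<Sum>i\<in>A. f i) = (\<Sum>i\<in>A. deriv_Q j (f i))"
  by (induction A rule: infinite_finite_induct) (auto simp: deriv_Q_add)

lemma deriv_Q_mult: "deriv_Q j (f * g) = f * deriv_Q j g + deriv_Q j f * g"
  by (simp add: deriv_Q_def pderivative_mult algebra_simps sum.distrib sum_distrib_left)

lemma deriv_Q_forms: "f \<in> forms V e \<Longrightarrow> deriv_Q j f \<in> forms V (e - 1)"
  unfolding deriv_Q_def
  by (intro forms_diff forms_sum forms_pconst_mult pderivative_forms)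

lemma deriv_Q_polys: "f \<in> polys V \<Longrightarrow> deriv_Q j f \<in> polys V"
  unfolding deriv_Q_def by (intro polys_diff polys_sum polys_mult pderivative_polys pconst_polys)

lemma deriv_Q_pvar:
  assumes "j \<in> Q" "m \<in> V"
  shows "deriv_Q j (pvar m) = (if m = j then 1 else if m \<in> P then - pconst (a m j) else 0)"
proof -
  have "(\<Sum>p\<in>P. pconst (a p j) * pderivative p (pvar m)) = (\<Sum>p\<in>P. if p = m then pconst (a p j) else 0)"
    by (intro sum.cong) (auto simp: pderivative_pvar)
  then show ?thesis using assms PQ finite_P by (auto simp: deriv_Q_def pderivative_pvar)
qed

lemma deriv_Q_pconst [simp]: "deriv_Q j (pconst b) = 0"
  by (simp add: deriv_Q_def)

lemma deriv_Q_lform: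
  assumes "j \<in> Q" "p \<in> P" shows "deriv_Q j (lform p) = 0"
proof -
  have "deriv_Q j (lform p) = deriv_Q j (pvar p) + (\<Sum>i\<in>Q. pconst (a p i) * deriv_Q j (pvar i))"
    by (simp add: lform_def deriv_Q_add deriv_Q_sum deriv_Q_mult)
  also have "(\<Sum>i\<in>Q. pconst (a p i) * deriv_Q j (pvar i)) = (\<Sum>i\<in>Q. if i = j then pconst (a p j) else 0)"
    using assms PQ by (intro sum.cong refl) (auto simp: deriv_Q_pvar Q_V)
  finally show ?thesis using assms PQ finite_Q P_V by (auto simp: deriv_Q_pvar)
qed

lemma deriv_Q_lideal:
  assumes "f \<in> lideal" "j \<in> Q" shows "deriv_Q j f \<in> lideal"
proof -
  obtain g where g: "\<forall>p\<in>P. g p \<in> polys V" "f = (\<Sum>p\<in>P. lform p * g p)"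
    using assms(1) by (auto simp: lideal_def)
  have "deriv_Q j f = (\<Sum>p\<in>P. lform p * deriv_Q j (g p))"
    unfolding g(2) deriv_Q_sum using assms(2)
    by (intro sum.cong refl) (simp add: deriv_Q_mult deriv_Q_lform)
  then show ?thesis using g(1) lidealI[of "\<lambda>p. deriv_Q j (g p)"] by (simp add: deriv_Q_polys)
qed

text \<open>Euler's identity in the adapted coordinates. The subtracted sum lies in
  \<open>lideal\<close>, so modulo this ideal the variables in Q alone carry the degree.\<close>

lemma euler_Q:
  assumes "f \<in> forms V e"
  shows "(\<Sum>j\<in>Q. pvar j * deriv_Q j f) = of_int e * f - (\<Sum>p\<in>P. lform p * pderivative p f)"
proof -
  have V: "(\<Sum>j\<in>V. g j) = (\<Sum>p\<in>P. g p) + (\<Sum>j\<in>Q. g j)" for g :: "nat \<Rightarrow> 'k mpoly"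
    unfolding V_eq by (rule sum.union_disjoint) (use finite_P finite_Q PQ V_eq in auto)
  have "(\<Sum>p\<in>P. lform p * pderivative p f) = (\<Sum>p\<in>P. pvar p * pderivative p f)
      + (\<Sum>p\<in>P. \<Sum>j\<in>Q. pvar j * (pconst (a p j) * pderivative p f))"
    by (simp only: lform_mult sum.distrib)
  also have "(\<Sum>p\<in>P. \<Sum>j\<in>Q. pvar j * (pconst (a p j) * pderivative p f))
      = (\<Sum>j\<in>Q. \<Sum>p\<in>P. pvar j * (pconst (a p j) * pderivative p f))"
    by (rule sum.swap)
  finally have "(\<Sum>p\<in>P. lform p * pderivative p f) = (\<Sum>p\<in>P. pvar p * pderivative p f)
      + (\<Sum>j\<in>Q. pvar j * (\<Sum>p\<in>P. pconst (a p j) * pderivative p f))"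
    by (simp add: sum_distrib_left)
  moreover have "(\<Sum>j\<in>Q. pvar j * deriv_Q j f) = (\<Sum>j\<in>Q. pvar j * pderivative j f)
      - (\<Sum>j\<in>Q. pvar j * (\<Sum>p\<in>P. pconst (a p j) * pderivative p f))"
    by (simp add: deriv_Q_def right_diff_distrib sum_subtractf)
  moreover have "(\<Sum>p\<in>P. pvar p * pderivative p f) + (\<Sum>j\<in>Q. pvar j * pderivative j f) = of_int e * f"
    using euler_identity[OF assms finite_V] by (simp only: V)
  ultimately show ?thesis by (simp add: algebra_simps)
qed

section \<open>The Koszul complex in adapted coordinates\<close>

text \<open>The factor of x_j when the Koszul differential is rewritten in terms of the
  \<open>lform p\<close> and the x_j with j in Q. Accordingly \<open>number_Q\<close> counts the
  exterior factors belonging to Q in the dual of the adapted basis.\<close>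

definition contract_Q :: "nat \<Rightarrow> (nat set \<Rightarrow> 'k mpoly) \<Rightarrow> nat set \<Rightarrow> 'k mpoly" where
  "contract_Q j c = contract j c - (\<Sum>p\<in>P. scale (pconst (a p j)) (contract p c))"

definition number_Q :: "(nat set \<Rightarrow> 'k mpoly) \<Rightarrow> nat set \<Rightarrow> 'k mpoly" where
  "number_Q c = (\<Sum>j\<in>Q. wedge j (contract_Q j c))"

lemma contract_Q_diff: "contract_Q j (c - d) = contract_Q j c - contract_Q j d"
  by (simp add: contract_Q_def contract_diff scale_diff sum_subtractf)

lemma contract_Q_0 [simp]: "contract_Q j 0 = 0"
  using contract_Q_diff[of j 0 0] by simp

lemma contract_Q_minus: "contract_Q j (- d) = - contract_Q j d"
  using contract_Q_diff[of j 0 d] by simp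

lemma contract_Q_add: "contract_Q j (c + d) = contract_Q j c + contract_Q j d"
  using contract_Q_diff[of j c "- d"] by (simp add: contract_Q_minus)

lemma contract_Q_scale: "contract_Q j (scale b c) = scale b (contract_Q j c)"
  by (simp add: contract_Q_def contract_scale scale_diff scale_sum scale_scale mult.commute)

lemma contract_Q_sum: "contract_Q j (\<Sum>i\<in>A. f i) = (\<Sum>i\<in>A. contract_Q j (f i))"
  using sum_comp_morphism[of "contract_Q j" f A, OF contract_Q_0 contract_Q_add] by (simp add: comp_def)

lemma contract_contract_Q: "contract m (contract_Q j c) = - contract_Q j (contract m c)"
  unfolding contract_Q_def
  by (simp add: contract_diff contract_sum contract_scale contract_contract[of m] scale_minus sum_negf)

lemma contract_Q_contract_Q: "contract_Q j (contract_Q k c) = - contract_Q k (contract_Q j c)"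
  by (subst contract_Q_def)
    (simp add: contract_contract_Q scale_minus sum_negf, simp add: contract_Q_def[of j]
      contract_Q_diff contract_Q_sum contract_Q_scale)

lemma contract_Q_wedge:
  assumes "j \<in> Q" "k \<in> Q"
  shows "contract_Q j (wedge k c) = (if j = k then c else 0) - wedge k (contract_Q j c)"
proof -
  have "contract p (wedge k c) = - wedge k (contract p c)" if "p \<in> P" for p
    using contract_wedge[of p k c] that assms PQ by auto
  then have "(\<Sum>p\<in>P. scale (pconst (a p j)) (contract p (wedge k c)))
      = (\<Sum>p\<in>P. - wedge k (scale (pconst (a p j)) (contract p c)))"
    by (intro sum.cong refl) (simp add: scale_minus wedge_scale)
  then show ?thesis
    by (simp add: contract_Q_def contract_wedge[of j] wedge_diff wedge_sum sum_negf)
qed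

text \<open>For indices in Q, \<open>wedge\<close> and \<open>contract_Q\<close> obey the
  anticommutation rules of an exterior algebra and its contractions, so the summands of
  \<open>number_Q\<close> are commuting idempotents.\<close>

lemma number_Q_falling_product: "falling_product number_Q 0 (Suc (card Q)) w = 0"
proof -
  have "falling_product (\<lambda>w. \<Sum>j\<in>Q. wedge j (contract_Q j w)) 0 (Suc (card Q)) w = 0"
  proof (rule falling_product_idempotents)
    show "finite Q" by (rule finite_Q)
    show "wedge j (contract_Q j (v - w)) = wedge j (contract_Q j v) - wedge j (contract_Q j w)" for j v w
      by (simp add: contract_Q_diff wedge_diff)
    show "wedge j (contract_Q j (scale b w)) = scale b (wedge j (contract_Q j w))" for j b w
      by (simp add: contract_Q_scale wedge_scale)
    have ww: "wedge j (wedge j c) = 0" for j and c :: "nat set \<Rightarrow> 'k mpoly"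
      by (auto simp: wedge_def fun_eq_iff)
    show "wedge j (contract_Q j (wedge j (contract_Q j w))) = wedge j (contract_Q j w)" if "j \<in> Q" for j w
      by (simp add: contract_Q_wedge that wedge_diff ww)
    show "wedge j (contract_Q j (wedge k (contract_Q k w))) = wedge k (contract_Q k (wedge j (contract_Q j w)))"
      if "j \<in> Q" "k \<in> Q" for j k w
    proof (cases "j = k")
      case False
      then have "wedge j (contract_Q j (wedge k (contract_Q k w))) = - wedge j (wedge k (contract_Q j (contract_Q k w)))"
        using that by (simp add: contract_Q_wedge wedge_minus)
      also have "\<dots> = - wedge k (wedge j (contract_Q k (contract_Q j w)))"
        by (subst wedge_wedge, subst contract_Q_contract_Q) (simp add: wedge_minus)
      also have "\<dots> = wedge k (contract_Q k (wedge j (contract_Q j w)))"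
        using that False by (simp add: contract_Q_wedge wedge_minus)
      finally show ?thesis .
    qed simp
  qed
  then show ?thesis by (simp add: number_Q_def[abs_def])
qed

lemma contract_Q_chains:
  assumes "c \<in> chains V (Suc n) (forms V r)" shows "contract_Q j c \<in> chains V n (forms V r)"
  unfolding contract_Q_def
  by (intro chains_diff chains_sum additive_set_forms chains_scale[OF contract_chains[OF _ assms finite_V]]
      contract_chains[OF _ assms finite_V] forms_pconst_mult)

lemma number_Q_chains:
  assumes "c \<in> chains V (Suc n) (forms V r)" shows "number_Q c \<in> chains V (Suc n) (forms V r)"
  unfolding number_Q_def
  by (intro chains_sum additive_set_forms wedge_chains[OF _ contract_Q_chains[OF assms] finite_V Q_V])

lemma lideal_coeffs:
  fixes c d :: "nat set \<Rightarrow> 'k mpoly"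
  assumes "\<And>T. c T \<in> lideal"
  shows "contract m c T \<in> lideal" "wedge m c T \<in> lideal" "contract_Q j c T \<in> lideal"
    "number_Q c T \<in> lideal" "h \<in> polys V \<Longrightarrow> scale h c T \<in> lideal"
proof -
  have con: "contract m c T \<in> lideal" for m T
    using assms by (simp add: contract_def additive_set_sign lideal_additive additive_set_0)
  have wed: "wedge m c T \<in> lideal" if "\<And>T. c T \<in> lideal" for m T and c :: "nat set \<Rightarrow> 'k mpoly"
    using that by (simp add: wedge_def additive_set_sign lideal_additive additive_set_0)
  show "contract m c T \<in> lideal" by (rule con)
  show "wedge m c T \<in> lideal" by (rule wed[OF assms])
  have conQ: "contract_Q j c T \<in> lideal" for j T
    unfolding contract_Q_def fun_diff_def sum_fun_apply scale_def
    by (intro additive_set_diff additive_set_sum lideal_additive lideal_mult con pconst_polys)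
  show "contract_Q j c T \<in> lideal" by (rule conQ)
  show "number_Q c T \<in> lideal"
    unfolding number_Q_def sum_fun_apply by (intro additive_set_sum lideal_additive wed conQ)
  show "scale h c T \<in> lideal" if "h \<in> polys V"
    unfolding scale_def by (intro lideal_mult assms that)
qed

lemma kdiff_contract: "kdiff U (contract m c) = - contract m (kdiff U c)"
  unfolding kdiff_def contract_sum contract_scale sum_negf[symmetric]
  by (intro sum.cong refl) (simp add: contract_contract[of m] scale_minus)

lemma kdiff_contract_Q: "kdiff V (contract_Q j c) = - contract_Q j (kdiff V c)"
  unfolding contract_Q_def kdiff_diff kdiff_sum kdiff_scale kdiff_contract
  by (simp add: scale_minus sum_negf)

text \<open>The differential in adapted coordinates: modulo \<open>lideal\<close> only the part
  belonging to Q survives.\<close>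

lemma sum_Q_contract_Q:
  "(\<Sum>j\<in>Q. scale (pvar j) (contract_Q j c)) = kdiff V c - (\<Sum>p\<in>P. scale (lform p) (contract p c))"
proof
  fix T
  have "(\<Sum>p\<in>P. lform p * contract p c T) = (\<Sum>p\<in>P. pvar p * contract p c T)
      + (\<Sum>p\<in>P. \<Sum>j\<in>Q. pvar j * (pconst (a p j) * contract p c T))"
    by (simp only: lform_mult sum.distrib)
  also have "(\<Sum>p\<in>P. \<Sum>j\<in>Q. pvar j * (pconst (a p j) * contract p c T))
      = (\<Sum>j\<in>Q. pvar j * (\<Sum>p\<in>P. pconst (a p j) * contract p c T))"
    by (subst sum.swap) (simp add: sum_distrib_left)
  finally have l: "(\<Sum>p\<in>P. lform p * contract p c T) = (\<Sum>p\<in>P. pvar p * contract p c T)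
      + (\<Sum>j\<in>Q. pvar j * (\<Sum>p\<in>P. pconst (a p j) * contract p c T))" .
  have V: "(\<Sum>j\<in>V. g j) = (\<Sum>p\<in>P. g p) + (\<Sum>j\<in>Q. g j)" for g :: "nat \<Rightarrow> 'k mpoly"
    unfolding V_eq by (rule sum.union_disjoint) (use finite_P finite_Q PQ V_eq in auto)
  show "(\<Sum>j\<in>Q. scale (pvar j) (contract_Q j c)) T
      = (kdiff V c - (\<Sum>p\<in>P. scale (lform p) (contract p c))) T"
    by (simp add: kdiff_def sum_fun_apply scale_def contract_Q_def V l right_diff_distrib sum_subtractf)
qed

text \<open>Modulo \<open>lideal\<close> the commutator of the differential with
  \<open>number_Q\<close> is the differential itself. So \<open>number_Q\<close> maps cycles modulo
  \<open>lideal\<close> to such cycles, and can be iterated on them.\<close>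

lemma kdiff_number_Q:
  "kdiff V (number_Q c) = kdiff V c - (\<Sum>p\<in>P. scale (lform p) (contract p c)) + number_Q (kdiff V c)"
proof -
  have "kdiff V (number_Q c) = (\<Sum>j\<in>Q. scale (pvar j) (contract_Q j c) + wedge j (contract_Q j (kdiff V c)))"
    unfolding number_Q_def kdiff_sum
    by (intro sum.cong refl) (simp add: kdiff_wedge[OF finite_V Q_V] kdiff_contract_Q wedge_minus)
  then show ?thesis by (simp only: sum.distrib sum_Q_contract_Q number_Q_def)
qed

definition homotopy_Q :: "(nat set \<Rightarrow> 'k mpoly) \<Rightarrow> nat set \<Rightarrow> 'k mpoly" where
  "homotopy_Q c = (\<Sum>j\<in>Q. wedge j (\<lambda>T. deriv_Q j (c T)))"

text \<open>On the variables, \<open>deriv_Q j\<close> takes the coefficients with which the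
  \<open>contract m\<close> enter \<open>contract_Q j\<close>; hence the last sum in Cartan's
  formula is \<open>number_Q\<close>.\<close>

lemma kdiff_homotopy_Q:
  assumes "\<And>T. c T \<in> forms V r"
  shows "kdiff V (homotopy_Q c) + homotopy_Q (kdiff V c)
    = scale (of_int r) c - (\<Sum>p\<in>P. scale (lform p) (\<lambda>T. pderivative p (c T))) + number_Q c"
proof -
  have "kdiff V (homotopy_Q c) + homotopy_Q (kdiff V c)
    = (\<Sum>j\<in>Q. scale (pvar j) (\<lambda>T. deriv_Q j (c T)))
    + (\<Sum>j\<in>Q. \<Sum>m\<in>V. scale (deriv_Q j (pvar m)) (wedge j (contract m c)))"
    unfolding homotopy_Q_def
    by (rule kdiff_homotopy) (use Q_V in \<open>auto simp: deriv_Q_add deriv_Q_mult finite_V\<close>)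
  moreover have "(\<Sum>j\<in>Q. scale (pvar j) (\<lambda>T. deriv_Q j (c T)))
      = scale (of_int r) c - (\<Sum>p\<in>P. scale (lform p) (\<lambda>T. pderivative p (c T)))"
    by (rule ext) (simp add: sum_fun_apply scale_def euler_Q[OF assms])
  moreover have "(\<Sum>j\<in>Q. \<Sum>m\<in>V. scale (deriv_Q j (pvar m)) (wedge j (contract m c))) = number_Q c"
    unfolding number_Q_def
  proof (rule sum.cong[OF refl])
    fix j assume j: "j \<in> Q"
    have "(\<Sum>m\<in>V. scale (deriv_Q j (pvar m)) (wedge j (contract m c)))
        = (\<Sum>m\<in>P. scale (deriv_Q j (pvar m)) (wedge j (contract m c)))
        + (\<Sum>m\<in>Q. scale (deriv_Q j (pvar m)) (wedge j (contract m c)))"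
      unfolding V_eq by (rule sum.union_disjoint) (use finite_P finite_Q PQ V_eq in auto)
    also have "(\<Sum>m\<in>P. scale (deriv_Q j (pvar m)) (wedge j (contract m c)))
        = (\<Sum>m\<in>P. - wedge j (scale (pconst (a m j)) (contract m c)))"
    proof (rule sum.cong[OF refl])
      fix m assume "m \<in> P"
      then have "deriv_Q j (pvar m) = - pconst (a m j)"
        using j PQ by (auto simp: deriv_Q_pvar P_V)
      then show "scale (deriv_Q j (pvar m)) (wedge j (contract m c)) = - wedge j (scale (pconst (a m j)) (contract m c))"
        by (simp add: wedge_scale) (simp add: scale_def fun_eq_iff)
    qed
    also have "(\<Sum>m\<in>Q. scale (deriv_Q j (pvar m)) (wedge j (contract m c)))
        = (\<Sum>m\<in>Q. if m = j then wedge j (contract j c) else 0)"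
      using j PQ by (intro sum.cong refl) (auto simp: deriv_Q_pvar Q_V)
    also have "\<dots> = wedge j (contract j c)"
      using j finite_Q by simp
    finally show "(\<Sum>m\<in>V. scale (deriv_Q j (pvar m)) (wedge j (contract m c))) = wedge j (contract_Q j c)"
      by (simp only: contract_Q_def wedge_diff wedge_sum sum_negf uminus_add_conv_diff)
  qed
  ultimately show ?thesis by simp
qed

text \<open>
  Modulo \<open>lideal\<close>, the homotopy shows that \<open>number_Q\<close> acts as \<open>- r\<close> on the homology in polynomial
  degree \<open>r\<close>, while its eigenvalues are nonnegative.
\<close>

lemma koszul_cycle_mod_lideal:
  assumes "w \<in> chains V (Suc n) (forms V r)" "\<And>T. kdiff V w T \<in> lideal" "r \<ge> 1"
  obtains u where "u \<in> chains V (Suc (Suc n)) (forms V (r - 1))" "\<And>T. (w - kdiff V u) T \<in> lideal"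
proof -
  \<comment> \<open>W consists of the cycles modulo \<open>lideal\<close>, G of the boundaries
    modulo \<open>lideal\<close>.\<close>
  define W where "W = {w \<in> chains V (Suc n) (forms V r). \<forall>T. kdiff V w T \<in> lideal}"
  define G where "G = {w \<in> chains V (Suc n) (forms V r).
    \<exists>u\<in>chains V (Suc (Suc n)) (forms V (r - 1)). \<forall>T. (w - kdiff V u) T \<in> lideal}"
  have coeff: "c T \<in> forms V r" if "c \<in> chains V (Suc n) (forms V r)"
    for c :: "nat set \<Rightarrow> 'k mpoly" and T
    using chainsD[OF that] by simp
  have polys: "contract p c T \<in> polys V" if "c \<in> chains V (Suc n) (forms V r)"
    for c :: "nat set \<Rightarrow> 'k mpoly" and T p
    using chainsD[OF contract_chains[OF additive_set_forms that finite_V], of p T] by (simp add: forms_def)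
  have W_number: "number_Q w \<in> W" if w: "w \<in> W" for w
  proof -
    have "kdiff V (number_Q w) T \<in> lideal" for T
    proof -
      have "kdiff V w T - (\<Sum>p\<in>P. lform p * contract p w T) + number_Q (kdiff V w) T \<in> lideal"
        using w polys[of w]
        by (intro additive_set_add[OF lideal_additive] additive_set_diff[OF lideal_additive] lidealI lideal_coeffs(4))
          (auto simp: W_def)
      then show ?thesis by (simp add: kdiff_number_Q sum_fun_apply scale_def)
    qed
    then show ?thesis using w number_Q_chains by (auto simp: W_def)
  qed
  have scaleW: "scale (pconst b) w \<in> W" if "w \<in> W" for b w
    using that chains_scale[of w V "Suc n" "forms V r" "pconst b" "forms V r"] lideal_mult
    by (auto simp: W_def kdiff_scale forms_pconst_mult) (simp add: scale_def)
  have diffW: "v - w \<in> W" if "v \<in> W" "w \<in> W" for v w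
    using that chains_diff[OF additive_set_forms] additive_set_diff[OF lideal_additive]
    by (auto simp: W_def kdiff_diff)
  have diffG: "v - w \<in> G" if v: "v \<in> G" and w: "w \<in> G" for v w
  proof -
    obtain u u' where u: "u \<in> chains V (Suc (Suc n)) (forms V (r - 1))" "\<forall>T. (v - kdiff V u) T \<in> lideal"
      "u' \<in> chains V (Suc (Suc n)) (forms V (r - 1))" "\<forall>T. (w - kdiff V u') T \<in> lideal"
      using v w unfolding G_def by blast
    have "((v - w) - kdiff V (u - u')) T \<in> lideal" for T
      using additive_set_diff[OF lideal_additive u(2)[rule_format, of T] u(4)[rule_format, of T]]
      by (simp add: kdiff_diff algebra_simps)
    moreover have "u - u' \<in> chains V (Suc (Suc n)) (forms V (r - 1))"
      using u by (intro chains_diff additive_set_forms)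
    moreover have "v - w \<in> chains V (Suc n) (forms V r)"
      using v w by (intro chains_diff additive_set_forms) (auto simp: G_def)
    ultimately show ?thesis unfolding G_def by blast
  qed
  have scaleG: "scale (pconst b) w \<in> G" if w: "w \<in> G" for b w
  proof -
    obtain u where u: "u \<in> chains V (Suc (Suc n)) (forms V (r - 1))" "\<forall>T. (w - kdiff V u) T \<in> lideal"
      using w unfolding G_def by blast
    have "(scale (pconst b) w - kdiff V (scale (pconst b) u)) T \<in> lideal" for T
      using lideal_mult[OF u(2)[rule_format, of T], of "pconst b"]
      unfolding kdiff_scale by (simp add: scale_def right_diff_distrib)
    moreover have "scale (pconst b) u \<in> chains V (Suc (Suc n)) (forms V (r - 1))"
      using u(1) by (rule chains_scale) (rule forms_pconst_mult)
    moreover have "scale (pconst b) w \<in> chains V (Suc n) (forms V r)"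
      using w by (auto simp: G_def intro: chains_scale forms_pconst_mult)
    ultimately show ?thesis unfolding G_def by blast
  qed
  have key: "number_Q w + scale (of_int r) w \<in> G" if w: "w \<in> W" for w
  proof -
    have wc: "w \<in> chains V (Suc n) (forms V r)" using w by (simp add: W_def)
    have h: "homotopy_Q w \<in> chains V (Suc (Suc n)) (forms V (r - 1))"
      unfolding homotopy_Q_def
      by (intro chains_sum additive_set_forms wedge_chains chains_map[OF wc] finite_V Q_V)
        (auto intro: deriv_Q_forms)
    have hk: "homotopy_Q (kdiff V w) T \<in> lideal" for T
      unfolding homotopy_Q_def sum_fun_apply
      using w by (intro additive_set_sum[OF lideal_additive] lideal_coeffs(2) deriv_Q_lideal)
        (auto simp: W_def)
    have "number_Q w + scale (of_int r) w - kdiff V (homotopy_Q w)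
      = homotopy_Q (kdiff V w) + (\<Sum>p\<in>P. scale (lform p) (\<lambda>T. pderivative p (w T)))"
      using kdiff_homotopy_Q[of w r, OF coeff[OF wc]] by (simp add: algebra_simps)
    moreover have "(homotopy_Q (kdiff V w) + (\<Sum>p\<in>P. scale (lform p) (\<lambda>T. pderivative p (w T)))) T
        \<in> lideal" for T
      using coeff[OF wc] unfolding plus_fun_apply sum_fun_apply scale_def
      by (intro additive_set_add[OF lideal_additive] hk lidealI pderivative_polys)
        (auto simp: forms_def)
    ultimately have "(number_Q w + scale (of_int r) w - kdiff V (homotopy_Q w)) T \<in> lideal" for T
      by simp
    moreover have "number_Q w + scale (of_int r) w \<in> chains V (Suc n) (forms V r)"
    proof (intro chains_add additive_set_forms number_Q_chains[OF wc])
      show "scale (of_int r) w \<in> chains V (Suc n) (forms V r)"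
        by (rule chains_scale[OF wc]) (metis forms_pconst_mult pconst_of_int)
    qed
    ultimately show ?thesis unfolding G_def using h by blast
  qed
  \<comment> \<open>Strips one factor off the product: both \<open>number_Q w\<close> + r w and
    \<open>number_Q w\<close> - k w lie in G, hence so does their difference (r + k) w, and r + k >
    0 because r >= 1 and k >= 0.\<close>
  have descend: "w \<in> G" if "w \<in> W" "falling_product number_Q k e w \<in> G" "k \<ge> 0" for k e w
    using that
  proof (induction e arbitrary: k w)
    case (Suc e)
    let ?v = "number_Q w - scale (of_int k) w"
    have "?v \<in> W"
      using scaleW[OF Suc.prems(1), of "of_int k"] W_number[OF Suc.prems(1)]
      by (intro diffW) (simp_all add: pconst_of_int)
    moreover have "falling_product number_Q (k + 1) e ?v \<in> G" "0 \<le> k + 1"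
      using Suc.prems(2,3) by (simp_all only: falling_product.simps add_nonneg_nonneg zero_le_one)
    ultimately have "?v \<in> G" by (rule Suc.IH)
    from diffG[OF key[OF Suc.prems(1)] this] have "scale (of_int (r + k)) w \<in> G"
      by (simp add: scale_def algebra_simps plus_fun_def fun_diff_def)
    from scaleG[OF this, of "1 / of_int (r + k)"]
    have "scale (pconst (1 / of_int (r + k)) * of_int (r + k)) w \<in> G" by (simp only: scale_scale)
    moreover have "of_int (r + k) \<noteq> (0 :: 'k)"
      using Suc.prems(3) assms(3) by (subst of_int_eq_0_iff) simp
    then have "pconst (1 / of_int (r + k)) * of_int (r + k) = (1 :: 'k mpoly)"
      using pconst_mult[of "1 / of_int (r + k)" "of_int (r + k) :: 'k"]
      by (simp only: pconst_of_int) simp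
    ultimately show ?case by simp
  qed simp
  have wW: "w \<in> W" using assms by (simp add: W_def)
  have "0 \<in> G"
    using diffG[OF key[OF wW] key[OF wW]] by (simp only: diff_self)
  then have "w \<in> G"
    by (intro descend[OF wW, of 0 "Suc (card Q)"]) (simp_all only: number_Q_falling_product order.refl)
  then show thesis using that unfolding G_def by blast
qed

text \<open>The connecting map for \<open>lideal\<close> inside the polynomial ring: c bounds some w
  over the ring, w is a cycle modulo \<open>lideal\<close> of degree s - 1, and subtracting a
  boundary moves it into \<open>lideal\<close>. The quotient is acyclic in degrees >= 1, whence s >=
  2.\<close>

lemma lideal_koszul_acyclic:
  assumes "c \<in> chains V i (lideal \<inter> forms V s)" "kdiff V c = 0" "s \<ge> 2"
  obtains b where "b \<in> chains V (Suc i) (lideal \<inter> forms V (s - 1))" "kdiff V b = c"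
proof -
  have "c \<in> chains V i (forms V s)" using assms(1) by (rule chains_mono[rotated]) simp
  then obtain w where w: "w \<in> chains V (Suc i) (forms V (s - 1))" "kdiff V w = c"
    using koszul_acyclic[OF finite_V _ assms(2)] assms(3) by (smt (verit) of_nat_0_le_iff)
  have "kdiff V w T \<in> lideal" for T
    using chainsD[OF assms(1)] w(2) lideal_additive by (auto simp: additive_set_def)
  then obtain u where u: "u \<in> chains V (Suc (Suc i)) (forms V (s - 1 - 1))"
    "\<And>T. (w - kdiff V u) T \<in> lideal"
    using koszul_cycle_mod_lideal[OF w(1)] assms(3) by (metis le_diff_eq one_add_one)
  have "kdiff V u \<in> chains V (Suc i) (forms V (s - 1))"
    using u(1) forms_mult[OF pvar_forms, of _ V _ "s - 1 - 1"]
    by (intro kdiff_chains[OF u(1)] finite_V additive_set_forms) auto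
  then have "w - kdiff V u \<in> chains V (Suc i) (forms V (s - 1))"
    by (intro chains_diff additive_set_forms w(1))
  then have "w - kdiff V u \<in> chains V (Suc i) (lideal \<inter> forms V (s - 1))"
    using u(2) by (auto simp: chains_def split: if_splits)
  moreover have "kdiff V (w - kdiff V u) = c" by (simp add: kdiff_diff kdiff_kdiff w(2))
  ultimately show thesis by (rule that)
qed

end

section \<open>Elimination of the first variable\<close>

declare One_nat_def [simp del]

lemma chains_inside: "c \<in> chains V i A \<Longrightarrow> T \<subseteq> V \<Longrightarrow> card T = i \<Longrightarrow> c T \<in> A"
  unfolding chains_def by (drule CollectD, drule spec[of _ T]) simp

lemma pvar_power_forms: "i \<in> V \<Longrightarrow> pvar i ^ n \<in> forms V (int n)"
  using homogeneous_power[OF homogeneous_pvar[of i], of n] by (auto simp: forms_def)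

lemma koszul_sign_polys: "koszul_sign j T \<in> polys V"
  unfolding koszul_sign_def by (intro polys_power polys_minus one_polys)

section \<open>The filtration by the degree in x0\<close>

definition x0_degree_le :: "nat \<Rightarrow> 'k::comm_ring_1 mpoly \<Rightarrow> bool" where
  "x0_degree_le m f \<longleftrightarrow> (\<forall>n>m. x0_coeff n f = 0)"

lemma x0_degree_le_diff: "x0_degree_le m f \<Longrightarrow> x0_degree_le m g \<Longrightarrow> x0_degree_le m (f - g)"
  by (simp add: x0_degree_le_def x0_coeff_diff)

lemma x0_degree_le_add: "x0_degree_le m f \<Longrightarrow> x0_degree_le m g \<Longrightarrow> x0_degree_le m (f + g)"
  by (simp add: x0_degree_le_def x0_coeff_add)

lemma x0_degree_le_0 [simp]: "x0_degree_le m 0"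
  by (simp add: x0_degree_le_def)

lemma x0_degree_le_sum: "(\<And>i. i \<in> A \<Longrightarrow> x0_degree_le m (f i)) \<Longrightarrow> x0_degree_le m (\<Sum>i\<in>A. f i)"
  by (simp add: x0_degree_le_def x0_coeff_sum)

lemma x0_degree_le_mult:
  "g \<in> polys V \<Longrightarrow> 0 \<notin> V \<Longrightarrow> x0_degree_le m f \<Longrightarrow> x0_degree_le m (g * f)"
  by (simp add: x0_degree_le_def x0_coeff_mult)

lemma x0_degree_le_pvar0: "x0_degree_le m f \<Longrightarrow> x0_degree_le (Suc m) (pvar 0 * f)"
  by (auto simp: x0_degree_le_def x0_coeff_Suc_pvar elim!: less_natE)

lemma x0_degree_le_mono: "x0_degree_le m f \<Longrightarrow> m \<le> n \<Longrightarrow> x0_degree_le n f"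
  by (simp add: x0_degree_le_def)

lemma x0_degree_le_Suc: "x0_degree_le (Suc m) f \<Longrightarrow> x0_coeff (Suc m) f = 0 \<Longrightarrow> x0_degree_le m f"
  unfolding x0_degree_le_def by (metis Suc_lessI)

lemma x0_degree_le_polys: "f \<in> polys V \<Longrightarrow> 0 \<notin> V \<Longrightarrow> x0_degree_le m f"
  by (simp add: x0_degree_le_def x0_coeff_free)

lemma x0_degree_le_forms: "f \<in> forms V e \<Longrightarrow> e \<le> int m \<Longrightarrow> x0_degree_le m f"
  by (auto simp: x0_degree_le_def intro: x0_coeff_eq_0)

lemma wedge_x0_degree: "(\<And>T. x0_degree_le m (c T)) \<Longrightarrow> x0_degree_le m (wedge j c T)"
  by (simp add: wedge_def x0_degree_le_mult[OF koszul_sign_polys[of _ _ "{}"]])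

lemma wedge_x0_coeff: "x0_coeff n (wedge j c T) = wedge j (\<lambda>T. x0_coeff n (c T)) T"
  by (simp add: wedge_def x0_coeff_mult[OF koszul_sign_polys[of _ _ "{}"]])

text \<open>What the algebra retains of the geometry: \<open>I_low\<close> comes from nondegeneracy
  (and q in X for constants), \<open>I_center\<close> from q in X, \<open>I_top\<close> from
  smoothness at q, and \<open>I_Tor\<close> is property N_{2,p} on the level of chains over I. The
  quadrics F combine smoothness with generation of I by quadrics.\<close>

locale inner_projection_setup =
  linear_forms "{1..N}" P Q a for N :: nat and P Q :: "nat set" and a :: "nat \<Rightarrow> nat \<Rightarrow> 'k::field_char_0" +
  fixes I :: "'k mpoly set" and F :: "nat \<Rightarrow> 'k mpoly" and p :: nat
  assumes I_additive: "additive_set I"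
    and I_mult: "\<And>f g. f \<in> I \<Longrightarrow> g \<in> polys {0..N} \<Longrightarrow> g * f \<in> I"
    and I_low: "\<And>f e. f \<in> I \<inter> forms {0..N} e \<Longrightarrow> e \<le> 1 \<Longrightarrow> f = 0"
    and I_center: "\<And>f e. f \<in> I \<inter> forms {0..N} (int e) \<Longrightarrow> x0_coeff e f = 0"
    and F_I: "\<And>i. i \<in> P \<Longrightarrow> F i \<in> I \<inter> forms {0..N} 2"
    and F_coeff: "\<And>i. i \<in> P \<Longrightarrow> x0_coeff 1 (F i) = lform i"
    and I_top: "\<And>f e m. f \<in> I \<inter> forms {0..N} e \<Longrightarrow> x0_degree_le m f \<Longrightarrow> x0_coeff m f \<in> lideal"
    and I_Tor: "\<And>i e c. i + 1 \<le> p \<Longrightarrow> e \<ge> 3 \<Longrightarrow> c \<in> chains {0..N} i (I \<inter> forms {0..N} e)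
      \<Longrightarrow> kdiff {0..N} c = 0
      \<Longrightarrow> \<exists>b\<in>chains {0..N} (Suc i) (I \<inter> forms {0..N} (e - 1)). kdiff {0..N} b = c"
begin

abbreviation (input) "R \<equiv> {0..N}"
abbreviation (input) "S \<equiv> {1..N}"
abbreviation "IR e \<equiv> I \<inter> forms {0..N} e"

lemma R_eq: "R = insert 0 S" by auto

lemma R_minus_0: "R - {0} = S" by auto

lemma x0_coeff_forms_S: "f \<in> forms R e \<Longrightarrow> x0_coeff n f \<in> forms S (e - int n)"
  using x0_coeff_forms[of f R e n] by (simp only: R_minus_0)

lemma S_R: "S \<subseteq> R" by auto

lemma IR_additive: "additive_set (IR e)"
  by (intro additive_set_Int I_additive additive_set_forms)

lemma IR_pvar: "j \<in> R \<Longrightarrow> f \<in> IR e \<Longrightarrow> pvar j * f \<in> IR (e + 1)"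
  using I_mult[of f "pvar j"] forms_mult[OF pvar_forms, of j R f e] by (auto simp: pvar_polys add.commute)

lemma IR_pvar': "j \<in> R \<Longrightarrow> f \<in> IR (e - 1) \<Longrightarrow> pvar j * f \<in> IR e"
  using IR_pvar[of j f "e - 1"] by simp

lemma chains_kdiff_IR:
  assumes "c \<in> chains S (Suc i) (IR (e - 1))" shows "kdiff S c \<in> chains S i (IR e)"
proof (rule kdiff_chains[OF assms finite_V IR_additive IR_additive])
  show "pvar j * f \<in> IR e" if "j \<in> S" "f \<in> IR (e - 1)" for j f
    using IR_pvar'[of j f e] that S_R by blast
qed

section \<open>The mapping cone of multiplication by x0\<close>

text \<open>The mapping cone itself: a chain over R consists of a part without e_0 and of its
  contraction by e_0, and x0 maps the second to the first.\<close>

lemma kdiff_R: "kdiff R c = scale (pvar 0) (contract 0 c) + kdiff S c"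
  unfolding kdiff_def R_eq by (subst sum.insert) auto

lemma chains_mono_vars:
  assumes "c \<in> chains S i A" "0 \<in> A" shows "c \<in> chains R i A"
proof (rule chainsI)
  fix T assume "\<not> (T \<subseteq> R \<and> card T = i)"
  then have "\<not> (T \<subseteq> S \<and> card T = i)" using S_R by blast
  then show "c T = 0" by (rule chains_outside[OF assms(1)])
qed (rule chainsD[OF assms])

lemma contract_0_S:
  assumes "c \<in> chains S i A" shows "contract 0 c = 0"
proof
  fix T
  have "c (insert 0 T) = 0" by (rule chains_outside[OF assms]) auto
  then show "contract 0 c T = 0 T" by (simp add: contract_def)
qed

lemma chains_restrict:
  assumes "c \<in> chains R i A" "contract 0 c = 0"
  shows "c \<in> chains S i A"
proof -
  have 0: "c T = 0" if "0 \<in> T" for T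
  proof -
    have "contract 0 c (T - {0}) = 0" by (simp add: assms(2))
    then have "koszul_sign 0 (T - {0}) * c T = 0" using that by (simp add: contract_def insert_absorb)
    moreover have "c T = koszul_sign 0 (T - {0}) * (koszul_sign 0 (T - {0}) * c T)" by simp
    ultimately show ?thesis by simp
  qed
  show ?thesis
  proof (rule chainsI)
    fix T assume "T \<subseteq> S" "card T = i"
    then show "c T \<in> A" using chains_inside[OF assms(1), of T] S_R by blast
  next
    fix T assume T: "\<not> (T \<subseteq> S \<and> card T = i)"
    show "c T = 0"
    proof (cases "0 \<in> T")
      case False
      then have "\<not> (T \<subseteq> R \<and> card T = i)" using T R_eq by auto
      then show ?thesis by (rule chains_outside[OF assms(1)])
    qed (rule 0)
  qed
qed

lemma contract_0_chains:
  assumes "c \<in> chains R (Suc i) (IR e)" shows "contract 0 c \<in> chains S i (IR e)"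
proof (rule chains_restrict[OF contract_chains[OF IR_additive assms]])
  have "contract 0 (contract 0 c) T = 0" for T by (simp add: contract_def)
  then show "contract 0 (contract 0 c) = 0" by (simp add: fun_eq_iff)
qed simp

lemma kdiff_wedge_0: "kdiff S (wedge 0 c) = - wedge 0 (kdiff S c)"
  unfolding kdiff_def wedge_sum sum_negf[symmetric]
  by (intro sum.cong refl) (subst contract_wedge, simp add: scale_minus wedge_scale)

text \<open>
  Exactness of the mapping cone sequence turns \<open>I_Tor\<close> into surjectivity and injectivity of
  multiplication by \<open>x\<^sub>0\<close> on the Koszul homology over \<open>S\<close>.
\<close>

lemma x0_surjective:
  assumes "c \<in> chains S i (IR e)" "kdiff S c = 0" "i + 1 \<le> p" "e \<ge> 3"
  obtains y b where "y \<in> chains S i (IR (e - 1))" "kdiff S y = 0"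
    "b \<in> chains S (Suc i) (IR (e - 1))" "c = scale (pvar 0) y + kdiff S b"
proof -
  have "c \<in> chains R i (IR e)"
    using chains_mono_vars[OF assms(1)] additive_set_0[OF IR_additive] by blast
  moreover have "kdiff R c = 0"
    by (simp only: kdiff_R contract_0_S[OF assms(1)] assms(2) scale_0 add_0)
  ultimately obtain Y where Y: "Y \<in> chains R (Suc i) (IR (e - 1))" "kdiff R Y = c"
    using I_Tor[of i e c] assms(3,4) by blast
  \<comment> \<open>The e_0-component of the bounding chain Y becomes the factor of x0, and the rest
    b accounts for the boundary over S. That y is a cycle follows by contracting the equation for Y
    with e_0.\<close>
  define y where "y = contract 0 Y"
  define b where "b = Y - wedge 0 y"
  have y: "y \<in> chains S i (IR (e - 1))" unfolding y_def by (rule contract_0_chains[OF Y(1)])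
  have "kdiff R y = - contract 0 (kdiff R Y)" unfolding y_def by (rule kdiff_contract)
  also have "\<dots> = 0" by (simp only: Y(2) contract_0_S[OF assms(1)] minus_zero)
  finally have dy: "kdiff S y = 0"
    by (simp only: kdiff_R contract_0_S[OF y] scale_0 add_0)
  have "wedge 0 y \<in> chains R (Suc i) (IR (e - 1))"
    using chains_mono_vars[OF y additive_set_0[OF IR_additive]] by (intro wedge_chains IR_additive) auto
  then have "b \<in> chains R (Suc i) (IR (e - 1))"
    unfolding b_def by (intro chains_diff IR_additive Y(1))
  moreover have "contract 0 b = 0"
    unfolding b_def contract_diff contract_wedge y_def[symmetric] contract_0_S[OF y]
    by (simp only: wedge_0 refl if_True diff_0_right diff_self)
  ultimately have b: "b \<in> chains S (Suc i) (IR (e - 1))" by (rule chains_restrict)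
  have "kdiff S b = kdiff S Y"
    unfolding b_def kdiff_diff kdiff_wedge_0 dy by (simp only: wedge_0 minus_zero diff_0_right)
  then have "c = scale (pvar 0) y + kdiff S b"
    using Y(2) by (simp only: kdiff_R y_def)
  then show thesis using that y dy b by blast
qed

lemma x0_injective:
  assumes "c \<in> chains S i (IR e)" "kdiff S c = 0" "i + 2 \<le> p" "e \<ge> 3"
    and "w \<in> chains S (Suc i) (IR e)" "kdiff S w = scale (pvar 0) c"
  obtains b where "b \<in> chains S (Suc i) (IR (e - 1))" "kdiff S b = c"
proof -
  have cR: "c \<in> chains R i (IR e)" and wR: "w \<in> chains R (Suc i) (IR e)"
    using chains_mono_vars[OF assms(1)] chains_mono_vars[OF assms(5)] additive_set_0[OF IR_additive] by blast+
  \<comment> \<open>The cycle of the mapping cone given by c together with the chain w that bounds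
    x0 c. It has homological degree i + 1, hence the bound i + 2 <= p.\<close>
  define C where "C = w - wedge 0 c"
  have C: "C \<in> chains R (Suc i) (IR e)"
    unfolding C_def by (intro chains_diff IR_additive wR wedge_chains cR) auto
  have cC: "contract 0 C = - c"
    unfolding C_def contract_diff contract_wedge contract_0_S[OF assms(1)] contract_0_S[OF assms(5)]
    by (simp only: wedge_0 refl if_True diff_0_right diff_0)
  have "kdiff S C = scale (pvar 0) c"
    unfolding C_def kdiff_diff kdiff_wedge_0 assms(2,6) by (simp only: wedge_0 minus_zero diff_0_right)
  then have "kdiff R C = 0"
    unfolding kdiff_R cC scale_minus by (simp only: left_minus)
  then obtain Y where Y: "Y \<in> chains R (Suc (Suc i)) (IR (e - 1))" "kdiff R Y = C"
    using I_Tor[of "Suc i" e C] C assms(3,4) by auto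
  have y: "contract 0 Y \<in> chains S (Suc i) (IR (e - 1))" by (rule contract_0_chains[OF Y(1)])
  have "kdiff S (contract 0 Y) = kdiff R (contract 0 Y)"
    by (simp only: kdiff_R contract_0_S[OF y] scale_0 add_0)
  also have "\<dots> = - contract 0 (kdiff R Y)" by (rule kdiff_contract)
  also have "\<dots> = c" by (simp only: Y(2) cC minus_minus)
  finally show thesis using that y by blast
qed

section \<open>Lifting leading coefficients and lowering the degree in x0\<close>

text \<open>Each \<open>F i\<close> is x0 times \<open>lform i\<close> plus a form free of x0, the
  square of x0 being excluded by q in X. Multiplying by the power m - 1 of x0 moves the linear forms
  to the exponent m, which requires m >= 1.\<close>

lemma lideal_lift:
  assumes "g \<in> lideal \<inter> forms S s" "m \<ge> 1"
  obtains f where "f \<in> IR (s + int m)" "x0_coeff m f = g" "x0_degree_le m f"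
proof -
  obtain h where h: "\<And>i. i \<in> P \<Longrightarrow> h i \<in> forms S (s - 1)" "g = (\<Sum>i\<in>P. lform i * h i)"
    using lideal_forms[OF assms(1)] by blast
  define f where "f = (\<Sum>i\<in>P. h i * (pvar 0 ^ (m - 1) * F i))"
  have hS: "h i \<in> polys S" "h i \<in> polys R" if "i \<in> P" for i
    using h(1)[OF that] polys_mono[OF S_R] by (auto simp: forms_def)
  have pow: "pvar 0 ^ (m - 1) \<in> forms R (int (m - 1))"
    by (rule pvar_power_forms) simp
  have "h i * (pvar 0 ^ (m - 1) * F i) \<in> IR (s + int m)" if "i \<in> P" for i
  proof -
    have "h i * (pvar 0 ^ (m - 1) * F i) \<in> forms R (s - 1 + (int (m - 1) + 2))"
      using F_I[OF that] pow forms_mono[OF S_R h(1)[OF that]] by (intro forms_mult) auto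
    moreover have "s - 1 + (int (m - 1) + 2) = s + int m" using assms(2) by simp
    moreover have "h i * (pvar 0 ^ (m - 1) * F i) \<in> I"
      using F_I[OF that] pow hS[OF that] by (intro I_mult) (auto simp: forms_def)
    ultimately show ?thesis by simp
  qed
  then have "f \<in> IR (s + int m)"
    unfolding f_def by (intro additive_set_sum IR_additive) auto
  moreover have "x0_coeff n f = (\<Sum>i\<in>P. h i * (if n < m - 1 then 0 else x0_coeff (n - (m - 1)) (F i)))" for n
    unfolding f_def x0_coeff_sum
    by (intro sum.cong refl) (simp add: x0_coeff_mult[OF hS(1)] x0_coeff_power_mult)
  note coeff = this
  have "x0_coeff m f = g"
    unfolding coeff h(2) using assms(2) by (intro sum.cong refl) (simp add: F_coeff mult.commute)
  moreover have "x0_degree_le m f"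
    unfolding x0_degree_le_def
  proof (intro allI impI)
    fix n assume n: "n > m"
    have "x0_coeff (n - (m - 1)) (F i) = 0" if "i \<in> P" for i
    proof (cases "n = Suc m")
      case True
      then have "n - (m - 1) = 2" using assms(2) by simp
      then show ?thesis using I_center[of "F i" 2] F_I[OF that] by simp
    next
      case False
      then have "2 < n - (m - 1)" using n assms(2) by linarith
      then have "2 < int (n - (m - 1))" by simp
      then show ?thesis using x0_coeff_eq_0 F_I[OF that] by blast
    qed
    then show "x0_coeff n f = 0" unfolding coeff by (intro sum.neutral) auto
  qed
  ultimately show thesis by (rule that)
qed

lemma chains_lift:
  assumes "b \<in> chains S i (lideal \<inter> forms S s)" "m \<ge> 1"
  obtains w where "w \<in> chains S i (IR (s + int m))" "\<And>T. x0_coeff m (w T) = b T"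
    "\<And>T. x0_degree_le m (w T)"
proof -
  have "\<forall>T. \<exists>f. (T \<subseteq> S \<and> card T = i \<longrightarrow> f \<in> IR (s + int m)) \<and> (\<not> (T \<subseteq> S \<and> card T = i) \<longrightarrow> f = 0)
    \<and> x0_coeff m f = b T \<and> x0_degree_le m f"
  proof
    fix T
    show "\<exists>f. (T \<subseteq> S \<and> card T = i \<longrightarrow> f \<in> IR (s + int m)) \<and> (\<not> (T \<subseteq> S \<and> card T = i) \<longrightarrow> f = 0)
      \<and> x0_coeff m f = b T \<and> x0_degree_le m f"
    proof (cases "T \<subseteq> S \<and> card T = i")
      case True
      then have "b T \<in> lideal \<inter> forms S s" using chains_inside[OF assms(1)] by blast
      then show ?thesis using lideal_lift[OF _ assms(2)] True by metis
    next
      case False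
      then show ?thesis using chains_outside[OF assms(1) False] by (intro exI[of _ 0]) auto
    qed
  qed
  then obtain w where "\<forall>T. (T \<subseteq> S \<and> card T = i \<longrightarrow> w T \<in> IR (s + int m)) \<and>
    (\<not> (T \<subseteq> S \<and> card T = i) \<longrightarrow> w T = 0) \<and> x0_coeff m (w T) = b T \<and> x0_degree_le m (w T)"
    by metis
  then show thesis by (intro that[of w]) (auto simp: chains_def)
qed

lemma x0_coeff_kdiff: "kdiff S (\<lambda>T. x0_coeff n (c T)) = (\<lambda>T. x0_coeff n (kdiff S c T))"
  by (rule kdiff_map) (auto simp: x0_coeff_add x0_coeff_mult[OF pvar_polys, of _ S])

lemma kdiff_x0_degree:
  assumes "\<And>T. x0_degree_le m (c T)" shows "x0_degree_le m (kdiff S c T)"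
  unfolding x0_degree_le_def
proof (intro allI impI)
  fix n assume "m < n"
  then have "(\<lambda>T. x0_coeff n (c T)) = 0" using assms by (auto simp: x0_degree_le_def)
  then have "kdiff S (\<lambda>T. x0_coeff n (c T)) = 0" by (simp only: kdiff_0)
  from fun_cong[OF this, of T] show "x0_coeff n (kdiff S c T) = 0"
    unfolding x0_coeff_kdiff by simp
qed

text \<open>
  The top coefficients of \<open>c\<close> in \<open>x\<^sub>0\<close> form a Koszul cycle of \<open>lideal\<close> in polynomial degree at
  least 2, hence a boundary, and that boundary lifts to \<open>I\<close>.
\<close>

lemma reduce_x0_degree:
  assumes "c \<in> chains S i (IR e)" "\<And>T. x0_degree_le 0 (kdiff S c T)" "\<And>T. x0_degree_le m (c T)"
    and "int m + 2 \<le> e"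
  obtains w where "w \<in> chains S (Suc i) (IR (e - 1))" "\<And>T. x0_degree_le 0 ((c - kdiff S w) T)"
  using assms
proof (induction m arbitrary: c thesis)
  case 0
  have "(0 :: nat set \<Rightarrow> 'k mpoly) \<in> chains S (Suc i) (IR (e - 1))"
    by (intro chains_zero additive_set_0 IR_additive)
  moreover have "x0_degree_le 0 ((c - kdiff S 0) T)" for T
    using "0.prems"(4) by (simp only: kdiff_0 diff_0_right)
  ultimately show ?case by (rule "0.prems"(1))
next
  case (Suc m)
  define t where "t T = x0_coeff (Suc m) (c T)" for T
  have "t \<in> chains S i (lideal \<inter> forms S (e - int (Suc m)))"
    unfolding t_def
  proof (rule chains_coeffs)
    show "(\<lambda>T. x0_coeff (Suc m) (c T)) \<in> chains S i (forms S (e - int (Suc m)))"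
      by (rule chains_map[OF Suc.prems(2) x0_coeff_forms_S]) simp_all
    then have "x0_coeff (Suc m) (c T) \<in> forms S (e - int (Suc m))" for T
      by (rule chainsD) simp
    then show "x0_coeff (Suc m) (c T) \<in> lideal \<inter> forms S (e - int (Suc m))" for T
      using I_top[OF chainsD[OF Suc.prems(2) additive_set_0[OF IR_additive]] Suc.prems(4)] by blast
  qed
  \<comment> \<open>The boundary of \<open>t\<close> is the coefficient of the positive power m + 1
    of x0 in the boundary of \<open>c\<close>, which is free of x0.\<close>
  moreover have "kdiff S t = 0"
    unfolding t_def x0_coeff_kdiff using Suc.prems(3) by (auto simp: fun_eq_iff x0_degree_le_def)
  moreover have "e - int (Suc m) \<ge> 2" using Suc.prems(5) by simp
  ultimately obtain b where b: "b \<in> chains S (Suc i) (lideal \<inter> forms S (e - int (Suc m) - 1))"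
    "kdiff S b = t"
    by (rule lideal_koszul_acyclic)
  obtain w where w: "w \<in> chains S (Suc i) (IR (e - int (Suc m) - 1 + int (Suc m)))"
    "\<And>T. x0_coeff (Suc m) (w T) = b T" "\<And>T. x0_degree_le (Suc m) (w T)"
    using chains_lift[OF b(1), of "Suc m"] by auto
  have w1: "w \<in> chains S (Suc i) (IR (e - 1))" using w(1) by simp
  let ?c = "c - kdiff S w"
  have "?c \<in> chains S i (IR e)"
    by (intro chains_diff IR_additive Suc.prems(2) chains_kdiff_IR w1)
  moreover have "kdiff S ?c = kdiff S c" unfolding kdiff_diff kdiff_kdiff by (rule diff_0_right)
  then have "x0_degree_le 0 (kdiff S ?c T)" for T using Suc.prems(3) by simp
  moreover have "x0_degree_le m (?c T)" for T
  proof (rule x0_degree_le_Suc)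
    show "x0_degree_le (Suc m) (?c T)"
      unfolding fun_diff_def by (intro x0_degree_le_diff Suc.prems(4) kdiff_x0_degree w(3))
    have "x0_coeff (Suc m) (kdiff S w T) = kdiff S b T"
      using fun_cong[OF x0_coeff_kdiff[of "Suc m" w], of T] w(2) by simp
    then show "x0_coeff (Suc m) (?c T) = 0"
      by (simp add: x0_coeff_diff b(2) t_def)
  qed
  moreover have "int m + 2 \<le> e" using Suc.prems(5) by simp
  ultimately obtain w' where w': "w' \<in> chains S (Suc i) (IR (e - 1))"
    "\<And>T. x0_degree_le 0 ((?c - kdiff S w') T)"
    using Suc.IH[of ?c] by blast
  have "w + w' \<in> chains S (Suc i) (IR (e - 1))" by (intro chains_add IR_additive w1 w'(1))
  moreover have "c - kdiff S (w + w') = ?c - kdiff S w'" by (simp only: kdiff_add diff_diff_add)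
  ultimately show ?case using Suc.prems(1) w'(2) by metis
qed

section \<open>Cycles over the elimination ideal\<close>

definition J :: "'k mpoly set" where "J = I \<inter> polys {1..N}"

lemma J_additive: "additive_set J"
  unfolding J_def by (intro additive_set_Int I_additive) (auto simp: additive_set_def)

lemma J_mult: "f \<in> J \<Longrightarrow> g \<in> polys S \<Longrightarrow> g * f \<in> J"
  using I_mult polys_mono[OF S_R] by (auto simp: J_def)

lemma J_forms: "J \<inter> forms S e = IR e \<inter> polys S"
  using polys_mono[OF S_R] by (auto simp: J_def forms_def)

lemma chains_J:
  assumes "c \<in> chains S i (IR e)" "\<And>T. x0_degree_le 0 (c T)"
  shows "c \<in> chains S i (J \<inter> forms S e)"
proof (rule chains_coeffs[OF assms(1)])
  fix T
  have c: "c T \<in> IR e" using chainsD[OF assms(1) additive_set_0[OF IR_additive]] .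
  then have "c T \<in> polys (R - {0})"
    using assms(2) by (intro x0_free_polysI) (auto simp: forms_def x0_degree_le_def)
  then show "c T \<in> J \<inter> forms S e" unfolding J_forms using c by (simp add: R_minus_0)
qed

lemma chains_J_IR: "c \<in> chains S i (J \<inter> forms S e) \<Longrightarrow> c \<in> chains S i (IR e)"
  unfolding J_forms by (rule chains_mono[rotated]) auto

lemma chains_J_x0: "c \<in> chains S i (J \<inter> forms S e) \<Longrightarrow> x0_degree_le m (c T)"
  using chainsD[of c S i "J \<inter> forms S e" T] additive_set_0[OF additive_set_Int[OF J_additive additive_set_forms]]
  by (intro x0_degree_le_polys[of _ S]) (auto simp: J_def)

text \<open>Multiplication by the power t of x0 raises the polynomial degree to e + t and the degree
  in x0 only to t, so for e >= 2 the top coefficients removed all have degree at least 2 and x0 can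
  be eliminated completely.\<close>

lemma x0_power_cycle_boundary:
  assumes "c \<in> chains S i (J \<inter> forms S e)" "kdiff S c = 0" "e \<ge> 2"
  obtains t w where "w \<in> chains S (Suc i) (IR (e + int t - 1))" "kdiff S w = scale (pvar 0 ^ t) c"
proof -
  obtain t\<^sub>0 where t\<^sub>0: "\<And>t c. t\<^sub>0 \<le> t \<Longrightarrow> c \<in> chains S i (J \<inter> forms S (int (Suc t))) \<Longrightarrow> kdiff S c = 0
    \<Longrightarrow> \<exists>b \<in> chains S (Suc i) (J \<inter> forms S (int t)). kdiff S b = c"
    using koszul_homology_high_degree[OF finite_V J_additive J_mult, where i = i] by metis
  define c' where "c' = scale (pvar 0 ^ t\<^sub>0) c"
  have c': "c' \<in> chains S i (IR (e + int t\<^sub>0))"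
    unfolding c'_def
  proof (rule chains_scale[OF chains_J_IR[OF assms(1)]])
    fix f assume f: "f \<in> IR e"
    have "pvar 0 ^ t\<^sub>0 \<in> forms R (int t\<^sub>0)"
      by (rule pvar_power_forms) simp
    then show "pvar 0 ^ t\<^sub>0 * f \<in> IR (e + int t\<^sub>0)"
      using f I_mult[of f] forms_mult[of "pvar 0 ^ t\<^sub>0" R "int t\<^sub>0" f e] by (auto simp: forms_def add.commute)
  qed
  have dc': "kdiff S c' = 0" unfolding c'_def kdiff_scale assms(2) by (rule scale_0)
  have "x0_degree_le t\<^sub>0 (c' T)" for T
    using chains_J_x0[OF assms(1), of 0 T]
    by (auto simp: c'_def scale_def x0_degree_le_def x0_coeff_power_mult)
  moreover have "x0_degree_le 0 (kdiff S c' T)" for T by (simp add: dc')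
  moreover have "int t\<^sub>0 + 2 \<le> e + int t\<^sub>0" using assms(3) by simp
  ultimately obtain w where w: "w \<in> chains S (Suc i) (IR (e + int t\<^sub>0 - 1))"
    "\<And>T. x0_degree_le 0 ((c' - kdiff S w) T)"
    using reduce_x0_degree[OF c'] by metis
  have "c' - kdiff S w \<in> chains S i (J \<inter> forms S (e + int t\<^sub>0))"
    by (rule chains_J) (intro chains_diff IR_additive c' chains_kdiff_IR w(1), rule w(2))
  moreover have "kdiff S (c' - kdiff S w) = 0"
    unfolding kdiff_diff kdiff_kdiff dc' by (rule diff_0_right)
  \<comment> \<open>The same number serves as the exponent of x0 and as the bound beyond which the
    homology of J vanishes: the degree e plus this exponent lies above the bound.\<close>
  moreover have "e + int t\<^sub>0 = int (Suc (nat (e + int t\<^sub>0 - 1)))" "t\<^sub>0 \<le> nat (e + int t\<^sub>0 - 1)"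
    using assms(3) by auto
  ultimately obtain b where b: "b \<in> chains S (Suc i) (J \<inter> forms S (int (nat (e + int t\<^sub>0 - 1))))"
    "kdiff S b = c' - kdiff S w"
    using t\<^sub>0[of "nat (e + int t\<^sub>0 - 1)" "c' - kdiff S w"] by metis
  have "b \<in> chains S (Suc i) (IR (e + int t\<^sub>0 - 1))"
    using chains_J_IR[OF b(1)] assms(3) by simp
  then have "w + b \<in> chains S (Suc i) (IR (e + int t\<^sub>0 - 1))"
    by (intro chains_add IR_additive w(1))
  moreover have "kdiff S (w + b) = scale (pvar 0 ^ t\<^sub>0) c"
    unfolding kdiff_add b(2) c'_def[symmetric] by (subst add.commute) (rule diff_add_cancel)
  ultimately show thesis by (rule that)
qed

text \<open>The powers of x0 are divided out one at a time by \<open>x0_injective\<close>; all the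
  degrees e + t met on the way stay at least 3.\<close>

lemma J_cycle_is_I_boundary:
  assumes "c \<in> chains S i (J \<inter> forms S e)" "kdiff S c = 0" "e \<ge> 3" "i + 2 \<le> p"
  obtains w where "w \<in> chains S (Suc i) (IR (e - 1))" "kdiff S w = c"
proof -
  obtain t w where w: "w \<in> chains S (Suc i) (IR (e + int t - 1))" "kdiff S w = scale (pvar 0 ^ t) c"
    using assms(3) by (auto intro: x0_power_cycle_boundary[OF assms(1,2)])
  have "\<exists>w. w \<in> chains S (Suc i) (IR (e - 1)) \<and> kdiff S w = c"
    using w
  proof (induction t arbitrary: w)
    case (Suc t)
    let ?c = "scale (pvar 0 ^ t) c"
    have "?c \<in> chains S i (IR (e + int t))"
    proof (rule chains_scale[OF chains_J_IR[OF assms(1)]])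
      fix f assume f: "f \<in> IR e"
      have "pvar 0 ^ t \<in> forms R (int t)"
        by (rule pvar_power_forms) simp
      then show "pvar 0 ^ t * f \<in> IR (e + int t)"
        using f I_mult[of f] forms_mult[of "pvar 0 ^ t" R "int t" f e] by (auto simp: forms_def add.commute)
    qed
    moreover have "kdiff S ?c = 0" unfolding kdiff_scale assms(2) by (rule scale_0)
    moreover have "w \<in> chains S (Suc i) (IR (e + int t))" using Suc.prems(1) by simp
    moreover have "kdiff S w = scale (pvar 0) ?c" using Suc.prems(2) by (simp add: scale_scale)
    moreover have "e + int t \<ge> 3" using assms(3) by simp
    ultimately obtain b where "b \<in> chains S (Suc i) (IR (e + int t - 1))" "kdiff S b = ?c"
      using x0_injective[of ?c i "e + int t" w] assms(4) by blast
    then show ?case by (rule Suc.IH)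
  qed auto
  then show thesis using that by blast
qed

text \<open>
  Koszul's construction for the quadrics \<open>F i = \<Sum>\<^sub>j x\<^sub>j G\<^sub>i\<^sub>j\<close>: with \<open>\<theta>\<^sub>i = \<Sum>\<^sub>j G\<^sub>i\<^sub>j e\<^sub>j\<close> one has \<open>d \<theta>\<^sub>i = F i\<close>, and the
  products of the \<open>\<theta>\<^sub>i\<close> have boundaries with coefficients in \<open>I\<close>.
\<close>

lemma F_decomposition:
  assumes "i \<in> P"
  obtains G where "\<And>j. j \<in> S \<Longrightarrow> G j \<in> forms S 1"
    "F i = pvar 0 * lform i + (\<Sum>j\<in>S. pvar j * G j)"
proof -
  let ?q = "x0_coeff 0 (F i)"
  have F: "F i = pvar 0 * lform i + ?q"
  proof (rule x0_coeff_eqI)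
    fix n
    have q: "?q \<in> forms S 2"
      using x0_coeff_forms_S[of "F i" 2 0] F_I[OF assms] by simp
    have "x0_coeff n (pvar 0 * lform i) = (if n = 1 then lform i else 0)"
      using x0_coeff_power_mult[of n 1 "lform i"] x0_coeff_free[OF lform_polys[OF assms], of "n - 1"]
      by auto
    moreover have "x0_coeff n ?q = (if n = 0 then ?q else 0)"
      using q by (intro x0_coeff_free[of _ S]) (auto simp: forms_def)
    moreover have "x0_coeff n (F i) = 0" if "n \<ge> 2"
      using x0_coeff_eq_0[of "F i" R 2 n] I_center[of "F i" 2] F_I[OF assms] that
      by (cases "n = 2") auto
    ultimately show "x0_coeff n (F i) = x0_coeff n (pvar 0 * lform i + ?q)"
      using F_coeff[OF assms] by (cases "n = 0"; cases "n = 1") (auto simp: x0_coeff_add)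
  qed
  have q: "?q \<in> forms S 2"
    using x0_coeff_forms_S[of "F i" 2 0] F_I[OF assms] by simp
  have half: "pconst (1/2) * 2 = (1 :: 'k mpoly)"
    using pconst_mult[of "1/2" "2 :: 'k"] pconst_of_nat[of 2, where 'a='k] by simp
  \<comment> \<open>Euler's identity for the quadratic form \<open>?q\<close>, whence the factor
    1/2.\<close>
  define G where "G j = pconst (1/2) * pderivative j ?q" for j
  have "(\<Sum>j\<in>S. pvar j * G j) = pconst (1/2) * (\<Sum>j\<in>S. pvar j * pderivative j ?q)"
    by (simp add: G_def sum_distrib_left mult.left_commute)
  also have "\<dots> = pconst (1/2) * (of_int 2 * ?q)" by (simp only: euler_identity[OF q finite_V])
  also have "\<dots> = ?q" using half by (simp flip: mult.assoc)
  finally have "F i = pvar 0 * lform i + (\<Sum>j\<in>S. pvar j * G j)" using F by simp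
  moreover have "G j \<in> forms S 1" for j
    using pderivative_forms[OF q, of j] by (simp add: G_def forms_pconst_mult)
  ultimately show thesis using that by blast
qed

text \<open>Exterior multiplication by e_i plus the sum of the a_ij e_j over Q, the vector whose
  boundary is \<open>lform i\<close>. It is the coefficient of x0 in \<theta>_i.\<close>

definition wedge_lform :: "nat \<Rightarrow> (nat set \<Rightarrow> 'k mpoly) \<Rightarrow> nat set \<Rightarrow> 'k mpoly" where
  "wedge_lform i c = wedge i c + (\<Sum>j\<in>Q. scale (pconst (a i j)) (wedge j c))"

text \<open>A chain killed by all \<open>contract_Q j\<close> lies in the exterior algebra on the
  vectors of \<open>wedge_lform\<close>, and contraction by e_i with i in P is dual to these. So the
  sum is again the number operator.\<close>

lemma sum_wedge_lform_contract:
  assumes "\<And>j. j \<in> Q \<Longrightarrow> contract_Q j w = 0"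
  shows "(\<Sum>i\<in>P. wedge_lform i (contract i w)) = (\<Sum>j\<in>S. wedge j (contract j w))"
proof -
  have "(\<Sum>i\<in>P. wedge_lform i (contract i w)) = (\<Sum>i\<in>P. wedge i (contract i w))
      + (\<Sum>i\<in>P. \<Sum>j\<in>Q. scale (pconst (a i j)) (wedge j (contract i w)))"
    by (simp only: wedge_lform_def sum.distrib)
  also have "(\<Sum>i\<in>P. \<Sum>j\<in>Q. scale (pconst (a i j)) (wedge j (contract i w)))
      = (\<Sum>j\<in>Q. \<Sum>i\<in>P. wedge j (scale (pconst (a i j)) (contract i w)))"
    by (subst sum.swap) (simp only: wedge_scale)
  also have "\<dots> = (\<Sum>j\<in>Q. wedge j (contract j w))"
  proof (rule sum.cong[OF refl])
    fix j assume "j \<in> Q"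
    then have "contract j w = (\<Sum>i\<in>P. scale (pconst (a i j)) (contract i w))"
      using assms[of j] unfolding contract_Q_def by (simp only: right_minus_eq)
    then show "(\<Sum>i\<in>P. wedge j (scale (pconst (a i j)) (contract i w))) = wedge j (contract j w)"
      by (simp only: wedge_sum)
  qed
  also have "(\<Sum>i\<in>P. wedge i (contract i w)) + \<dots> = (\<Sum>j\<in>S. wedge j (contract j w))"
    unfolding V_eq by (rule sum.union_disjoint[symmetric]) (use finite_P finite_Q PQ in auto)
  finally show ?thesis .
qed

text \<open>By the number operator, w is the sum of the \<open>wedge_lform i\<close> applied to its
  contractions, divided by m + 1. Replacing these vectors by \<theta>_i, and the contractions by
  lifts obtained inductively, keeps w as the leading coefficient; the boundary stays in I by the
  product rule, as \<theta>_i has boundary \<open>F i\<close>.\<close>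

lemma koszul_lift:
  assumes "w \<in> chains S m (forms S 0)" "\<And>j. j \<in> Q \<Longrightarrow> contract_Q j w = 0"
  shows "\<exists>\<Theta>. \<Theta> \<in> chains S m (forms R (int m)) \<and> (\<forall>T. kdiff S \<Theta> T \<in> I)
    \<and> (\<forall>T. x0_degree_le m (\<Theta> T)) \<and> (\<forall>T. x0_coeff m (\<Theta> T) = w T)"
  using assms
proof (induction m arbitrary: w)
  case 0
  have "w T \<in> forms S 0" for T by (rule chainsD[OF 0(1)]) simp
  then have "x0_degree_le 0 (w T)" "x0_coeff 0 (w T) = w T" for T
    by (auto simp: forms_def intro!: x0_degree_le_polys[of _ S] simp: x0_coeff_free[of _ S])
  moreover have "w \<in> chains S 0 (forms R 0)"
    using 0(1) forms_mono[OF S_R] by (intro chains_mono[OF _ 0(1)]) auto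
  moreover have "kdiff S w T \<in> I" for T
    using additive_set_0[OF I_additive] by (simp add: kdiff_chains_0[OF 0(1) finite_V])
  ultimately show ?case by (intro exI[of _ w]) simp
next
  case (Suc m)
  have "\<forall>i\<in>P. \<exists>\<Theta>. \<Theta> \<in> chains S m (forms R (int m)) \<and> (\<forall>T. kdiff S \<Theta> T \<in> I)
    \<and> (\<forall>T. x0_degree_le m (\<Theta> T)) \<and> (\<forall>T. x0_coeff m (\<Theta> T) = contract i w T)"
  proof
    fix i assume "i \<in> P"
    have "contract_Q j (contract i w) = 0" if "j \<in> Q" for j
    proof -
      have "contract i (contract_Q j w) = - contract_Q j (contract i w)" by (rule contract_contract_Q)
      then have "- contract_Q j (contract i w) = 0" unfolding Suc.prems(2)[OF that] by (simp only: contract_0)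
      then show ?thesis by (simp only: neg_equal_0_iff_equal)
    qed
    then show "\<exists>\<Theta>. \<Theta> \<in> chains S m (forms R (int m)) \<and> (\<forall>T. kdiff S \<Theta> T \<in> I)
      \<and> (\<forall>T. x0_degree_le m (\<Theta> T)) \<and> (\<forall>T. x0_coeff m (\<Theta> T) = contract i w T)"
      by (intro Suc.IH contract_chains additive_set_forms Suc.prems(1) finite_V)
  qed
  then obtain \<Theta> where \<Theta>: "\<And>i. i \<in> P \<Longrightarrow> \<Theta> i \<in> chains S m (forms R (int m))"
    "\<And>i T. i \<in> P \<Longrightarrow> kdiff S (\<Theta> i) T \<in> I" "\<And>i T. i \<in> P \<Longrightarrow> x0_degree_le m (\<Theta> i T)"
    "\<And>i T. i \<in> P \<Longrightarrow> x0_coeff m (\<Theta> i T) = contract i w T" by metis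
  have "\<forall>i\<in>P. \<exists>G. (\<forall>j\<in>S. G j \<in> forms S 1) \<and> F i = pvar 0 * lform i + (\<Sum>j\<in>S. pvar j * G j)"
    using F_decomposition by metis
  from bchoice[OF this] obtain G where "\<forall>i\<in>P. (\<forall>j\<in>S. G i j \<in> forms S 1)
    \<and> F i = pvar 0 * lform i + (\<Sum>j\<in>S. pvar j * G i j)" ..
  then have G: "\<And>i j. i \<in> P \<Longrightarrow> j \<in> S \<Longrightarrow> G i j \<in> forms S 1"
    "\<And>i. i \<in> P \<Longrightarrow> F i = pvar 0 * lform i + (\<Sum>j\<in>S. pvar j * G i j)" by blast+
  \<comment> \<open>Exterior multiplication by \<theta>_i, written so that the coefficient of x0 is
    visible.\<close>
  define \<theta> where "\<theta> i c = scale (pvar 0) (wedge_lform i c) + (\<Sum>j\<in>S. scale (G i j) (wedge j c))"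
    for i and c :: "nat set \<Rightarrow> 'k mpoly"
  have kdiff_\<theta>: "kdiff S (\<theta> i c) = scale (F i) c - \<theta> i (kdiff S c)" if i: "i \<in> P" for i c
  proof -
    have "kdiff S (wedge_lform i c) = scale (lform i) c - wedge_lform i (kdiff S c)"
    proof -
      have "kdiff S (wedge_lform i c) = scale (pvar i) c - wedge i (kdiff S c)
          + (\<Sum>j\<in>Q. scale (pconst (a i j)) (scale (pvar j) c - wedge j (kdiff S c)))"
        unfolding wedge_lform_def kdiff_add kdiff_sum kdiff_scale
        by (simp only: kdiff_wedge[OF finite_V P_V[OF i]] kdiff_wedge[OF finite_V Q_V] cong: sum.cong)
      then show ?thesis
        by (auto simp: wedge_lform_def lform_def scale_def fun_eq_iff sum_fun_apply algebra_simps
            sum_distrib_left sum_subtractf)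
    qed
    moreover have "kdiff S (\<Sum>j\<in>S. scale (G i j) (wedge j c))
        = (\<Sum>j\<in>S. scale (G i j) (scale (pvar j) c - wedge j (kdiff S c)))"
      unfolding kdiff_sum kdiff_scale by (intro sum.cong refl) (simp only: kdiff_wedge[OF finite_V])
    ultimately have "kdiff S (\<theta> i c) = scale (pvar 0) (scale (lform i) c - wedge_lform i (kdiff S c))
        + (\<Sum>j\<in>S. scale (G i j) (scale (pvar j) c - wedge j (kdiff S c)))"
      unfolding \<theta>_def kdiff_add kdiff_scale by (simp only:)
    then show ?thesis
      by (auto simp: \<theta>_def G(2)[OF i] scale_def fun_eq_iff sum_fun_apply algebra_simps
            sum_distrib_left sum_subtractf sum.distrib)
  qed
  define u :: "'k mpoly" where "u = pconst (1 / of_nat (Suc m))"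
  have u: "u * of_nat (Suc m) = 1"
    using pconst_mult[of "1 / of_nat (Suc m)" "of_nat (Suc m) :: 'k"]
    by (simp only: u_def pconst_of_nat[symmetric]) (simp del: of_nat_Suc)
  define \<Xi> where "\<Xi> = scale u (\<Sum>i\<in>P. \<theta> i (\<Theta> i))"
  have wl: "wedge_lform i (\<Theta> i) \<in> chains S (Suc m) (forms R (int m))" if "i \<in> P" for i
    unfolding wedge_lform_def
    by (intro chains_add chains_sum additive_set_forms wedge_chains[OF _ \<Theta>(1)] that finite_V P_V Q_V
        chains_scale[OF wedge_chains[OF _ \<Theta>(1)]] forms_pconst_mult)
  have "\<theta> i (\<Theta> i) \<in> chains S (Suc m) (forms R (int (Suc m)))" if i: "i \<in> P" for i
    unfolding \<theta>_def
  proof (intro chains_add chains_sum additive_set_forms chains_scale[OF wl[OF i]])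
    show "pvar 0 * b \<in> forms R (int (Suc m))" if "b \<in> forms R (int m)" for b
      using forms_mult[OF pvar_forms[of 0 R] that] by simp
    show "scale (G i j) (wedge j (\<Theta> i)) \<in> chains S (Suc m) (forms R (int (Suc m)))" if j: "j \<in> S" for j
    proof (rule chains_scale[OF wedge_chains[OF additive_set_forms \<Theta>(1)[OF i] finite_V j]])
      show "G i j * b \<in> forms R (int (Suc m))" if "b \<in> forms R (int m)" for b
        using forms_mult[OF forms_mono[OF S_R G(1)[OF i j]] that] by simp
    qed
  qed
  then have "(\<Sum>i\<in>P. \<theta> i (\<Theta> i)) \<in> chains S (Suc m) (forms R (int (Suc m)))"
    by (rule chains_sum[OF additive_set_forms])
  then have "\<Xi> \<in> chains S (Suc m) (forms R (int (Suc m)))"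
    unfolding \<Xi>_def u_def by (rule chains_scale) (rule forms_pconst_mult)
  moreover have "kdiff S \<Xi> T \<in> I" for T
  proof -
    have "\<theta> i c T \<in> I" if i: "i \<in> P" and c: "\<And>T. c T \<in> I" for i c
    proof -
      have wI: "wedge j c T \<in> I" for j
        using c by (simp add: wedge_def additive_set_sign I_additive additive_set_0)
      have "G i j \<in> polys R" if "j \<in> S" for j
        using forms_mono[OF S_R G(1)[OF i that]] by (simp add: forms_def)
      then show ?thesis
        unfolding \<theta>_def wedge_lform_def plus_fun_apply sum_fun_apply scale_def
        by (intro additive_set_add[OF I_additive] additive_set_sum[OF I_additive] I_mult wI) auto
    qed
    then have *: "\<theta> i (kdiff S (\<Theta> i)) T \<in> I" if "i \<in> P" for i using \<Theta>(2) that by blast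
    have **: "F i * \<Theta> i T \<in> I" if i: "i \<in> P" for i
    proof -
      have "\<Theta> i T \<in> polys R" using chainsD[OF \<Theta>(1)[OF i], of T] by (simp add: forms_def)
      then show ?thesis using I_mult[of "F i" "\<Theta> i T"] F_I[OF i] by (simp add: mult.commute)
    qed
    have "kdiff S \<Xi> T = u * (\<Sum>i\<in>P. F i * \<Theta> i T - \<theta> i (kdiff S (\<Theta> i)) T)"
      unfolding \<Xi>_def kdiff_scale kdiff_sum
      by (simp add: scale_def sum_fun_apply kdiff_\<theta>)
    moreover have "(\<Sum>i\<in>P. F i * \<Theta> i T - \<theta> i (kdiff S (\<Theta> i)) T) \<in> I"
      by (intro additive_set_sum[OF I_additive] additive_set_diff[OF I_additive] * **)
    ultimately show ?thesis using I_mult[of _ u] by (simp add: u_def)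
  qed
  moreover have \<Xi>: "\<Xi> T = u * (\<Sum>i\<in>P. pvar 0 * wedge_lform i (\<Theta> i) T + (\<Sum>j\<in>S. G i j * wedge j (\<Theta> i) T))"
    for T
    by (simp add: \<Xi>_def \<theta>_def scale_def sum_fun_apply)
  have GS: "G i j \<in> polys S" if "i \<in> P" "j \<in> S" for i j using G(1)[OF that] by (simp add: forms_def)
  have wl_deg: "x0_degree_le m (wedge_lform i (\<Theta> i) T)" if "i \<in> P" for i T
    unfolding wedge_lform_def plus_fun_apply sum_fun_apply scale_def
    by (intro x0_degree_le_add x0_degree_le_sum x0_degree_le_mult[of _ "{}"] wedge_x0_degree \<Theta>(3) that) auto
  have "x0_degree_le (Suc m) (\<Xi> T)" for T
    unfolding \<Xi> u_def
    by (intro x0_degree_le_mult[of _ "{}"] x0_degree_le_sum x0_degree_le_add x0_degree_le_pvar0 wl_deg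
        x0_degree_le_mult[OF GS] x0_degree_le_mono[OF wedge_x0_degree[OF \<Theta>(3)], of _ "Suc m"]) auto
  moreover have "x0_coeff (Suc m) (\<Xi> T) = w T" for T
  proof -
    have 1: "x0_coeff (Suc m) (G i j * wedge j (\<Theta> i) T) = 0" if "i \<in> P" "j \<in> S" for i j
      using wedge_x0_degree[of m "\<Theta> i" j T, OF \<Theta>(3)[OF that(1)]]
      by (simp add: x0_coeff_mult[OF GS[OF that]] x0_degree_le_def)
    have \<Theta>4: "(\<lambda>T. x0_coeff m (\<Theta> i T)) = contract i w" if "i \<in> P" for i
      using \<Theta>(4)[OF that] by (rule ext)
    have 2: "x0_coeff m (wedge_lform i (\<Theta> i) T) = wedge_lform i (contract i w) T" if i: "i \<in> P" for i
      unfolding wedge_lform_def plus_fun_apply sum_fun_apply scale_def x0_coeff_add x0_coeff_sum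
      by (simp only: x0_coeff_mult[OF pconst_polys[of _ "{}"]] wedge_x0_coeff \<Theta>4[OF i] empty_iff not_False_eq_True)
    have "x0_coeff (Suc m) (\<Xi> T) = u * (\<Sum>i\<in>P. wedge_lform i (contract i w) T)"
      unfolding \<Xi> u_def
      by (simp add: x0_coeff_mult[OF pconst_polys[of _ "{}"]] x0_coeff_sum x0_coeff_add x0_coeff_Suc_pvar 1 2)
    also have "(\<Sum>i\<in>P. wedge_lform i (contract i w) T) = (\<Sum>i\<in>P. wedge_lform i (contract i w)) T"
      by (rule sum_fun_apply[symmetric])
    also have "(\<Sum>i\<in>P. wedge_lform i (contract i w)) = scale (of_nat (Suc m)) w"
      using sum_wedge_lform_contract[OF Suc.prems(2)] wedge_contract_number[OF Suc.prems(1) finite_V]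
      by (rule trans)
    finally show ?thesis using u by (simp add: scale_def flip: mult.assoc del: of_nat_Suc)
  qed
  ultimately show ?case by blast
qed

section \<open>Lifting the linear cycles of the tangent ideal\<close>

lemma deriv_Q_pvar_Q: "j \<in> Q \<Longrightarrow> m \<in> Q \<Longrightarrow> deriv_Q j (pvar m) = (if m = j then 1 else 0)"
  using deriv_Q_pvar[of j m] Q_V[of m] PQ by auto

text \<open>The cycle bounds a chain w with constant coefficients. Modulo \<open>lideal\<close> its
  boundary is the sum of the x_m \<open>contract_Q m w\<close>, so this sum lies in
  \<open>lideal\<close>; applying \<open>deriv_Q j\<close> isolates a constant in
  \<open>lideal\<close>, which is 0. Thus w lifts by \<open>koszul_lift\<close> to homological
  degree i + 1, with exponent i + 1 of x0, and the boundary of the lift is the desired cycle of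
  degree i + 2.\<close>

lemma lideal_cycle_lift_high:
  assumes "w\<^sub>0 \<in> chains S i (lideal \<inter> forms S 1)" "kdiff S w\<^sub>0 = 0"
  obtains c where "c \<in> chains S i (IR (int i + 2))" "kdiff S c = 0" "\<And>T. x0_coeff (i + 1) (c T) = w\<^sub>0 T"
proof -
  have "w\<^sub>0 \<in> chains S i (forms S 1)" using assms(1) by (rule chains_mono[rotated]) simp
  then obtain w where "w \<in> chains S (Suc i) (forms S (1 - 1))" and dw: "kdiff S w = w\<^sub>0"
    using koszul_acyclic[OF finite_V _ assms(2)] by (metis add_nonneg_pos of_nat_0_le_iff zero_less_one)
  then have w: "w \<in> chains S (Suc i) (forms S 0)" by simp
  have "contract_Q j w T = 0" if j: "j \<in> Q" for j T
  proof -
    have cw: "contract m w T \<in> forms S 0" for m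
      by (rule chainsD[OF contract_chains[OF additive_set_forms w finite_V]]) simp
    have cQ: "contract_Q m w T \<in> forms S 0" for m
      by (rule chainsD[OF contract_Q_chains[OF w]]) simp
    have const: "deriv_Q j f = 0" if "f \<in> forms S 0" for f
      using homogeneous_degree_0[of f] that by (metis (no_types, lifting) deriv_Q_pconst forms_def mem_Collect_eq)
    have "(\<Sum>m\<in>Q. pvar m * contract_Q m w T) = w\<^sub>0 T - (\<Sum>i\<in>P. lform i * contract i w T)"
      using fun_cong[OF sum_Q_contract_Q[of w], of T] by (simp add: sum_fun_apply scale_def dw)
    moreover have "w\<^sub>0 T \<in> lideal"
      using chainsD[OF assms(1), of T] additive_set_0[OF lideal_additive] by simp
    ultimately have "(\<Sum>m\<in>Q. pvar m * contract_Q m w T) \<in> lideal"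
      using cw by (auto simp: forms_def intro!: additive_set_diff[OF lideal_additive] lidealI)
    then have "deriv_Q j (\<Sum>m\<in>Q. pvar m * contract_Q m w T) \<in> lideal" using j by (rule deriv_Q_lideal)
    also have "deriv_Q j (\<Sum>m\<in>Q. pvar m * contract_Q m w T) = (\<Sum>m\<in>Q. if m = j then contract_Q j w T else 0)"
      unfolding deriv_Q_sum using j PQ
      by (intro sum.cong refl) (simp add: deriv_Q_mult const[OF cQ] deriv_Q_pvar_Q)
    also have "\<dots> = contract_Q j w T" using j finite_Q by simp
    finally show ?thesis using lideal_forms_0 cQ by blast
  qed
  then have "contract_Q j w = 0" if "j \<in> Q" for j using that by (simp add: fun_eq_iff)
  from koszul_lift[OF w this] obtain \<Theta> where \<Theta>: "\<Theta> \<in> chains S (Suc i) (forms R (int (Suc i)))"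
    "\<And>T. kdiff S \<Theta> T \<in> I" "\<And>T. x0_coeff (Suc i) (\<Theta> T) = w T" by blast
  have k: "kdiff S \<Theta> \<in> chains S i (forms R (int i + 2))"
  proof (rule kdiff_chains[OF \<Theta>(1) finite_V additive_set_forms additive_set_forms])
    show "pvar j * f \<in> forms R (int i + 2)" if "j \<in> S" "f \<in> forms R (int (Suc i))" for j f
      using forms_mult[OF pvar_forms[of j R] that(2)] that(1) S_R by (auto simp: add.commute)
  qed
  have "kdiff S \<Theta> T \<in> IR (int i + 2)" for T
    using \<Theta>(2) chainsD[OF k, of T] by simp
  with k have "kdiff S \<Theta> \<in> chains S i (IR (int i + 2))" by (rule chains_coeffs)
  moreover have "kdiff S (kdiff S \<Theta>) = 0" by (rule kdiff_kdiff)
  moreover have "x0_coeff (i + 1) (kdiff S \<Theta> T) = w\<^sub>0 T" for T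
  proof -
    have "(\<lambda>T. x0_coeff (Suc i) (\<Theta> T)) = w" using \<Theta>(3) by (rule ext)
    then show ?thesis using fun_cong[OF x0_coeff_kdiff[of "Suc i" \<Theta>], of T] by (simp add: dw Suc_eq_plus1)
  qed
  ultimately show thesis by (rule that)
qed

text \<open>The previous construction reaches only m = i. Multiplication by x0 increases m, and
  surjectivity of that multiplication on homology decreases it.\<close>

lemma lideal_cycle_lift:
  assumes "w\<^sub>0 \<in> chains S i (lideal \<inter> forms S 1)" "kdiff S w\<^sub>0 = 0" "i + 1 \<le> p"
  shows "\<exists>c\<in>chains S i (IR (int (m + 2))). kdiff S c = 0 \<and> (\<forall>T. x0_coeff (m + 1) (c T) = w\<^sub>0 T)"
proof -
  let ?L = "\<lambda>m. \<exists>c\<in>chains S i (IR (int (m + 2))). kdiff S c = 0 \<and> (\<forall>T. x0_coeff (m + 1) (c T) = w\<^sub>0 T)"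
  have up: "?L (Suc m)" if L: "?L m" for m
  proof -
    obtain c where c: "c \<in> chains S i (IR (int (m + 2)))" "kdiff S c = 0" "\<And>T. x0_coeff (m + 1) (c T) = w\<^sub>0 T"
      using L by blast
    have "scale (pvar 0) c \<in> chains S i (IR (int (Suc m + 2)))"
      using IR_pvar[of 0 _ "int (m + 2)"] by (intro chains_scale[OF c(1)]) (auto simp: add.commute)
    moreover have "kdiff S (scale (pvar 0) c) = 0" unfolding kdiff_scale c(2) by (rule scale_0)
    moreover have "x0_coeff (Suc m + 1) (scale (pvar 0) c T) = w\<^sub>0 T" for T
      using c(3)[of T] by (simp add: scale_def x0_coeff_Suc_pvar)
    ultimately show ?thesis by blast
  qed
  have down: "?L m" if L: "?L (Suc m)" for m
  proof -
    obtain c where c: "c \<in> chains S i (IR (int (Suc m + 2)))" "kdiff S c = 0" "\<And>T. x0_coeff (Suc m + 1) (c T) = w\<^sub>0 T"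
      using L by blast
    obtain y b where y: "y \<in> chains S i (IR (int (Suc m + 2) - 1))" "kdiff S y = 0"
      "b \<in> chains S (Suc i) (IR (int (Suc m + 2) - 1))" "c = scale (pvar 0) y + kdiff S b"
      by (rule x0_surjective[OF c(1,2) assms(3)]) auto
    \<comment> \<open>As q lies in X, a form of degree m + 2 in I does not involve the power m + 2
      of x0. So the boundary of b cannot disturb the coefficient of that power in c, which therefore
      comes from y alone.\<close>
    have "x0_degree_le (m + 1) (b T)" for T
    proof -
      have bT: "b T \<in> IR (int (m + 2))"
        using chainsD[OF y(3) additive_set_0[OF IR_additive], of T] by simp
      have "x0_degree_le (Suc (m + 1)) (b T)"
        by (rule x0_degree_le_forms[of _ R "int (m + 2)"]) (use bT in auto)
      moreover have "x0_coeff (Suc (m + 1)) (b T) = 0"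
        using I_center[OF bT] by (simp add: Suc_eq_plus1)
      ultimately show ?thesis by (rule x0_degree_le_Suc)
    qed
    then have "x0_degree_le (m + 1) (kdiff S b T)" for T by (rule kdiff_x0_degree)
    then have "x0_coeff (m + 1) (y T) = w\<^sub>0 T" for T
      using c(3)[of T] by (simp add: y(4) x0_coeff_add scale_def x0_coeff_Suc_pvar x0_degree_le_def)
    then show ?thesis using y(1,2) by (intro bexI[of _ y]) simp_all
  qed
  have i: "?L i" using lideal_cycle_lift_high[OF assms(1,2)] by (metis of_nat_add of_nat_numeral)
  show ?thesis
  proof (cases "m \<le> i")
    case True
    from this i show ?thesis by (induction rule: inc_induct) (use down in blast)+
  next
    case False
    then have "i \<le> m" by simp
    from this i show ?thesis by (induction rule: dec_induct) (use up in blast)+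
  qed
qed

text \<open>A bounding chain w over I is corrected by a cycle over I until
  \<open>reduce_x0_degree\<close> applies. The correction takes place in homological degree i + 1,
  so the lifting of cycles needs i + 2 <= p.\<close>

theorem J_acyclic:
  assumes "c \<in> chains S i (J \<inter> forms S e)" "kdiff S c = 0" "e \<ge> 3" "i + 2 \<le> p"
  obtains b where "b \<in> chains S (Suc i) (J \<inter> forms S (e - 1))" "kdiff S b = c"
proof -
  obtain w where w: "w \<in> chains S (Suc i) (IR (e - 1))" "kdiff S w = c"
    using J_cycle_is_I_boundary[OF assms] by blast
  \<comment> \<open>So w has coefficients of degree m + 2, in which x0 has exponent at most m + 1
    because q lies in X; the top coefficient is then linear. Once it is removed,
    \<open>reduce_x0_degree\<close> applies with its degree condition as an equality.\<close>
  define m where "m = nat (e - 3)"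
  have e: "e - 1 = int (m + 2)" using assms(3) by (simp add: m_def)
  have wT: "w T \<in> IR (int (m + 2))" for T
    using chainsD[OF w(1) additive_set_0[OF IR_additive], of T] e by simp
  have deg: "x0_degree_le (Suc m) (w T)" for T
  proof (rule x0_degree_le_Suc)
    show "x0_degree_le (Suc (Suc m)) (w T)"
      by (rule x0_degree_le_forms[of _ R "int (m + 2)"]) (use wT[of T] in auto)
    show "x0_coeff (Suc (Suc m)) (w T) = 0" using I_center[OF wT[of T]] by simp
  qed
  define t where "t T = x0_coeff (m + 1) (w T)" for T
  have "t \<in> chains S (Suc i) (lideal \<inter> forms S 1)"
    unfolding t_def
  proof (rule chains_coeffs)
    have f: "x0_coeff (m + 1) f \<in> forms S 1" if "f \<in> IR (e - 1)" for f
    proof -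
      have "f \<in> forms R (int (m + 2))" using that e by simp
      from x0_coeff_forms_S[OF this, of "m + 1"] show ?thesis by (simp add: algebra_simps)
    qed
    show "(\<lambda>T. x0_coeff (m + 1) (w T)) \<in> chains S (Suc i) (forms S 1)"
      by (rule chains_map[OF w(1) f]) simp_all
    show "x0_coeff (m + 1) (w T) \<in> lideal \<inter> forms S 1" for T
      using I_top[OF wT[of T] deg[of T]] f[of "w T"] wT[of T] e by (simp add: Suc_eq_plus1)
  qed
  moreover have "kdiff S t = 0"
    using chains_J_x0[OF assms(1), of 0] unfolding t_def x0_coeff_kdiff w(2)
    by (auto simp: fun_eq_iff x0_degree_le_def)
  moreover have "Suc i + 1 \<le> p" using assms(4) by simp
  ultimately obtain c' where c': "c' \<in> chains S (Suc i) (IR (int (m + 2)))" "kdiff S c' = 0"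
    "\<And>T. x0_coeff (m + 1) (c' T) = t T"
    using lideal_cycle_lift[of t "Suc i" m] by blast
  have c'T: "c' T \<in> IR (int (m + 2))" for T
    by (rule chainsD[OF c'(1) additive_set_0[OF IR_additive]])
  have deg': "x0_degree_le (Suc m) (c' T)" for T
  proof (rule x0_degree_le_Suc)
    show "x0_degree_le (Suc (Suc m)) (c' T)"
      by (rule x0_degree_le_forms[of _ R "int (m + 2)"]) (use c'T[of T] in auto)
    show "x0_coeff (Suc (Suc m)) (c' T) = 0" using I_center[OF c'T[of T]] by simp
  qed
  define v where "v = w - c'"
  have v: "v \<in> chains S (Suc i) (IR (int (m + 2)))"
    unfolding v_def using w(1) e by (intro chains_diff IR_additive c'(1)) simp
  have dv: "kdiff S v = c" unfolding v_def kdiff_diff w(2) c'(2) by (rule diff_0_right)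
  have "x0_degree_le m (v T)" for T
  proof (rule x0_degree_le_Suc)
    show "x0_degree_le (Suc m) (v T)"
      unfolding v_def fun_diff_def by (intro x0_degree_le_diff deg deg')
    show "x0_coeff (Suc m) (v T) = 0" using c'(3)[of T] by (simp add: v_def x0_coeff_diff t_def Suc_eq_plus1)
  qed
  moreover have "x0_degree_le 0 (kdiff S v T)" for T
    unfolding dv by (rule chains_J_x0[OF assms(1)])
  ultimately obtain w' where w': "w' \<in> chains S (Suc (Suc i)) (IR (int (m + 2) - 1))"
    "\<And>T. x0_degree_le 0 ((v - kdiff S w') T)"
    using reduce_x0_degree[OF v, of m] by auto
  have "v - kdiff S w' \<in> chains S (Suc i) (J \<inter> forms S (int (m + 2)))"
    by (rule chains_J) (intro chains_diff IR_additive v chains_kdiff_IR w'(1), rule w'(2))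
  moreover have "kdiff S (v - kdiff S w') = c"
    unfolding kdiff_diff kdiff_kdiff dv by (rule diff_0_right)
  ultimately show thesis using that[of "v - kdiff S w'"] e by simp
qed

end

section \<open>The tangent cone at a smooth point\<close>

lemma polys_ring_induct [consumes 1, case_names pconst pvar add mult]:
  assumes "f \<in> polys V"
    and pconst: "\<And>a. P (pconst a)" and pvar: "\<And>i. i \<in> V \<Longrightarrow> P (pvar i)"
    and add: "\<And>g h. P g \<Longrightarrow> P h \<Longrightarrow> P (g + h)" and mult: "\<And>g h. P g \<Longrightarrow> P h \<Longrightarrow> P (g * h)"
  shows "P f"
  using assms(1)
proof (induction rule: polys_induct)
  case zero
  show ?case using pconst[of 0] by simp
next
  case (single m a)
  have pow: "P (pvar i ^ n)" if "i \<in> V" for i n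
    by (induction n) (use pconst[of 1] pvar mult that in auto)
  have "P (\<Prod>i\<in>A. pvar i ^ lookup m i)" if "A \<subseteq> V" for A
    using that by (induction A rule: infinite_finite_induct) (use pconst[of 1] pow mult in auto)
  from mult[OF pconst this[OF single]] show ?case unfolding single_eq_prod_pvar[of m a] .
qed (rule add)

subsection \<open>Order of vanishing at the origin\<close>

definition order_ge :: "nat \<Rightarrow> 'k::comm_ring_1 mpoly \<Rightarrow> bool" where
  "order_ge n f \<longleftrightarrow> (\<forall>m\<in>keys f. n \<le> mono_deg m)"

lemma order_ge_0 [simp]: "order_ge 0 f" and order_ge_zero [simp]: "order_ge n 0"
  by (simp_all add: order_ge_def)

lemma order_ge_add: "order_ge n f \<Longrightarrow> order_ge n g \<Longrightarrow> order_ge n (f + g)"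
  using Poly_Mapping.keys_add[of f g] by (auto simp: order_ge_def)

lemma order_ge_minus: "order_ge n f \<Longrightarrow> order_ge n (- f)"
  by (simp add: order_ge_def)

lemma order_ge_sum: "(\<And>i. i \<in> A \<Longrightarrow> order_ge n (f i)) \<Longrightarrow> order_ge n (\<Sum>i\<in>A. f i)"
  by (induction A rule: infinite_finite_induct) (auto intro: order_ge_add)

lemma order_ge_mult:
  assumes "order_ge m f" "order_ge n g" shows "order_ge (m + n) (f * g)"
  unfolding order_ge_def
proof
  fix k assume "k \<in> keys (f * g)"
  then obtain a b where "k = a + b" "a \<in> keys f" "b \<in> keys g"
    using Poly_Mapping.keys_mult[of f g] by blast
  then show "m + n \<le> mono_deg k"
    using assms by (auto simp: order_ge_def mono_deg_add intro: add_mono)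
qed

lemma order_ge_mult_left: "order_ge n f \<Longrightarrow> order_ge n (f * g)"
  using order_ge_mult[of n f 0 g] by simp

lemma order_ge_mono: "order_ge n f \<Longrightarrow> m \<le> n \<Longrightarrow> order_ge m f"
  by (auto simp: order_ge_def)

lemma order_ge_homogeneous: "homogeneous (int n) f \<Longrightarrow> order_ge n f"
  by (auto simp: order_ge_def homogeneous_def)

lemma order_ge_iff: "order_ge n f \<longleftrightarrow> (\<forall>d<n. hom_component (int d) f = 0)"
proof
  assume f: "order_ge n f"
  show "\<forall>d<n. hom_component (int d) f = 0"
  proof (intro allI impI)
    fix d assume "d < n"
    then have "lookup f m = 0" if "mono_deg m = d" for m
      using f that \<open>d < n\<close> by (metis in_keys_iff leD order_ge_def)
    then show "hom_component (int d) f = 0"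
      by (intro poly_mapping_eqI) (auto simp: lookup_hom_component)
  qed
next
  assume f: "\<forall>d<n. hom_component (int d) f = 0"
  show "order_ge n f"
    unfolding order_ge_def
  proof
    fix m assume m: "m \<in> keys f"
    show "n \<le> mono_deg m"
    proof (rule ccontr)
      assume "\<not> n \<le> mono_deg m"
      then have "lookup (hom_component (int (mono_deg m)) f) m = 0" using f by simp
      then show False using m by (simp add: lookup_hom_component in_keys_iff)
    qed
  qed
qed

lemma hom_component_diff: "hom_component e (f - g) = hom_component e f - hom_component e g"
  by (rule poly_mapping_eqI) (simp add: lookup_hom_component lookup_minus)

lemma order_ge_hom_component:
  assumes "order_ge n f" shows "order_ge (Suc n) (f - hom_component (int n) f)"
proof -
  have "hom_component (int d) (hom_component (int n) f) = 0" if "d < n" for d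
    using that by (intro hom_component_other[OF homogeneous_hom_component]) simp
  moreover have "hom_component (int n) (hom_component (int n) f) = hom_component (int n) f"
    by (rule hom_component_homogeneous) simp
  ultimately show ?thesis
    using assms unfolding order_ge_iff hom_component_diff by (auto simp: less_Suc_eq)
qed

lemma order_ge_Suc_iff: "order_ge (Suc n) f \<longleftrightarrow> order_ge n f \<and> hom_component (int n) f = 0"
  unfolding order_ge_iff by (auto simp: less_Suc_eq)

text \<open>What remains of each factor after removal of its initial form has higher order, so it
  cannot contribute in degree m + n.\<close>

lemma hom_component_order_mult:
  assumes "order_ge m f" "order_ge n g"
  shows "hom_component (int (m + n)) (f * g) = hom_component (int m) f * hom_component (int n) g"
proof -
  let ?f = "hom_component (int m) f" and ?g = "hom_component (int n) g"
  have "f * g - ?f * ?g = (f - ?f) * g + ?f * (g - ?g)" by (simp add: algebra_simps)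
  moreover have "order_ge (Suc (m + n)) ((f - ?f) * g)"
    using order_ge_mult[OF order_ge_hom_component[OF assms(1)] assms(2)] by simp
  moreover have "order_ge (Suc (m + n)) (?f * (g - ?g))"
    using order_ge_mult[OF order_ge_homogeneous order_ge_hom_component[OF assms(2)], of m ?f] by simp
  ultimately have "order_ge (Suc (m + n)) (f * g - ?f * ?g)" by (metis order_ge_add)
  then have "hom_component (int (m + n)) (f * g) = hom_component (int (m + n)) (?f * ?g)"
    by (simp add: order_ge_Suc_iff hom_component_diff)
  also have "\<dots> = ?f * ?g"
    using homogeneous_mult[of "int m" ?f "int n" ?g] by (intro hom_component_homogeneous) simp
  finally show ?thesis .
qed

lemma hom_component_0_eq: "hom_component 0 f = pconst (lookup f 0)"
  using homogeneous_degree_0[of "hom_component 0 f"] by (simp add: lookup_hom_component)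

lemma order_ge_subst_form:
  fixes h :: "'k::comm_ring_1 mpoly"
  assumes "h \<in> forms V (int d)" "\<And>i. i \<in> V \<Longrightarrow> order_ge 1 (\<gamma> i)"
  shows "order_ge d (subst \<gamma> h)"
    and "hom_component (int d) (subst \<gamma> h) = subst (\<lambda>i. hom_component 1 (\<gamma> i)) h"
proof -
  let ?\<rho> = "\<lambda>i. hom_component 1 (\<gamma> i)"
  have pow: "order_ge n (\<gamma> i ^ n) \<and> hom_component (int n) (\<gamma> i ^ n) = ?\<rho> i ^ n" if "i \<in> V" for i n
  proof (induction n)
    case 0
    then show ?case using hom_component_homogeneous[of 0 "1 :: 'k mpoly"] by simp
  next
    case (Suc n)
    then show ?case
      using order_ge_mult[OF assms(2)[OF that], of n "\<gamma> i ^ n"]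
        hom_component_order_mult[OF assms(2)[OF that], of n "\<gamma> i ^ n"]
      by (simp add: Suc_eq_plus1_left power_add)
  qed
  have prod: "order_ge (\<Sum>i\<in>A. e i) (\<Prod>i\<in>A. \<gamma> i ^ e i) \<and>
      hom_component (int (\<Sum>i\<in>A. e i)) (\<Prod>i\<in>A. \<gamma> i ^ e i) = (\<Prod>i\<in>A. ?\<rho> i ^ e i)"
    if "finite A" "A \<subseteq> V" for A and e :: "nat \<Rightarrow> nat"
    using that
  proof (induction A rule: finite_induct)
    case empty
    then show ?case using hom_component_homogeneous[of 0 "1 :: 'k mpoly"] by simp
  next
    case (insert x A)
    then have IH: "order_ge (\<Sum>i\<in>A. e i) (\<Prod>i\<in>A. \<gamma> i ^ e i)"
      "hom_component (int (\<Sum>i\<in>A. e i)) (\<Prod>i\<in>A. \<gamma> i ^ e i) = (\<Prod>i\<in>A. ?\<rho> i ^ e i)" and x: "x \<in> V"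
      by auto
    show ?case
      using order_ge_mult[OF conjunct1[OF pow[OF x]] IH(1), of "e x"]
        hom_component_order_mult[OF conjunct1[OF pow[OF x]] IH(1), of "e x"]
        IH(2) pow[OF x, of "e x"] insert.hyps by (simp add: of_nat_add[symmetric] del: of_nat_add of_nat_sum)
  qed
  have mono: "order_ge d (\<Prod>i\<in>keys m. \<gamma> i ^ lookup m i) \<and>
      hom_component (int d) (\<Prod>i\<in>keys m. \<gamma> i ^ lookup m i) = (\<Prod>i\<in>keys m. ?\<rho> i ^ lookup m i)"
    if "m \<in> keys h" for m
  proof -
    have "mono_deg m = d" "keys m \<subseteq> V" using that assms(1) by (auto simp: forms_def polys_def homogeneous_def)
    then show ?thesis using prod[of "keys m" "lookup m"] by (simp add: mono_deg_def)
  qed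
  have cst: "order_ge d (pconst a * f) \<and> hom_component (int d) (pconst a * f) = pconst a * hom_component (int d) f"
    if "order_ge d f" for a and f :: "'k mpoly"
    using order_ge_mult[OF _ that, of 0 "pconst a"] hom_component_mult[of 0 "pconst a" "int d" f] by simp
  show "order_ge d (subst \<gamma> h)"
    unfolding subst_def linear_ext_def using cst mono by (intro order_ge_sum) blast
  show "hom_component (int d) (subst \<gamma> h) = subst ?\<rho> h"
    unfolding subst_def linear_ext_def hom_component_sum using cst mono by (intro sum.cong) auto
qed

text \<open>As the \<gamma> i have no constant term, the component of degree n of h contributes only
  in orders >= n. In degree d this leaves the lowest form of h, evaluated at the linear parts of
  \<gamma>.\<close>

lemma order_ge_subst:
  fixes h :: "'k::comm_ring_1 mpoly"
  assumes "h \<in> polys V" "order_ge d h" "\<And>i. i \<in> V \<Longrightarrow> order_ge 1 (\<gamma> i)"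
  shows "order_ge d (subst \<gamma> h)"
    and "hom_component (int d) (subst \<gamma> h)
      = subst (\<lambda>i. hom_component 1 (\<gamma> i)) (hom_component (int d) h)"
proof -
  have comp: "order_ge n (subst \<gamma> (hom_component (int n) h))" for n
    using order_ge_subst_form(1)[OF formsI[OF hom_component_polys[OF assms(1)] homogeneous_hom_component]]
      assms(3) by blast
  have ord: "order_ge n (subst \<gamma> g)" if g: "g \<in> polys V" "order_ge n g" for g n
  proof -
    obtain E where E: "finite E" "g = (\<Sum>e\<in>E. hom_component e g)" by (rule sum_hom_components)
    have "order_ge n (subst \<gamma> (hom_component e g))" for e
    proof (cases "e < int n")
      case True
      then have "hom_component e g = 0"
      proof (cases "e < 0")
        case False
        then obtain d where "e = int d" by (metis nonneg_int_cases not_less)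
        then show ?thesis using True g(2) by (simp add: order_ge_iff)
      qed (simp add: homogeneous_neg_eq_0[OF homogeneous_hom_component])
      then show ?thesis by simp
    next
      case False
      then obtain d where d: "e = int d" by (metis nonneg_int_cases not_less of_nat_0_le_iff order_trans)
      have "order_ge d (subst \<gamma> (hom_component (int d) g))"
        using order_ge_subst_form(1)[OF formsI[OF hom_component_polys[OF g(1)] homogeneous_hom_component]]
          assms(3) by blast
      then show ?thesis using False d by (auto elim: order_ge_mono)
    qed
    then have "order_ge n (\<Sum>e\<in>E. subst \<gamma> (hom_component e g))" by (rule order_ge_sum)
    then show ?thesis using E(2) by (simp flip: subst_sum)
  qed
  show "order_ge d (subst \<gamma> h)" by (rule ord[OF assms(1,2)])
  let ?h = "hom_component (int d) h"
  have "order_ge (Suc d) (subst \<gamma> (h - ?h))"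
    by (intro ord polys_diff assms(1) hom_component_polys order_ge_hom_component assms(2))
  then have "hom_component (int d) (subst \<gamma> h) = hom_component (int d) (subst \<gamma> ?h)"
    by (simp add: subst_diff order_ge_Suc_iff hom_component_diff)
  also have "\<dots> = subst (\<lambda>i. hom_component 1 (\<gamma> i)) ?h"
    by (rule order_ge_subst_form(2)[OF formsI[OF hom_component_polys[OF assms(1)] homogeneous_hom_component]])
      (rule assms(3))
  finally show "hom_component (int d) (subst \<gamma> h) = subst (\<lambda>i. hom_component 1 (\<gamma> i)) ?h" .
qed

text \<open>First-order Taylor expansion with the gradient taken at the origin: moving it there from
  \<gamma> costs one order, since \<gamma> has no constant term, and \<eta> already has order n + 1.
  The induction over ring operations reduces products to the Leibniz rule for the gradient.\<close>

lemma order_ge_taylor: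
  fixes f :: "'k::comm_ring_1 mpoly"
  assumes "f \<in> polys V" "\<And>i. i \<in> V \<Longrightarrow> order_ge 1 (\<gamma> i)" "\<And>i. i \<in> V \<Longrightarrow> order_ge (Suc n) (\<eta> i)"
    and "finite V"
  shows "order_ge (Suc (Suc n))
    (subst (\<lambda>i. \<gamma> i + \<eta> i) f - subst \<gamma> f - (\<Sum>i\<in>V. pconst (gradient_q f i) * \<eta> i))"
proof -
  let ?\<gamma>' = "\<lambda>i. \<gamma> i + \<eta> i"
  let ?grad = "\<lambda>f. \<Sum>i\<in>V. pconst (gradient_q f i) * \<eta> i"
  let ?T = "\<lambda>f. order_ge (Suc (Suc n)) (subst ?\<gamma>' f - subst \<gamma> f - ?grad f)"
  have \<gamma>': "order_ge 1 (?\<gamma>' i)" if "i \<in> V" for i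
    using assms(2) order_ge_mono[OF assms(3), of i 1] that by (intro order_ge_add) simp_all
  have const: "order_ge 1 (subst \<delta> g - pconst (lookup g 0))"
    if "g \<in> polys V" "\<And>i. i \<in> V \<Longrightarrow> order_ge 1 (\<delta> i)" for g and \<delta> :: "nat \<Rightarrow> 'k mpoly"
  proof -
    have "order_ge (Suc 0) (g - hom_component (int 0) g)" by (rule order_ge_hom_component) simp
    then have "order_ge 1 (g - pconst (lookup g 0))" by (simp add: hom_component_0_eq One_nat_def)
    then have "order_ge 1 (subst \<delta> (g - pconst (lookup g 0)))"
      using that by (intro order_ge_subst(1)[of _ V] polys_diff) auto
    then show ?thesis by (simp add: subst_diff)
  qed
  have grad_ord: "order_ge (Suc n) (?grad g)" for g
    using order_ge_mult[of 0 _ "Suc n"] assms(3) by (intro order_ge_sum) fastforce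
  have grad_mult: "gradient_q (g * h) i = lookup g 0 * gradient_q h i + gradient_q g i * lookup h 0"
    for g h :: "'k mpoly" and i
  proof -
    have lin: "hom_component 1 (g * h) = pconst (lookup g 0) * hom_component 1 h + hom_component 1 g * pconst (lookup h 0)"
    proof -
      let ?g = "pconst (lookup g 0)" and ?h = "pconst (lookup h 0)"
      have ord: "order_ge 1 (f - pconst (lookup f 0))" for f :: "'k mpoly"
        using order_ge_hom_component[of 0 f] by (simp add: hom_component_0_eq One_nat_def)
      have "g * h = (g - ?g) * (h - ?h) + ?g * h + g * ?h - ?g * ?h" by (simp add: algebra_simps)
      then have "hom_component 1 (g * h) = hom_component 1 ((g - ?g) * (h - ?h) + ?g * h + g * ?h - ?g * ?h)"
        by (rule arg_cong)
      moreover have "hom_component 1 ((g - ?g) * (h - ?h)) = 0"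
        using order_ge_mult[OF ord[of g] ord[of h]] unfolding order_ge_iff
        by (metis of_nat_1 one_add_one one_less_numeral_iff semiring_norm(76))
      moreover have "hom_component 1 (?g * h) = ?g * hom_component 1 h"
        using hom_component_mult[of 0 ?g 1 h] by simp
      moreover have "hom_component 1 (g * ?h) = hom_component 1 g * ?h"
        using hom_component_mult[of 0 ?h 1 g] by (simp add: mult.commute)
      moreover have "hom_component 1 (?g * ?h) = 0"
        using hom_component_other[of 0 "?g * ?h" 1] homogeneous_mult[of 0 ?g 0 ?h] by simp
      ultimately show ?thesis by (simp only: hom_component_add hom_component_diff add_0 diff_zero)
    qed
    have grad: "gradient_q f i = lookup (hom_component 1 f) (Poly_Mapping.single i 1)" for f :: "'k mpoly"
      by (simp add: gradient_q_def lookup_hom_component)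
    show ?thesis
      unfolding grad lin lookup_add by (simp add: lookup_pconst_mult mult.commute[of _ "pconst _"])
  qed
  have "f \<in> polys V \<and> ?T f"
    using assms(1)
  proof (induction rule: polys_ring_induct)
    case (pconst a)
    have "gradient_q (pconst a) i = 0" for i
      by (simp add: gradient_q_def pconst_def lookup_single when_def)
        (metis zero_neq_one lookup_single_eq lookup_zero)
    then show ?case by simp
  next
    case (pvar i)
    have "gradient_q (pvar i) j = (if j = i then 1 else 0 :: 'k)" for j
    proof (cases "j = i")
      case False
      then have "Poly_Mapping.single i (1::nat) \<noteq> Poly_Mapping.single j 1"
        by (metis lookup_single_eq lookup_single_not_eq zero_neq_one)
      then show ?thesis using False by (simp add: gradient_q_def pvar_def lookup_single_not_eq)
    qed (simp add: gradient_q_def pvar_def)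
    then have "?grad (pvar i) = (\<Sum>j\<in>V. if j = i then \<eta> i else 0)"
      by (intro sum.cong refl) auto
    also have "\<dots> = \<eta> i" using pvar assms(4) by simp
    finally show ?case using pvar by (auto simp: pvar_polys)
  next
    case (add g h)
    have "?grad (g + h) = ?grad g + ?grad h"
      by (simp add: gradient_q_def lookup_add pconst_add distrib_right sum.distrib)
    then have eq: "subst ?\<gamma>' (g + h) - subst \<gamma> (g + h) - ?grad (g + h)
      = (subst ?\<gamma>' g - subst \<gamma> g - ?grad g) + (subst ?\<gamma>' h - subst \<gamma> h - ?grad h)"
      by (simp add: subst_add)
    show ?case
      unfolding eq by (intro conjI polys_add order_ge_add) (use add in blast)+
  next
    case (mult g h)
    let ?g = "pconst (lookup g 0)" and ?h = "pconst (lookup h 0)"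
    have "?grad (g * h) = ?g * ?grad h + ?grad g * ?h"
      unfolding sum_distrib_left sum_distrib_right sum.distrib[symmetric]
      by (intro sum.cong refl) (simp add: grad_mult pconst_add pconst_mult algebra_simps)
    then have eq: "subst ?\<gamma>' (g * h) - subst \<gamma> (g * h) - ?grad (g * h)
      = (subst ?\<gamma>' g - subst \<gamma> g - ?grad g) * subst ?\<gamma>' h + ?grad g * (subst ?\<gamma>' h - ?h)
        + (subst ?\<gamma>' h - subst \<gamma> h - ?grad h) * subst \<gamma> g + ?grad h * (subst \<gamma> g - ?g)"
      by (simp add: subst_mult algebra_simps)
    have "order_ge (Suc (Suc n)) (?grad g * (subst ?\<gamma>' h - ?h))"
      using order_ge_mult[OF grad_ord const[of h ?\<gamma>', OF _ \<gamma>']] mult by (simp add: Suc_eq_plus1)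
    moreover have "order_ge (Suc (Suc n)) (?grad h * (subst \<gamma> g - ?g))"
      using order_ge_mult[OF grad_ord const[of g \<gamma>, OF _ assms(2)]] mult by (simp add: Suc_eq_plus1)
    moreover have "order_ge (Suc (Suc n)) ((subst ?\<gamma>' g - subst \<gamma> g - ?grad g) * subst ?\<gamma>' h)"
      by (rule order_ge_mult_left) (use mult in blast)
    moreover have "order_ge (Suc (Suc n)) ((subst ?\<gamma>' h - subst \<gamma> h - ?grad h) * subst \<gamma> g)"
      by (rule order_ge_mult_left) (use mult in blast)
    ultimately show ?case unfolding eq using mult by (intro conjI order_ge_add) auto
  qed
  then show ?thesis by blast
qed

subsection \<open>Formal solutions of a system with independent gradients\<close>

text \<open>Newton's method: the equations \<open>g p = 0\<close> are solved for the variables in \<open>P\<close> up to order \<open>n\<close>.\<close>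

lemma formal_implicit_function:
  fixes g :: "nat \<Rightarrow> 'k::comm_ring_1 mpoly"
  assumes "finite V" "P \<subseteq> V" "\<And>p. p \<in> P \<Longrightarrow> g p \<in> polys V" "\<And>p. p \<in> P \<Longrightarrow> lookup (g p) 0 = 0"
    and "\<And>p q. p \<in> P \<Longrightarrow> q \<in> P \<Longrightarrow> gradient_q (g p) q = (if p = q then 1 else 0)"
  shows "\<exists>\<gamma>. (\<forall>j. j \<notin> P \<longrightarrow> \<gamma> j = pvar j) \<and> (\<forall>i\<in>V. order_ge 1 (\<gamma> i) \<and> \<gamma> i \<in> polys V)
    \<and> (\<forall>p\<in>P. order_ge (Suc n) (subst \<gamma> (g p)))"
proof (induction n)
  case 0
  define \<gamma> where "\<gamma> j = (if j \<in> P then 0 else pvar j :: 'k mpoly)" for j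
  have \<gamma>: "order_ge 1 (\<gamma> i)" "\<gamma> i \<in> polys V" if "i \<in> V" for i
    using that order_ge_homogeneous[of 1 "pvar i :: 'k mpoly"] by (auto simp: \<gamma>_def)
  have "order_ge 1 (subst \<gamma> (g p))" if "p \<in> P" for p
  proof (rule order_ge_subst(1)[OF assms(3)[OF that] _ \<gamma>(1)])
    show "order_ge 1 (g p)"
      using assms(4)[OF that] order_ge_Suc_iff[of 0 "g p"] by (simp add: hom_component_0_eq One_nat_def)
  qed
  moreover have "\<gamma> j = pvar j" if "j \<notin> P" for j using that by (simp add: \<gamma>_def)
  ultimately show ?case using \<gamma> unfolding One_nat_def by (intro exI[of _ \<gamma>]) blast
next
  case (Suc n)
  then obtain \<gamma> where \<gamma>: "\<And>j. j \<notin> P \<Longrightarrow> \<gamma> j = pvar j" "\<And>i. i \<in> V \<Longrightarrow> order_ge 1 (\<gamma> i)"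
    "\<And>i. i \<in> V \<Longrightarrow> \<gamma> i \<in> polys V" "\<And>p. p \<in> P \<Longrightarrow> order_ge (Suc n) (subst \<gamma> (g p))" by blast
  \<comment> \<open>The Newton correction: the gradients of the g p form the identity matrix in the
    directions P, so it is minus the lowest remaining error term.\<close>
  define \<eta> where "\<eta> i = (if i \<in> P then - hom_component (int (Suc n)) (subst \<gamma> (g i)) else 0)" for i
  have \<eta>_ord: "order_ge (Suc n) (\<eta> i)" for i
    by (cases "i \<in> P") (simp_all only: \<eta>_def if_True if_False order_ge_zero order_ge_minus
        order_ge_homogeneous homogeneous_hom_component)
  have \<eta>_polys: "\<eta> i \<in> polys V" for i
    using assms(2,3) \<gamma>(3) by (auto simp: \<eta>_def intro!: polys_minus hom_component_polys subst_polys[of _ V])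
  let ?\<gamma>' = "\<lambda>i. \<gamma> i + \<eta> i"
  have "order_ge (Suc (Suc n)) (subst ?\<gamma>' (g p))" if p: "p \<in> P" for p
  proof -
    have "(\<Sum>i\<in>V. pconst (gradient_q (g p) i) * \<eta> i) = (\<Sum>i\<in>V. if i = p then \<eta> p else 0)"
      using assms(5)[OF p] by (intro sum.cong refl) (auto simp: \<eta>_def)
    then have "(\<Sum>i\<in>V. pconst (gradient_q (g p) i) * \<eta> i) = \<eta> p"
      using assms(1,2) p by auto
    then have "order_ge (Suc (Suc n)) (subst ?\<gamma>' (g p) - subst \<gamma> (g p) - \<eta> p)"
      using order_ge_taylor[of "g p" V \<gamma> n \<eta>] assms(1,3) p \<gamma>(2) \<eta>_ord by simp
    moreover have "order_ge (Suc (Suc n)) (subst \<gamma> (g p) + \<eta> p)"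
      using order_ge_hom_component[OF \<gamma>(4)[OF p]] p by (simp add: \<eta>_def del: of_nat_Suc)
    ultimately have "order_ge (Suc (Suc n)) ((subst ?\<gamma>' (g p) - subst \<gamma> (g p) - \<eta> p) + (subst \<gamma> (g p) + \<eta> p))"
      by (rule order_ge_add)
    then show ?thesis by simp
  qed
  moreover have "?\<gamma>' j = pvar j" if "j \<notin> P" for j using that by (simp add: \<gamma>(1) \<eta>_def)
  moreover have "order_ge 1 (?\<gamma>' i) \<and> ?\<gamma>' i \<in> polys V" if "i \<in> V" for i
    using that \<gamma>(2,3) \<eta>_polys order_ge_mono[OF \<eta>_ord, of 1 i] by (auto intro!: order_ge_add)
  ultimately show ?case by (intro exI[of _ ?\<gamma>']) blast
qed

section \<open>Lowest forms in the ideal of the local equations\<close>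

context linear_forms
begin

text \<open>Cancellation between the products \<open>g p * h p\<close> can raise the order of f, so
  its lowest form cannot be read off from the summands. Instead f is restricted to a formal solution
  of the equations g p = 0: there it has order above d, hence its lowest form vanishes on the linear
  part of the solution, which parametrizes the tangent space.\<close>

lemma lideal_lowest_form:
  assumes "\<And>p. p \<in> P \<Longrightarrow> g p \<in> polys V" "\<And>p. p \<in> P \<Longrightarrow> hom_component 0 (g p) = 0"
    and "\<And>p. p \<in> P \<Longrightarrow> hom_component 1 (g p) = lform p"
    and "\<And>p. p \<in> P \<Longrightarrow> h p \<in> polys V" "f = (\<Sum>p\<in>P. g p * h p)" "order_ge d f"
  shows "hom_component (int d) f \<in> lideal"
proof -
  have const: "lookup (g p) 0 = 0" if "p \<in> P" for p
    using assms(2)[OF that] lookup_hom_component[of 0 "g p" 0] by simp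
  have single_neq: "Poly_Mapping.single i (1::nat) \<noteq> Poly_Mapping.single j 1" if "i \<noteq> j" for i j :: nat
    using that by (metis lookup_single_eq lookup_single_not_eq zero_neq_one)
  have grad: "gradient_q (g p) q = (if p = q then 1 else 0)" if "p \<in> P" "q \<in> P" for p q
  proof -
    have "gradient_q (g p) q = lookup (lform p) (Poly_Mapping.single q 1)"
      using assms(3)[OF that(1)] lookup_hom_component[of 1 "g p" "Poly_Mapping.single q 1"]
      by (simp add: gradient_q_def)
    also have "\<dots> = (if p = q then 1 else 0) + (\<Sum>j\<in>Q. a p j * (if j = q then 1 else 0))"
      using single_neq
      by (auto simp: lform_def lookup_add lookup_sum lookup_pconst_mult pvar_def lookup_single_not_eq
          intro!: sum.cong)
    also have "(\<Sum>j\<in>Q. a p j * (if j = q then 1 else 0)) = 0"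
      using that PQ by (intro sum.neutral) auto
    finally show ?thesis by simp
  qed
  \<comment> \<open>The order d + 2 exceeds d, as f requires, and is at least 2 even for d = 0, as
    the comparison of linear parts requires.\<close>
  obtain \<gamma> where \<gamma>: "\<And>j. j \<notin> P \<Longrightarrow> \<gamma> j = pvar j" "\<And>i. i \<in> V \<Longrightarrow> order_ge 1 (\<gamma> i)"
    "\<And>i. i \<in> V \<Longrightarrow> \<gamma> i \<in> polys V" "\<And>p. p \<in> P \<Longrightarrow> order_ge (Suc (Suc d)) (subst \<gamma> (g p))"
    using formal_implicit_function[of V P g "Suc d", OF finite_V _ assms(1) const grad] P_V
    by auto blast
  define \<rho> where "\<rho> i = hom_component 1 (\<gamma> i)" for i
  have \<rho>: "\<rho> = (\<lambda>i. hom_component 1 (\<gamma> i))" by (rule ext) (rule \<rho>_def)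
  have \<rho>Q: "\<rho> j = pvar j" if "j \<in> Q" for j
  proof -
    have "j \<notin> P" using that PQ by blast
    then have "\<gamma> j = pvar j" by (rule \<gamma>(1))
    then show ?thesis by (simp add: \<rho>_def hom_component_homogeneous)
  qed
  \<comment> \<open>The linear part of the equation g p = 0 along \<gamma> says that
    \<open>lform p\<close> vanishes on \<rho>; it is solved for the pivot variable.\<close>
  have \<rho>P: "\<rho> p = - (\<Sum>j\<in>Q. pconst (a p j) * pvar j)" if p: "p \<in> P" for p
  proof -
    have "order_ge 1 (g p)"
      using assms(2)[OF p] order_ge_Suc_iff[of 0 "g p"] by (simp add: One_nat_def)
    then have "hom_component (int 1) (subst \<gamma> (g p)) = subst \<rho> (hom_component (int 1) (g p))"
      unfolding \<rho>_def by (rule order_ge_subst(2)[OF assms(1)[OF p]]) (rule \<gamma>(2))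
    moreover have "hom_component (int 1) (subst \<gamma> (g p)) = 0"
      using \<gamma>(4)[OF p] unfolding order_ge_iff by (metis One_nat_def Suc_less_eq zero_less_Suc)
    ultimately have "subst \<rho> (lform p) = 0" using assms(3)[OF p] by simp
    moreover have "subst \<rho> (lform p) = \<rho> p + (\<Sum>j\<in>Q. pconst (a p j) * pvar j)"
      by (simp add: lform_def subst_add subst_sum subst_mult \<rho>Q)
    ultimately show ?thesis by (simp add: eq_neg_iff_add_eq_0)
  qed
  have \<rho>_polys: "\<rho> i \<in> polys V" if "i \<in> V" for i
    unfolding \<rho>_def using \<gamma>(3)[OF that] by (rule hom_component_polys)
  \<comment> \<open>Substituting \<rho> is reduction modulo \<open>lideal\<close>, so a polynomial
    vanishing under it lies in \<open>lideal\<close>.\<close>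
  have mod: "t \<in> polys V \<and> t - subst \<rho> t \<in> lideal" if "t \<in> polys V" for t
    using that
  proof (induction rule: polys_ring_induct)
    case (pconst b)
    then show ?case using additive_set_0[OF lideal_additive] by simp
  next
    case (pvar i)
    show ?case
    proof (cases "i \<in> P")
      case True
      then have "pvar i - subst \<rho> (pvar i) = lform i * 1" by (simp add: \<rho>P lform_def)
      then show ?thesis using lform_mult_lideal[OF True, of 1] pvar by auto
    next
      case False
      then have "i \<in> Q" using pvar V_eq by auto
      then show ?thesis using additive_set_0[OF lideal_additive] pvar by (auto simp: \<rho>Q)
    qed
  next
    case (add s t)
    have "s + t - subst \<rho> (s + t) = (s - subst \<rho> s) + (t - subst \<rho> t)" by (simp add: subst_add)
    then show ?case using add additive_set_add[OF lideal_additive] by (metis polys_add)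
  next
    case (mult s t)
    have "s * t - subst \<rho> (s * t) = t * (s - subst \<rho> s) + subst \<rho> s * (t - subst \<rho> t)"
      by (simp add: subst_mult algebra_simps)
    moreover have "subst \<rho> s \<in> polys V" using mult \<rho>_polys by (blast intro: subst_polys)
    ultimately show ?case using mult additive_set_add[OF lideal_additive] lideal_mult by (metis polys_mult)
  qed
  have fV: "f \<in> polys V" unfolding assms(5) using assms(1,4) by auto
  have "order_ge (Suc d) (subst \<gamma> f)"
    unfolding assms(5) subst_sum subst_mult
  proof (rule order_ge_sum)
    fix p assume p: "p \<in> P"
    from order_ge_mult[OF \<gamma>(4)[OF p], of 0 "subst \<gamma> (h p)"]
    show "order_ge (Suc d) (subst \<gamma> (g p) * subst \<gamma> (h p))" by (auto elim: order_ge_mono)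
  qed
  then have "subst \<rho> (hom_component (int d) f) = 0"
    using order_ge_subst(2)[OF fV assms(6), of \<gamma>, OF \<gamma>(2)]
    unfolding \<rho>[symmetric] by (simp add: order_ge_Suc_iff)
  then show ?thesis using mod[OF hom_component_polys[OF fV, of "int d"]] by simp
qed

end

section \<open>Gaussian elimination of gradients\<close>

lemma gradient_q_add: "gradient_q (f + g) j = gradient_q f j + gradient_q g j"
  and gradient_q_diff: "gradient_q (f - g) j = gradient_q f j - gradient_q g j"
  and gradient_q_pconst_mult: "gradient_q (pconst b * f) j = b * gradient_q f j"
  and gradient_q_sum: "gradient_q (\<Sum>i\<in>A. h i) j = (\<Sum>i\<in>A. gradient_q (h i) j)"
  by (simp_all add: gradient_q_def lookup_add lookup_minus lookup_pconst_mult lookup_sum)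

text \<open>Elimination acts on the equations themselves, by constant combinations determined by
  their gradients. The last clause recovers the old equations from the new ones, so both generate
  the same ideal.\<close>

lemma gauss_elimination:
  fixes f :: "nat \<Rightarrow> 'k::field mpoly"
  assumes "\<And>a. (\<forall>j\<in>V. (\<Sum>l<c. a l * gradient_q (f l) j) = 0) \<Longrightarrow> \<forall>l<c. a l = 0"
  shows "\<exists>P g. finite P \<and> P \<subseteq> V \<and> (\<forall>p\<in>P. \<exists>b. g p = (\<Sum>l<c. pconst (b l) * f l))
    \<and> (\<forall>p\<in>P. \<forall>q\<in>P. gradient_q (g p) q = (if p = q then 1 else 0))
    \<and> (\<forall>l<c. f l = (\<Sum>p\<in>P. pconst (gradient_q (f l) p) * g p))"
  using assms
proof (induction c)
  case 0
  show ?case by (intro exI[of _ "{}"]) simp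
next
  case (Suc c)
  define span where "span n h \<longleftrightarrow> (\<exists>b. h = (\<Sum>l<n. pconst (b l) * f l))" for n h
  have span_diff: "span n (h - h')" if hh: "span n h" "span n h'" for n h h'
  proof -
    obtain b b' where "h = (\<Sum>l<n. pconst (b l) * f l)" "h' = (\<Sum>l<n. pconst (b' l) * f l)"
      using hh unfolding span_def by blast
    then have "h - h' = (\<Sum>l<n. pconst (b l + - b' l) * f l)"
      unfolding pconst_add pconst_minus by (simp add: sum_subtractf left_diff_distrib)
    then show ?thesis unfolding span_def by (intro exI)
  qed
  have span_mult: "span n (pconst e * h)" if hh: "span n h" for n e h
  proof -
    obtain b where "h = (\<Sum>l<n. pconst (b l) * f l)" using hh unfolding span_def by blast
    then have "pconst e * h = (\<Sum>l<n. pconst (e * b l) * f l)"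
      by (simp add: sum_distrib_left pconst_mult mult.assoc)
    then show ?thesis unfolding span_def by (intro exI)
  qed
  have span_Suc: "span (Suc n) h" if hh: "span n h" for n h
  proof -
    obtain b where "h = (\<Sum>l<n. pconst (b l) * f l)" using hh unfolding span_def by blast
    then have "h = (\<Sum>l<Suc n. pconst (if l < n then b l else 0) * f l)" by simp
    then show ?thesis unfolding span_def by (intro exI)
  qed
  have indep: "\<forall>l<c. a l = 0" if a: "\<forall>j\<in>V. (\<Sum>l<c. a l * gradient_q (f l) j) = 0" for a
  proof -
    have "\<forall>l<Suc c. (if l < c then a l else 0) = 0"
      by (rule Suc.prems) (use a in simp)
    then show ?thesis by (metis less_SucI)
  qed
  have "\<exists>P g. finite P \<and> P \<subseteq> V \<and> (\<forall>p\<in>P. span c (g p))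
    \<and> (\<forall>p\<in>P. \<forall>q\<in>P. gradient_q (g p) q = (if p = q then 1 else 0))
    \<and> (\<forall>l<c. f l = (\<Sum>p\<in>P. pconst (gradient_q (f l) p) * g p))"
    unfolding span_def by (rule Suc.IH) (rule indep)
  then obtain P g where PG: "finite P \<and> P \<subseteq> V \<and> (\<forall>p\<in>P. span c (g p))
    \<and> (\<forall>p\<in>P. \<forall>q\<in>P. gradient_q (g p) q = (if p = q then 1 else 0))
    \<and> (\<forall>l<c. f l = (\<Sum>p\<in>P. pconst (gradient_q (f l) p) * g p))"
    by (elim exE) (erule that)
  then have P: "finite P" "P \<subseteq> V" "\<And>p. p \<in> P \<Longrightarrow> span c (g p)"
    "\<And>p q. p \<in> P \<Longrightarrow> q \<in> P \<Longrightarrow> gradient_q (g p) q = (if p = q then 1 else 0)"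
    by (blast, blast, blast, blast)
  have fP: "\<And>l. l < c \<Longrightarrow> f l = (\<Sum>p\<in>P. pconst (gradient_q (f l) p) * g p)"
    using conjunct2[OF conjunct2[OF conjunct2[OF conjunct2[OF PG]]]] by blast
  \<comment> \<open>Subtracting s clears the gradient of the new equation in all pivot directions.
    By independence some other entry j of the gradient of v is nonzero; it becomes the new
    pivot.\<close>
  define s where "s = (\<Sum>p\<in>P. pconst (gradient_q (f c) p) * g p)"
  define v where "v = f c - s"
  have span_zero: "span c 0" unfolding span_def by (intro exI[of _ "\<lambda>_. 0"]) simp
  have span_add: "span n (h + h')" if hh: "span n h" "span n h'" for n h h'
    using span_diff[OF hh(1) span_mult[OF hh(2), of "- 1"]] by (simp add: pconst_minus)
  have "span c (\<Sum>p\<in>A. pconst (gradient_q (f c) p) * g p)" if "A \<subseteq> P" for A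
    using finite_subset[OF that P(1)] that
    by (induction A rule: finite_induct) (auto simp: span_zero intro!: span_add span_mult P(3))
  then have "span c s" unfolding s_def by blast
  then obtain b where b: "s = (\<Sum>l<c. pconst (b l) * f l)" unfolding span_def by blast
  define a where "a l = (if l < c then - b l else 1)" for l
  have "(\<Sum>l<c. pconst (a l) * f l) = - (\<Sum>l<c. pconst (b l) * f l)"
    unfolding sum_negf[symmetric] by (intro sum.cong refl) (simp add: a_def pconst_minus)
  then have v: "v = (\<Sum>l<Suc c. pconst (a l) * f l)"
    by (simp add: v_def b a_def)
  have "\<not> (\<forall>j\<in>V. (\<Sum>l<Suc c. a l * gradient_q (f l) j) = 0)"
  proof
    assume "\<forall>j\<in>V. (\<Sum>l<Suc c. a l * gradient_q (f l) j) = 0"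
    from Suc.prems[OF this] have "a c = 0" by blast
    then show False by (simp add: a_def)
  qed
  moreover have "gradient_q v j = (\<Sum>l<Suc c. a l * gradient_q (f l) j)" for j
    unfolding v gradient_q_sum gradient_q_pconst_mult ..
  ultimately obtain j where j: "j \<in> V" "gradient_q v j \<noteq> 0" by auto
  have grad_s: "gradient_q s q = (\<Sum>p\<in>P. gradient_q (f c) p * gradient_q (g p) q)" for q
    by (simp add: s_def gradient_q_sum gradient_q_pconst_mult)
  have v0: "gradient_q v q = 0" if "q \<in> P" for q
  proof -
    have "gradient_q s q = (\<Sum>p\<in>P. if p = q then gradient_q (f c) q else 0)"
      unfolding grad_s using that by (intro sum.cong refl) (simp add: P(4))
    then show ?thesis using that P(1) by (simp add: v_def gradient_q_diff)
  qed
  then have jP: "j \<notin> P" using j(2) by blast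
  define r where "r = pconst (1 / gradient_q v j) * v"
  have v_r: "v = pconst (gradient_q v j) * r"
    using j(2) by (simp add: r_def mult.assoc[symmetric] pconst_mult[symmetric])
  define g' where "g' p = (if p = j then r else g p - pconst (gradient_q (g p) j) * r)" for p
  have r: "gradient_q r j = 1" "\<And>q. q \<in> P \<Longrightarrow> gradient_q r q = 0"
    using j(2) v0 by (simp_all add: r_def gradient_q_pconst_mult)
  have sum: "(\<Sum>p\<in>P. pconst (e p) * g p)
      = (\<Sum>p\<in>P. pconst (e p) * g' p) + pconst (\<Sum>p\<in>P. e p * gradient_q (g p) j) * r" for e
  proof -
    have "pconst (e p) * g p = pconst (e p) * g' p + pconst (e p * gradient_q (g p) j) * r"
      if "p \<in> P" for p
    proof -
      have "p \<noteq> j" using that jP by blast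
      then show ?thesis by (simp add: g'_def right_diff_distrib pconst_mult mult.assoc)
    qed
    moreover have "pconst (sum h A) = (\<Sum>p\<in>A. pconst (h p))" for h :: "nat \<Rightarrow> 'k" and A
      by (induction A rule: infinite_finite_induct) (simp_all add: pconst_add)
    ultimately show ?thesis by (simp add: sum.distrib sum_distrib_right)
  qed
  have sum': "(\<Sum>p\<in>insert j P. pconst (e p) * g' p) = (\<Sum>p\<in>P. pconst (e p) * g' p) + pconst (e j) * r" for e
    using P(1) jP by (simp add: g'_def add.commute)
  have span_v: "span (Suc c) v" unfolding span_def using v by (intro exI)
  have span_r: "span (Suc c) r" unfolding r_def by (rule span_mult[OF span_v])
  show ?case
    unfolding span_def[symmetric]
  proof (intro exI[of _ "insert j P"] exI[of _ g'] conjI ballI allI impI)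
    show "finite (insert j P)" "insert j P \<subseteq> V" using P(1,2) j(1) by auto
    show "span (Suc c) (g' p)" if "p \<in> insert j P" for p
    proof (cases "p = j")
      case False
      then have "p \<in> P" using that by blast
      then have "span (Suc c) (g p - pconst (gradient_q (g p) j) * r)"
        by (intro span_diff[OF span_Suc[OF P(3)] span_mult[OF span_r]])
      then show ?thesis using False by (simp add: g'_def)
    qed (simp add: g'_def span_r)
    show "gradient_q (g' p) q = (if p = q then 1 else 0)" if "p \<in> insert j P" "q \<in> insert j P" for p q
      using that jP r P(4) by (auto simp: g'_def gradient_q_diff gradient_q_pconst_mult)
    show "f l = (\<Sum>p\<in>insert j P. pconst (gradient_q (f l) p) * g' p)" if l: "l < Suc c" for l
    proof (cases "l < c")
      case True
      have "gradient_q (f l) j = (\<Sum>p\<in>P. gradient_q (f l) p * gradient_q (g p) j)"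
        using arg_cong[OF fP[OF True], of "\<lambda>h. gradient_q h j"]
        by (simp add: gradient_q_sum gradient_q_pconst_mult)
      then show ?thesis unfolding sum' using fP[OF True] sum[of "gradient_q (f l)"] by simp
    next
      case False
      then have lc: "l = c" using l by simp
      define \<alpha> \<beta> where "\<alpha> = gradient_q s j" and "\<beta> = gradient_q v j"
      have s: "s = (\<Sum>p\<in>P. pconst (gradient_q (f c) p) * g' p) + pconst \<alpha> * r"
        unfolding \<alpha>_def grad_s by (simp only: s_def sum)
      have v: "v = pconst \<beta> * r" unfolding \<beta>_def by (rule v_r)
      have "f c = s + v" by (simp add: v_def)
      also have "\<dots> = (\<Sum>p\<in>P. pconst (gradient_q (f c) p) * g' p) + pconst (\<alpha> + \<beta>) * r"
        unfolding s v by (simp add: pconst_add distrib_right)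
      also have "\<alpha> + \<beta> = gradient_q (f c) j"
        by (simp add: \<alpha>_def \<beta>_def v_def gradient_q_diff)
      finally show ?thesis unfolding sum' lc .
    qed
  qed
qed

lemma genideal_subset_combinations:
  fixes g :: "nat \<Rightarrow> 'k::comm_ring_1 mpoly"
  assumes "finite P" "\<And>p. p \<in> P \<Longrightarrow> g p \<in> polys V" "\<And>x. x \<in> X \<Longrightarrow> \<exists>h. (\<forall>p\<in>P. h p \<in> polys V) \<and> x = (\<Sum>p\<in>P. g p * h p)"
    and "y \<in> genideal (poly_ring V) X"
  shows "\<exists>h. (\<forall>p\<in>P. h p \<in> polys V) \<and> y = (\<Sum>p\<in>P. g p * h p)"
proof -
  define B where "B = {y. \<exists>h. (\<forall>p\<in>P. h p \<in> polys V) \<and> y = (\<Sum>p\<in>P. g p * h p)}"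
  interpret cring "poly_ring V :: 'k mpoly ring" by (rule cring_poly_ring)
  have B_mult: "u * y \<in> B" if uy: "u \<in> polys V" "y \<in> B" for u y
  proof -
    obtain h where "\<forall>p\<in>P. h p \<in> polys V" "y = (\<Sum>p\<in>P. g p * h p)" using uy(2) unfolding B_def by blast
    then have "u * y = (\<Sum>p\<in>P. g p * (u * h p))" "\<forall>p\<in>P. u * h p \<in> polys V"
      using uy(1) by (auto simp: sum_distrib_left mult.left_commute)
    then show ?thesis unfolding B_def by (intro CollectI exI[of _ "\<lambda>p. u * h p"] conjI)
  qed
  have B_add: "x + y \<in> B" if xy: "x \<in> B" "y \<in> B" for x y
  proof -
    obtain h h' where "\<forall>p\<in>P. h p \<in> polys V" "x = (\<Sum>p\<in>P. g p * h p)"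
      "\<forall>p\<in>P. h' p \<in> polys V" "y = (\<Sum>p\<in>P. g p * h' p)" using xy unfolding B_def by blast
    then have "x + y = (\<Sum>p\<in>P. g p * (h p + h' p))" "\<forall>p\<in>P. h p + h' p \<in> polys V"
      by (auto simp: distrib_left sum.distrib)
    then show ?thesis unfolding B_def by (intro CollectI exI[of _ "\<lambda>p. h p + h' p"] conjI)
  qed
  have B_zero: "0 \<in> B" unfolding B_def by (intro CollectI exI[of _ "\<lambda>_. 0"]) simp
  have B_polys: "B \<subseteq> polys V" using assms(2) by (auto simp: B_def)
  have neg: "\<ominus>\<^bsub>poly_ring V\<^esub> y = - y" if "y \<in> polys V" for y :: "'k mpoly"
    using that by (intro minus_equality) (auto simp: poly_ring_def)
  have "ideal B (poly_ring V)"
  proof (rule idealI)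
    show "ring (poly_ring V :: 'k mpoly ring)" by (rule ring_axioms)
    show "subgroup B (add_monoid (poly_ring V))"
    proof (rule add.subgroupI)
      show "B \<subseteq> carrier (poly_ring V)" using B_polys by (simp add: poly_ring_def)
      show "B \<noteq> {}" using B_zero by blast
      show "\<ominus>\<^bsub>poly_ring V\<^esub> y \<in> B" if "y \<in> B" for y
      proof -
        have "y \<in> polys V" using that B_polys by blast
        moreover have "- 1 * y \<in> B" by (rule B_mult[OF polys_minus[OF one_polys] that])
        ultimately show ?thesis using neg by simp
      qed
      show "x \<oplus>\<^bsub>poly_ring V\<^esub> y \<in> B" if "x \<in> B" "y \<in> B" for x y
        using B_add[OF that] by (simp add: poly_ring_def)
    qed
    show "x \<otimes>\<^bsub>poly_ring V\<^esub> y \<in> B" if "y \<in> B" "x \<in> carrier (poly_ring V)" for x y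
      using B_mult[of x y] that by (simp add: poly_ring_def)
    show "y \<otimes>\<^bsub>poly_ring V\<^esub> x \<in> B" if "y \<in> B" "x \<in> carrier (poly_ring V)" for x y
      using B_mult[of x y] that by (simp add: poly_ring_def mult.commute)
  qed
  moreover have "X \<subseteq> B" unfolding B_def using assms(3) by blast
  ultimately have "genideal (poly_ring V) X \<subseteq> B" by (rule genideal_minimal)
  then show ?thesis using assms(4) unfolding B_def by blast
qed

section \<open>From the chart at q to the algebraic setup\<close>

text \<open>The dictionary between the chart and the filtration: the leading coefficient in x0 of a
  form is the lowest form of its dehomogenization at the origin q.\<close>

lemma hom_component_dehomogenize:
  assumes "f \<in> forms {0..N} (int e)"
  shows "hom_component (int d) (dehomogenize 0 f) = (if d \<le> e then x0_coeff (e - d) f else 0)"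
proof -
  obtain n where n: "\<forall>m\<ge>n. f = (\<Sum>k<m. pvar 0 ^ k * x0_coeff k f)" using x0_expansion by blast
  define m where "m = n + e + 1"
  have "f = (\<Sum>k<m. pvar 0 ^ k * x0_coeff k f)" using n by (simp add: m_def)
  then have "dehomogenize 0 f = dehomogenize 0 (\<Sum>k<m. pvar 0 ^ k * x0_coeff k f)" by (rule arg_cong)
  also have "\<dots> = (\<Sum>k<m. subst (pvar(0 := 1)) (x0_coeff k f))"
    by (simp add: dehomogenize_eq_subst subst_sum subst_mult subst_power)
  also have "\<dots> = (\<Sum>k<m. x0_coeff k f)"
    using x0_coeff_forms[OF assms] by (intro sum.cong refl subst_pvar_id) (auto simp: forms_def)
  finally have "hom_component (int d) (dehomogenize 0 f) = (\<Sum>k<m. hom_component (int d) (x0_coeff k f))"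
    by (simp add: hom_component_sum)
  also have "\<dots> = (\<Sum>k<m. if d \<le> e \<and> k = e - d then x0_coeff k f else 0)"
  proof (intro sum.cong refl)
    fix k
    have h: "homogeneous (int e - int k) (x0_coeff k f)" using x0_coeff_forms[OF assms, of k] by (simp add: forms_def)
    show "hom_component (int d) (x0_coeff k f) = (if d \<le> e \<and> k = e - d then x0_coeff k f else 0)"
    proof (cases "d \<le> e \<and> k = e - d")
      case True
      then have "int d = int e - int k" by auto
      then show ?thesis using True hom_component_homogeneous[OF h] by simp
    next
      case False
      then have "int d \<noteq> int e - int k" by auto
      then show ?thesis unfolding if_not_P[OF False] by (rule hom_component_other[OF h])
    qed
  qed
  also have "\<dots> = (if d \<le> e then x0_coeff (e - d) f else 0)"
    by (auto simp: m_def intro!: sum.neutral)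
  finally show ?thesis .
qed

lemma lookup_pderivative_0: "lookup (pderivative j f) 0 = gradient_q f j"
proof (induction f rule: mpoly_induct)
  case (single m b)
  have "m - Poly_Mapping.single j 1 = 0 \<and> lookup m j \<noteq> 0 \<longleftrightarrow> m = Poly_Mapping.single j 1" if "lookup m j \<le> 1"
    using that by (auto simp: poly_mapping_eq_iff fun_eq_iff lookup_minus lookup_single when_def)
  moreover have "m - Poly_Mapping.single j 1 \<noteq> 0 \<and> m \<noteq> Poly_Mapping.single j 1" if "lookup m j > 1"
  proof
    have "lookup (m - Poly_Mapping.single j 1) j \<noteq> 0" using that by (simp add: lookup_minus)
    then show "m - Poly_Mapping.single j 1 \<noteq> 0" by auto
    show "m \<noteq> Poly_Mapping.single j 1" using that by auto
  qed
  ultimately show ?case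
    by (cases "lookup m j > 1"; cases "lookup m j = 0")
      (auto simp: pderivative_single gradient_q_def lookup_single when_def)
next
  case zero
  show ?case by (simp add: gradient_q_def)
qed (simp_all add: pderivative_add lookup_add gradient_q_add)

text \<open>\<open>I_generators\<close> is the consequence of N_{2,p} for p >= 1 that turns
  equations of any degree into quadrics; together with \<open>I_low\<close> it says that I is
  generated by quadrics.\<close>

locale projected_ideal =
  fixes N :: nat and I :: "'k::field_char_0 mpoly set"
  assumes I_additive: "additive_set I"
    and I_mult: "\<And>f g. f \<in> I \<Longrightarrow> g \<in> polys {0..N} \<Longrightarrow> g * f \<in> I"
    and I_polys: "I \<subseteq> polys {0..N}"
    and I_hom: "\<And>f e. f \<in> I \<Longrightarrow> hom_component e f \<in> I"
    and I_low: "\<And>f e. f \<in> I \<inter> forms {0..N} e \<Longrightarrow> e \<le> 1 \<Longrightarrow> f = 0"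
    and I_center: "\<And>f e. f \<in> I \<inter> forms {0..N} (int e) \<Longrightarrow> x0_coeff e f = 0"
    and I_generators: "\<And>f e. e \<ge> 3 \<Longrightarrow> f \<in> I \<inter> forms {0..N} e
      \<Longrightarrow> \<exists>g. (\<forall>j\<in>{0..N}. g j \<in> I \<inter> forms {0..N} (e - 1)) \<and> f = (\<Sum>j\<in>{0..N}. pvar j * g j)"
    and smooth: "smooth_at_q N I"
begin

text \<open>If f is the sum of the x_j g_j, only g_0 contributes to the power e of x0: the g_j have
  degree e, and as q lies in X they do not contain that power. Descending to degree 2 shows that the
  coefficient already occurs in a quadric.\<close>

lemma linear_top_coeff:
  assumes "f \<in> I \<inter> forms {0..N} (int (Suc e))"
  shows "\<exists>F\<in>I \<inter> forms {0..N} 2. x0_coeff e f = x0_coeff 1 F"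
  using assms
proof (induction e arbitrary: f)
  case 0
  then have "f = 0" using I_low[of f 1] by simp
  then show ?case using additive_set_0[OF I_additive] by (intro bexI[of _ 0]) simp_all
next
  case (Suc e)
  show ?case
  proof (cases "e = 0")
    case True
    then show ?thesis using Suc.prems by (intro bexI[of _ f]) (simp_all add: One_nat_def)
  next
    case False
    then have "int (Suc (Suc e)) \<ge> 3" by simp
    then obtain g where g: "\<And>j. j \<in> {0..N} \<Longrightarrow> g j \<in> I \<inter> forms {0..N} (int (Suc (Suc e)) - 1)"
      "f = (\<Sum>j\<in>{0..N}. pvar j * g j)" using I_generators Suc.prems by blast
    have g1: "g j \<in> I \<inter> forms {0..N} (int (Suc e))" if "j \<in> {0..N}" for j
      using g(1)[OF that] by simp
    have "x0_coeff (Suc e) f = (\<Sum>j\<in>{0..N}. if j = 0 then x0_coeff e (g 0) else 0)"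
      unfolding g(2) x0_coeff_sum
    proof (intro sum.cong refl)
      fix j assume j: "j \<in> {0..N}"
      show "x0_coeff (Suc e) (pvar j * g j) = (if j = 0 then x0_coeff e (g 0) else 0)"
      proof (cases "j = 0")
        case False
        then have "x0_coeff (Suc e) (pvar j * g j) = pvar j * x0_coeff (Suc e) (g j)"
          by (intro x0_coeff_mult[of _ "{j}"]) auto
        then show ?thesis using False I_center[OF g1[OF j]] by simp
      qed (simp add: x0_coeff_Suc_pvar)
    qed
    also have "\<dots> = x0_coeff e (g 0)" by simp
    finally show ?thesis using Suc.IH[OF g1[of 0]] by simp
  qed
qed

text \<open>Every component of an equation in I is treated separately: q in X excludes a constant
  term in the chart, and the linear term is the coefficient provided by
  \<open>linear_top_coeff\<close>.\<close>

lemma chart_ideal_lowest_forms: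
  assumes "g \<in> chart_ideal 0 I"
  shows "g \<in> polys {1..N}" "hom_component 0 g = 0"
    "\<exists>F\<in>I \<inter> forms {0..N} 2. hom_component 1 g = x0_coeff 1 F"
proof -
  obtain f where f: "f \<in> I" "g = dehomogenize 0 f" using assms by (auto simp: chart_ideal_def)
  have "f \<in> polys {0..N}" using f(1) I_polys by blast
  then show "g \<in> polys {1..N}"
    unfolding f(2) dehomogenize_eq_subst by (rule subst_polys) (auto intro!: pvar_polys)
  obtain E where E: "finite E" "f = (\<Sum>e\<in>E. hom_component e f)" by (rule sum_hom_components)
  have fe: "hom_component e f \<in> I \<inter> forms {0..N} e" for e
    using f(1) I_polys I_hom by (auto simp: forms_def intro: hom_component_polys)
  have comp: "hom_component (int d) g = (\<Sum>e\<in>E. hom_component (int d) (dehomogenize 0 (hom_component e f)))" for d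
  proof -
    have "dehomogenize 0 f = (\<Sum>e\<in>E. dehomogenize 0 (hom_component e f))"
      unfolding dehomogenize_eq_subst subst_sum[symmetric] using E(2) by (rule arg_cong)
    then show ?thesis unfolding f(2) hom_component_sum[symmetric] by (rule arg_cong)
  qed
  have zero: "hom_component 0 (dehomogenize 0 (hom_component e f)) = 0" for e
  proof (cases "e < 0")
    case True
    then show ?thesis by (simp add: homogeneous_neg_eq_0[OF homogeneous_hom_component] dehomogenize_eq_subst)
  next
    case False
    then obtain n where n: "e = int n" by (metis nonneg_int_cases not_less)
    then show ?thesis
      using hom_component_dehomogenize[of "hom_component e f" N n 0] fe[of e] I_center[of "hom_component e f" n] by simp
  qed
  show "hom_component 0 g = 0" using comp[of 0] zero by simp
  let ?L = "\<lambda>h. \<exists>F\<in>I \<inter> forms {0..N} 2. h = x0_coeff 1 F"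
  have each: "?L (hom_component 1 (dehomogenize 0 (hom_component e f)))" for e
  proof (cases "e \<le> 0")
    case True
    then have "hom_component e f = 0" using I_low[of "hom_component e f" e] fe[of e] by simp
    then have "hom_component 1 (dehomogenize 0 (hom_component e f)) = 0" by (simp add: dehomogenize_eq_subst)
    then show ?thesis using additive_set_0[OF I_additive] by (intro bexI[of _ 0]) simp_all
  next
    case False
    then obtain n where n: "e = int (Suc n)" by (metis not_le zero_less_imp_eq_int gr0_implies_Suc)
    have "hom_component (int 1) (dehomogenize 0 (hom_component e f)) = x0_coeff n (hom_component e f)"
      using hom_component_dehomogenize[of "hom_component e f" N "Suc n" 1] fe[of e] n by (simp add: One_nat_def)
    then show ?thesis using linear_top_coeff[of "hom_component e f" n] fe[of e] n by simp
  qed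
  have add: "?L (h + h')" if hh: "?L h" "?L h'" for h h'
  proof -
    obtain F F' where "F \<in> I \<inter> forms {0..N} 2" "F' \<in> I \<inter> forms {0..N} 2" "h = x0_coeff 1 F" "h' = x0_coeff 1 F'"
      using hh by blast
    then show ?thesis
      using additive_set_add[OF I_additive] by (intro bexI[of _ "F + F'"]) (auto simp: x0_coeff_add forms_add)
  qed
  have zero: "?L 0" using additive_set_0[OF I_additive] by (intro bexI[of _ 0]) simp_all
  have "?L (\<Sum>e\<in>A. hom_component 1 (dehomogenize 0 (hom_component e f)))" for A
  proof (induction A rule: infinite_finite_induct)
    case (insert x A)
    then show ?case using add[OF each[of x]] by simp
  qed (simp_all only: sum.infinite sum.empty zero not_False_eq_True)
  then show "?L (hom_component 1 g)" using comp[of 1] by simp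
qed

lemma chart_ideal_combination:
  fixes c :: nat
  shows "(\<And>l. l < c \<Longrightarrow> f l \<in> chart_ideal 0 I) \<Longrightarrow> (\<Sum>l<c. pconst (b l) * f l) \<in> chart_ideal 0 I"
proof (induction c)
  case 0
  show ?case using additive_set_0[OF I_additive] by (auto simp: chart_ideal_def dehomogenize_eq_subst intro!: image_eqI[of _ _ 0])
next
  case (Suc c)
  then have "(\<Sum>l<c. pconst (b l) * f l) \<in> chart_ideal 0 I" "f c \<in> chart_ideal 0 I" by auto
  then obtain u v where "u \<in> I" "v \<in> I" "(\<Sum>l<c. pconst (b l) * f l) = dehomogenize 0 u" "f c = dehomogenize 0 v"
    by (auto simp: chart_ideal_def)
  then have "u + pconst (b c) * v \<in> I" "(\<Sum>l<Suc c. pconst (b l) * f l) = dehomogenize 0 (u + pconst (b c) * v)"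
    using I_mult additive_set_add[OF I_additive] by (auto simp: dehomogenize_eq_subst subst_add subst_mult)
  then show ?case by (auto simp: chart_ideal_def)
qed

theorem exists_inner_projection_setup:
  assumes "\<And>i e c. i + 1 \<le> p \<Longrightarrow> e \<ge> 3 \<Longrightarrow> c \<in> chains {0..N} i (I \<inter> forms {0..N} e)
      \<Longrightarrow> kdiff {0..N} c = 0
      \<Longrightarrow> \<exists>b\<in>chains {0..N} (Suc i) (I \<inter> forms {0..N} (e - 1)). kdiff {0..N} b = c"
  shows "\<exists>P Q a F. inner_projection_setup N P Q a I F p"
proof -
  obtain c :: nat and f where cf: "(\<forall>l<c. f l \<in> chart_ideal 0 I) \<and> (\<forall>g\<in>chart_ideal 0 I. \<exists>u\<in>polys {1..N}.
      lookup u 0 \<noteq> 0 \<and> u * g \<in> genideal (poly_ring {1..N}) (f ` {..<c}))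
    \<and> (\<forall>a. (\<forall>j\<in>{1..N}. (\<Sum>l<c. a l * gradient_q (f l) j) = 0) \<longrightarrow> (\<forall>l<c. a l = 0))"
    using smooth unfolding smooth_at_q_def by (elim exE) blast
  have f: "\<And>l. l < c \<Longrightarrow> f l \<in> chart_ideal 0 I"
    "\<And>g. g \<in> chart_ideal 0 I \<Longrightarrow> \<exists>u\<in>polys {1..N}. lookup u 0 \<noteq> 0 \<and> u * g \<in> genideal (poly_ring {1..N}) (f ` {..<c})"
    using conjunct1[OF cf] conjunct1[OF conjunct2[OF cf]] by (simp_all only:)
  have indep: "\<And>a. (\<forall>j\<in>{1..N}. (\<Sum>l<c. a l * gradient_q (f l) j) = 0) \<Longrightarrow> \<forall>l<c. a l = 0"
    using conjunct2[OF conjunct2[OF cf]] by blast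
  have "\<exists>P g. finite P \<and> P \<subseteq> {1..N} \<and> (\<forall>p\<in>P. \<exists>b. g p = (\<Sum>l<c. pconst (b l) * f l))
    \<and> (\<forall>p\<in>P. \<forall>q\<in>P. gradient_q (g p) q = (if p = q then 1 else 0))
    \<and> (\<forall>l<c. f l = (\<Sum>p\<in>P. pconst (gradient_q (f l) p) * g p))"
    by (rule gauss_elimination) (rule indep)
  then obtain P g where PG: "finite P \<and> P \<subseteq> {1..N} \<and> (\<forall>p\<in>P. \<exists>b. g p = (\<Sum>l<c. pconst (b l) * f l))
    \<and> (\<forall>p\<in>P. \<forall>q\<in>P. gradient_q (g p) q = (if p = q then 1 else 0))
    \<and> (\<forall>l<c. f l = (\<Sum>p\<in>P. pconst (gradient_q (f l) p) * g p))"
    by (elim exE) (erule that)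
  then have P: "finite P" "P \<subseteq> {1..N}" and g: "\<And>p. p \<in> P \<Longrightarrow> \<exists>b. g p = (\<Sum>l<c. pconst (b l) * f l)"
    "\<And>p q. p \<in> P \<Longrightarrow> q \<in> P \<Longrightarrow> gradient_q (g p) q = (if p = q then 1 else 0)"
    by (blast, blast, blast, blast)
  have fg: "\<And>l. l < c \<Longrightarrow> f l = (\<Sum>p\<in>P. pconst (gradient_q (f l) p) * g p)"
    using conjunct2[OF conjunct2[OF conjunct2[OF conjunct2[OF PG]]]] by blast
  \<comment> \<open>The pivots serve as P, and the remaining entries of the gradients of the reduced
    equations are the coefficients of the linear forms.\<close>
  define Q where "Q = {1..N} - P"
  define a where "a p j = gradient_q (g p) j" for p j
  interpret linear_forms "{1..N}" P Q a
    by unfold_locales (use P in \<open>auto simp: Q_def\<close>)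
  have gA: "g i \<in> chart_ideal 0 I" if "i \<in> P" for i
    using g(1)[OF that] chart_ideal_combination[of c f, OF f(1)] by auto
  note g_props = chart_ideal_lowest_forms[OF gA]
  have lin: "hom_component 1 h = (\<Sum>j\<in>{1..N}. pconst (gradient_q h j) * pvar j)" if h: "h \<in> polys {1..N}" for h :: "'k mpoly"
  proof -
    have "pderivative j (hom_component 1 h) = pconst (gradient_q h j)" for j
    proof -
      have f1: "hom_component 1 h \<in> forms {1..N} 1" using h by (simp add: forms_def hom_component_polys)
      have "pderivative j (hom_component 1 h) \<in> forms {1..N} 0" using pderivative_forms[OF f1, of j] by simp
      then have "pderivative j (hom_component 1 h) = pconst (lookup (pderivative j (hom_component 1 h)) 0)"
        by (intro homogeneous_degree_0) (simp add: forms_def)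
      also have "lookup (pderivative j (hom_component 1 h)) 0 = gradient_q (hom_component 1 h) j"
        by (rule lookup_pderivative_0)
      also have "gradient_q (hom_component 1 h) j = gradient_q h j"
        by (simp add: gradient_q_def lookup_hom_component)
      finally show ?thesis .
    qed
    then show ?thesis
      using euler_identity[of "hom_component 1 h" "{1..N}" 1] h
      by (simp add: forms_def hom_component_polys mult.commute)
  qed
  have g_lin: "hom_component 1 (g i) = lform i" if i: "i \<in> P" for i
  proof -
    have "hom_component 1 (g i) = (\<Sum>j\<in>P. pconst (gradient_q (g i) j) * pvar j) + (\<Sum>j\<in>Q. pconst (a i j) * pvar j)"
      unfolding lin[OF g_props(1)[OF i]] V_eq a_def by (rule sum.union_disjoint) (use finite_P finite_Q PQ in auto)
    also have "(\<Sum>j\<in>P. pconst (gradient_q (g i) j) * pvar j) = (\<Sum>j\<in>P. if j = i then pvar i else 0)"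
      using g(2)[OF i] by (intro sum.cong refl) auto
    finally show ?thesis using i finite_P by (simp add: lform_def)
  qed
  have "\<forall>i\<in>P. \<exists>F. F \<in> I \<inter> forms {0..N} 2 \<and> x0_coeff 1 F = lform i"
    using g_props(3) g_lin by metis
  from bchoice[OF this] obtain F where F: "\<forall>i\<in>P. F i \<in> I \<inter> forms {0..N} 2 \<and> x0_coeff 1 (F i) = lform i" ..
  \<comment> \<open>The coefficient of the power m of x0 is the component of degree n - m of \<phi>,
    which has at least that order. Smoothness places u \<phi> in the ideal of the g p for a local
    unit u, and passing from \<phi> to u \<phi> multiplies this component by the nonzero constant
    term of u.\<close>
  have top: "x0_coeff m h \<in> lideal" if h: "h \<in> I \<inter> forms {0..N} e" and m: "x0_degree_le m h" for h e m
  proof (cases "e < int m")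
    case True
    then have "x0_coeff m h = 0" using h x0_coeff_eq_0 by blast
    then show ?thesis using additive_set_0[OF lideal_additive] by simp
  next
    case False
    then obtain n where e: "e = int n" "m \<le> n" by (metis nonneg_int_cases not_less of_nat_0_le_iff of_nat_le_iff order_trans)
    have hn: "h \<in> forms {0..N} (int n)" using h e by simp
    define \<phi> where "\<phi> = dehomogenize 0 h"
    have "\<phi> \<in> chart_ideal 0 I" using h by (auto simp: \<phi>_def chart_ideal_def)
    then obtain u where u: "u \<in> polys {1..N}" "lookup u 0 \<noteq> 0" "u * \<phi> \<in> genideal (poly_ring {1..N}) (f ` {..<c})"
      using f(2) by blast
    have "\<exists>h. (\<forall>p\<in>P. h p \<in> polys {1..N}) \<and> x = (\<Sum>p\<in>P. g p * h p)" if x: "x \<in> f ` {..<c}" for x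
    proof -
      obtain l where "l < c" "x = f l" using x by auto
      then show ?thesis using fg[of l]
        by (intro exI[of _ "\<lambda>p. pconst (gradient_q x p)"]) (simp add: mult.commute)
    qed
    from genideal_subset_combinations[OF P(1) g_props(1) this u(3)]
    obtain k where k: "\<forall>p\<in>P. k p \<in> polys {1..N}" "u * \<phi> = (\<Sum>p\<in>P. g p * k p)" by blast
    have ord: "order_ge (n - m) \<phi>"
      unfolding order_ge_iff \<phi>_def hom_component_dehomogenize[OF hn]
      using m by (auto simp: x0_degree_le_def)
    have low: "hom_component (int (n - m)) \<phi> = x0_coeff m h"
      using e(2) by (simp add: \<phi>_def hom_component_dehomogenize[OF hn] del: of_nat_diff)
    have "hom_component (int (n - m)) (u * \<phi>) \<in> lideal"
      by (rule lideal_lowest_form[of g k]) (use g_props g_lin k order_ge_mult[of 0 u, OF _ ord] in auto)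
    moreover have "hom_component (int (n - m)) (u * \<phi>) = pconst (lookup u 0) * x0_coeff m h"
      using hom_component_order_mult[of 0 u, OF _ ord] low by (simp add: hom_component_0_eq)
    ultimately have "pconst (1 / lookup u 0) * (pconst (lookup u 0) * x0_coeff m h) \<in> lideal"
      using lideal_mult by simp
    then show ?thesis using u(2) by (simp add: mult.assoc[symmetric] pconst_mult[symmetric])
  qed
  have "inner_projection_setup N P Q a I F p"
  proof (intro inner_projection_setup.intro inner_projection_setup_axioms.intro linear_forms_axioms)
    show "F i \<in> I \<inter> forms {0..N} 2" "x0_coeff 1 (F i) = lform i" if "i \<in> P" for i
      using F that by blast+
  qed (fact I_additive I_mult I_low I_center top assms)+
  then show ?thesis by blast
qed

end

section \<open>The ideal of the inner projection\<close>

subsection \<open>Ideals of polynomial rings\<close>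

lemma ideal_poly_ring_iff:
  "ideal K (poly_ring V :: 'k::comm_ring_1 mpoly ring)
    \<longleftrightarrow> additive_set K \<and> K \<subseteq> polys V \<and> (\<forall>f\<in>K. \<forall>g\<in>polys V. g * f \<in> K)"
proof -
  interpret cring "poly_ring V :: 'k mpoly ring" by (rule cring_poly_ring)
  have neg: "\<ominus>\<^bsub>poly_ring V\<^esub> y = - y" if "y \<in> polys V" for y :: "'k mpoly"
    using that by (intro minus_equality) (auto simp: poly_ring_def)
  show ?thesis
  proof
    assume K: "ideal K (poly_ring V)"
    then have sub: "K \<subseteq> polys V" using ideal.Icarr[OF K] by (auto simp: poly_ring_def)
    have mult: "g * f \<in> K" if "f \<in> K" "g \<in> polys V" for f g
      using ideal.I_l_closed[OF K that(1), of g] that(2) by (simp add: poly_ring_def)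
    have "0 \<in> K" using additive_subgroup.zero_closed[OF ideal.axioms(1)[OF K]] by (simp add: poly_ring_def)
    moreover have "f - g \<in> K" if "f \<in> K" "g \<in> K" for f g
      using additive_subgroup.a_closed[OF ideal.axioms(1)[OF K] that(1) mult[OF that(2) polys_minus[OF one_polys]]]
      by (simp add: poly_ring_def)
    ultimately show "additive_set K \<and> K \<subseteq> polys V \<and> (\<forall>f\<in>K. \<forall>g\<in>polys V. g * f \<in> K)"
      using sub mult by (auto simp: additive_set_def)
  next
    assume K: "additive_set K \<and> K \<subseteq> polys V \<and> (\<forall>f\<in>K. \<forall>g\<in>polys V. g * f \<in> K)"
    show "ideal K (poly_ring V)"
    proof (rule idealI)
      show "ring (poly_ring V :: 'k mpoly ring)" by (rule ring_axioms)
      show "subgroup K (add_monoid (poly_ring V))"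
      proof (rule add.subgroupI)
        show "K \<subseteq> carrier (poly_ring V)" using K by (simp add: poly_ring_def)
        show "K \<noteq> {}" using K additive_set_0 by blast
        show "\<ominus>\<^bsub>poly_ring V\<^esub> y \<in> K" if "y \<in> K" for y
          using neg[of y] additive_set_minus[of K y] K that by auto
        show "x \<oplus>\<^bsub>poly_ring V\<^esub> y \<in> K" if "x \<in> K" "y \<in> K" for x y
          using additive_set_add[of K x y] K that by (simp add: poly_ring_def)
      qed
      show "x \<otimes>\<^bsub>poly_ring V\<^esub> y \<in> K" if "y \<in> K" "x \<in> carrier (poly_ring V)" for x y
        using K that by (simp add: poly_ring_def)
      show "y \<otimes>\<^bsub>poly_ring V\<^esub> x \<in> K" if "y \<in> K" "x \<in> carrier (poly_ring V)" for x y
      proof -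
        have "x * y \<in> K" using K that by (simp add: poly_ring_def)
        then show ?thesis by (simp add: poly_ring_def mult.commute)
      qed
    qed
  qed
qed

lemma homogeneous_idealD:
  assumes "homogeneous_ideal V K"
  shows "additive_set K" "K \<subseteq> polys V" "\<And>f g. f \<in> K \<Longrightarrow> g \<in> polys V \<Longrightarrow> g * f \<in> K"
    "\<And>f e. f \<in> K \<Longrightarrow> hom_component e f \<in> K"
  using assms unfolding homogeneous_ideal_def ideal_poly_ring_iff by blast+

lemma primeideal_poly_ring_iff:
  "primeideal K (poly_ring V :: 'k::comm_ring_1 mpoly ring) \<longleftrightarrow> ideal K (poly_ring V) \<and> 1 \<notin> K
    \<and> (\<forall>f\<in>polys V. \<forall>g\<in>polys V. f * g \<in> K \<longrightarrow> f \<in> K \<or> g \<in> K)"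
proof
  assume K: "primeideal K (poly_ring V :: 'k mpoly ring)"
  then have i: "ideal K (poly_ring V)" by (rule primeideal.axioms(1))
  have "1 \<notin> K"
  proof
    assume "1 \<in> K"
    then have "g \<in> K" if "g \<in> polys V" for g
      using i that unfolding ideal_poly_ring_iff by (metis mult.right_neutral)
    then have "carrier (poly_ring V) = K"
      using i unfolding ideal_poly_ring_iff by (auto simp: poly_ring_def)
    then show False using primeideal.I_notcarr[OF K] by blast
  qed
  then show "ideal K (poly_ring V) \<and> 1 \<notin> K \<and> (\<forall>f\<in>polys V. \<forall>g\<in>polys V. f * g \<in> K \<longrightarrow> f \<in> K \<or> g \<in> K)"
    using i primeideal.I_prime[OF K] by (auto simp: poly_ring_def)
next
  assume K: "ideal K (poly_ring V) \<and> 1 \<notin> K \<and> (\<forall>f\<in>polys V. \<forall>g\<in>polys V. f * g \<in> K \<longrightarrow> f \<in> K \<or> g \<in> K)"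
  show "primeideal K (poly_ring V :: 'k mpoly ring)"
  proof (rule primeidealI)
    show "ideal K (poly_ring V)" using K by blast
    show "cring (poly_ring V :: 'k mpoly ring)" by (rule cring_poly_ring)
    show "carrier (poly_ring V) \<noteq> K" using K one_polys[of V] by (auto simp: poly_ring_def)
    show "f \<in> K \<or> g \<in> K" if "f \<in> carrier (poly_ring V)" "g \<in> carrier (poly_ring V)"
      "f \<otimes>\<^bsub>poly_ring V\<^esub> g \<in> K" for f g
      using K that by (auto simp: poly_ring_def)
  qed
qed

lemma proj_pointsD:
  assumes "K \<in> proj_points V"
  shows "homogeneous_ideal V K" "1 \<notin> K" "\<And>f g. f \<in> polys V \<Longrightarrow> g \<in> polys V \<Longrightarrow> f * g \<in> K \<Longrightarrow> f \<in> K \<or> g \<in> K"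
    "\<not> pvar ` V \<subseteq> K"
  using assms unfolding proj_points_def primeideal_poly_ring_iff by blast+

lemma prime_power:
  assumes "1 \<notin> K" "\<And>f g. f \<in> polys V \<Longrightarrow> g \<in> polys V \<Longrightarrow> f * g \<in> K \<Longrightarrow> f \<in> K \<or> g \<in> K"
    and "f \<in> polys V" "f ^ n \<in> K"
  shows "f \<in> K"
  using assms(4)
proof (induction n)
  case (Suc n)
  then show ?case using assms(2)[of f "f ^ n"] assms(3) by auto
qed (use assms(1) in simp)

text \<open>By Euler's identity a form of positive degree is, up to the factor e, a combination of
  the variables.\<close>

lemma form_in_ideal_of_variables:
  fixes f :: "'k::field_char_0 mpoly"
  assumes "f \<in> forms W (int e)" "e > 0" "finite W" "W \<subseteq> V" "additive_set K"
    and "\<And>f g. f \<in> K \<Longrightarrow> g \<in> polys V \<Longrightarrow> g * f \<in> K" "pvar ` W \<subseteq> K"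
  shows "f \<in> K"
proof -
  have "pderivative j f * pvar j \<in> K" if "j \<in> W" for j
  proof (rule assms(6))
    have "pderivative j f \<in> polys W" using assms(1) by (simp add: forms_def pderivative_polys)
    then show "pderivative j f \<in> polys V" using polys_mono assms(4) by blast
    show "pvar j \<in> K" using assms(7) that by blast
  qed
  then have "(\<Sum>j\<in>W. pvar j * pderivative j f) \<in> K"
    by (intro additive_set_sum assms(5)) (simp add: mult.commute)
  then have "of_nat e * f \<in> K" using euler_identity[OF assms(1,3)] by simp
  from assms(6)[OF this pconst_polys] have "pconst (1 / of_nat e) * (of_nat e * f) \<in> K" .
  moreover have "pconst (1 / of_nat e) * of_nat e = (1 :: 'k mpoly)"
    using pconst_mult[of "1 / of_nat e" "of_nat e :: 'k"] assms(2) by (simp add: pconst_of_nat)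
  ultimately show ?thesis by (simp flip: mult.assoc)
qed

lemma form_mod_variables:
  fixes f :: "'k::field_char_0 mpoly"
  assumes "f \<in> forms {0..N} (int e)" "additive_set K"
    and "\<And>f g. f \<in> K \<Longrightarrow> g \<in> polys {0..N} \<Longrightarrow> g * f \<in> K" "pvar ` {1..N} \<subseteq> K"
  shows "f - pvar 0 ^ e * x0_coeff e f \<in> K"
proof -
  obtain n where n: "\<forall>m\<ge>n. f = (\<Sum>k<m. pvar 0 ^ k * x0_coeff k f)" using x0_expansion by blast
  define m where "m = n + e + 1"
  have f: "f = (\<Sum>k<m. pvar 0 ^ k * x0_coeff k f)" using n by (simp add: m_def)
  have S: "{0..N} - {0} = {1..N}" by auto
  have "(\<Sum>k<m. pvar 0 ^ k * x0_coeff k f) = pvar 0 ^ e * x0_coeff e f + (\<Sum>k\<in>{..<m} - {e}. pvar 0 ^ k * x0_coeff k f)"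
    by (rule sum.remove) (auto simp: m_def)
  with f have "f = pvar 0 ^ e * x0_coeff e f + (\<Sum>k\<in>{..<m} - {e}. pvar 0 ^ k * x0_coeff k f)"
    by (rule trans)
  then have "f - pvar 0 ^ e * x0_coeff e f = (\<Sum>k\<in>{..<m} - {e}. pvar 0 ^ k * x0_coeff k f)"
    unfolding diff_eq_eq by (rule trans) (rule add.commute)
  moreover have "(\<Sum>k\<in>{..<m} - {e}. pvar 0 ^ k * x0_coeff k f) \<in> K"
  proof (intro additive_set_sum assms(2))
    fix k assume k: "k \<in> {..<m} - {e}"
    have form: "x0_coeff k f \<in> forms {1..N} (int e - int k)"
      using x0_coeff_forms[OF assms(1), of k] by (simp only: S)
    show "pvar 0 ^ k * x0_coeff k f \<in> K"
    proof (cases "k < e")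
      case True
      then have "x0_coeff k f \<in> forms {1..N} (int (e - k))" using form by (simp add: of_nat_diff)
      then have "x0_coeff k f \<in> K"
        by (rule form_in_ideal_of_variables[where V = "{0..N}" and K = K]) (use True assms in auto)
      then show ?thesis by (intro assms(3) polys_power pvar_polys) auto
    next
      case False
      then have "x0_coeff k f = 0" using k forms_neg[OF form] by simp
      then show ?thesis using additive_set_0[OF assms(2)] by simp
    qed
  qed
  ultimately show ?thesis by simp
qed

subsection \<open>Homogeneous primes and radicals\<close>

text \<open>If f and g are both outside K, consider their highest components outside K, of degrees s
  and t. In degree s + t every other product contributing to f g has a factor of degree above s or
  above t, hence lies in K; so the product of these two components lies in K.\<close>

lemma homogeneous_prime:
  fixes K :: "'k::field mpoly set"
  assumes K: "homogeneous_ideal V K" and "1 \<notin> K"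
    and hom: "\<And>f g d e. f \<in> forms V d \<Longrightarrow> g \<in> forms V e \<Longrightarrow> f * g \<in> K \<Longrightarrow> f \<in> K \<or> g \<in> K"
    and "f \<in> polys V" "g \<in> polys V" "f * g \<in> K"
  shows "f \<in> K \<or> g \<in> K"
proof (rule ccontr)
  note KD = homogeneous_idealD[OF K]
  assume "\<not> (f \<in> K \<or> g \<in> K)"
  then have fg: "f \<notin> K" "g \<notin> K" by auto
  have top: "\<exists>s. hom_component s h \<notin> K \<and> (\<forall>e>s. hom_component e h \<in> K)" if h: "h \<notin> K" for h
  proof -
    obtain E where E: "finite E" "h = (\<Sum>e\<in>E. hom_component e h)" by (rule sum_hom_components)
    let ?B = "{e. hom_component e h \<notin> K}"
    have "?B \<subseteq> E"
    proof
      fix d assume d: "d \<in> ?B"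
      have "hom_component d h = hom_component d (\<Sum>e\<in>E. hom_component e h)"
        using E(2) by (rule arg_cong)
      also have "\<dots> = (\<Sum>e\<in>E. if e = d then hom_component d h else 0)"
        unfolding hom_component_sum
        by (intro sum.cong refl) (simp add: hom_component_homogeneous hom_component_other[OF homogeneous_hom_component])
      also have "\<dots> = (if d \<in> E then hom_component d h else 0)" using E(1) by simp
      finally show "d \<in> E" using d additive_set_0[OF KD(1)] by (auto split: if_splits)
    qed
    then have fin: "finite ?B" using E(1) by (rule finite_subset)
    have ne: "?B \<noteq> {}"
    proof
      assume "?B = {}"
      then have "(\<Sum>e\<in>E. hom_component e h) \<in> K" by (intro additive_set_sum KD(1)) auto
      then show False using E(2) h by simp
    qed
    have "\<forall>e>Max ?B. hom_component e h \<in> K"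
      using Max_ge[OF fin] by (metis (no_types, lifting) mem_Collect_eq not_le)
    moreover have "hom_component (Max ?B) h \<notin> K" using Max_in[OF fin ne] by blast
    ultimately show ?thesis by blast
  qed
  obtain s where s: "hom_component s f \<notin> K" "\<And>e. e > s \<Longrightarrow> hom_component e f \<in> K" using top[OF fg(1)] by blast
  obtain t where t: "hom_component t g \<notin> K" "\<And>e. e > t \<Longrightarrow> hom_component e g \<in> K" using top[OF fg(2)] by blast
  obtain E where E: "finite E" "f = (\<Sum>e\<in>E. hom_component e f)" by (rule sum_hom_components)
  have hV: "hom_component e f \<in> polys V" "hom_component e g \<in> polys V" for e
    using assms(4,5) by (auto intro: hom_component_polys)
  have sE: "s \<in> E"
  proof (rule ccontr)
    assume "s \<notin> E"
    have "hom_component s f = hom_component s (\<Sum>e\<in>E. hom_component e f)"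
      using E(2) by (rule arg_cong)
    also have "\<dots> = 0"
      unfolding hom_component_sum using \<open>s \<notin> E\<close>
      by (intro sum.neutral) (auto intro!: hom_component_other[OF homogeneous_hom_component])
    finally show False using s(1) additive_set_0[OF KD(1)] by simp
  qed
  have "hom_component (s + t) (f * g) = hom_component (s + t) (\<Sum>e\<in>E. hom_component e f * g)"
    using E(2) by (metis sum_distrib_right)
  also have "\<dots> = (\<Sum>e\<in>E. hom_component e f * hom_component (s + t - e) g)"
    unfolding hom_component_sum by (intro sum.cong refl hom_component_mult) simp
  also have "\<dots> = hom_component s f * hom_component t g
      + (\<Sum>e\<in>E - {s}. hom_component e f * hom_component (s + t - e) g)"
    using sum.remove[OF E(1) sE, of "\<lambda>e. hom_component e f * hom_component (s + t - e) g"] by simp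
  finally have eq: "hom_component s f * hom_component t g = hom_component (s + t) (f * g)
      - (\<Sum>e\<in>E - {s}. hom_component e f * hom_component (s + t - e) g)" by simp
  have "(\<Sum>e\<in>E - {s}. hom_component e f * hom_component (s + t - e) g) \<in> K"
  proof (intro additive_set_sum KD(1))
    fix e assume "e \<in> E - {s}"
    then consider "e > s" | "s + t - e > t" by fastforce
    then show "hom_component e f * hom_component (s + t - e) g \<in> K"
    proof cases
      case 1
      then show ?thesis using KD(3)[OF s(2) hV(2)] by (simp add: mult.commute)
    next
      case 2
      then show ?thesis using KD(3)[OF t(2) hV(1)] by simp
    qed
  qed
  then have "hom_component s f * hom_component t g \<in> K"
    unfolding eq using KD(4)[OF assms(6)] by (intro additive_set_diff KD(1))
  then have "hom_component s f \<in> K \<or> hom_component t g \<in> K"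
    using hV by (intro hom[of _ s _ t]) (auto simp: forms_def)
  then show False using s(1) t(1) by blast
qed

lemma homogeneous_ideal_add_form:
  fixes K :: "'k::comm_ring_1 mpoly set"
  assumes K: "homogeneous_ideal V K" and a: "a \<in> forms V d"
  shows "homogeneous_ideal V {k + r * a |k r. k \<in> K \<and> r \<in> polys V}"
proof -
  note KD = homogeneous_idealD[OF K]
  define B where "B = {k + r * a |k r. k \<in> K \<and> r \<in> polys V}"
  have aV: "a \<in> polys V" "homogeneous d a" using a by (auto simp: forms_def)
  have BI: "k + r * a \<in> B" if "k \<in> K" "r \<in> polys V" for k r using that unfolding B_def by blast
  have "0 \<in> B" using BI[of 0 0] additive_set_0[OF KD(1)] by simp
  moreover have "x - y \<in> B" if xy: "x \<in> B" "y \<in> B" for x y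
  proof -
    obtain k r k' r' where "k \<in> K" "r \<in> polys V" "x = k + r * a" "k' \<in> K" "r' \<in> polys V" "y = k' + r' * a"
      using xy unfolding B_def by blast
    then show ?thesis
      using BI[of "k - k'" "r - r'"] additive_set_diff[OF KD(1)] by (auto simp: algebra_simps)
  qed
  moreover have "g * x \<in> B" if xg: "x \<in> B" "g \<in> polys V" for x g
  proof -
    obtain k r where "k \<in> K" "r \<in> polys V" "x = k + r * a" using xg unfolding B_def by blast
    then show ?thesis using BI[of "g * k" "g * r"] KD(3) xg by (auto simp: algebra_simps)
  qed
  moreover have "hom_component e x \<in> B" if x: "x \<in> B" for x e
  proof -
    obtain k r where kr: "k \<in> K" "r \<in> polys V" "x = k + r * a" using x unfolding B_def by blast
    have "hom_component e (r * a) = hom_component (e - d) r * a"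
      using hom_component_mult[OF aV(2), of e r] by (simp add: mult.commute)
    then show ?thesis
      using BI[of "hom_component e k" "hom_component (e - d) r"] KD(4) kr
      by (simp add: hom_component_add hom_component_polys)
  qed
  moreover have "B \<subseteq> polys V" using KD(2) aV unfolding B_def by auto
  ultimately have "homogeneous_ideal V B"
    unfolding homogeneous_ideal_def ideal_poly_ring_iff additive_set_def by blast
  then show ?thesis by (simp only: B_def)
qed

text \<open>Zorn's lemma is applied to homogeneous ideals containing I and no power of f. Adjoining
  a form keeps an ideal homogeneous, so a maximal one is prime with respect to forms, which is
  enough by \<open>homogeneous_prime\<close>.\<close>

lemma homogeneous_prime_avoiding:
  fixes I :: "'k::field mpoly set"
  assumes "homogeneous_ideal V I" "f \<in> polys V" "\<And>n. f ^ n \<notin> I"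
  obtains K where "homogeneous_ideal V K" "primeideal K (poly_ring V)" "I \<subseteq> K" "f \<notin> K"
proof -
  define \<A> where "\<A> = {K. homogeneous_ideal V K \<and> I \<subseteq> K \<and> (\<forall>n. f ^ n \<notin> K)}"
  have "\<exists>M\<in>\<A>. \<forall>X\<in>\<A>. M \<subseteq> X \<longrightarrow> X = M"
  proof (rule subset_Zorn_nonempty)
    show "\<A> \<noteq> {}" using assms by (auto simp: \<A>_def)
    fix \<C> assume ne: "\<C> \<noteq> {}" and chain: "subset.chain \<A> \<C>"
    have sub: "\<C> \<subseteq> \<A>" and lin: "\<And>X Y. X \<in> \<C> \<Longrightarrow> Y \<in> \<C> \<Longrightarrow> X \<subseteq> Y \<or> Y \<subseteq> X"
      using chain by (auto simp: subset_chain_def)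
    have CD: "homogeneous_ideal V X" if "X \<in> \<C>" for X using sub that by (auto simp: \<A>_def)
    note D = homogeneous_idealD[OF CD]
    have "additive_set (\<Union>\<C>)"
      unfolding additive_set_def
    proof (intro conjI ballI)
      show "0 \<in> \<Union>\<C>" using ne additive_set_0[OF D(1)] by blast
      fix a b assume "a \<in> \<Union>\<C>" "b \<in> \<Union>\<C>"
      then obtain X Y where "X \<in> \<C>" "a \<in> X" "Y \<in> \<C>" "b \<in> Y" by blast
      then obtain Z where "Z \<in> \<C>" "a \<in> Z" "b \<in> Z" using lin by blast
      then show "a - b \<in> \<Union>\<C>" using additive_set_diff[OF D(1)] by blast
    qed
    moreover have "\<Union>\<C> \<subseteq> polys V" using D(2) by blast
    moreover have "g * a \<in> \<Union>\<C>" if "a \<in> \<Union>\<C>" "g \<in> polys V" for a g using that D(3) by blast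
    moreover have "hom_component e a \<in> \<Union>\<C>" if "a \<in> \<Union>\<C>" for a e using that D(4) by blast
    ultimately have "homogeneous_ideal V (\<Union>\<C>)"
      unfolding homogeneous_ideal_def ideal_poly_ring_iff by blast
    moreover have "I \<subseteq> \<Union>\<C>" using ne sub by (auto simp: \<A>_def)
    moreover have "f ^ n \<notin> \<Union>\<C>" for n using sub by (auto simp: \<A>_def)
    ultimately show "\<Union>\<C> \<in> \<A>" by (simp add: \<A>_def)
  qed
  then obtain K where KA: "K \<in> \<A>" and max: "\<And>X. X \<in> \<A> \<Longrightarrow> K \<subseteq> X \<Longrightarrow> X = K" by blast
  have K: "homogeneous_ideal V K" "I \<subseteq> K" "\<And>n. f ^ n \<notin> K" using KA by (auto simp: \<A>_def)
  note KD = homogeneous_idealD[OF K(1)]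
  have one: "1 \<notin> K" using K(3)[of 0] by simp
  have power: "\<exists>n k r. k \<in> K \<and> r \<in> polys V \<and> f ^ n = k + r * a" if a: "a \<in> forms V d" "a \<notin> K" for a d
  proof (rule ccontr)
    assume none: "\<not> ?thesis"
    let ?B = "{k + r * a |k r. k \<in> K \<and> r \<in> polys V}"
    have KB: "K \<subseteq> ?B"
    proof
      fix k assume "k \<in> K"
      then show "k \<in> ?B" by (intro CollectI exI[of _ k] exI[of _ 0]) simp
    qed
    moreover have "?B \<in> \<A>"
      using homogeneous_ideal_add_form[OF K(1) a(1)] KB K(2) none unfolding \<A>_def by blast
    ultimately have "?B = K" using max by blast
    moreover have "a \<in> ?B"
      using additive_set_0[OF KD(1)] by (intro CollectI exI[of _ 0] exI[of _ 1]) simp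
    ultimately show False using a(2) by blast
  qed
  have "a \<in> K \<or> b \<in> K" if ab: "a \<in> forms V d" "b \<in> forms V e" "a * b \<in> K" for a b d e
  proof (rule ccontr)
    assume "\<not> (a \<in> K \<or> b \<in> K)"
    then obtain n k r m k' r' where k: "k \<in> K" "r \<in> polys V" "f ^ n = k + r * a"
      and k': "k' \<in> K" "r' \<in> polys V" "f ^ m = k' + r' * b"
      using power[OF ab(1)] power[OF ab(2)] by blast
    have aV: "a \<in> polys V" using ab(1) by (simp add: forms_def)
    have "f ^ (n + m) = f ^ m * k + (r * a) * k' + (r * r') * (a * b)"
      by (simp add: power_add k(3) algebra_simps) (simp add: k'(3) algebra_simps)
    moreover have "f ^ m * k + (r * a) * k' + (r * r') * (a * b) \<in> K"
      by (intro additive_set_add[OF KD(1)] KD(3)[OF k(1)] KD(3)[OF k'(1)] KD(3)[OF ab(3)]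
          polys_mult polys_power k(2) k'(2) aV assms(2))
    ultimately show False using K(3) by metis
  qed
  then have "\<forall>g\<in>polys V. \<forall>h\<in>polys V. g * h \<in> K \<longrightarrow> g \<in> K \<or> h \<in> K"
    using homogeneous_prime[OF K(1) one] by blast
  then have "primeideal K (poly_ring V)"
    unfolding primeideal_poly_ring_iff using K(1) one by (auto simp: homogeneous_ideal_def)
  moreover have "f \<notin> K" using K(3)[of 1] by simp
  ultimately show thesis using that K by blast
qed

section \<open>Rehomogenization, saturation and reducedness\<close>

text \<open>In a fixed degree the exponent of x_i is determined by the other exponents, so no two
  monomials merge when x_i is set to 1.\<close>

lemma dehomogenize_inj:
  assumes "homogeneous d f" "homogeneous d g" "dehomogenize i f = dehomogenize i g"
  shows "f = g"
proof -
  let ?h = "f - g"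
  have hom: "homogeneous d ?h" using assms by (intro homogeneous_diff)
  have "dehomogenize i ?h = 0" using assms(3) by (simp add: dehomogenize_eq_subst subst_diff)
  have "keys ?h = {}"
  proof (rule ccontr)
    assume "keys ?h \<noteq> {}"
    then obtain m where m: "m \<in> keys ?h" by blast
    have uniq: "n = m" if n: "n \<in> keys ?h" "Poly_Mapping.update i 0 n = Poly_Mapping.update i 0 m" for n
    proof -
      have "mono_deg n = mono_deg m" using hom n(1) m unfolding homogeneous_def by (metis of_nat_eq_iff)
      then have "lookup n i = lookup m i" using mono_deg_update_0[of n i] mono_deg_update_0[of m i] n(2) by simp
      moreover have "lookup n j = lookup m j" if "j \<noteq> i" for j
        using arg_cong[OF n(2), of "\<lambda>k. lookup k j"] that by (simp add: lookup_update)
      ultimately show ?thesis by (metis poly_mapping_eqI)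
    qed
    have "lookup (dehomogenize i ?h) (Poly_Mapping.update i 0 m)
        = (\<Sum>n\<in>keys ?h. if n = m then lookup ?h m else 0)"
      unfolding dehomogenize_def lookup_sum
      using uniq by (intro sum.cong refl) (auto simp: lookup_single when_def)
    also have "\<dots> = lookup ?h m" using m by simp
    finally show False using m \<open>dehomogenize i ?h = 0\<close> by (simp add: in_keys_iff)
  qed
  then show ?thesis by simp
qed

text \<open>An element F of I with the same dehomogenization may have components of many degrees.
  Suitable powers of x_i bring all of them to degree M + d without changing the dehomogenization,
  which then determines the form.\<close>

lemma chart_ideal_rehomogenize:
  fixes I :: "'k::comm_ring_1 mpoly set"
  assumes I: "homogeneous_ideal V I" and "i \<in> V" and f: "f \<in> forms V (int d)"
    and "dehomogenize i f \<in> chart_ideal i I"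
  shows "\<exists>m. pvar i ^ m * f \<in> I"
proof -
  note ID = homogeneous_idealD[OF I]
  obtain F where F: "F \<in> I" "dehomogenize i F = dehomogenize i f"
    using assms(4) by (auto simp: chart_ideal_def)
  obtain E where E: "finite E" "F = (\<Sum>e\<in>E. hom_component e F)" by (rule sum_hom_components)
  \<comment> \<open>\<open>insert 0\<close> keeps the maximum defined when E is empty.\<close>
  define M where "M = Max (nat ` insert 0 E)"
  have M: "nat e \<le> M" if "e \<in> E" for e unfolding M_def using that E(1) by (intro Max_ge) auto
  define G where "G = (\<Sum>e\<in>E. pvar i ^ (M + d - nat e) * hom_component e F)"
  have "G \<in> I"
    unfolding G_def using assms(2) by (intro additive_set_sum ID(1) ID(3) ID(4) F(1) polys_power pvar_polys)
  moreover have "pvar i ^ M * f = G"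
  proof (rule dehomogenize_inj)
    have "homogeneous (int M * 1 + int d) (pvar i ^ M * f)"
      using f by (intro homogeneous_mult homogeneous_power homogeneous_pvar) (simp add: forms_def)
    then show "homogeneous (int (M + d)) (pvar i ^ M * f)" by simp
    show "homogeneous (int (M + d)) G"
      unfolding G_def
    proof (rule homogeneous_sum)
      fix e assume e: "e \<in> E"
      show "homogeneous (int (M + d)) (pvar i ^ (M + d - nat e) * hom_component e F)"
      proof (cases "e < 0")
        case True
        then show ?thesis by (simp add: homogeneous_neg_eq_0[OF homogeneous_hom_component])
      next
        case False
        have "homogeneous (int (M + d - nat e) * 1 + e) (pvar i ^ (M + d - nat e) * hom_component e F)"
          by (intro homogeneous_mult homogeneous_power homogeneous_pvar) simp
        then show ?thesis using M[OF e] False by (simp add: of_nat_diff)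
      qed
    qed
    have "dehomogenize i G = (\<Sum>e\<in>E. dehomogenize i (hom_component e F))"
      unfolding G_def dehomogenize_eq_subst subst_sum by (simp add: subst_mult subst_power)
    also have "\<dots> = dehomogenize i F"
      using E(2) unfolding dehomogenize_eq_subst subst_sum[symmetric] by (rule arg_cong[OF sym])
    also note F(2)
    also have "dehomogenize i f = dehomogenize i (pvar i ^ M * f)"
      unfolding dehomogenize_eq_subst by (simp add: subst_mult subst_power)
    finally show "dehomogenize i (pvar i ^ M * f) = dehomogenize i G" ..
  qed
  ultimately show ?thesis by metis
qed

text \<open>Pigeonhole: in a monomial whose degree is the sum of the m i, some x_i has exponent at
  least m i. Thus all forms of that degree multiply f into I, and saturation applies.\<close>

lemma saturated_variable_powers:
  fixes I :: "'k::comm_ring_1 mpoly set"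
  assumes I: "homogeneous_ideal V I" "saturated V I" and V: "finite V" "V \<noteq> {}"
    and f: "f \<in> polys V" "\<And>i. i \<in> V \<Longrightarrow> \<exists>m. pvar i ^ m * f \<in> I"
  shows "f \<in> I"
proof -
  note ID = homogeneous_idealD[OF I(1)]
  obtain m where m: "\<And>i. i \<in> V \<Longrightarrow> pvar i ^ m i * f \<in> I" using f(2) by metis
  define n where "n = (\<Sum>i\<in>V. m i)"
  have mono: "Poly_Mapping.single k b * f \<in> I" if k: "keys k \<subseteq> V" "mono_deg k = n" for k and b :: 'k
  proof -
    have "\<exists>i\<in>V. m i \<le> lookup k i"
    proof (rule ccontr)
      assume "\<not> ?thesis"
      then have "(\<Sum>i\<in>V. lookup k i) < (\<Sum>i\<in>V. m i)" using V by (intro sum_strict_mono) auto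
      then show False using mono_deg_superset[OF V(1) k(1)] k(2) by (simp add: n_def)
    qed
    then obtain i where i: "i \<in> V" "m i \<le> lookup k i" by blast
    have "k = (k - Poly_Mapping.single i (m i)) + Poly_Mapping.single i (m i)"
      using i(2) by (intro poly_mapping_eqI) (auto simp: lookup_add lookup_minus lookup_single when_def)
    then have "Poly_Mapping.single k b * f
        = Poly_Mapping.single (k - Poly_Mapping.single i (m i)) b * (pvar i ^ m i * f)"
      by (simp add: pvar_power mult_single flip: mult.assoc)
    moreover have "Poly_Mapping.single (k - Poly_Mapping.single i (m i)) b \<in> polys V"
      using k(1) by (intro single_polys) (auto simp: in_keys_iff lookup_minus)
    ultimately show ?thesis using ID(3)[OF m[OF i(1)]] by simp
  qed
  have "g * f \<in> I" if g: "g \<in> forms V (int n)" for g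
  proof -
    have "(\<Sum>k\<in>keys g. Poly_Mapping.single k (lookup g k) * f) \<in> I"
      using g by (intro additive_set_sum ID(1) mono) (auto simp: forms_def polys_def homogeneous_def)
    then show ?thesis by (simp add: mpoly_expand flip: sum_distrib_right)
  qed
  then show ?thesis using I(2) f(1) unfolding saturated_def by blast
qed

text \<open>Reducedness is known on the charts only; there f lies in the ideal, rehomogenizing gives
  f times a power of each x_i, and saturation removes these powers.\<close>

lemma reduced_scheme_radical:
  fixes I :: "'k::comm_ring_1 mpoly set"
  assumes I: "homogeneous_ideal V I" "saturated V I" "reduced_scheme V I" and V: "finite V" "V \<noteq> {}"
    and f: "f \<in> forms V (int d)" "f ^ n \<in> I"
  shows "f \<in> I"
proof (rule saturated_variable_powers[OF I(1,2) V])
  show fV: "f \<in> polys V" using f(1) by (simp add: forms_def)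
  fix i assume i: "i \<in> V"
  have "dehomogenize i f \<in> polys (V - {i})"
    unfolding dehomogenize_eq_subst by (rule subst_polys[OF fV]) (auto intro!: pvar_polys)
  moreover have "dehomogenize i f ^ n \<in> chart_ideal i I"
    using f(2) by (auto simp: chart_ideal_def dehomogenize_eq_subst simp flip: subst_power)
  ultimately have "dehomogenize i f \<in> chart_ideal i I"
    using I(3) i unfolding reduced_scheme_def by blast
  then show "\<exists>m. pvar i ^ m * f \<in> I" by (rule chart_ideal_rehomogenize[OF I(1) i f(1)])
qed

subsection \<open>The inner projection\<close>

lemma center_q_ideal:
  "ideal (center_q N :: 'k::comm_ring_1 mpoly set) (poly_ring {0..N})" "pvar ` {1..N} \<subseteq> (center_q N :: 'k mpoly set)"
proof -
  interpret cring "poly_ring {0..N} :: 'k mpoly ring" by (rule cring_poly_ring)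
  have X: "pvar ` {1..N} \<subseteq> carrier (poly_ring {0..N} :: 'k mpoly ring)"
    by (auto simp: poly_ring_def intro!: pvar_polys)
  show "ideal (center_q N :: 'k mpoly set) (poly_ring {0..N})"
    unfolding center_q_def by (rule genideal_ideal[OF X])
  show "pvar ` {1..N} \<subseteq> (center_q N :: 'k mpoly set)"
    unfolding center_q_def by (rule genideal_self[OF X])
qed

lemma center_q_minimal:
  "ideal K (poly_ring {0..N}) \<Longrightarrow> pvar ` {1..N} \<subseteq> K \<Longrightarrow> center_q N \<subseteq> (K :: 'k::comm_ring_1 mpoly set)"
  unfolding center_q_def by (rule ring.genideal_minimal[OF cring.axioms(1)[OF cring_poly_ring]])

text \<open>Modulo the variables x_1, ..., x_N only the pure power of x0 in f survives. If it
  occurred, x0 would lie in K as well, and K would contain the irrelevant ideal.\<close>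

lemma prime_constant_power:
  fixes K :: "'k::field_char_0 mpoly set"
  assumes K: "K \<in> proj_points {0..N}" "pvar ` {1..N} \<subseteq> K" and f: "f \<in> K" "f \<in> forms {0..N} (int e)"
  shows "x0_coeff e f = 0"
proof (rule ccontr)
  assume ne: "x0_coeff e f \<noteq> 0"
  note KP = proj_pointsD[OF K(1)] and KD = homogeneous_idealD[OF proj_pointsD(1)[OF K(1)]]
  have S: "{0..N} - {0} = {1..N}" by auto
  have "x0_coeff e f \<in> forms {1..N} 0" using x0_coeff_forms[OF f(2), of e] by (simp add: S)
  then obtain c where c: "x0_coeff e f = pconst c"
    using homogeneous_degree_0 by (auto simp: forms_def)
  have c0: "c \<noteq> 0" using ne c by auto
  have "f - pvar 0 ^ e * x0_coeff e f \<in> K"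
    by (rule form_mod_variables[OF f(2) KD(1,3) K(2)])
  from additive_set_diff[OF KD(1) f(1) this] have "pvar 0 ^ e * pconst c \<in> K" by (simp add: c)
  from KD(3)[OF this pconst_polys] have "pconst (1 / c) * (pvar 0 ^ e * pconst c) \<in> K" .
  moreover have "pconst (1 / c) * (pvar 0 ^ e * pconst c) = pvar 0 ^ e"
    using c0 pconst_mult[of "1 / c" c] by (simp add: mult.left_commute)
  ultimately have p: "pvar 0 ^ e \<in> K" by simp
  have "pvar 0 \<in> K" by (rule prime_power[OF KP(2) KP(3) _ p]) (auto intro: pvar_polys)
  moreover have "{0..N} = insert 0 {1..N}" by auto
  ultimately show False using K(2) KP(4) by simp
qed

lemma project_q_proj_point:
  fixes K :: "'k::field_char_0 mpoly set"
  assumes K: "K \<in> proj_points {0..N}" "\<not> pvar ` {1..N} \<subseteq> K"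
  shows "project_q N K \<in> proj_points {1..N}"
proof -
  note KP = proj_pointsD[OF K(1)] and KD = homogeneous_idealD[OF proj_pointsD(1)[OF K(1)]]
  have mono: "f \<in> polys {0..N}" if "f \<in> polys {1..N}" for f :: "'k mpoly"
    using polys_mono[of "{1..N}" "{0..N}"] that by auto
  have i: "ideal (project_q N K) (poly_ring {1..N})"
    unfolding ideal_poly_ring_iff project_q_def
    using KD(1,3) mono by (auto simp: additive_set_def)
  moreover have "homogeneous_ideal {1..N} (project_q N K)"
    using i KD(4) by (auto simp: homogeneous_ideal_def project_q_def hom_component_polys)
  moreover have "primeideal (project_q N K) (poly_ring {1..N})"
    unfolding primeideal_poly_ring_iff using i KP(2,3) mono by (auto simp: project_q_def)
  moreover have "\<not> pvar ` {1..N} \<subseteq> project_q N K" using K(2) by (auto simp: project_q_def)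
  ultimately show ?thesis by (simp add: proj_points_def)
qed

text \<open>The centre is the only point with all of x_1, ..., x_N in its ideal, so K \<inter> S is
  a point for every other K.\<close>

lemma proj_point_center:
  fixes K :: "'k::field_char_0 mpoly set"
  assumes K: "K \<in> proj_points {0..N}" "pvar ` {1..N} \<subseteq> K"
  shows "K = center_q N"
proof
  note KD = homogeneous_idealD[OF proj_pointsD(1)[OF K(1)]]
  note C = center_q_ideal[of N, where 'k='k]
  have CD: "additive_set (center_q N :: 'k mpoly set)"
    "\<And>f g. f \<in> (center_q N :: 'k mpoly set) \<Longrightarrow> g \<in> polys {0..N} \<Longrightarrow> g * f \<in> center_q N"
    using C(1) unfolding ideal_poly_ring_iff by blast+
  show "K \<subseteq> center_q N"
  proof
    fix f assume f: "f \<in> K"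
    obtain E where E: "finite E" "f = (\<Sum>e\<in>E. hom_component e f)" by (rule sum_hom_components)
    have "hom_component e f \<in> center_q N" for e
    proof (cases "e < 0")
      case True
      then show ?thesis
        using additive_set_0[OF CD(1)] by (simp add: homogeneous_neg_eq_0[OF homogeneous_hom_component])
    next
      case False
      then obtain d where d: "e = int d" by (metis nonneg_int_cases not_less)
      have fe: "hom_component e f \<in> forms {0..N} (int d)"
        using f KD(2) d by (auto simp: forms_def intro: hom_component_polys)
      have "x0_coeff d (hom_component e f) = 0"
        by (rule prime_constant_power[OF K KD(4)[OF f] fe])
      then show ?thesis using form_mod_variables[OF fe CD C(2)] by simp
    qed
    then have "(\<Sum>e\<in>E. hom_component e f) \<in> center_q N" by (intro additive_set_sum CD(1))
    then show "f \<in> center_q N" using E(2) by simp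
  qed
  show "center_q N \<subseteq> K"
    using KD(1-3) K(2) by (intro center_q_minimal) (auto simp: ideal_poly_ring_iff)
qed

text \<open>A form of positive degree in S but outside I avoids some homogeneous prime K over I,
  because I is radical on forms. Being a form in the variables of S, it keeps K from containing all
  of them, so K is not the centre and has an image under the projection, on which the form does not
  vanish.\<close>

theorem inner_projection_ideal_eq:
  fixes I :: "'k::field_char_0 mpoly set"
  assumes N: "1 \<le> N" and I: "closed_subscheme_ideal {0..N} I" "reduced_scheme {0..N} I"
    "nondegenerate {0..N} I"
  shows "inner_projection_ideal N I = I \<inter> polys {1..N}"
proof
  have hI: "homogeneous_ideal {0..N} I" "saturated {0..N} I" using I(1) by (auto simp: closed_subscheme_ideal_def)
  note ID = homogeneous_idealD[OF hI(1)]
  have S_R: "{1..N} \<subseteq> {0..N}" by auto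
  have prime: "\<exists>K\<in>proj_zeros {0..N} I - {center_q N}. f \<notin> K"
    if f: "f \<in> forms {1..N} (int e)" "e > 0" "f \<notin> I" for f e
  proof -
    have fR: "f \<in> forms {0..N} (int e)" using forms_mono[OF S_R f(1)] .
    then have "f ^ n \<notin> I" for n
      using reduced_scheme_radical[OF hI I(2) _ _ fR, of n] f(3) by auto
    then obtain K where K: "homogeneous_ideal {0..N} K" "primeideal K (poly_ring {0..N})" "I \<subseteq> K" "f \<notin> K"
      using homogeneous_prime_avoiding[OF hI(1)] fR by (auto simp: forms_def)
    note KD = homogeneous_idealD[OF K(1)]
    have nS: "\<not> pvar ` {1..N} \<subseteq> K"
      using form_in_ideal_of_variables[OF f(1,2) _ S_R KD(1,3)] K(4) by auto
    then have "\<not> pvar ` {0..N} \<subseteq> K" using S_R by blast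
    then have "K \<in> proj_zeros {0..N} I" using K by (simp add: proj_zeros_def proj_points_def)
    moreover have "K \<noteq> center_q N" using nS center_q_ideal(2)[of N, where 'k='k] by blast
    ultimately show ?thesis using K(4) by blast
  qed
  have closure: "project_q N K \<in> inner_projection N I" if "K \<in> proj_zeros {0..N} I - {center_q N}" for K
    using that project_q_proj_point[of K N] proj_point_center[of K N]
    by (auto simp: inner_projection_def zariski_closure_def proj_zeros_def)
  show "inner_projection_ideal N I \<subseteq> I \<inter> polys {1..N}"
  proof
    fix f assume f: "f \<in> inner_projection_ideal N I"
    then have fS: "f \<in> polys {1..N}" by (simp add: inner_projection_ideal_def vanishing_ideal_def)
    have fK: "hom_component e f \<in> K" if "K \<in> proj_zeros {0..N} I - {center_q N}" for K e
    proof -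
      have "f \<in> project_q N K"
        using closure[OF that] f by (simp add: inner_projection_ideal_def vanishing_ideal_def)
      then have "f \<in> K" by (simp add: project_q_def)
      moreover have "homogeneous_ideal {0..N} K" using that by (simp add: proj_zeros_def proj_points_def)
      ultimately show ?thesis using homogeneous_idealD(4) by blast
    qed
    have "hom_component e f \<in> I" for e
    proof (rule ccontr)
      assume notin: "hom_component e f \<notin> I"
      have form: "hom_component e f \<in> forms {1..N} e" using fS by (simp add: forms_def hom_component_polys)
      consider "e < 0" | "e = 0" | "e > 0" by linarith
      then show False
      proof cases
        case 1
        then show ?thesis using notin forms_neg[OF form] additive_set_0[OF ID(1)] by simp
      next
        \<comment> \<open>A constant needs some point of X other than q to be excluded. As x_1 is
          not in I by nondegeneracy, the argument for positive degree supplies one.\<close>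
        case 2
        have x1: "pvar 1 \<in> forms {1..N} (int 1)" using N by (simp add: pvar_forms)
        then have "pvar 1 \<notin> I"
          using I(3) forms_mono[OF S_R x1] by (auto simp: nondegenerate_def)
        then obtain K where K: "K \<in> proj_zeros {0..N} I - {center_q N}" using prime[OF x1] by auto
        then have Kp: "K \<in> proj_points {0..N}" by (simp add: proj_zeros_def)
        have c: "hom_component e f = pconst (lookup f 0)" unfolding 2 by (rule hom_component_0_eq)
        have "lookup f 0 \<noteq> 0" using notin c additive_set_0[OF ID(1)] by auto
        moreover have "pconst (1 / lookup f 0) * pconst (lookup f 0) \<in> K"
          using fK[OF K, of e] c homogeneous_idealD(3)[OF proj_pointsD(1)[OF Kp]] by simp
        ultimately have "1 \<in> K" by (simp flip: pconst_mult)
        then show ?thesis using proj_pointsD(2)[OF Kp] by blast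
      next
        case 3
        then obtain d where "e = int d" "d > 0" by (metis zero_less_imp_eq_int)
        then show ?thesis using prime[of "hom_component e f" d] form notin fK by blast
      qed
    qed
    moreover obtain E where "finite E" "f = (\<Sum>e\<in>E. hom_component e f)" by (rule sum_hom_components)
    ultimately have "f \<in> I" by (metis additive_set_sum[OF ID(1)])
    then show "f \<in> I \<inter> polys {1..N}" using fS by blast
  qed
  show "I \<inter> polys {1..N} \<subseteq> inner_projection_ideal N I"
  proof
    fix f assume f: "f \<in> I \<inter> polys {1..N}"
    have "project_q N ` (proj_zeros {0..N} I - {center_q N}) \<subseteq> proj_zeros {1..N} {f}"
    proof (rule image_subsetI)
      fix K assume K: "K \<in> proj_zeros {0..N} I - {center_q N}"
      then have "project_q N K \<in> proj_points {1..N}"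
        using project_q_proj_point[of K N] proj_point_center[of K N] by (auto simp: proj_zeros_def)
      then show "project_q N K \<in> proj_zeros {1..N} {f}"
        using K f by (auto simp: proj_zeros_def project_q_def)
    qed
    then have "f \<in> K" if "K \<in> inner_projection N I" for K
      using that f unfolding inner_projection_def zariski_closure_def proj_zeros_def[of "{1..N}"] by blast
    then show "f \<in> inner_projection_ideal N I"
      using f by (simp add: inner_projection_ideal_def vanishing_ideal_def)
  qed
qed

section \<open>Tor as Koszul homology\<close>

definition coset :: "'a set \<Rightarrow> 'a \<Rightarrow> 'a::ab_group_add set" where
  "coset B z = (\<lambda>h. h + z) ` B"

lemma coset_iff: "x \<in> coset B z \<longleftrightarrow> x - z \<in> B"
  unfolding coset_def by (metis (no_types, lifting) add_diff_cancel diff_add_cancel image_iff)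

lemma coset_eq_iff:
  assumes "additive_set B" shows "coset B z = coset B z' \<longleftrightarrow> z - z' \<in> B"
proof
  assume "coset B z = coset B z'"
  moreover have "z \<in> coset B z" using additive_set_0[OF assms] by (simp add: coset_iff)
  ultimately show "z - z' \<in> B" by (simp add: coset_iff)
next
  assume zz': "z - z' \<in> B"
  have "x - z \<in> B \<longleftrightarrow> x - z' \<in> B" for x
    using additive_set_add[OF assms, of "x - z" "z - z'"] additive_set_diff[OF assms, of "x - z'" "z - z'"] zz'
    by auto
  then show "coset B z = coset B z'" by (auto simp: coset_iff)
qed

lemma coset_0: "coset B 0 = B"
  by (auto simp: coset_def)

text \<open>With B' = B this is addition in a quotient; with B' smaller and z' = 0 it is the map of
  quotients by B' and B induced by an inclusion.\<close>

lemma sum_coset: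
  assumes "additive_set B" "additive_set B'" "B' \<subseteq> B"
  shows "(\<Union>x\<in>coset B' z. \<Union>y\<in>coset B z'. {x + y}) = coset B (z + z')"
proof -
  have "\<exists>x\<in>coset B' z. \<exists>y\<in>coset B z'. w = x + y" if w: "w \<in> coset B (z + z')" for w
  proof (intro bexI)
    show "w = z + (w - z)" by simp
    show "z \<in> coset B' z" using additive_set_0[OF assms(2)] by (simp add: coset_iff)
    show "w - z \<in> coset B z'" using w by (simp add: coset_iff algebra_simps)
  qed
  moreover have "x + y \<in> coset B (z + z')" if xy: "x \<in> coset B' z" "y \<in> coset B z'" for x y
    using additive_set_add[OF assms(1), of "x - z" "y - z'"] xy assms(3) by (auto simp: coset_iff algebra_simps)
  ultimately show ?thesis by blast
qed

text \<open>The union over representatives in the scalar multiplication of a quotient collapses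
  because all of them give the same coset.\<close>

lemma scaled_coset:
  assumes "additive_set B" "\<And>x y. s (x - y) = s x - s y" "\<And>x. x \<in> B \<Longrightarrow> s x \<in> B"
  shows "(\<Union>x\<in>coset B z. coset B (s x)) = coset B (s z)"
proof -
  have "coset B (s x) = coset B (s z)" if "x \<in> coset B z" for x
    using that assms(3)[of "x - z"] by (simp add: coset_eq_iff[OF assms(1)] coset_iff assms(2))
  moreover have "z \<in> coset B z" using additive_set_0[OF assms(1)] by (simp add: coset_iff)
  ultimately show ?thesis by blast
qed

subsection \<open>Koszul homology of a quotient ring\<close>

text \<open>Used with the coset map onto the quotient ring and with the identity on an ideal;
  \<open>K\<close> is the domain on which \<phi> is additive.\<close>

lemma finsum_transfer:
  assumes "abelian_monoid M" "finite A" "\<And>j. j \<in> A \<Longrightarrow> \<phi> (f j) \<in> carrier M" "\<phi> 0 = \<zero>\<^bsub>M\<^esub>"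
    and "\<And>a b. a \<in> K \<Longrightarrow> b \<in> K \<Longrightarrow> \<phi> (a + b) = \<phi> a \<oplus>\<^bsub>M\<^esub> \<phi> b" "\<And>j. j \<in> A \<Longrightarrow> f j \<in> K" "additive_set K"
  shows "(\<Oplus>\<^bsub>M\<^esub>j\<in>A. \<phi> (f j)) = \<phi> (\<Sum>j\<in>A. f j)"
  using assms(2,3,6)
proof (induction A rule: finite_induct)
  case empty
  show ?case by (simp add: abelian_monoid.finsum_empty[OF assms(1)] assms(4))
next
  case (insert x A)
  have "(\<Oplus>\<^bsub>M\<^esub>j\<in>insert x A. \<phi> (f j)) = \<phi> (f x) \<oplus>\<^bsub>M\<^esub> (\<Oplus>\<^bsub>M\<^esub>j\<in>A. \<phi> (f j))"
    using insert by (intro abelian_monoid.finsum_insert[OF assms(1)]) auto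
  also have "(\<Oplus>\<^bsub>M\<^esub>j\<in>A. \<phi> (f j)) = \<phi> (\<Sum>j\<in>A. f j)" using insert by auto
  also have "\<phi> (f x) \<oplus>\<^bsub>M\<^esub> \<phi> (\<Sum>j\<in>A. f j) = \<phi> (f x + (\<Sum>j\<in>A. f j))"
    using insert.prems by (intro assms(5)[symmetric] additive_set_sum assms(7)) auto
  finally show ?case using insert.hyps by simp
qed

lemma graded_quotient_simps:
  fixes V :: "nat set" and I :: "'k::comm_ring_1 mpoly set"
  defines "M \<equiv> graded_quotient (ideal_module (polys V)) I"
  shows "carrier M = coset I ` polys V" "\<zero>\<^bsub>M\<^esub> = I" "grading M e = coset I ` forms V e"
    "C \<oplus>\<^bsub>M\<^esub> C' = (\<Union>x\<in>C. \<Union>y\<in>C'. {x + y})" "a \<odot>\<^bsub>M\<^esub> C = (\<Union>x\<in>C. coset I (a * x))"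
  unfolding M_def graded_quotient_def quotient_module_def ideal_module_def module.defs graded_module.defs
  by (auto simp: coset_def a_r_coset_def' A_RCOSETS_def' set_add_def' forms_def)

lemma graded_quotient_add:
  assumes "additive_set I"
  shows "coset I f \<oplus>\<^bsub>graded_quotient (ideal_module (polys V)) I\<^esub> coset I g = coset I (f + g)"
  unfolding graded_quotient_simps by (rule sum_coset[OF assms assms order.refl])

lemma abelian_monoid_graded_quotient:
  fixes I :: "'k::comm_ring_1 mpoly set"
  assumes "additive_set I"
  shows "abelian_monoid (graded_quotient (ideal_module (polys V)) I)"
proof -
  let ?M = "graded_quotient (ideal_module (polys V)) I"
  note add = graded_quotient_add[OF assms]
  have carrierE: "\<exists>f\<in>polys V. C = coset I f" if "C \<in> carrier ?M" for C
    using that by (auto simp: graded_quotient_simps)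
  have carrierI: "coset I f \<in> carrier ?M" if "f \<in> polys V" for f
    using that by (simp add: graded_quotient_simps)
  have zero: "\<zero>\<^bsub>?M\<^esub> = coset I 0" by (simp add: graded_quotient_simps coset_0)
  show ?thesis
  proof (rule abelian_monoidI)
    show "\<zero>\<^bsub>?M\<^esub> \<in> carrier ?M" unfolding zero by (rule carrierI) simp
    fix C D assume CD: "C \<in> carrier ?M" "D \<in> carrier ?M"
    obtain f where f: "f \<in> polys V" "C = coset I f" using carrierE[OF CD(1)] by blast
    obtain g where g: "g \<in> polys V" "D = coset I g" using carrierE[OF CD(2)] by blast
    note fg = f g
    show "C \<oplus>\<^bsub>?M\<^esub> D \<in> carrier ?M" unfolding fg add using fg by (intro carrierI polys_add)
    show "C \<oplus>\<^bsub>?M\<^esub> D = D \<oplus>\<^bsub>?M\<^esub> C" unfolding fg add by (simp only: add.commute)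
    show "\<zero>\<^bsub>?M\<^esub> \<oplus>\<^bsub>?M\<^esub> C = C" unfolding fg zero add by simp
    fix E assume E: "E \<in> carrier ?M"
    obtain h where h: "E = coset I h" using carrierE[OF E] by blast
    show "C \<oplus>\<^bsub>?M\<^esub> D \<oplus>\<^bsub>?M\<^esub> E = C \<oplus>\<^bsub>?M\<^esub> (D \<oplus>\<^bsub>?M\<^esub> E)"
      unfolding fg h add by (simp only: add.assoc)
  qed
qed

lemma koszul_diff_graded_quotient:
  fixes I :: "'k::comm_ring_1 mpoly set"
  assumes I: "additive_set I" "\<And>f g. f \<in> I \<Longrightarrow> g \<in> polys V \<Longrightarrow> g * f \<in> I" and "finite V"
    and c: "\<And>T. c T \<in> polys V"
  shows "koszul_diff V (graded_quotient (ideal_module (polys V)) I) (\<lambda>T. coset I (c T))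
    = (\<lambda>T. coset I (kdiff V c T))"
proof
  fix T
  let ?M = "graded_quotient (ideal_module (polys V)) I"
  have s: "(- 1) ^ n * pvar j \<in> polys V" if "j \<in> V" for n j
    using that by (intro polys_mult polys_power polys_minus one_polys pvar_polys)
  have smult: "a \<odot>\<^bsub>?M\<^esub> coset I f = coset I (a * f)" if "a \<in> polys V" for a f
    unfolding graded_quotient_simps using I that
    by (intro scaled_coset) (auto simp: right_diff_distrib)
  have "koszul_diff V ?M (\<lambda>T. coset I (c T)) T
      = (\<Oplus>\<^bsub>?M\<^esub>j\<in>V - T. coset I (koszul_sign j T * pvar j * c (insert j T)))"
    unfolding koszul_diff_def koszul_sign_def
  proof (rule abelian_monoid.finsum_cong'[OF abelian_monoid_graded_quotient[OF I(1)] refl])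
    show "(\<lambda>j. coset I ((- 1) ^ card {t \<in> T. t < j} * pvar j * c (insert j T))) \<in> V - T \<rightarrow> carrier ?M"
      unfolding graded_quotient_simps(1) by (intro Pi_I imageI polys_mult[OF s c]) simp
    show "((- 1) ^ card {t \<in> T. t < j} * pvar j) \<odot>\<^bsub>?M\<^esub> coset I (c (insert j T))
      = coset I ((- 1) ^ card {t \<in> T. t < j} * pvar j * c (insert j T))" if "j \<in> V - T" for j
      using that by (intro smult s) simp
  qed
  also have "\<dots> = coset I (\<Sum>j\<in>V - T. koszul_sign j T * pvar j * c (insert j T))"
  proof (rule finsum_transfer[OF abelian_monoid_graded_quotient[OF I(1)], where K = "polys V"])
    show "koszul_sign j T * pvar j * c (insert j T) \<in> polys V" if "j \<in> V - T" for j
      using that c s unfolding koszul_sign_def by (intro polys_mult) auto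
    then show "coset I (koszul_sign j T * pvar j * c (insert j T)) \<in> carrier ?M" if "j \<in> V - T" for j
      using that by (simp add: graded_quotient_simps)
    show "coset I 0 = \<zero>\<^bsub>?M\<^esub>" by (simp add: graded_quotient_simps coset_0)
    show "coset I (a + b) = coset I a \<oplus>\<^bsub>?M\<^esub> coset I b" for a b
      by (rule graded_quotient_add[OF I(1), symmetric])
  qed (use assms(3) in \<open>auto simp: additive_set_def\<close>)
  also have "\<dots> = coset I (kdiff V c T)" by (simp add: kdiff_apply[OF assms(3)])
  finally show "koszul_diff V ?M (\<lambda>T. coset I (c T)) T = coset I (kdiff V c T)" .
qed

text \<open>Choosing representatives in the polynomial ring: vanishing of Tor_i of the quotient says
  that cycles modulo I are boundaries modulo I.\<close>

lemma property_N2_chains: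
  fixes I :: "'k::comm_ring_1 mpoly set"
  assumes N2: "property_N2 V p I" and I: "homogeneous_ideal V I" and V: "finite V"
    and ij: "i \<le> p" "j \<ge> 2" and w: "w \<in> chains V i (forms V j)" "\<And>T. kdiff V w T \<in> I"
  obtains v where "v \<in> chains V (Suc i) (forms V (j - 1))" "\<And>T. (w - kdiff V v) T \<in> I"
proof -
  let ?M = "graded_quotient (ideal_module (polys V)) I" and ?d = "int i + j"
  note ID = homogeneous_idealD[OF I]
  have diff: "koszul_diff V ?M (\<lambda>T. coset I (c T)) = (\<lambda>T. coset I (kdiff V c T))"
    if "\<And>T. c T \<in> polys V" for c
    by (rule koszul_diff_graded_quotient) (use ID V that in auto)
  have coset_I: "coset I f = I \<longleftrightarrow> f \<in> I" for f
    using coset_eq_iff[OF ID(1), of f 0] by (simp add: coset_0)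
  let ?Z = "koszul_cycles V ?M i ?d" and ?B = "koszul_boundaries V ?M i ?d"
  define z where "z T = coset I (w T)" for T
  have wV: "w T \<in> polys V" for T
    using chainsD[OF w(1), of T] by (simp add: forms_def)
  have z_chain: "z \<in> koszul_chains V ?M i ?d"
    using w(1) by (auto simp: koszul_chains_def chains_def z_def graded_quotient_simps coset_0)
  moreover have "koszul_diff V ?M z = (\<lambda>_. \<zero>\<^bsub>?M\<^esub>)"
    unfolding z_def diff[OF wV] by (rule ext) (simp add: coset_I w(2) graded_quotient_simps)
  ultimately have z: "z \<in> carrier ?Z" by (simp add: koszul_cycles_def)
  have zero: "(\<lambda>T. \<zero>\<^bsub>?M\<^esub>) \<in> ?B"
  proof -
    have "I \<in> coset I ` forms V e" for e
      using coset_0[of I] forms_0 by (metis image_eqI)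
    then have "(\<lambda>T. coset I ((\<lambda>_. 0) T)) \<in> koszul_chains V ?M (i + 1) ?d"
      by (simp add: koszul_chains_def graded_quotient_simps coset_0)
    moreover have "koszul_diff V ?M (\<lambda>T. coset I ((\<lambda>_. 0) T)) = (\<lambda>T. \<zero>\<^bsub>?M\<^esub>)"
    proof -
      have "kdiff V (\<lambda>_. 0 :: 'k mpoly) = (\<lambda>_. 0)" using kdiff_0[of V] by (simp only: zero_fun_def)
      then show ?thesis by (subst diff) (simp_all add: graded_quotient_simps coset_0)
    qed
    ultimately show ?thesis unfolding koszul_boundaries_def by (metis image_eqI)
  qed
  have "carrier (Tor V ?M i ?d) = {\<zero>\<^bsub>Tor V ?M i ?d\<^esub>}" using N2 ij unfolding property_N2_def by blast
  then have "?B +>\<^bsub>?Z\<^esub> z = ?B"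
    using z unfolding Tor_def quotient_module_def by (auto simp: A_RCOSETS_def')
  \<comment> \<open>Elements of the coset have the form h + z with a boundary h; the choice h = 0
    exhibits z itself.\<close>
  moreover have "(\<lambda>T. \<zero>\<^bsub>?M\<^esub> \<oplus>\<^bsub>?M\<^esub> z T) \<in> ?B +>\<^bsub>?Z\<^esub> z"
    using zero by (auto simp: a_r_coset_def' koszul_cycles_def)
  moreover have "\<zero>\<^bsub>?M\<^esub> \<oplus>\<^bsub>?M\<^esub> z T = z T" for T
  proof (rule abelian_monoid.l_zero[OF abelian_monoid_graded_quotient[OF ID(1)]])
    show "z T \<in> carrier ?M" using wV by (simp add: z_def graded_quotient_simps)
  qed
  ultimately have "z \<in> ?B" by simp
  then obtain c where c: "c \<in> koszul_chains V ?M (i + 1) ?d" "z = koszul_diff V ?M c"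
    by (auto simp: koszul_boundaries_def)
  have cT: "if T \<subseteq> V \<and> card T = i + 1 then c T \<in> grading ?M (?d - int (i + 1)) else c T = \<zero>\<^bsub>?M\<^esub>" for T
    using c(1) unfolding koszul_chains_def by blast
  \<comment> \<open>The representatives are chosen to be 0 outside the sets T of size i + 1, so that
    they form a chain and not only one modulo I.\<close>
  have "\<forall>T. \<exists>f. (if T \<subseteq> V \<and> card T = Suc i then f \<in> forms V (j - 1) else f = 0) \<and> c T = coset I f"
  proof
    fix T
    show "\<exists>f. (if T \<subseteq> V \<and> card T = Suc i then f \<in> forms V (j - 1) else f = 0) \<and> c T = coset I f"
    proof (cases "T \<subseteq> V \<and> card T = i + 1")
      case True
      then have "c T \<in> grading ?M (?d - int (i + 1))" using cT[of T] by (simp only: if_P)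
      then show ?thesis using True by (auto simp: graded_quotient_simps Suc_eq_plus1)
    next
      case False
      then have "c T = \<zero>\<^bsub>?M\<^esub>" using cT[of T] by (simp only: if_not_P if_False)
      then show ?thesis using False
        by (intro exI[of _ 0] conjI) (simp_all only: Suc_eq_plus1 if_False graded_quotient_simps coset_0)
    qed
  qed
  then obtain v where v: "\<And>T. if T \<subseteq> V \<and> card T = Suc i then v T \<in> forms V (j - 1) else v T = 0"
    "\<And>T. c T = coset I (v T)" by metis
  have vc: "v \<in> chains V (Suc i) (forms V (j - 1))" using v(1) by (simp add: chains_def)
  have vV: "v T \<in> polys V" for T using chainsD[OF vc, of T] by (simp add: forms_def)
  have "c = (\<lambda>T. coset I (v T))" using v(2) by (rule ext)
  then have "z T = coset I (kdiff V v T)" for T using c(2) diff[of v, OF vV] by simp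
  then have "(w - kdiff V v) T \<in> I" for T using coset_eq_iff[OF ID(1)] by (simp add: z_def)
  with vc show thesis by (rule that)
qed

text \<open>Dimension shift from the quotient ring to I: c bounds a chain w over the polynomial
  ring, and w is a cycle modulo I in homological degree i + 1 with coefficients of degree e - 1.
  This turns j >= 2 into e >= 3 and i <= p into i + 1 <= p.\<close>

lemma property_N2_ideal:
  fixes I :: "'k::field_char_0 mpoly set"
  assumes N2: "property_N2 V p I" and I: "homogeneous_ideal V I" and V: "finite V"
    and "i + 1 \<le> p" "e \<ge> 3" and c: "c \<in> chains V i (I \<inter> forms V e)" "kdiff V c = 0"
  shows "\<exists>b\<in>chains V (Suc i) (I \<inter> forms V (e - 1)). kdiff V b = c"
proof -
  note ID = homogeneous_idealD[OF I]
  have "c \<in> chains V i (forms V e)" using c(1) by (rule chains_mono[rotated]) simp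
  then obtain w where w: "w \<in> chains V (Suc i) (forms V (e - 1))" "kdiff V w = c"
    using koszul_acyclic[OF V _ c(2)] assms(5) by (smt (verit) of_nat_0_le_iff)
  have dw: "kdiff V w T \<in> I" for T
    using chainsD[OF c(1), of T] w(2) additive_set_0[OF ID(1)] by simp
  obtain v where v: "v \<in> chains V (Suc (Suc i)) (forms V (e - 1 - 1))" "\<And>T. (w - kdiff V v) T \<in> I"
    by (rule property_N2_chains[OF N2 I V _ _ w(1) dw]) (use assms(4,5) in auto)
  have "kdiff V v \<in> chains V (Suc i) (forms V (e - 1))"
    using forms_mult[OF pvar_forms, of _ V _ "e - 1 - 1"]
    by (intro kdiff_chains[OF v(1)] V additive_set_forms) auto
  then have b: "w - kdiff V v \<in> chains V (Suc i) (forms V (e - 1))"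
    by (intro chains_diff additive_set_forms w(1))
  have "(w - kdiff V v) T \<in> I \<inter> forms V (e - 1)" for T
    using v(2)[of T] chainsD[OF b, of T] by simp
  with b have "w - kdiff V v \<in> chains V (Suc i) (I \<inter> forms V (e - 1))" by (rule chains_coeffs)
  moreover have "kdiff V (w - kdiff V v) = c"
    unfolding kdiff_diff kdiff_kdiff w(2) by (rule diff_0_right)
  ultimately show ?thesis by blast
qed

subsection \<open>Koszul homology of an ideal\<close>

definition cycles :: "nat set \<Rightarrow> 'k::comm_ring_1 mpoly set \<Rightarrow> nat \<Rightarrow> int \<Rightarrow> (nat set \<Rightarrow> 'k mpoly) set" where
  "cycles V K i d = {c \<in> chains V i {f \<in> K. homogeneous (d - int i) f}. kdiff V c = 0}"

definition boundaries :: "nat set \<Rightarrow> 'k::comm_ring_1 mpoly set \<Rightarrow> nat \<Rightarrow> int \<Rightarrow> (nat set \<Rightarrow> 'k mpoly) set" where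
  "boundaries V K i d = kdiff V ` chains V (Suc i) {f \<in> K. homogeneous (d - int (Suc i)) f}"

lemma ideal_module_simps:
  "carrier (ideal_module K) = K" "\<zero>\<^bsub>ideal_module K\<^esub> = 0" "f \<oplus>\<^bsub>ideal_module K\<^esub> g = f + g"
  "a \<odot>\<^bsub>ideal_module K\<^esub> f = a * f" "grading (ideal_module K) e = {f \<in> K. homogeneous e f}"
  by (simp_all add: ideal_module_def)

text \<open>K is stable under \<open>polys V\<close> but may lie outside it, so that the ideal of X
  is covered over S as well as over R.\<close>

locale koszul_ideal =
  fixes V :: "nat set" and K :: "'k::comm_ring_1 mpoly set"
  assumes finite_V: "finite V" and K_additive: "additive_set K"
    and K_mult: "\<And>f g. f \<in> K \<Longrightarrow> g \<in> polys V \<Longrightarrow> g * f \<in> K"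
begin

lemma abelian_monoid_ideal_module: "abelian_monoid (ideal_module K)"
  by (rule abelian_monoidI)
    (auto simp: ideal_module_def add_ac intro: additive_set_add[OF K_additive] additive_set_0[OF K_additive])

lemma graded_additive: "additive_set {f \<in> K. homogeneous e f}"
  using K_additive by (auto simp: additive_set_def intro: homogeneous_diff)

lemma koszul_chains_eq: "koszul_chains V (ideal_module K) i d = chains V i {f \<in> K. homogeneous (d - int i) f}"
  by (simp add: koszul_chains_def chains_def ideal_module_def)

lemma koszul_diff_eq:
  assumes c: "\<And>T. c T \<in> K" shows "koszul_diff V (ideal_module K) c = kdiff V c"
proof
  fix T
  have K: "koszul_sign j T * pvar j * c (insert j T) \<in> K" if "j \<in> V" for j
    using that by (intro K_mult c polys_mult koszul_sign_polys pvar_polys)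
  have "koszul_diff V (ideal_module K) c T
      = (\<Oplus>\<^bsub>ideal_module K\<^esub>j\<in>V - T. koszul_sign j T * pvar j * c (insert j T))"
    by (simp add: koszul_diff_def koszul_sign_def ideal_module_simps)
  also have "\<dots> = (\<Sum>j\<in>V - T. koszul_sign j T * pvar j * c (insert j T))"
    by (rule finsum_transfer[OF abelian_monoid_ideal_module, where \<phi> = "\<lambda>x. x" and K = K])
      (use K finite_V K_additive in \<open>auto simp: ideal_module_def\<close>)
  also have "\<dots> = kdiff V c T" by (simp add: kdiff_apply[OF finite_V])
  finally show "koszul_diff V (ideal_module K) c T = kdiff V c T" .
qed

lemma chains_K: "c \<in> chains V i {f \<in> K. homogeneous e f} \<Longrightarrow> c T \<in> K"
  using chainsD[of c V i "{f \<in> K. homogeneous e f}" T] additive_set_0[OF K_additive] by simp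

lemma koszul_cycles_eq:
  "carrier (koszul_cycles V (ideal_module K) i d) = cycles V K i d"
  "c \<oplus>\<^bsub>koszul_cycles V (ideal_module K) i d\<^esub> c' = c + c'"
  "a \<odot>\<^bsub>koszul_cycles V (ideal_module K) i d\<^esub> c = scale (pconst a) c"
proof -
  have "koszul_diff V (ideal_module K) c = kdiff V c" if "c \<in> chains V i {f \<in> K. homogeneous e f}" for c e
    by (rule koszul_diff_eq) (rule chains_K[OF that])
  then show "carrier (koszul_cycles V (ideal_module K) i d) = cycles V K i d"
    by (auto simp: koszul_cycles_def cycles_def koszul_chains_eq zero_fun_def ideal_module_simps)
qed (simp_all add: koszul_cycles_def ideal_module_simps scale_def plus_fun_def)

lemma koszul_boundaries_eq: "koszul_boundaries V (ideal_module K) i d = boundaries V K i d"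
proof -
  have "koszul_diff V (ideal_module K) c = kdiff V c" if "c \<in> chains V j {f \<in> K. homogeneous e f}" for c e j
    by (rule koszul_diff_eq) (rule chains_K[OF that])
  then show ?thesis
    by (simp add: koszul_boundaries_def boundaries_def koszul_chains_eq Suc_eq_plus1)
qed

lemma boundaries_additive: "additive_set (boundaries V K i d)"
  unfolding additive_set_def boundaries_def
proof (intro conjI ballI)
  show "0 \<in> kdiff V ` chains V (Suc i) {f \<in> K. homogeneous (d - int (Suc i)) f}"
    using chains_zero[OF additive_set_0[OF graded_additive]] by (intro image_eqI[of _ _ 0]) simp_all
  fix x y assume "x \<in> kdiff V ` chains V (Suc i) {f \<in> K. homogeneous (d - int (Suc i)) f}"
    "y \<in> kdiff V ` chains V (Suc i) {f \<in> K. homogeneous (d - int (Suc i)) f}"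
  then show "x - y \<in> kdiff V ` chains V (Suc i) {f \<in> K. homogeneous (d - int (Suc i)) f}"
    using chains_diff[OF graded_additive] by (auto simp: kdiff_diff[symmetric])
qed

lemma cycles_additive: "additive_set (cycles V K i d)"
  using chains_additive[OF graded_additive] by (auto simp: additive_set_def cycles_def kdiff_diff)

lemma scale_chains: "c \<in> chains V i {f \<in> K. homogeneous e f} \<Longrightarrow> scale (pconst a) c \<in> chains V i {f \<in> K. homogeneous e f}"
  by (erule chains_scale) (auto intro: K_mult homogeneous_pconst_mult)

lemma scale_boundaries: "c \<in> boundaries V K i d \<Longrightarrow> scale (pconst a) c \<in> boundaries V K i d"
  unfolding boundaries_def using scale_chains by (auto simp: kdiff_scale[symmetric])

lemma scale_cycles: "c \<in> cycles V K i d \<Longrightarrow> scale (pconst a) c \<in> cycles V K i d"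
  using scale_chains by (auto simp: cycles_def kdiff_scale)

lemma Tor_carrier: "carrier (Tor V (ideal_module K) i d) = coset (boundaries V K i d) ` cycles V K i d"
  by (auto simp: Tor_def quotient_module_def A_RCOSETS_def' a_r_coset_def' koszul_cycles_eq koszul_boundaries_eq
      coset_def)

lemma Tor_add:
  "coset (boundaries V K i d) z \<oplus>\<^bsub>Tor V (ideal_module K) i d\<^esub> coset (boundaries V K i d) z'
    = coset (boundaries V K i d) (z + z')"
  using sum_coset[OF boundaries_additive boundaries_additive order.refl]
  by (simp add: Tor_def quotient_module_def set_add_def' koszul_cycles_eq)

lemma Tor_smult:
  "a \<odot>\<^bsub>Tor V (ideal_module K) i d\<^esub> coset (boundaries V K i d) z
    = coset (boundaries V K i d) (scale (pconst a) z)"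
proof -
  have "a \<odot>\<^bsub>Tor V (ideal_module K) i d\<^esub> coset (boundaries V K i d) z
      = (\<Union>x\<in>coset (boundaries V K i d) z. coset (boundaries V K i d) (scale (pconst a) x))"
    by (simp add: Tor_def quotient_module_def a_r_coset_def' koszul_cycles_eq koszul_boundaries_eq
        coset_def image_def) blast
  also have "\<dots> = coset (boundaries V K i d) (scale (pconst a) z)"
    by (rule scaled_coset) (simp_all add: boundaries_additive scale_diff scale_boundaries)
  finally show ?thesis .
qed

lemma tor_map_coset:
  assumes "additive_set B" "B \<subseteq> boundaries V K i d"
  shows "tor_map V (ideal_module K) i d (\<lambda>c. c) (coset B z) = coset (boundaries V K i d) z"
  using sum_coset[OF boundaries_additive assms, where z = z and z' = 0]
  by (simp add: tor_map_def set_add_def' koszul_cycles_eq koszul_boundaries_eq coset_0)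

end

text \<open>Both factors of f are the identity on cycles and only enlarge the group of boundaries,
  so one lemma serves the change of ideal and the change of ring.\<close>

lemma tor_map_linear:
  assumes "koszul_ideal V K" "koszul_ideal V' K'"
    and "cycles V K i d \<subseteq> cycles V' K' i d" "boundaries V K i d \<subseteq> boundaries V' K' i d"
  shows "tor_map V' (ideal_module K') i d (\<lambda>c. c)
    \<in> linear_maps (Tor V (ideal_module K) i d) (Tor V' (ideal_module K') i d)"
proof -
  interpret A: koszul_ideal V K by (rule assms(1))
  interpret B: koszul_ideal V' K' by (rule assms(2))
  note coset = B.tor_map_coset[OF A.boundaries_additive assms(4)]
  have "scale (pconst a) z \<in> cycles V K i d" if "z \<in> cycles V K i d" for a z
    using that by (rule A.scale_cycles)
  then show ?thesis
    unfolding linear_maps_def A.Tor_carrier B.Tor_carrier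
    using assms(3) by (auto simp: A.Tor_add B.Tor_add A.Tor_smult B.Tor_smult coset)
qed

lemma linear_maps_comp:
  "h \<in> linear_maps A B \<Longrightarrow> g \<in> linear_maps B C \<Longrightarrow> g \<circ> h \<in> linear_maps A C"
  unfolding linear_maps_def by (auto simp: Pi_iff)

section \<open>Comparison of the homology over S and over R\<close>

context inner_projection_setup
begin

lemma kdiff_R_S: "c \<in> chains S i A \<Longrightarrow> kdiff R c = kdiff S c"
  by (simp only: kdiff_R contract_0_S scale_0 add_0)

lemma graded_I: "I \<subseteq> polys R \<Longrightarrow> {f \<in> I. homogeneous e f} = IR e"
  by (auto simp: forms_def)

lemma graded_J: "{f \<in> J. homogeneous e f} = J \<inter> forms S e"
  by (auto simp: forms_def J_def)

lemma cycles_S_R: "cycles S I i d \<subseteq> cycles R I i d"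
proof
  fix c assume "c \<in> cycles S I i d"
  then have c: "c \<in> chains S i {f \<in> I. homogeneous (d - int i) f}" "kdiff S c = 0" by (auto simp: cycles_def)
  moreover have "0 \<in> {f \<in> I. homogeneous (d - int i) f}" using additive_set_0[OF I_additive] by simp
  ultimately show "c \<in> cycles R I i d"
    using chains_mono_vars[OF c(1)] kdiff_R_S[OF c(1)] by (simp add: cycles_def)
qed

lemma boundaries_S_R: "boundaries S I i d \<subseteq> boundaries R I i d"
proof
  fix x assume "x \<in> boundaries S I i d"
  then obtain c where c: "c \<in> chains S (Suc i) {f \<in> I. homogeneous (d - int (Suc i)) f}" "x = kdiff S c"
    by (auto simp: boundaries_def)
  have "0 \<in> {f \<in> I. homogeneous (d - int (Suc i)) f}" using additive_set_0[OF I_additive] by simp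
  with c(1) have cR: "c \<in> chains R (Suc i) {f \<in> I. homogeneous (d - int (Suc i)) f}" by (rule chains_mono_vars)
  have "x = kdiff R c" unfolding c(2) by (rule kdiff_R_S[OF c(1), symmetric])
  then show "x \<in> boundaries R I i d" unfolding boundaries_def using cR by (rule image_eqI)
qed

lemma chains_J_I:
  "chains S i {f \<in> J. homogeneous e f} \<subseteq> chains S i {f \<in> I. homogeneous e f}"
proof
  fix c assume "c \<in> chains S i {f \<in> J. homogeneous e f}"
  moreover have "{f \<in> J. homogeneous e f} \<subseteq> {f \<in> I. homogeneous e f}" by (auto simp: J_def)
  ultimately show "c \<in> chains S i {f \<in> I. homogeneous e f}" by (rule chains_mono[rotated])
qed

lemma cycles_J_I: "cycles S J i d \<subseteq> cycles S I i d"
proof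
  fix c assume "c \<in> cycles S J i d"
  then show "c \<in> cycles S I i d"
    unfolding cycles_def mem_Collect_eq by (elim conjE) (intro conjI subsetD[OF chains_J_I])
qed

lemma boundaries_J_I: "boundaries S J i d \<subseteq> boundaries S I i d"
  unfolding boundaries_def by (rule image_mono[OF chains_J_I])

text \<open>For j <= 2 a bounding chain over R has coefficients of degree j - 1 <= 1, where I is
  zero, so z itself is 0. For j >= 3 every cycle over J bounds by \<open>J_acyclic\<close>.\<close>

lemma cycle_boundary_J:
  assumes "I \<subseteq> polys R" "i + 2 \<le> p" "z \<in> cycles S J i (int i + j)" "z \<in> boundaries R I i (int i + j)"
  shows "z \<in> boundaries S J i (int i + j)"
proof (cases "j \<le> 2")
  case True
  obtain b where b: "b \<in> chains R (Suc i) (IR (int i + j - int (Suc i)))" "z = kdiff R b"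
    using assms(4) unfolding boundaries_def graded_I[OF assms(1)] by blast
  have "b T = 0" for T
    using I_low[OF chainsD[OF b(1) additive_set_0[OF IR_additive]], of T] True by simp
  then have "b = 0" by (simp add: fun_eq_iff)
  then have "z = kdiff S 0" using b(2) by (simp only: kdiff_0)
  moreover have "0 \<in> chains S (Suc i) (J \<inter> forms S (int i + j - int (Suc i)))"
    by (intro chains_zero additive_set_0 additive_set_Int J_additive additive_set_forms)
  ultimately show ?thesis unfolding boundaries_def graded_J by (rule image_eqI)
next
  case False
  have "z \<in> chains S i (J \<inter> forms S j)" "kdiff S z = 0"
    using assms(3) unfolding cycles_def graded_J by simp_all
  then obtain b where "b \<in> chains S (Suc i) (J \<inter> forms S (j - 1))" "kdiff S b = z"
    using J_acyclic[of z i j] False assms(2) by auto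
  moreover have "int i + j - int (Suc i) = j - 1" by simp
  ultimately show ?thesis unfolding boundaries_def graded_J by (metis image_eqI)
qed

end

theorem theorem3p1:
  fixes I\<^sub>X :: "'k::{alg_closed_field, field_char_0} mpoly set"
    and N p :: nat
  assumes "1 \<le> N"
    and "closed_subscheme_ideal {0..N} I\<^sub>X"
    and "reduced_scheme {0..N} I\<^sub>X"
    and "nondegenerate {0..N} I\<^sub>X"
    and "quadratic_scheme {0..N} I\<^sub>X"
    and "1 \<le> p"
    and "property_N2 {0..N} p I\<^sub>X"
    and "center_q N \<in> proj_zeros {0..N} I\<^sub>X"
    and "smooth_at_q N I\<^sub>X"
  shows "inner_projection_ideal N I\<^sub>X \<subseteq> I\<^sub>X \<and>
    (\<forall>(i::nat) (j::int). i + 2 \<le> p \<longrightarrow>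
      (let T\<^sub>1 = Tor {1..N} (ideal_module (inner_projection_ideal N I\<^sub>X)) i (int i + j);
           T\<^sub>2 = Tor {1..N} (ideal_module I\<^sub>X) i (int i + j);
           T\<^sub>3 = Tor {0..N} (ideal_module I\<^sub>X) i (int i + j);
           h = tor_module_map {1..N} (ideal_module I\<^sub>X) i (int i + j) (\<lambda>x. x);
           g = tor_elimination_map {0..N} (ideal_module I\<^sub>X) i (int i + j);
           f = g \<circ> h
       in h \<in> linear_maps T\<^sub>1 T\<^sub>2 \<and> g \<in> linear_maps T\<^sub>2 T\<^sub>3 \<and>
          f \<in> linear_maps T\<^sub>1 T\<^sub>3 \<and> inj_on f (carrier T\<^sub>1)))"
proof -
  let ?I = "I\<^sub>X" and ?R = "{0..N}" and ?S = "{1..N}"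
  have hI: "homogeneous_ideal ?R ?I" using assms(2) by (simp add: closed_subscheme_ideal_def)
  note ID = homogeneous_idealD[OF hI]
  have J: "inner_projection_ideal N ?I = ?I \<inter> polys ?S"
    by (rule inner_projection_ideal_eq[OF assms(1-4)])
  have center: "(center_q N :: 'k mpoly set) \<in> proj_points ?R" "?I \<subseteq> center_q N"
    using assms(8) by (auto simp: proj_zeros_def)
  have I_center: "x0_coeff e f = 0" if "f \<in> ?I \<inter> forms ?R (int e)" for f e
    using prime_constant_power[OF center(1) center_q_ideal(2)] center(2) that by blast
  have I_low: "f = 0" if f: "f \<in> ?I \<inter> forms ?R e" "e \<le> 1" for f e
  proof -
    consider "e < 0" | "e = 0" | "e = 1" using f(2) by linarith
    then show ?thesis
    proof cases
      case 1
      then show ?thesis using f(1) forms_neg by blast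
    next
      case 2
      then have "f = pconst (lookup f 0)"
        using f(1) by (intro homogeneous_degree_0) (simp add: forms_def)
      moreover have "x0_coeff 0 f = 0" using I_center[of f 0] f(1) 2 by simp
      moreover have "x0_coeff 0 (pconst (lookup f 0)) = pconst (lookup f 0)"
        by (subst x0_coeff_free[of _ "{}"]) simp_all
      ultimately show ?thesis by metis
    next
      case 3
      then show ?thesis using f(1) assms(4) by (auto simp: nondegenerate_def)
    qed
  qed
  note I_Tor = property_N2_ideal[OF assms(7) hI finite_atLeastAtMost]
  have I_generators: "\<exists>g. (\<forall>j\<in>?R. g j \<in> ?I \<inter> forms ?R (e - 1)) \<and> f = (\<Sum>j\<in>?R. pvar j * g j)"
    if e: "e \<ge> 3" and f: "f \<in> ?I \<inter> forms ?R e" for f e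
  proof -
    \<comment> \<open>A form regarded as a cycle of homological degree 0; a chain bounding it writes
      f as a combination of the variables with coefficients in I of degree e - 1. Here p >= 1
      enters.\<close>
    define c where "c T = (if T = {} then f else 0)" for T :: "nat set"
    have c: "c \<in> chains ?R 0 (?I \<inter> forms ?R e)"
    proof (rule chainsI)
      fix T assume "T \<subseteq> ?R" "card T = 0"
      then have "T = {}" using finite_subset[of T ?R] by simp
      then show "c T \<in> ?I \<inter> forms ?R e" using f by (simp add: c_def)
    qed (auto simp: c_def)
    have "kdiff ?R c = 0" by (rule kdiff_chains_0[OF c]) simp
    then obtain b where b: "b \<in> chains ?R (Suc 0) (?I \<inter> forms ?R (e - 1))" "kdiff ?R b = c"
      using I_Tor[OF _ e c] assms(6) by auto
    have "f = kdiff ?R b {}" by (simp add: b(2) c_def)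
    also have "\<dots> = (\<Sum>j\<in>?R. pvar j * b {j})"
      by (subst kdiff_apply) (simp_all add: koszul_sign_def)
    finally show ?thesis
      using chains_inside[OF b(1)] by (intro exI[of _ "\<lambda>j. b {j}"]) simp
  qed
  interpret pr: projected_ideal N ?I
    by (rule projected_ideal.intro)
      (fact ID(1) ID(3) ID(2) ID(4) I_low I_center I_generators assms(9))+
  obtain P Q a F where ips: "inner_projection_setup N P Q a ?I F p"
    using pr.exists_inner_projection_setup[of p, OF I_Tor] by blast
  interpret inner_projection_setup N P Q a ?I F p by (rule ips)
  have J': "inner_projection_ideal N ?I = J" unfolding J J_def ..
  have K1: "koszul_ideal ?S J" and K2: "koszul_ideal ?S ?I" and K3: "koszul_ideal ?R ?I"
    by (rule koszul_ideal.intro, rule finite_atLeastAtMost, rule J_additive, erule (1) J_mult,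
        rule koszul_ideal.intro, rule finite_atLeastAtMost, rule I_additive,
        erule I_mult, erule polys_mono[OF S_R],
        rule koszul_ideal.intro, rule finite_atLeastAtMost, rule I_additive, erule (1) I_mult)
  have main: "h \<in> linear_maps T\<^sub>1 T\<^sub>2 \<and> g \<in> linear_maps T\<^sub>2 T\<^sub>3 \<and> g \<circ> h \<in> linear_maps T\<^sub>1 T\<^sub>3 \<and> inj_on (g \<circ> h) (carrier T\<^sub>1)"
    if i: "i + 2 \<le> p" and defs: "T\<^sub>1 = Tor ?S (ideal_module J) i (int i + j)"
      "T\<^sub>2 = Tor ?S (ideal_module ?I) i (int i + j)" "T\<^sub>3 = Tor ?R (ideal_module ?I) i (int i + j)"
      "h = tor_map ?S (ideal_module ?I) i (int i + j) (\<lambda>c. c)"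
      "g = tor_map ?R (ideal_module ?I) i (int i + j) (\<lambda>c. c)"
    for i j T\<^sub>1 T\<^sub>2 T\<^sub>3 h g
  proof -
    have h: "h \<in> linear_maps T\<^sub>1 T\<^sub>2"
      unfolding defs by (rule tor_map_linear[OF K1 K2 cycles_J_I boundaries_J_I])
    have g: "g \<in> linear_maps T\<^sub>2 T\<^sub>3"
      unfolding defs by (rule tor_map_linear[OF K2 K3 cycles_S_R boundaries_S_R])
    let ?d = "int i + j"
    have gh: "(g \<circ> h) (coset (boundaries ?S J i ?d) z) = coset (boundaries ?R ?I i ?d) z" for z
      by (simp only: comp_apply defs koszul_ideal.tor_map_coset[OF K2 koszul_ideal.boundaries_additive[OF K1] boundaries_J_I]
          koszul_ideal.tor_map_coset[OF K3 koszul_ideal.boundaries_additive[OF K2] boundaries_S_R])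
    have "inj_on (g \<circ> h) (carrier T\<^sub>1)"
      unfolding defs(1) koszul_ideal.Tor_carrier[OF K1]
    proof (rule inj_onI)
      fix C C' assume C: "C \<in> coset (boundaries ?S J i ?d) ` cycles ?S J i ?d"
        and C': "C' \<in> coset (boundaries ?S J i ?d) ` cycles ?S J i ?d" and eq: "(g \<circ> h) C = (g \<circ> h) C'"
      obtain z where z: "z \<in> cycles ?S J i ?d" "C = coset (boundaries ?S J i ?d) z" using C by blast
      obtain z' where z': "z' \<in> cycles ?S J i ?d" "C' = coset (boundaries ?S J i ?d) z'" using C' by blast
      have "z - z' \<in> boundaries ?R ?I i ?d"
        using eq unfolding z(2) z'(2) gh coset_eq_iff[OF koszul_ideal.boundaries_additive[OF K3]] .
      moreover have "z - z' \<in> cycles ?S J i ?d"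
        by (rule additive_set_diff[OF koszul_ideal.cycles_additive[OF K1] z(1) z'(1)])
      ultimately have "z - z' \<in> boundaries ?S J i ?d" using cycle_boundary_J[OF ID(2) i] by blast
      then show "C = C'" unfolding z(2) z'(2) coset_eq_iff[OF koszul_ideal.boundaries_additive[OF K1]] .
    qed
    then show ?thesis using h g linear_maps_comp[OF h g] by blast
  qed
  show ?thesis
    unfolding Let_def J' tor_module_map_def tor_elimination_map_def
    using main[OF _ refl refl refl refl refl] by (auto simp: J_def)
qed

end
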